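(* Let $(Q,I)$ be a gentle presentation with $Q$ finite, connected and having at least one arrow, let $A=\Bbbk Q/I$ and let $T$ be a spanning tree of $Q$. The Hochschild cohomology $\mathrm{HH}^*(A)$ is the graded vector space freely generated by (i.e. having as a basis) the cohomology classes of the following homogeneous cocycles of the complex $\Bbbk(\Gamma\parallel\mathcal B)$: (I) the element $\mathbf 1=\sum_{i\in Q_0}(e_i,e_i)$; (II) the pairs $(s(\alpha),\alpha)$ in $\Gamma_0\parallel\mathcal B$ with $\alpha$ a $\mathcal B$-maximal path; (III) the sums $\langle\langle\alpha\rangle\rangle=\sum_{i=0}^{r-1}(s(\mathrm{rot}^i(\alpha)),\mathrm{rot}^i(\alpha))$ with $\alpha\in\overline{\mathscr C}(\mathcal B)$ and $r$ the period of $\alpha$; (IV) the pairs $(c,c)$ with $c$ an arrow in $Q_1\setminus T$; (V) the pairs $(c,c\alpha)$ with $\alpha\in\overline{\mathscr C}(\mathcal B)$ and $c$ the first arrow of $\alpha$; (VI) the pairs $(\gamma,\alpha)\in\Gamma\parallel\mathcal B$ with $\gamma$ a $\Gamma$-maximal element of $\Gamma$ and with $\gamma$ and $\alpha$ neither beginning nor ending with the same arrow; (VII) the sums $\langle\langle C\rangle\rangle=\sum_{i=0}^{r-1}(\mathrm{rot}^i(C),s(\mathrm{rot}^i(C)))$, one for each $m\ge1$ such that $m$ is even or $\mathrm{char}\,\Bbbk=2$ and each $C\in\overline{\mathscr C}^{\circ}(\Gamma)$ of length $m$, with $r$ the period of $C$; (VIII) the pairs $(bC,b)$, one for each $m\geq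 2$ such that $m$ is odd or $\mathrm{char}\,\Bbbk=2$ and each $C\in\overline{\mathscr C}^{\circ}(\Gamma)$ of length $m-1$, with $b$ the first arrow of $C$.
   Context: $\Bbbk$ is a field. $Q=(Q_0,Q_1,s,t)$ is a quiver. Paths are written from right to left: $c_m\cdots c_1$ has first arrow $c_1$, last arrow $c_m$, and $t(c_i)=s(c_{i+1})$; vertices $e_i$ are the paths of length $0$. $(Q,I)$ is a gentle presentation: $I$ is an ideal of $\Bbbk Q$ generated by paths of length $2$; every vertex is the source of at most two arrows and the target of at most two arrows; for every arrow $a$ there is at most one arrow $b$ with $t(b)=s(a)$ and $ab\notin I$, at most one arrow $c$ with $t(a)=s(c)$ and $ca\notin I$, at most one arrow $b$ with $t(b)=s(a)$ and $ab\in I$, and at most one arrow $c$ with $t(a)=s(c)$ and $ca\in I$. $A$ may be infinite-dimensional. $R$ is the set of paths of length $2$ in $I$; $\mathcal B$ is the set of paths with no subpath in $R$ (a basis of $A$); $\Gamma$ is the set of paths all of whose subpaths of length $2$ are in $R$ (so it contains all vertices and arrows); $\Gamma_m$ is its subset of paths of length $m$. A path is $\mathcal B$-maximal (resp. $\Gamma$-maximal) if it is in $\mathcal B$ (resp. $\Gamma$) and is not a proper subpath of another element of $\mathcal B$ (resp. $\Gamma$). Two paths are parallel if they have the same source and the same target. $\Gamma_m\parallel\mathcal B$ is the set of pairs $(\gamma,\alpha)\in\Gamma_m\times\mathcal B$ with $\gamma,\alpha$ parallel, and $\Bbbk(\Gamma_m\parallel\mathcal B)$ the vector space with that basis. These are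 the components of a cochain complex $\Bbbk(\Gamma\parallel\mathcal B)$ with $$d^m(\gamma,\alpha)=\sum_{b}(b\gamma,b\alpha)-(-1)^m\sum_{a}(\gamma a,\alpha a),$$ the sums over the arrows $b$ (resp. $a$) such that the displayed pair is in $\Gamma_{m+1}\parallel\mathcal B$. It is isomorphic to $\mathrm{Hom}_{A^e}(\mathcal R,A)$ with $\mathcal R$ the Bardzell resolution of $A$, with $\mathcal R_m=A\otimes_E\Bbbk\Gamma_m\otimes_EA$, $E=\Bbbk Q_0$ (the pair $(\gamma,\alpha)$ corresponding to the bimodule map sending $1\otimes\gamma\otimes1$ to $\alpha$ and $1\otimes\gamma'\otimes 1$ to $0$ for the other $\gamma'\in\Gamma_m$), so its cohomology is identified with $\mathrm{HH}^*(A)=\mathrm{Ext}^*_{A^e}(A,A)$. A cycle is a path of positive length whose source and target coincide; $\mathrm{rot}(c_m\cdots c_1)=c_{m-1}\cdots c_1c_m$. A cycle is primitive if it is not a proper power of another cycle; the period of $C$ is the least $i\ge1$ with $\mathrm{rot}^i(C)=C$. A circuit is an equivalence class of cycles under rotation. A cycle $C$ (and its circuit) is complete if $C^2\in\Gamma$ and cocomplete if $C^2\in\mathcal B$. $\overline{\mathscr C}(\mathcal B)$ is the set of all positive powers of a fixed choice of one representative of each primitive cocomplete circuit; $\overline{\mathscr C}^{\circ}(\Gamma)$ is the set of all positive powers of a fixed choice of one representative of each primitive complete circuit. A spanning tree of $Q$ is the set of arrows of a connected subquiver, acyclic as an undirected graph, that contains all vertices. *)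

theory Defs
  imports "Graph_Theory.Digraph_Component" "HOL-Algebra.Module" "HOL-Algebra.QuotRing"
begin

section \<open>Paths\<close>

text \<open>A quiver is a \<^typ>\<open>('v, 'a) pre_digraph\<close>. The path $c_m\cdots c_1$ is the pair
  \<open>(s(c\<^sub>1), [c\<^sub>1, \<dots>, c\<^sub>m])\<close>: the arrows are listed in the order in which they are traversed, that is,
  in the opposite order to the written one. The vertex $e_i$ is \<open>(i, [])\<close>.\<close>

type_synonym ('v, 'a) path = "'v \<times> 'a list"

definition qpaths :: "('v, 'a) pre_digraph \<Rightarrow> ('v, 'a) path set" where
  "qpaths Q = {p. \<exists>w. pre_digraph.awalk Q (fst p) (snd p) w}"

definition psrc :: "('v, 'a) path \<Rightarrow> 'v" where
  "psrc p = fst p"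

definition ptgt :: "('v, 'a) pre_digraph \<Rightarrow> ('v, 'a) path \<Rightarrow> 'v" where
  "ptgt Q p = last (pre_digraph.awalk_verts Q (fst p) (snd p))"

definition plen :: "('v, 'a) path \<Rightarrow> nat" where
  "plen p = length (snd p)"

definition vpath :: "'v \<Rightarrow> ('v, 'a) path" where
  "vpath i = (i, [])"

definition arrow :: "('v, 'a) pre_digraph \<Rightarrow> 'a \<Rightarrow> ('v, 'a) path" where
  "arrow Q c = (tail Q c, [c])"

text \<open>\<open>pcomp \<beta> \<alpha>\<close> is the path written $\beta\alpha$; it is meaningful when
  \<open>psrc \<beta> = ptgt Q \<alpha>\<close>.\<close>

definition pcomp :: "('v, 'a) path \<Rightarrow> ('v, 'a) path \<Rightarrow> ('v, 'a) path" where
  "pcomp \<beta> \<alpha> = (fst \<alpha>, snd \<alpha> @ snd \<beta>)"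

definition subpath :: "('v, 'a) pre_digraph \<Rightarrow> ('v, 'a) path \<Rightarrow> ('v, 'a) path \<Rightarrow> bool" where
  "subpath Q \<beta> \<alpha> \<longleftrightarrow> (\<exists>\<delta>\<in>qpaths Q. \<exists>\<epsilon>\<in>qpaths Q.
     psrc \<delta> = ptgt Q \<beta> \<and> psrc \<beta> = ptgt Q \<epsilon> \<and> \<alpha> = pcomp \<delta> (pcomp \<beta> \<epsilon>))"

definition parallel_paths :: "('v, 'a) pre_digraph \<Rightarrow> ('v, 'a) path \<Rightarrow> ('v, 'a) path \<Rightarrow> bool" where
  "parallel_paths Q \<beta> \<alpha> \<longleftrightarrow> psrc \<beta> = psrc \<alpha> \<and> ptgt Q \<beta> = ptgt Q \<alpha>"


section \<open>Free vector spaces\<close>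

text \<open>The vector space with basis \<open>X\<close> consists of the finitely supported functions on \<open>X\<close>;
  \<open>bvec x\<close> is the basis vector \<open>x\<close>.\<close>

definition free_space :: "'x set \<Rightarrow> ('x \<Rightarrow> 'k::field) set" where
  "free_space X = {f. finite {x. f x \<noteq> 0} \<and> {x. f x \<noteq> 0} \<subseteq> X}"

definition bvec :: "'x \<Rightarrow> 'x \<Rightarrow> 'k::field" where
  "bvec x = (\<lambda>y. if y = x then 1 else 0)"

definition lin_ext :: "('x \<Rightarrow> 'y \<Rightarrow> 'k::field) \<Rightarrow> ('x \<Rightarrow> 'k) \<Rightarrow> 'y \<Rightarrow> 'k" where
  "lin_ext \<phi> f = (\<lambda>y. \<Sum>x | f x \<noteq> 0. f x * \<phi> x y)"

definition bilin_ext ::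
  "('x \<Rightarrow> 'y \<Rightarrow> 'z \<Rightarrow> 'k::field) \<Rightarrow> ('x \<Rightarrow> 'k) \<Rightarrow> ('y \<Rightarrow> 'k) \<Rightarrow> 'z \<Rightarrow> 'k" where
  "bilin_ext \<phi> f g = lin_ext (\<lambda>x. lin_ext (\<phi> x) g) f"


section \<open>The path algebra, gentle presentations and the algebra $A$\<close>

text \<open>The algebra with basis a set \<open>X\<close> of paths, in which the product of two paths is their
  concatenation if that is defined and belongs to \<open>X\<close>, and zero otherwise.\<close>

definition path_mult :: "('v, 'a) pre_digraph \<Rightarrow> ('v, 'a) path set
    \<Rightarrow> ('v, 'a) path \<Rightarrow> ('v, 'a) path \<Rightarrow> ('v, 'a) path \<Rightarrow> 'k::field" where
  "path_mult Q X \<beta> \<alpha> =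
     (if psrc \<beta> = ptgt Q \<alpha> \<and> pcomp \<beta> \<alpha> \<in> X then bvec (pcomp \<beta> \<alpha>) else (\<lambda>_. 0))"

definition path_ring :: "('v, 'a) pre_digraph \<Rightarrow> ('v, 'a) path set
    \<Rightarrow> (('v, 'a) path \<Rightarrow> 'k::field) ring" where
  "path_ring Q X = \<lparr>carrier = free_space X,
     mult = bilin_ext (path_mult Q X),
     one = (\<lambda>p. if p \<in> vpath ` verts Q then 1 else 0),
     zero = (\<lambda>_. 0), add = (\<lambda>f g p. f p + g p)\<rparr>"

definition path_algebra :: "('v, 'a) pre_digraph \<Rightarrow> (('v, 'a) path \<Rightarrow> 'k::field) ring" where
  "path_algebra Q = path_ring Q (qpaths Q)"

definition relations ::
  "('v, 'a) pre_digraph \<Rightarrow> (('v, 'a) path \<Rightarrow> 'k::field) set \<Rightarrow> ('v, 'a) path set" where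
  "relations Q I = {p \<in> qpaths Q. plen p = 2 \<and> bvec p \<in> I}"

definition gentle_presentation ::
  "('v, 'a) pre_digraph \<Rightarrow> (('v, 'a) path \<Rightarrow> 'k::field) set \<Rightarrow> bool" where
  "gentle_presentation Q I \<longleftrightarrow>
     wf_digraph Q \<and>
     (\<exists>S \<subseteq> {p \<in> qpaths Q. plen p = 2}. I = Idl\<^bsub>path_algebra Q\<^esub> (bvec ` S)) \<and>
     (\<forall>i\<in>verts Q. finite (out_arcs Q i) \<and> card (out_arcs Q i) \<le> 2) \<and>
     (\<forall>i\<in>verts Q. finite (in_arcs Q i) \<and> card (in_arcs Q i) \<le> 2) \<and>
     (\<forall>a\<in>arcs Q.
       (\<exists>\<^sub>\<le>\<^sub>1 b. b \<in> arcs Q \<and> head Q b = tail Q a \<and> bvec (pcomp (arrow Q a) (arrow Q b)) \<notin> I) \<and>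
       (\<exists>\<^sub>\<le>\<^sub>1 c. c \<in> arcs Q \<and> head Q a = tail Q c \<and> bvec (pcomp (arrow Q c) (arrow Q a)) \<notin> I) \<and>
       (\<exists>\<^sub>\<le>\<^sub>1 b. b \<in> arcs Q \<and> head Q b = tail Q a \<and> bvec (pcomp (arrow Q a) (arrow Q b)) \<in> I) \<and>
       (\<exists>\<^sub>\<le>\<^sub>1 c. c \<in> arcs Q \<and> head Q a = tail Q c \<and> bvec (pcomp (arrow Q c) (arrow Q a)) \<in> I))"

definition \<B> ::
  "('v, 'a) pre_digraph \<Rightarrow> (('v, 'a) path \<Rightarrow> 'k::field) set \<Rightarrow> ('v, 'a) path set" where
  "\<B> Q I = {p \<in> qpaths Q. \<forall>r\<in>relations Q I. \<not> subpath Q r p}"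

definition \<Gamma> ::
  "('v, 'a) pre_digraph \<Rightarrow> (('v, 'a) path \<Rightarrow> 'k::field) set \<Rightarrow> ('v, 'a) path set" where
  "\<Gamma> Q I = {p \<in> qpaths Q. \<forall>r\<in>qpaths Q. plen r = 2 \<and> subpath Q r p \<longrightarrow> r \<in> relations Q I}"

definition \<Gamma>m ::
  "('v, 'a) pre_digraph \<Rightarrow> (('v, 'a) path \<Rightarrow> 'k::field) set \<Rightarrow> nat \<Rightarrow> ('v, 'a) path set" where
  "\<Gamma>m Q I m = {p \<in> \<Gamma> Q I. plen p = m}"

definition maximal_in :: "('v, 'a) pre_digraph \<Rightarrow> ('v, 'a) path set \<Rightarrow> ('v, 'a) path \<Rightarrow> bool" where
  "maximal_in Q X p \<longleftrightarrow> p \<in> X \<and> \<not> (\<exists>q\<in>X. q \<noteq> p \<and> subpath Q p q)"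

text \<open>The algebra $A = \Bbbk Q/I$, realised on its basis $\mathcal B$. That this ring is the
  quotient of the path algebra by \<open>I\<close> is lemma \<open>gentle_algebra_iso_quotient\<close> below.\<close>

definition gentle_algebra ::
  "('v, 'a) pre_digraph \<Rightarrow> (('v, 'a) path \<Rightarrow> 'k::field) set \<Rightarrow> (('v, 'a) path \<Rightarrow> 'k) ring" where
  "gentle_algebra Q I = path_ring Q (\<B> Q I)"

text \<open>The inclusion of the field in a ring of functions.\<close>

definition scalar :: "('x \<Rightarrow> 'k::field) ring \<Rightarrow> 'k \<Rightarrow> 'x \<Rightarrow> 'k" where
  "scalar A c = (\<lambda>p. c * \<one>\<^bsub>A\<^esub> p)"

lemma free_spaceD: "f \<in> free_space X \<Longrightarrow> finite {x. f x \<noteq> 0}" "f \<in> free_space X \<Longrightarrow> f x \<noteq> 0 \<Longrightarrow> x \<in> X"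
  by (auto simp: free_space_def)

lemma bvec_supp: "{y. (bvec x y :: 'k::field) \<noteq> 0} = {x}"
  by (auto simp: bvec_def)

lemma lin_ext_superset:
  assumes "finite S" "{x. f x \<noteq> 0} \<subseteq> S"
  shows "lin_ext \<phi> f y = (\<Sum>x\<in>S. f x * \<phi> x y)"
  unfolding lin_ext_def by (rule sum.mono_neutral_left) (use assms in auto)

lemma lin_ext_cong: "(\<And>x. f x \<noteq> 0 \<Longrightarrow> \<phi> x = \<phi>' x) \<Longrightarrow> lin_ext \<phi> f = lin_ext \<phi>' f"
  by (auto simp: lin_ext_def fun_eq_iff intro!: sum.cong)

lemma lin_ext_bvec [simp]: "lin_ext \<phi> (bvec x) = \<phi> x"
  unfolding lin_ext_def bvec_supp by (simp add: bvec_def fun_eq_iff)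

lemma lin_ext_zero [simp]: "lin_ext \<phi> (\<lambda>_. 0) = (\<lambda>_. 0)" "lin_ext (\<lambda>_ _. 0) f = (\<lambda>_. 0)"
  by (simp_all add: lin_ext_def)

lemma lin_ext_id: "finite {x. f x \<noteq> 0} \<Longrightarrow> lin_ext bvec f = f"
  by (auto simp: lin_ext_def bvec_def fun_eq_iff sum.delta if_distrib cong: if_cong)

lemma lin_ext_add:
  assumes "finite {x. f x \<noteq> 0}" "finite {x. g x \<noteq> 0}"
  shows "lin_ext \<phi> (\<lambda>x. f x + g x) = (\<lambda>y. lin_ext \<phi> f y + lin_ext \<phi> g y)"
proof
  fix y
  let ?S = "{x. f x \<noteq> 0} \<union> {x. g x \<noteq> 0}"
  have S: "finite ?S" using assms by simp
  show "lin_ext \<phi> (\<lambda>x. f x + g x) y = lin_ext \<phi> f y + lin_ext \<phi> g y"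
    by (subst (1 2 3) lin_ext_superset[OF S]) (auto simp: algebra_simps sum.distrib)
qed

lemma lin_ext_add_map: "lin_ext (\<lambda>x y. \<phi> x y + \<psi> x y) f = (\<lambda>y. lin_ext \<phi> f y + lin_ext \<psi> f y)"
  by (auto simp: lin_ext_def algebra_simps sum.distrib)

lemma lin_ext_comp:
  assumes "finite {x. f x \<noteq> 0}" "\<And>x. f x \<noteq> 0 \<Longrightarrow> finite {y. \<phi> x y \<noteq> 0}"
  shows "lin_ext \<psi> (lin_ext \<phi> f) = lin_ext (\<lambda>x. lin_ext \<psi> (\<phi> x)) f"
proof
  fix z
  let ?U = "\<Union>x\<in>{x. f x \<noteq> 0}. {y. \<phi> x y \<noteq> 0}"
  have U: "finite ?U" using assms by auto
  have sub: "{y. lin_ext \<phi> f y \<noteq> 0} \<subseteq> ?U"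
  proof
    fix y assume "y \<in> {y. lin_ext \<phi> f y \<noteq> 0}"
    then have "(\<Sum>x | f x \<noteq> 0. f x * \<phi> x y) \<noteq> 0" by (simp add: lin_ext_def)
    then obtain x where "f x \<noteq> 0" "f x * \<phi> x y \<noteq> 0"
      by (metis (mono_tags, lifting) mem_Collect_eq sum.neutral)
    then show "y \<in> ?U" by auto
  qed
  have "lin_ext \<psi> (lin_ext \<phi> f) z = (\<Sum>y\<in>?U. \<Sum>x | f x \<noteq> 0. f x * \<phi> x y * \<psi> y z)"
    by (subst lin_ext_superset[OF U sub]) (simp add: lin_ext_def sum_distrib_right)
  also have "\<dots> = (\<Sum>x | f x \<noteq> 0. \<Sum>y\<in>?U. f x * \<phi> x y * \<psi> y z)" by (rule sum.swap)
  also have "\<dots> = (\<Sum>x | f x \<noteq> 0. f x * lin_ext \<psi> (\<phi> x) z)"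
  proof (rule sum.cong)
    fix x assume "x \<in> {x. f x \<noteq> 0}"
    then have sub': "{y. \<phi> x y \<noteq> 0} \<subseteq> ?U" by auto
    show "(\<Sum>y\<in>?U. f x * \<phi> x y * \<psi> y z) = f x * lin_ext \<psi> (\<phi> x) z"
      unfolding lin_ext_superset[OF U sub'] sum_distrib_left mult.assoc ..
  qed simp
  finally show "lin_ext \<psi> (lin_ext \<phi> f) z = lin_ext (\<lambda>x. lin_ext \<psi> (\<phi> x)) f z"
    by (simp add: lin_ext_def)
qed

lemma lin_ext_closed:
  assumes "f \<in> free_space X" "\<And>x. x \<in> X \<Longrightarrow> \<phi> x \<in> free_space Y"
  shows "lin_ext \<phi> f \<in> free_space Y"
proof -
  let ?U = "\<Union>x\<in>{x. f x \<noteq> 0}. {y. \<phi> x y \<noteq> 0}"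
  have sub: "{y. lin_ext \<phi> f y \<noteq> 0} \<subseteq> ?U"
  proof
    fix y assume "y \<in> {y. lin_ext \<phi> f y \<noteq> 0}"
    then have "(\<Sum>x | f x \<noteq> 0. f x * \<phi> x y) \<noteq> 0" by (simp add: lin_ext_def)
    then obtain x where "f x \<noteq> 0" "f x * \<phi> x y \<noteq> 0"
      by (metis (mono_tags, lifting) mem_Collect_eq sum.neutral)
    then show "y \<in> ?U" by auto
  qed
  have "?U \<subseteq> Y" using assms unfolding free_space_def by blast
  moreover have "finite ?U" using assms unfolding free_space_def by blast
  ultimately show ?thesis
    using sub unfolding free_space_def by (auto intro: finite_subset)
qed

lemma bvec_free_space [simp]: "bvec x \<in> free_space X \<longleftrightarrow> x \<in> X"
  by (simp add: free_space_def bvec_supp)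

lemma zero_free_space [simp]: "(\<lambda>_. 0) \<in> free_space X"
  by (simp add: free_space_def)

lemma add_free_space: "f \<in> free_space X \<Longrightarrow> g \<in> free_space X \<Longrightarrow> (\<lambda>x. f x + g x) \<in> free_space X"
  unfolding free_space_def
  by (intro CollectI conjI; (rule finite_subset[of _ "{x. f x \<noteq> 0} \<union> {x. g x \<noteq> 0}"])?) force+

lemma scale_free_space: "f \<in> free_space X \<Longrightarrow> (\<lambda>x. c * f x) \<in> free_space X"
  unfolding free_space_def
  by (auto intro: finite_subset[of _ "{x. f x \<noteq> 0}"])

lemma psrc_pcomp [simp]: "psrc (pcomp \<beta> \<alpha>) = psrc \<alpha>"
  by (simp add: psrc_def pcomp_def)

lemma pcomp_assoc: "pcomp \<gamma> (pcomp \<beta> \<alpha>) = pcomp (pcomp \<gamma> \<beta>) \<alpha>"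
  by (simp add: pcomp_def)

lemma ptgt_pcomp:
  assumes "wf_digraph Q" "psrc \<beta> = ptgt Q \<alpha>"
  shows "ptgt Q (pcomp \<beta> \<alpha>) = ptgt Q \<beta>"
proof -
  interpret wf_digraph Q by fact
  show ?thesis using assms(2) by (simp add: ptgt_def psrc_def pcomp_def awlast_append)
qed

lemma qpaths_iff:
  assumes "wf_digraph Q"
  shows "p \<in> qpaths Q \<longleftrightarrow> pre_digraph.awalk Q (fst p) (snd p) (ptgt Q p)"
proof -
  interpret wf_digraph Q by fact
  show ?thesis unfolding qpaths_def ptgt_def by (auto simp: awalk_def awlast_if_cas)
qed

lemma qpaths_pcomp:
  assumes "wf_digraph Q" "psrc \<beta> = ptgt Q \<alpha>"
  shows "pcomp \<beta> \<alpha> \<in> qpaths Q \<longleftrightarrow> \<alpha> \<in> qpaths Q \<and> \<beta> \<in> qpaths Q"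
proof -
  interpret wf_digraph Q by fact
  show ?thesis
    using assms(2) ptgt_pcomp[OF assms]
    unfolding qpaths_iff[OF assms(1)] by (simp add: pcomp_def psrc_def ptgt_def)
qed

lemma vpath_qpaths: "wf_digraph Q \<Longrightarrow> vpath i \<in> qpaths Q \<longleftrightarrow> i \<in> verts Q"
  by (simp add: qpaths_iff) (simp add: vpath_def ptgt_def pre_digraph.awalk_def
      pre_digraph.awalk_verts.simps pre_digraph.cas.simps)

lemma psrc_vpath [simp]: "psrc (vpath i) = i"
  by (simp add: psrc_def vpath_def)

lemma ptgt_vpath [simp]: "ptgt Q (vpath i) = i"
  by (simp add: ptgt_def vpath_def pre_digraph.awalk_verts.simps)

lemma pcomp_vpath [simp]: "pcomp (vpath i) p = p" "psrc p = i \<Longrightarrow> pcomp p (vpath i) = p"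
  by (cases p; simp add: pcomp_def vpath_def psrc_def)+

lemma ends_in_verts:
  assumes "wf_digraph Q" "p \<in> qpaths Q"
  shows "psrc p \<in> verts Q" "ptgt Q p \<in> verts Q"
proof -
  interpret wf_digraph Q by fact
  show "psrc p \<in> verts Q" "ptgt Q p \<in> verts Q"
    using assms(2) by (auto simp: qpaths_iff[OF assms(1)] psrc_def)
qed

text \<open>Sets of paths that contain the vertices and are closed under taking factors.\<close>

definition factor_closed :: "('v, 'a) pre_digraph \<Rightarrow> ('v, 'a) path set \<Rightarrow> bool" where
  "factor_closed Q X \<longleftrightarrow> X \<subseteq> qpaths Q \<and> vpath ` verts Q \<subseteq> X \<and>
     (\<forall>\<alpha> \<beta>. psrc \<beta> = ptgt Q \<alpha> \<longrightarrow> pcomp \<beta> \<alpha> \<in> X \<longrightarrow> \<alpha> \<in> X \<and> \<beta> \<in> X)"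

lemma path_mult_closed: "path_mult Q X \<beta> \<alpha> \<in> free_space X"
  by (simp add: path_mult_def)

lemma path_mult_finite: "finite {p. path_mult Q X \<beta> \<alpha> p \<noteq> 0}"
  using free_spaceD(1)[OF path_mult_closed] .

lemma path_prod_closed:
  assumes "f \<in> free_space X" "g \<in> free_space X"
  shows "bilin_ext (path_mult Q X) f g \<in> free_space X"
  unfolding bilin_ext_def
  by (rule lin_ext_closed[OF assms(1)], rule lin_ext_closed[OF assms(2)], rule path_mult_closed)

lemma path_prod_assoc:
  fixes f g h :: "('v, 'a) path \<Rightarrow> 'k::field"
  assumes "wf_digraph Q" "factor_closed Q X"
    and f: "f \<in> free_space X" and g: "g \<in> free_space X" and h: "h \<in> free_space X"
  shows "bilin_ext (path_mult Q X) (bilin_ext (path_mult Q X) f g) h =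
         bilin_ext (path_mult Q X) f (bilin_ext (path_mult Q X) g h)"
proof -
  let ?\<phi> = "path_mult Q X :: _ \<Rightarrow> _ \<Rightarrow> _ \<Rightarrow> 'k"
  have fc: "\<alpha> \<in> X \<and> \<beta> \<in> X" if "psrc \<beta> = ptgt Q \<alpha>" "pcomp \<beta> \<alpha> \<in> X" for \<alpha> \<beta>
    using assms(2) that unfolding factor_closed_def by blast
  note fin = free_spaceD(1)[OF f] free_spaceD(1)[OF g] free_spaceD(1)[OF h]
  have fin2: "finite {y. lin_ext (?\<phi> u) g y \<noteq> 0}" "finite {y. lin_ext (?\<phi> u) h y \<noteq> 0}" for u
    by (rule free_spaceD(1), rule lin_ext_closed, rule g h, rule path_mult_closed)+
  have "bilin_ext ?\<phi> (bilin_ext ?\<phi> f g) h =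
      lin_ext (\<lambda>u. lin_ext (\<lambda>v. lin_ext (\<lambda>p. lin_ext (?\<phi> p) h) (?\<phi> u v)) g) f"
    unfolding bilin_ext_def
    by (subst lin_ext_comp[OF fin(1) fin2(1)], subst lin_ext_comp[OF fin(2) path_mult_finite], rule refl)
  also have "\<dots> = lin_ext (\<lambda>u. lin_ext (\<lambda>v. lin_ext (\<lambda>w. lin_ext (?\<phi> u) (?\<phi> v w)) h) g) f"
  proof (intro lin_ext_cong)
    fix u v assume "f u \<noteq> 0" "g v \<noteq> 0"
    then have X: "u \<in> X" "v \<in> X" using f g by (auto simp: free_space_def)
    show "lin_ext (\<lambda>p. lin_ext (?\<phi> p) h) (?\<phi> u v) = lin_ext (\<lambda>w. lin_ext (?\<phi> u) (?\<phi> v w)) h"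
    proof (cases "psrc u = ptgt Q v \<and> pcomp u v \<in> X")
      case True
      have "?\<phi> (pcomp u v) w = lin_ext (?\<phi> u) (?\<phi> v w)" for w
        using True fc[of u "pcomp v w"] ptgt_pcomp[OF assms(1), of v w] pcomp_assoc[of u v w]
        unfolding path_mult_def by auto
      then show ?thesis using True h
        by (auto simp: path_mult_def[of Q X u v] free_space_def intro!: lin_ext_cong)
    next
      case False
      have "lin_ext (?\<phi> u) (?\<phi> v w) = (\<lambda>_. 0)" for w
        using False fc[of "pcomp u v" w] ptgt_pcomp[OF assms(1), of v w] pcomp_assoc[of u v w]
        unfolding path_mult_def by auto
      then have "lin_ext (\<lambda>w. lin_ext (?\<phi> u) (?\<phi> v w)) h = lin_ext (\<lambda>_ _. 0) h"
        using h by (intro lin_ext_cong) (auto simp: free_space_def)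
      then show ?thesis using False by (auto simp: path_mult_def[of Q X u v])
    qed
  qed
  also have "\<dots> = bilin_ext ?\<phi> f (bilin_ext ?\<phi> g h)"
    unfolding bilin_ext_def
    by (intro lin_ext_cong, subst lin_ext_comp[OF fin(2) fin2(2)], subst lin_ext_comp[OF fin(3) path_mult_finite], rule refl)
  finally show ?thesis .
qed

lemma path_ring_one:
  assumes "fin_digraph Q"
  shows "(\<lambda>p. if p \<in> vpath ` verts Q then 1 else 0) = lin_ext bvec (\<lambda>p. if p \<in> vpath ` verts Q then 1 else 0)"
proof -
  interpret fin_digraph Q by fact
  show ?thesis by (subst lin_ext_id) auto
qed

lemma ring_path_ring:
  fixes X :: "('v, 'a) path set"
  assumes "fin_digraph Q" "factor_closed Q X"
  shows "ring (path_ring Q X :: (('v, 'a) path \<Rightarrow> 'k::field) ring)"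
proof -
  interpret fin_digraph Q by fact
  let ?R = "path_ring Q X :: (('v, 'a) path \<Rightarrow> 'k) ring"
  let ?one = "(\<lambda>p. if p \<in> vpath ` verts Q then 1 else 0) :: ('v, 'a) path \<Rightarrow> 'k"
  have wf: "wf_digraph Q" by (rule wf_digraph)
  have one: "?one \<in> free_space X"
    using assms(2) by (auto simp: free_space_def factor_closed_def)
  have vpath_eq: "psrc p = i \<longleftrightarrow> i = psrc p" for p :: "('v, 'a) path" and i by auto
  have l1: "bilin_ext (path_mult Q X) ?one f = f" if f: "f \<in> free_space X" for f :: "('v, 'a) path \<Rightarrow> 'k"
  proof -
    have "lin_ext (\<lambda>u. lin_ext (path_mult Q X u) f) ?one y = f y" for y
    proof -
      have "lin_ext (\<lambda>u. lin_ext (path_mult Q X u) f) ?one y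
          = (\<Sum>u\<in>vpath ` verts Q. lin_ext (path_mult Q X u) f y)"
        by (subst lin_ext_superset[of "vpath ` verts Q"]) auto
      also have "\<dots> = (\<Sum>x | f x \<noteq> 0. \<Sum>u\<in>vpath ` verts Q. f x * path_mult Q X u x y)"
        unfolding lin_ext_def by (rule sum.swap)
      also have "\<dots> = (\<Sum>x | f x \<noteq> 0. f x * bvec x y)"
      proof (rule sum.cong)
        fix x assume "x \<in> {x. f x \<noteq> 0}"
        then have x: "x \<in> X" "x \<in> qpaths Q" using f assms(2) by (auto simp: free_space_def factor_closed_def)
        have "(\<Sum>u\<in>vpath ` verts Q. f x * path_mult Q X u x y)
            = (\<Sum>u\<in>{vpath (ptgt Q x)}. f x * path_mult Q X u x y)"
          using ends_in_verts[OF wf x(2)]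
          by (intro sum.mono_neutral_right) (auto simp: path_mult_def)
        then show "(\<Sum>u\<in>vpath ` verts Q. f x * path_mult Q X u x y) = f x * bvec x y"
          using x by (simp add: path_mult_def)
      qed simp
      also have "\<dots> = f y" using fun_cong[OF lin_ext_id[OF free_spaceD(1)[OF f]], of y] by (simp add: lin_ext_def)
      finally show ?thesis .
    qed
    then show ?thesis by (simp add: bilin_ext_def fun_eq_iff)
  qed
  have r1: "bilin_ext (path_mult Q X) f ?one = f" if f: "f \<in> free_space X" for f :: "('v, 'a) path \<Rightarrow> 'k"
  proof -
    have "lin_ext (\<lambda>u. lin_ext (path_mult Q X u) ?one) f = lin_ext bvec f"
    proof (rule lin_ext_cong)
      fix x assume "f x \<noteq> 0"
      then have x: "x \<in> X" "x \<in> qpaths Q" using f assms(2) by (auto simp: free_space_def factor_closed_def)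
      show "lin_ext (path_mult Q X x) ?one = bvec x"
      proof
        fix y
        have "lin_ext (path_mult Q X x) ?one y = (\<Sum>u\<in>vpath ` verts Q. path_mult Q X x u y)"
          by (subst lin_ext_superset[of "vpath ` verts Q"]) auto
        also have "\<dots> = (\<Sum>u\<in>{vpath (psrc x)}. path_mult Q X x u y)"
          using ends_in_verts[OF wf x(2)]
          by (intro sum.mono_neutral_right) (auto simp: path_mult_def)
        finally show "lin_ext (path_mult Q X x) ?one y = bvec x y"
          using x by (simp add: path_mult_def)
      qed
    qed
    then show ?thesis using lin_ext_id[OF free_spaceD(1)[OF f]] by (simp add: bilin_ext_def)
  qed
  show ?thesis
  proof (rule ringI)
    show "abelian_group ?R"
    proof (rule abelian_groupI)
      fix x assume "x \<in> carrier ?R"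
      then show "\<exists>y\<in>carrier ?R. y \<oplus>\<^bsub>?R\<^esub> x = \<zero>\<^bsub>?R\<^esub>"
        using scale_free_space[of x X "- 1"]
        by (intro bexI[of _ "\<lambda>p. - x p"]) (auto simp: path_ring_def)
    qed (auto simp: path_ring_def add_free_space algebra_simps)
    show "Group.monoid ?R"
      by (rule monoidI)
        (auto simp: path_ring_def path_prod_closed one path_prod_assoc[OF wf assms(2)] l1 r1)
  next
    fix x y z assume "x \<in> carrier ?R" "y \<in> carrier ?R" "z \<in> carrier ?R"
    then have fin: "finite {p. x p \<noteq> 0}" "finite {p. y p \<noteq> 0}" "finite {p. z p \<noteq> 0}"
      by (auto simp: path_ring_def free_space_def)
    show "(x \<oplus>\<^bsub>?R\<^esub> y) \<otimes>\<^bsub>?R\<^esub> z = x \<otimes>\<^bsub>?R\<^esub> z \<oplus>\<^bsub>?R\<^esub> y \<otimes>\<^bsub>?R\<^esub> z"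
      by (simp add: path_ring_def bilin_ext_def lin_ext_add[OF fin(1,2)])
    show "z \<otimes>\<^bsub>?R\<^esub> (x \<oplus>\<^bsub>?R\<^esub> y) = z \<otimes>\<^bsub>?R\<^esub> x \<oplus>\<^bsub>?R\<^esub> z \<otimes>\<^bsub>?R\<^esub> y"
      by (simp add: path_ring_def bilin_ext_def lin_ext_add[OF fin(1,2)] lin_ext_add_map)
  qed
qed

lemma factor_closed_qpaths: "wf_digraph Q \<Longrightarrow> factor_closed Q (qpaths Q)"
  by (auto simp: factor_closed_def vpath_qpaths qpaths_pcomp)

lemma subpath_trans_factor:
  assumes wf: "wf_digraph Q" and c: "psrc \<beta> = ptgt Q \<alpha>" "\<alpha> \<in> qpaths Q" "\<beta> \<in> qpaths Q"
    and r: "r \<in> qpaths Q" and s: "subpath Q r \<alpha> \<or> subpath Q r \<beta>"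
  shows "subpath Q r (pcomp \<beta> \<alpha>)"
  using s
proof
  assume "subpath Q r \<alpha>"
  then obtain \<delta> \<epsilon> where d: "\<delta> \<in> qpaths Q" "\<epsilon> \<in> qpaths Q" "psrc \<delta> = ptgt Q r" "psrc r = ptgt Q \<epsilon>"
    "\<alpha> = pcomp \<delta> (pcomp r \<epsilon>)" by (auto simp: subpath_def)
  have "ptgt Q \<alpha> = ptgt Q \<delta>" using d ptgt_pcomp[OF wf] by simp
  then have "pcomp \<beta> \<delta> \<in> qpaths Q" using c d qpaths_pcomp[OF wf, of \<beta> \<delta>] by simp
  moreover have "pcomp \<beta> \<alpha> = pcomp (pcomp \<beta> \<delta>) (pcomp r \<epsilon>)" using d by (simp add: pcomp_assoc)
  ultimately show ?thesis unfolding subpath_def using d(2-4)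
    by (intro bexI[of _ "pcomp \<beta> \<delta>"] bexI[of _ \<epsilon>]) simp_all
next
  assume "subpath Q r \<beta>"
  then obtain \<delta> \<epsilon> where d: "\<delta> \<in> qpaths Q" "\<epsilon> \<in> qpaths Q" "psrc \<delta> = ptgt Q r" "psrc r = ptgt Q \<epsilon>"
    "\<beta> = pcomp \<delta> (pcomp r \<epsilon>)" by (auto simp: subpath_def)
  have "psrc \<epsilon> = ptgt Q \<alpha>" using d c by simp
  then have "pcomp \<epsilon> \<alpha> \<in> qpaths Q" "ptgt Q (pcomp \<epsilon> \<alpha>) = ptgt Q \<epsilon>"
    using c d qpaths_pcomp[OF wf, of \<epsilon> \<alpha>] ptgt_pcomp[OF wf, of \<epsilon> \<alpha>] by simp_all
  moreover have "pcomp \<beta> \<alpha> = pcomp \<delta> (pcomp r (pcomp \<epsilon> \<alpha>))" using d by (simp add: pcomp_assoc)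
  ultimately show ?thesis unfolding subpath_def using d(1,3,4)
    by (intro bexI[of _ \<delta>] bexI[of _ "pcomp \<epsilon> \<alpha>"]) simp_all
qed

lemma plen_pcomp [simp]: "plen (pcomp \<beta> \<alpha>) = plen \<beta> + plen \<alpha>"
  by (simp add: plen_def pcomp_def)

lemma factor_closed_\<B>:
  assumes "wf_digraph Q"
  shows "factor_closed Q (\<B> Q I)"
  unfolding factor_closed_def
proof (intro conjI allI impI)
  show "\<B> Q I \<subseteq> qpaths Q" by (auto simp: \<B>_def)
  have "\<not> subpath Q r (vpath i)" if "r \<in> relations Q I" for r i
  proof
    assume "subpath Q r (vpath i)"
    then have "plen r \<le> plen (vpath i :: ('a, 'b) path)" by (auto simp: subpath_def)
    then show False using that by (simp add: relations_def) (simp add: plen_def vpath_def)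
  qed
  then show "vpath ` verts Q \<subseteq> \<B> Q I"
    by (auto simp: \<B>_def vpath_qpaths[OF assms])
next
  fix \<alpha> \<beta> assume c: "psrc \<beta> = ptgt Q \<alpha>" and B: "pcomp \<beta> \<alpha> \<in> \<B> Q I"
  have q: "\<alpha> \<in> qpaths Q" "\<beta> \<in> qpaths Q"
    using B qpaths_pcomp[OF assms c] by (auto simp: \<B>_def)
  show "\<alpha> \<in> \<B> Q I" "\<beta> \<in> \<B> Q I"
    using B q subpath_trans_factor[OF assms c q]
    by (auto simp: \<B>_def relations_def)
qed

lemma carrier_path_ring: "carrier (path_ring Q X) = free_space X"
  by (simp add: path_ring_def)

text \<open>The reduction \<open>kQ \<rightarrow> A\<close>, which deletes the paths outside \<open>\<B>\<close>.\<close>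

definition reduce ::
  "('v, 'a) path set \<Rightarrow> (('v, 'a) path \<Rightarrow> 'k::field) \<Rightarrow> ('v, 'a) path \<Rightarrow> 'k" where
  "reduce X f = (\<lambda>p. if p \<in> X then f p else 0)"

lemma reduce_lin_ext: "reduce X (lin_ext \<phi> f) = lin_ext (\<lambda>x. reduce X (\<phi> x)) f"
  by (auto simp: reduce_def lin_ext_def fun_eq_iff)

lemma lin_ext_reduce:
  assumes "finite {x. f x \<noteq> 0}" "\<And>x. f x \<noteq> 0 \<Longrightarrow> x \<notin> X \<Longrightarrow> \<phi> x = (\<lambda>_. 0)"
  shows "lin_ext \<phi> (reduce X f) = lin_ext \<phi> f"
proof
  fix y
  have "lin_ext \<phi> (reduce X f) y = (\<Sum>x | f x \<noteq> 0. reduce X f x * \<phi> x y)"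
    by (rule lin_ext_superset[OF assms(1)]) (auto simp: reduce_def)
  also have "\<dots> = lin_ext \<phi> f y"
    unfolding lin_ext_def using assms(2) by (intro sum.cong) (auto simp: reduce_def)
  finally show "lin_ext \<phi> (reduce X f) y = lin_ext \<phi> f y" .
qed

lemma reduce_ring_hom:
  fixes X :: "('v, 'a) path set"
  assumes fin: "fin_digraph Q" and X: "factor_closed Q X"
  shows "ring_hom_ring (path_algebra Q) (path_ring Q X) (reduce X :: (('v, 'a) path \<Rightarrow> 'k::field) \<Rightarrow> _)"
proof (rule ring_hom_ringI)
  interpret fin_digraph Q by fact
  let ?K = "path_algebra Q :: (('v, 'a) path \<Rightarrow> 'k) ring"
  let ?A = "path_ring Q X :: (('v, 'a) path \<Rightarrow> 'k) ring"
  show "ring ?K" unfolding path_algebra_def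
    by (rule ring_path_ring[OF fin factor_closed_qpaths[OF wf_digraph]])
  show "ring ?A" by (rule ring_path_ring[OF fin X])
  show "reduce X f \<in> carrier ?A" if "f \<in> carrier ?K" for f :: "('v, 'a) path \<Rightarrow> 'k"
    using that unfolding path_algebra_def carrier_path_ring free_space_def
    by (auto simp: reduce_def elim!: finite_subset[rotated])
  show "reduce X (f \<oplus>\<^bsub>?K\<^esub> g) = reduce X f \<oplus>\<^bsub>?A\<^esub> reduce X g" for f g
    by (auto simp: path_algebra_def path_ring_def reduce_def)
  show "reduce X \<one>\<^bsub>?K\<^esub> = \<one>\<^bsub>?A\<^esub>"
    using X by (auto simp: path_algebra_def path_ring_def reduce_def factor_closed_def fun_eq_iff)
  fix f g :: "('v, 'a) path \<Rightarrow> 'k"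
  assume f: "f \<in> carrier ?K" and g: "g \<in> carrier ?K"
  have f': "finite {x. f x \<noteq> 0}" and g': "finite {x. g x \<noteq> 0}"
    using f g by (auto simp: path_algebra_def path_ring_def free_space_def)
  have red: "reduce X (path_mult Q (qpaths Q) u v) = (path_mult Q X u v :: _ \<Rightarrow> 'k)" for u v
    using X by (auto simp: reduce_def path_mult_def bvec_def factor_closed_def fun_eq_iff)
  have z: "(path_mult Q X u v :: _ \<Rightarrow> 'k) = (\<lambda>_. 0)" if "u \<notin> X \<or> v \<notin> X" for u v
    using X that unfolding path_mult_def factor_closed_def by metis
  have 1: "lin_ext (path_mult Q X u) (reduce X g) = lin_ext (path_mult Q X u) g" for u
    by (rule lin_ext_reduce[OF g']) (use z in auto)
  have 2: "lin_ext (\<lambda>u. lin_ext (path_mult Q X u) g) (reduce X f) = lin_ext (\<lambda>u. lin_ext (path_mult Q X u) g) f"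
  proof (rule lin_ext_reduce[OF f'])
    fix u assume "u \<notin> X"
    then have "path_mult Q X u = (\<lambda>_ _. 0 :: 'k)" using z by (auto simp: fun_eq_iff)
    then show "lin_ext (path_mult Q X u) g = (\<lambda>_. 0)" by simp
  qed
  show "reduce X (f \<otimes>\<^bsub>?K\<^esub> g) = reduce X f \<otimes>\<^bsub>?A\<^esub> reduce X g"
    by (simp add: path_algebra_def path_ring_def bilin_ext_def reduce_lin_ext red 1 2)
qed

lemma reduce_kernel:
  fixes I :: "(('v, 'a) path \<Rightarrow> 'k::field) set"
  assumes fin: "fin_digraph Q" and S: "S \<subseteq> {p \<in> qpaths Q. plen p = 2}"
    and I: "I = Idl\<^bsub>path_algebra Q\<^esub> (bvec ` S)"
  shows "a_kernel (path_algebra Q) (gentle_algebra Q I) (reduce (\<B> Q I)) = I"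
proof -
  interpret fin_digraph Q by fact
  let ?K = "path_algebra Q :: (('v, 'a) path \<Rightarrow> 'k) ring"
  have wf: "wf_digraph Q" by (rule wf_digraph)
  interpret h: ring_hom_ring ?K "gentle_algebra Q I" "reduce (\<B> Q I)"
    unfolding gentle_algebra_def by (rule reduce_ring_hom[OF fin factor_closed_\<B>[OF wf]])
  have carr: "carrier ?K = free_space (qpaths Q)"
    by (simp add: path_algebra_def carrier_path_ring)
  have Scarr: "bvec ` S \<subseteq> carrier ?K" using S by (auto simp: carr)
  interpret I: ideal I ?K unfolding I by (rule h.R.genideal_ideal[OF Scarr])
  have SI: "bvec ` S \<subseteq> I" unfolding I by (rule h.R.genideal_self[OF Scarr])
  have ker: "a_kernel ?K (gentle_algebra Q I) (reduce (\<B> Q I)) =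
      {f \<in> free_space (qpaths Q). \<forall>p\<in>\<B> Q I. f p = 0}"
    by (auto simp: a_kernel_def' carr gentle_algebra_def path_ring_def reduce_def fun_eq_iff)
  have self: "subpath Q p p" if "p \<in> qpaths Q" for p
    unfolding subpath_def using ends_in_verts[OF wf that] vpath_qpaths[OF wf]
      psrc_vpath[of "ptgt Q p"] ptgt_vpath[of Q "psrc p"] pcomp_vpath by metis
  have "(bvec :: ('v, 'a) path \<Rightarrow> _ \<Rightarrow> 'k) ` S \<subseteq> a_kernel ?K (gentle_algebra Q I) (reduce (\<B> Q I))"
  proof
    fix x assume "x \<in> (bvec :: ('v, 'a) path \<Rightarrow> _ \<Rightarrow> 'k) ` S"
    then obtain s where s: "s \<in> S" "x = bvec s" by blast
    then have "s \<in> relations Q I" using S SI by (auto simp: relations_def)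
    then have "s \<notin> \<B> Q I" using self[of s] unfolding \<B>_def relations_def by blast
    then show "x \<in> a_kernel ?K (gentle_algebra Q I) (reduce (\<B> Q I))"
      using s S by (auto simp: ker bvec_def) (auto simp: free_space_def)
  qed
  then have "I \<subseteq> a_kernel ?K (gentle_algebra Q I) (reduce (\<B> Q I))"
    by (subst I, intro h.R.genideal_minimal h.kernel_is_ideal)
  moreover have "f \<in> I" if f: "f \<in> free_space (qpaths Q)" "\<forall>p\<in>\<B> Q I. f p = 0" for f
  proof -
    have mult: "bvec \<beta> \<otimes>\<^bsub>?K\<^esub> bvec \<alpha> = bvec (pcomp \<beta> \<alpha>)"
      if "psrc \<beta> = ptgt Q \<alpha>" "\<alpha> \<in> qpaths Q" "\<beta> \<in> qpaths Q" for \<alpha> \<beta>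
      using that qpaths_pcomp[OF wf that(1)]
      by (simp add: path_algebra_def path_ring_def bilin_ext_def path_mult_def)
    have path: "bvec p \<in> I" if p: "p \<in> qpaths Q" "p \<notin> \<B> Q I" for p
    proof -
      obtain r \<delta> \<epsilon> where r: "r \<in> relations Q I" "\<delta> \<in> qpaths Q" "\<epsilon> \<in> qpaths Q"
        "psrc \<delta> = ptgt Q r" "psrc r = ptgt Q \<epsilon>" "p = pcomp \<delta> (pcomp r \<epsilon>)"
        using p by (auto simp: \<B>_def subpath_def)
      have rq: "r \<in> qpaths Q" "bvec r \<in> I" using r(1) by (auto simp: relations_def)
      have re: "pcomp r \<epsilon> \<in> qpaths Q" "ptgt Q (pcomp r \<epsilon>) = ptgt Q r"
        using r rq qpaths_pcomp[OF wf, of r \<epsilon>] ptgt_pcomp[OF wf, of r \<epsilon>] by auto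
      have "bvec r \<otimes>\<^bsub>?K\<^esub> bvec \<epsilon> \<in> I" by (rule I.I_r_closed) (use r rq in \<open>auto simp: carr\<close>)
      then have "bvec (pcomp r \<epsilon>) \<in> I" using mult[of r \<epsilon>] r rq by simp
      then have "bvec \<delta> \<otimes>\<^bsub>?K\<^esub> bvec (pcomp r \<epsilon>) \<in> I"
        by (rule I.I_l_closed) (use r in \<open>auto simp: carr\<close>)
      then show ?thesis using mult[of \<delta> "pcomp r \<epsilon>"] r re by simp
    qed
    have scal: "(\<lambda>p. c * x p) \<in> I" if x: "x \<in> I" for c x
    proof -
      have xc: "x \<in> carrier ?K" using I.a_subset x by auto
      have "(\<lambda>p. c * \<one>\<^bsub>?K\<^esub> p) \<in> carrier ?K"
        using h.R.one_closed unfolding carr by (rule scale_free_space)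
      then have "(\<lambda>p. c * \<one>\<^bsub>?K\<^esub> p) \<otimes>\<^bsub>?K\<^esub> x \<in> I" by (rule I.I_l_closed[OF x])
      moreover have "(\<lambda>p. c * \<one>\<^bsub>?K\<^esub> p) \<otimes>\<^bsub>?K\<^esub> x = (\<lambda>p. c * (\<one>\<^bsub>?K\<^esub> \<otimes>\<^bsub>?K\<^esub> x) p)"
      proof -
        have fin1: "finite {p. \<one>\<^bsub>?K\<^esub> p \<noteq> 0}" using h.R.one_closed unfolding carr by (rule free_spaceD)
        have "lin_ext \<phi> (\<lambda>p. c * \<one>\<^bsub>?K\<^esub> p) y = c * lin_ext \<phi> \<one>\<^bsub>?K\<^esub> y" for \<phi> :: "_ \<Rightarrow> ('v, 'a) path \<Rightarrow> 'k" and y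
          by (subst (1 2) lin_ext_superset[OF fin1]) (auto simp: sum_distrib_left mult.assoc)
        then show ?thesis by (simp add: path_algebra_def path_ring_def bilin_ext_def fun_eq_iff)
      qed
      ultimately show ?thesis using h.R.l_one[OF xc] by simp
    qed
    have part: "(\<lambda>p. if p \<in> U then f p else 0) \<in> I" if "finite U" "U \<subseteq> {p. f p \<noteq> 0}" for U
      using that
    proof (induction U rule: finite_induct)
      case empty
      then show ?case using I.zero_closed by (simp add: path_algebra_def path_ring_def)
    next
      case (insert q U)
      have "q \<in> qpaths Q" "q \<notin> \<B> Q I" using insert.prems f by (auto simp: free_space_def)
      then have "(\<lambda>p. f q * bvec q p) \<in> I" by (intro scal path)
      then have "(\<lambda>p. if p \<in> U then f p else 0) \<oplus>\<^bsub>?K\<^esub> (\<lambda>p. f q * bvec q p) \<in> I"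
        using insert by (intro I.a_closed) auto
      moreover have "(\<lambda>p. if p \<in> U then f p else 0) \<oplus>\<^bsub>?K\<^esub> (\<lambda>p. f q * bvec q p)
          = (\<lambda>p. if p \<in> insert q U then f p else 0)"
        using insert.hyps by (auto simp: path_algebra_def path_ring_def bvec_def fun_eq_iff)
      ultimately show ?case by simp
    qed
    have "(\<lambda>p. if p \<in> {p. f p \<noteq> 0} then f p else 0) = f" by auto
    then show ?thesis using part[of "{p. f p \<noteq> 0}"] free_spaceD(1)[OF f(1)] by auto
  qed
  ultimately show ?thesis unfolding ker by blast
qed

lemma gentle_algebra_iso_quotient:
  fixes I :: "(('v, 'a) path \<Rightarrow> 'k::field) set"
  assumes "fin_digraph Q" "gentle_presentation Q I"
  shows "ring (path_algebra Q :: (('v, 'a) path \<Rightarrow> 'k) ring)" "ring (gentle_algebra Q I)" "ideal I (path_algebra Q)"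
    and "path_algebra Q Quot I \<simeq> gentle_algebra Q I"
proof -
  interpret fin_digraph Q by fact
  obtain S where S: "S \<subseteq> {p \<in> qpaths Q. plen p = 2}" "I = Idl\<^bsub>path_algebra Q\<^esub> (bvec ` S)"
    using assms(2) by (auto simp: gentle_presentation_def)
  interpret h: ring_hom_ring "path_algebra Q" "gentle_algebra Q I" "reduce (\<B> Q I)"
    unfolding gentle_algebra_def by (rule reduce_ring_hom[OF assms(1) factor_closed_\<B>[OF wf_digraph]])
  show "ring (path_algebra Q :: (('v, 'a) path \<Rightarrow> 'k) ring)" by (rule h.R.ring_axioms)
  show "ring (gentle_algebra Q I)" by (rule h.S.ring_axioms)
  note k = reduce_kernel[OF assms(1) S]
  show "ideal I (path_algebra Q)" using h.kernel_is_ideal unfolding k .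
  have "reduce (\<B> Q I) ` carrier (path_algebra Q) = carrier (gentle_algebra Q I)"
  proof
    show "carrier (gentle_algebra Q I) \<subseteq> reduce (\<B> Q I) ` carrier (path_algebra Q)"
    proof
      fix f assume f: "f \<in> carrier (gentle_algebra Q I)"
      then have "reduce (\<B> Q I) f = f" "f \<in> carrier (path_algebra Q)"
        by (auto simp: gentle_algebra_def path_algebra_def carrier_path_ring free_space_def reduce_def
            \<B>_def fun_eq_iff)
      then show "f \<in> reduce (\<B> Q I) ` carrier (path_algebra Q)" by (metis image_eqI)
    qed
  qed (use h.hom_closed in auto)
  from h.FactRing_iso[OF this] show "path_algebra Q Quot I \<simeq> gentle_algebra Q I"
    unfolding k .
qed

section \<open>Modules over the enveloping algebra, projective resolutions and Ext\<close>

record ('r, 'm) bimodule = "('r, 'm) module" +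
  rsmult :: "'m \<Rightarrow> 'r \<Rightarrow> 'm"

text \<open>A module over the enveloping algebra $A^e = A\otimes_{\Bbbk}A^{op}$ is an
  \<open>A\<close>-\<open>A\<close>-bimodule on which the two actions of the field, given by \<open>\<eta> : k \<rightarrow> A\<close>, agree.\<close>

locale env_module = ring A + M?: abelian_group M
  for A :: "'r ring" and \<eta> :: "'k \<Rightarrow> 'r" and M :: "('r, 'm) bimodule" +
  assumes left_closed: "a \<in> carrier A \<Longrightarrow> x \<in> carrier M \<Longrightarrow> smult M a x \<in> carrier M"
    and right_closed: "a \<in> carrier A \<Longrightarrow> x \<in> carrier M \<Longrightarrow> rsmult M x a \<in> carrier M"
    and left_add_scalar: "a \<in> carrier A \<Longrightarrow> b \<in> carrier A \<Longrightarrow> x \<in> carrier M \<Longrightarrow>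
          smult M (a \<oplus>\<^bsub>A\<^esub> b) x = smult M a x \<oplus>\<^bsub>M\<^esub> smult M b x"
    and right_add_scalar: "a \<in> carrier A \<Longrightarrow> b \<in> carrier A \<Longrightarrow> x \<in> carrier M \<Longrightarrow>
          rsmult M x (a \<oplus>\<^bsub>A\<^esub> b) = rsmult M x a \<oplus>\<^bsub>M\<^esub> rsmult M x b"
    and left_add: "a \<in> carrier A \<Longrightarrow> x \<in> carrier M \<Longrightarrow> y \<in> carrier M \<Longrightarrow>
          smult M a (x \<oplus>\<^bsub>M\<^esub> y) = smult M a x \<oplus>\<^bsub>M\<^esub> smult M a y"
    and right_add: "a \<in> carrier A \<Longrightarrow> x \<in> carrier M \<Longrightarrow> y \<in> carrier M \<Longrightarrow>
          rsmult M (x \<oplus>\<^bsub>M\<^esub> y) a = rsmult M x a \<oplus>\<^bsub>M\<^esub> rsmult M y a"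
    and left_assoc: "a \<in> carrier A \<Longrightarrow> b \<in> carrier A \<Longrightarrow> x \<in> carrier M \<Longrightarrow>
          smult M (a \<otimes>\<^bsub>A\<^esub> b) x = smult M a (smult M b x)"
    and right_assoc: "a \<in> carrier A \<Longrightarrow> b \<in> carrier A \<Longrightarrow> x \<in> carrier M \<Longrightarrow>
          rsmult M x (a \<otimes>\<^bsub>A\<^esub> b) = rsmult M (rsmult M x a) b"
    and left_one: "x \<in> carrier M \<Longrightarrow> smult M \<one>\<^bsub>A\<^esub> x = x"
    and right_one: "x \<in> carrier M \<Longrightarrow> rsmult M x \<one>\<^bsub>A\<^esub> = x"
    and left_right: "a \<in> carrier A \<Longrightarrow> b \<in> carrier A \<Longrightarrow> x \<in> carrier M \<Longrightarrow>
          rsmult M (smult M a x) b = smult M a (rsmult M x b)"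
    and central: "x \<in> carrier M \<Longrightarrow> smult M (\<eta> c) x = rsmult M x (\<eta> c)"

definition regular_bimodule :: "'r ring \<Rightarrow> ('r, 'r) bimodule" where
  "regular_bimodule A = \<lparr>carrier = carrier A, mult = mult A, one = one A, zero = zero A, add = add A,
     smult = mult A, rsmult = mult A\<rparr>"

definition env_hom ::
  "'r ring \<Rightarrow> ('r, 'm) bimodule \<Rightarrow> ('r, 'n) bimodule \<Rightarrow> ('m \<Rightarrow> 'n) set" where
  "env_hom A M N = {f \<in> carrier M \<rightarrow>\<^sub>E carrier N.
     (\<forall>x\<in>carrier M. \<forall>y\<in>carrier M. f (x \<oplus>\<^bsub>M\<^esub> y) = f x \<oplus>\<^bsub>N\<^esub> f y) \<and>
     (\<forall>a\<in>carrier A. \<forall>x\<in>carrier M. f (smult M a x) = smult N a (f x)) \<and>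
     (\<forall>a\<in>carrier A. \<forall>x\<in>carrier M. f (rsmult M x a) = rsmult N (f x) a)}"

text \<open>HOL cannot quantify over types, so the lifting property is stated for epimorphisms of modules
  whose underlying type is given by the first argument. A theorem in which that type is a type variable
  covers all modules.\<close>

definition env_projective ::
  "'n itself \<Rightarrow> 'r ring \<Rightarrow> ('k \<Rightarrow> 'r) \<Rightarrow> ('r, 'm) bimodule \<Rightarrow> bool" where
  "env_projective _ A \<eta> P \<longleftrightarrow> env_module A \<eta> P \<and>
     (\<forall>(M :: ('r, 'n) bimodule) (N :: ('r, 'n) bimodule) g f.
        env_module A \<eta> M \<and> env_module A \<eta> N \<and>
        g \<in> env_hom A M N \<and> g ` carrier M = carrier N \<and> f \<in> env_hom A P N \<longrightarrow>
        (\<exists>h\<in>env_hom A P M. \<forall>x\<in>carrier P. g (h x) = f x))"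

text \<open>Here \<open>d (Suc m) : P (Suc m) \<rightarrow> P m\<close>; \<open>d 0\<close> is not used.\<close>

definition projective_resolution :: "'n itself \<Rightarrow> 'r ring \<Rightarrow> ('k \<Rightarrow> 'r) \<Rightarrow>
    (nat \<Rightarrow> ('r, 'm) bimodule) \<Rightarrow> (nat \<Rightarrow> 'm \<Rightarrow> 'm) \<Rightarrow> ('m \<Rightarrow> 'q) \<Rightarrow> ('r, 'q) bimodule \<Rightarrow> bool" where
  "projective_resolution t A \<eta> P d \<epsilon> N \<longleftrightarrow>
     env_module A \<eta> N \<and>
     (\<forall>m. env_projective t A \<eta> (P m)) \<and>
     (\<forall>m. d (Suc m) \<in> env_hom A (P (Suc m)) (P m)) \<and>
     \<epsilon> \<in> env_hom A (P 0) N \<and>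
     \<epsilon> ` carrier (P 0) = carrier N \<and>
     {x \<in> carrier (P 0). \<epsilon> x = \<zero>\<^bsub>N\<^esub>} = d 1 ` carrier (P 1) \<and>
     (\<forall>m. {x \<in> carrier (P (Suc m)). d (Suc m) x = \<zero>\<^bsub>P m\<^esub>} = d (Suc (Suc m)) ` carrier (P (Suc (Suc m))))"

text \<open>$\mathrm{Hom}_{A^e}(M, N)$ as a vector space.\<close>

definition hom_space :: "'r ring \<Rightarrow> ('k \<Rightarrow> 'r) \<Rightarrow> ('r, 'm) bimodule \<Rightarrow> ('r, 'n) bimodule
    \<Rightarrow> ('k, 'm \<Rightarrow> 'n) module" where
  "hom_space A \<eta> M N = \<lparr>carrier = env_hom A M N, mult = undefined, one = undefined,
     zero = (\<lambda>x\<in>carrier M. \<zero>\<^bsub>N\<^esub>),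
     add = (\<lambda>f g. \<lambda>x\<in>carrier M. f x \<oplus>\<^bsub>N\<^esub> g x),
     smult = (\<lambda>c f. \<lambda>x\<in>carrier M. smult N (\<eta> c) (f x))\<rparr>"

definition hom_cocycles :: "'r ring \<Rightarrow> (nat \<Rightarrow> ('r, 'm) bimodule) \<Rightarrow> (nat \<Rightarrow> 'm \<Rightarrow> 'm)
    \<Rightarrow> ('r, 'n) bimodule \<Rightarrow> nat \<Rightarrow> ('m \<Rightarrow> 'n) set" where
  "hom_cocycles A P d N m =
     {f \<in> env_hom A (P m) N. \<forall>x\<in>carrier (P (Suc m)). f (d (Suc m) x) = \<zero>\<^bsub>N\<^esub>}"

fun hom_coboundaries :: "'r ring \<Rightarrow> (nat \<Rightarrow> ('r, 'm) bimodule) \<Rightarrow> (nat \<Rightarrow> 'm \<Rightarrow> 'm)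
    \<Rightarrow> ('r, 'n) bimodule \<Rightarrow> nat \<Rightarrow> ('m \<Rightarrow> 'n) set" where
  "hom_coboundaries A P d N 0 = {\<lambda>x\<in>carrier (P 0). \<zero>\<^bsub>N\<^esub>}"
| "hom_coboundaries A P d N (Suc m) =
     (\<lambda>g. \<lambda>x\<in>carrier (P (Suc m)). g (d (Suc m) x)) ` env_hom A (P m) N"

definition ext_class :: "'r ring \<Rightarrow> ('k \<Rightarrow> 'r) \<Rightarrow> (nat \<Rightarrow> ('r, 'm) bimodule) \<Rightarrow> (nat \<Rightarrow> 'm \<Rightarrow> 'm)
    \<Rightarrow> ('r, 'n) bimodule \<Rightarrow> nat \<Rightarrow> ('m \<Rightarrow> 'n) \<Rightarrow> ('m \<Rightarrow> 'n) set" where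
  "ext_class A \<eta> P d N m f = hom_coboundaries A P d N m +>\<^bsub>hom_space A \<eta> (P m) N\<^esub> f"

text \<open>The vector space $\mathrm{Ext}^m_{A^e}(-, N)$ computed from the projective resolution \<open>(P, d)\<close>:
  cocycles modulo coboundaries, as a space of cosets.\<close>

definition ext_space :: "'r ring \<Rightarrow> ('k \<Rightarrow> 'r) \<Rightarrow> (nat \<Rightarrow> ('r, 'm) bimodule) \<Rightarrow> (nat \<Rightarrow> 'm \<Rightarrow> 'm)
    \<Rightarrow> ('r, 'n) bimodule \<Rightarrow> nat \<Rightarrow> ('k, ('m \<Rightarrow> 'n) set) module" where
  "ext_space A \<eta> P d N m = \<lparr>carrier = ext_class A \<eta> P d N m ` hom_cocycles A P d N m,
     mult = undefined, one = undefined,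
     zero = hom_coboundaries A P d N m,
     add = (\<lambda>X Y. X <+>\<^bsub>hom_space A \<eta> (P m) N\<^esub> Y),
     smult = (\<lambda>c X. \<Union>f\<in>X. ext_class A \<eta> P d N m (smult (hom_space A \<eta> (P m) N) c f))\<rparr>"

text \<open>The family \<open>(x j)\<close>, \<open>j \<in> J\<close>, is a basis of the vector space \<open>V\<close>; in particular its members
  are pairwise distinct.\<close>

definition is_basis :: "('k::field, 'w) module \<Rightarrow> 'j set \<Rightarrow> ('j \<Rightarrow> 'w) \<Rightarrow> bool" where
  "is_basis V J x \<longleftrightarrow> x \<in> J \<rightarrow> carrier V \<and>
     (\<forall>\<xi>\<in>carrier V. \<exists>!c. c \<in> free_space J \<and> \<xi> = (\<Oplus>\<^bsub>V\<^esub>j\<in>{j. c j \<noteq> 0}. c j \<odot>\<^bsub>V\<^esub> x j))"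


section \<open>The Bardzell resolution and Hochschild cohomology\<close>

text \<open>$\mathcal R_m=A\otimes_E\Bbbk\Gamma_m\otimes_EA$ has as basis the tensors
  $u\otimes\gamma\otimes v$ with $u,v\in\mathcal B$, $\gamma\in\Gamma_m$, $s(u)=t(\gamma)$ and
  $s(\gamma)=t(v)$.\<close>

definition bardzell_basis :: "('v, 'a) pre_digraph \<Rightarrow> (('v, 'a) path \<Rightarrow> 'k::field) set \<Rightarrow> nat
    \<Rightarrow> (('v, 'a) path \<times> ('v, 'a) path \<times> ('v, 'a) path) set" where
  "bardzell_basis Q I m = {(u, \<gamma>, v). u \<in> \<B> Q I \<and> \<gamma> \<in> \<Gamma>m Q I m \<and> v \<in> \<B> Q I \<and>
     psrc u = ptgt Q \<gamma> \<and> psrc \<gamma> = ptgt Q v}"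

definition bardzell :: "('v, 'a) pre_digraph \<Rightarrow> (('v, 'a) path \<Rightarrow> 'k::field) set \<Rightarrow> nat
    \<Rightarrow> (('v, 'a) path \<Rightarrow> 'k,
        ('v, 'a) path \<times> ('v, 'a) path \<times> ('v, 'a) path \<Rightarrow> 'k) bimodule" where
  "bardzell Q I m = \<lparr>carrier = free_space (bardzell_basis Q I m), mult = undefined, one = undefined,
     zero = (\<lambda>_. 0), add = (\<lambda>F G y. F y + G y),
     smult = bilin_ext (\<lambda>p (u, \<gamma>, v).
       if psrc p = ptgt Q u \<and> pcomp p u \<in> \<B> Q I then bvec (pcomp p u, \<gamma>, v) else (\<lambda>_. 0)),
     rsmult = bilin_ext (\<lambda>(u, \<gamma>, v) p.
       if psrc v = ptgt Q p \<and> pcomp v p \<in> \<B> Q I then bvec (u, \<gamma>, pcomp v p) else (\<lambda>_. 0))\<rparr>"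

text \<open>$u\otimes c_m\cdots c_1\otimes v\mapsto
  uc_m\otimes c_{m-1}\cdots c_1\otimes v+(-1)^m\,u\otimes c_m\cdots c_2\otimes c_1v$ for $m\ge1$, where
  $uc_m$ and $c_1v$ are products in $A$.\<close>

definition bardzell_diff :: "('v, 'a) pre_digraph \<Rightarrow> (('v, 'a) path \<Rightarrow> 'k::field) set \<Rightarrow> nat
    \<Rightarrow> (('v, 'a) path \<times> ('v, 'a) path \<times> ('v, 'a) path \<Rightarrow> 'k)
    \<Rightarrow> (('v, 'a) path \<times> ('v, 'a) path \<times> ('v, 'a) path \<Rightarrow> 'k)" where
  "bardzell_diff Q I m = (\<lambda>F\<in>carrier (bardzell Q I m). lin_ext (\<lambda>(u, \<gamma>, v) y.
     (let c1 = hd (snd \<gamma>); cm = last (snd \<gamma>);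
          uc = pcomp u (arrow Q cm); cv = pcomp (arrow Q c1) v
      in (if uc \<in> \<B> Q I then bvec (uc, (psrc \<gamma>, butlast (snd \<gamma>)), v) y else 0)
         + (-1) ^ m * (if cv \<in> \<B> Q I then bvec (u, (head Q c1, tl (snd \<gamma>)), cv) y else 0))) F)"

definition bardzell_aug :: "('v, 'a) pre_digraph \<Rightarrow> (('v, 'a) path \<Rightarrow> 'k::field) set
    \<Rightarrow> (('v, 'a) path \<times> ('v, 'a) path \<times> ('v, 'a) path \<Rightarrow> 'k) \<Rightarrow> ('v, 'a) path \<Rightarrow> 'k" where
  "bardzell_aug Q I = (\<lambda>F\<in>carrier (bardzell Q I 0).
     lin_ext (\<lambda>(u, \<gamma>, v). path_mult Q (\<B> Q I) u v) F)"

abbreviation gentle_unit ::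
  "('v, 'a) pre_digraph \<Rightarrow> (('v, 'a) path \<Rightarrow> 'k::field) set \<Rightarrow> 'k \<Rightarrow> ('v, 'a) path \<Rightarrow> 'k" where
  "gentle_unit Q I \<equiv> scalar (gentle_algebra Q I)"

abbreviation gentle_bimodule where
  "gentle_bimodule Q I \<equiv> regular_bimodule (gentle_algebra Q I)"

text \<open>$\mathrm{HH}^m(A)=\mathrm{Ext}^m_{A^e}(A,A)$, computed from the Bardzell resolution.\<close>

definition HH where
  "HH Q I m = ext_space (gentle_algebra Q I) (gentle_unit Q I)
     (bardzell Q I) (bardzell_diff Q I) (gentle_bimodule Q I) m"

definition HH_class where
  "HH_class Q I m f = ext_class (gentle_algebra Q I) (gentle_unit Q I)
     (bardzell Q I) (bardzell_diff Q I) (gentle_bimodule Q I) m f"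


section \<open>The complex of parallel paths\<close>

definition parallel :: "('v, 'a) pre_digraph \<Rightarrow> (('v, 'a) path \<Rightarrow> 'k::field) set \<Rightarrow> nat
    \<Rightarrow> (('v, 'a) path \<times> ('v, 'a) path) set" where
  "parallel Q I m = {(\<gamma>, \<alpha>). \<gamma> \<in> \<Gamma>m Q I m \<and> \<alpha> \<in> \<B> Q I \<and> parallel_paths Q \<gamma> \<alpha>}"

definition par_space :: "('v, 'a) pre_digraph \<Rightarrow> (('v, 'a) path \<Rightarrow> 'k::field) set \<Rightarrow> nat
    \<Rightarrow> (('v, 'a) path \<times> ('v, 'a) path \<Rightarrow> 'k) set" where
  "par_space Q I m = free_space (parallel Q I m)"

definition par_diff :: "('v, 'a) pre_digraph \<Rightarrow> (('v, 'a) path \<Rightarrow> 'k::field) set \<Rightarrow> nat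
    \<Rightarrow> (('v, 'a) path \<times> ('v, 'a) path \<Rightarrow> 'k) \<Rightarrow> (('v, 'a) path \<times> ('v, 'a) path \<Rightarrow> 'k)" where
  "par_diff Q I m = lin_ext (\<lambda>(\<gamma>, \<alpha>) y.
     (\<Sum>b | b \<in> arcs Q \<and> tail Q b = ptgt Q \<gamma> \<and>
          (pcomp (arrow Q b) \<gamma>, pcomp (arrow Q b) \<alpha>) \<in> parallel Q I (Suc m).
        bvec (pcomp (arrow Q b) \<gamma>, pcomp (arrow Q b) \<alpha>) y)
     - (-1) ^ m *
     (\<Sum>a | a \<in> arcs Q \<and> head Q a = psrc \<gamma> \<and>
          (pcomp \<gamma> (arrow Q a), pcomp \<alpha> (arrow Q a)) \<in> parallel Q I (Suc m).
        bvec (pcomp \<gamma> (arrow Q a), pcomp \<alpha> (arrow Q a)) y))"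

definition par_cocycles :: "('v, 'a) pre_digraph \<Rightarrow> (('v, 'a) path \<Rightarrow> 'k::field) set \<Rightarrow> nat
    \<Rightarrow> (('v, 'a) path \<times> ('v, 'a) path \<Rightarrow> 'k) set" where
  "par_cocycles Q I m = {x \<in> par_space Q I m. par_diff Q I m x = (\<lambda>_. 0)}"

text \<open>The identification of $\Bbbk(\Gamma_m\parallel\mathcal B)$ with
  $\mathrm{Hom}_{A^e}(\mathcal R_m,A)$: the pair $(\gamma,\alpha)$ is sent to the map
  $u\otimes\gamma\otimes v\mapsto u\alpha v$, $u\otimes\gamma'\otimes v\mapsto0$ for
  $\gamma'\ne\gamma$.\<close>

definition par_hom :: "('v, 'a) pre_digraph \<Rightarrow> (('v, 'a) path \<Rightarrow> 'k::field) set \<Rightarrow> nat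
    \<Rightarrow> (('v, 'a) path \<times> ('v, 'a) path \<Rightarrow> 'k)
    \<Rightarrow> (('v, 'a) path \<times> ('v, 'a) path \<times> ('v, 'a) path \<Rightarrow> 'k) \<Rightarrow> ('v, 'a) path \<Rightarrow> 'k" where
  "par_hom Q I m x = (\<lambda>F\<in>carrier (bardzell Q I m). bilin_ext (\<lambda>(\<gamma>, \<alpha>) (u, \<gamma>', v).
     if \<gamma>' = \<gamma> \<and> pcomp u (pcomp \<alpha> v) \<in> \<B> Q I then bvec (pcomp u (pcomp \<alpha> v)) else (\<lambda>_. 0)) x F)"

text \<open>The maps \<open>par_hom\<close> form an isomorphism of cochain complexes.\<close>

definition par_hom_iso :: "('v, 'a) pre_digraph \<Rightarrow> (('v, 'a) path \<Rightarrow> 'k::field) set \<Rightarrow> bool" where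
  "par_hom_iso Q I \<longleftrightarrow> (\<forall>m.
     bij_betw (par_hom Q I m) (par_space Q I m)
       (env_hom (gentle_algebra Q I) (bardzell Q I m) (gentle_bimodule Q I)) \<and>
     (\<forall>x\<in>par_space Q I m. \<forall>y\<in>par_space Q I m. \<forall>c. \<forall>F\<in>carrier (bardzell Q I m).
        par_hom Q I m (\<lambda>z. c * x z + y z) F = (\<lambda>p. c * par_hom Q I m x F p + par_hom Q I m y F p)) \<and>
     (\<forall>x\<in>par_space Q I m. par_diff Q I m x \<in> par_space Q I (Suc m) \<and>
        (\<forall>F\<in>carrier (bardzell Q I (Suc m)).
           par_hom Q I (Suc m) (par_diff Q I m x) F = par_hom Q I m x (bardzell_diff Q I (Suc m) F))))"


section \<open>Cycles, circuits and spanning trees\<close>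

definition cycles :: "('v, 'a) pre_digraph \<Rightarrow> ('v, 'a) path set" where
  "cycles Q = {C \<in> qpaths Q. 0 < plen C \<and> psrc C = ptgt Q C}"

definition rot :: "('v, 'a) pre_digraph \<Rightarrow> ('v, 'a) path \<Rightarrow> ('v, 'a) path" where
  "rot Q C = (tail Q (last (snd C)), last (snd C) # butlast (snd C))"

definition ppow :: "('v, 'a) path \<Rightarrow> nat \<Rightarrow> ('v, 'a) path" where
  "ppow C n = (fst C, concat (replicate n (snd C)))"

definition primitive :: "('v, 'a) pre_digraph \<Rightarrow> ('v, 'a) path \<Rightarrow> bool" where
  "primitive Q C \<longleftrightarrow> C \<in> cycles Q \<and> \<not> (\<exists>D\<in>cycles Q. \<exists>n\<ge>2. C = ppow D n)"

definition period :: "('v, 'a) pre_digraph \<Rightarrow> ('v, 'a) path \<Rightarrow> nat" where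
  "period Q C = (LEAST i. 1 \<le> i \<and> (rot Q ^^ i) C = C)"

text \<open>\<open>R\<close> consists of exactly one representative of each circuit of primitive cycles whose square
  lies in \<open>X\<close>.\<close>

definition circuit_reps ::
  "('v, 'a) pre_digraph \<Rightarrow> ('v, 'a) path set \<Rightarrow> ('v, 'a) path set \<Rightarrow> bool" where
  "circuit_reps Q X R \<longleftrightarrow>
     R \<subseteq> {C. primitive Q C \<and> ppow C 2 \<in> X} \<and>
     (\<forall>C. primitive Q C \<and> ppow C 2 \<in> X \<longrightarrow> (\<exists>!D. D \<in> R \<and> (\<exists>i. D = (rot Q ^^ i) C)))"

definition powers :: "('v, 'a) path set \<Rightarrow> ('v, 'a) path set" where
  "powers R = {ppow C n | C n. C \<in> R \<and> 1 \<le> n}"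

text \<open>The quiver in which each arrow \<open>c\<close> is replaced by \<open>(c, True)\<close>, parallel to \<open>c\<close>, and its
  formal inverse \<open>(c, False)\<close>. Undirected walks are walks in this quiver.\<close>

definition double_quiver :: "('v, 'a) pre_digraph \<Rightarrow> ('v, 'a \<times> bool) pre_digraph" where
  "double_quiver Q = \<lparr>verts = verts Q, arcs = arcs Q \<times> UNIV,
     tail = (\<lambda>(c, b). if b then tail Q c else head Q c),
     head = (\<lambda>(c, b). if b then head Q c else tail Q c)\<rparr>"

text \<open>The library's \<^const>\<open>forest\<close> and \<^const>\<open>spanning_tree\<close> only exclude directed cycles. An
  undirected cycle uses every arrow at most once; loops and pairs of parallel arrows give such
  cycles.\<close>

definition undirected_acyclic :: "('v, 'a) pre_digraph \<Rightarrow> bool" where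
  "undirected_acyclic Q \<longleftrightarrow>
     \<not> (\<exists>w. pre_digraph.cycle (double_quiver Q) w \<and> distinct (map fst w))"

definition spanning_tree_arrows :: "('v, 'a) pre_digraph \<Rightarrow> 'a set \<Rightarrow> bool" where
  "spanning_tree_arrows Q T \<longleftrightarrow> T \<subseteq> arcs Q \<and>
     connected (Q\<lparr>arcs := T\<rparr>) \<and> undirected_acyclic (Q\<lparr>arcs := T\<rparr>)"


section \<open>The generators\<close>

datatype ('v, 'a) generator =
    Gen_I
  | Gen_II "'v \<times> 'a list"
  | Gen_III "'v \<times> 'a list"
  | Gen_IV 'a
  | Gen_V "'v \<times> 'a list"
  | Gen_VI "'v \<times> 'a list" "'v \<times> 'a list"
  | Gen_VII "'v \<times> 'a list"
  | Gen_VIII "'v \<times> 'a list"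

definition same_first :: "('v, 'a) path \<Rightarrow> ('v, 'a) path \<Rightarrow> bool" where
  "same_first \<gamma> \<alpha> \<longleftrightarrow> snd \<gamma> \<noteq> [] \<and> snd \<alpha> \<noteq> [] \<and> hd (snd \<gamma>) = hd (snd \<alpha>)"

definition same_last :: "('v, 'a) path \<Rightarrow> ('v, 'a) path \<Rightarrow> bool" where
  "same_last \<gamma> \<alpha> \<longleftrightarrow> snd \<gamma> \<noteq> [] \<and> snd \<alpha> \<noteq> [] \<and> last (snd \<gamma>) = last (snd \<alpha>)"

text \<open>The generators of degree \<open>m\<close>; \<open>RB\<close> and \<open>RG\<close> are the chosen representatives of the primitive
  cocomplete and complete circuits.\<close>

definition generators :: "('v, 'a) pre_digraph \<Rightarrow> (('v, 'a) path \<Rightarrow> 'k::field) set \<Rightarrow> 'a set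
    \<Rightarrow> ('v, 'a) path set \<Rightarrow> ('v, 'a) path set \<Rightarrow> nat \<Rightarrow> ('v, 'a) generator set" where
  "generators Q I T RB RG m =
     (if m = 0 then {Gen_I} else {})
   \<union> {Gen_II \<alpha> | \<alpha>. m = 0 \<and> maximal_in Q (\<B> Q I) \<alpha> \<and> (vpath (psrc \<alpha>), \<alpha>) \<in> parallel Q I 0}
   \<union> {Gen_III \<alpha> | \<alpha>. m = 0 \<and> \<alpha> \<in> powers RB}
   \<union> {Gen_IV c | c. m = 1 \<and> c \<in> arcs Q - T}
   \<union> {Gen_V \<alpha> | \<alpha>. m = 1 \<and> \<alpha> \<in> powers RB}
   \<union> {Gen_VI \<gamma> \<alpha> | \<gamma> \<alpha>. (\<gamma>, \<alpha>) \<in> parallel Q I m \<and> maximal_in Q (\<Gamma> Q I) \<gamma> \<and>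
        \<not> same_first \<gamma> \<alpha> \<and> \<not> same_last \<gamma> \<alpha>}
   \<union> {Gen_VII C | C. 1 \<le> m \<and> (even m \<or> CHAR('k) = 2) \<and> C \<in> powers RG \<and> plen C = m}
   \<union> {Gen_VIII C | C. 2 \<le> m \<and> (odd m \<or> CHAR('k) = 2) \<and> C \<in> powers RG \<and> plen C = m - 1}"

fun gen_cochain :: "('v, 'a) pre_digraph \<Rightarrow> ('v, 'a) generator
    \<Rightarrow> ('v, 'a) path \<times> ('v, 'a) path \<Rightarrow> 'k::field" where
  "gen_cochain Q Gen_I = (\<lambda>y. \<Sum>i\<in>verts Q. bvec (vpath i, vpath i) y)"
| "gen_cochain Q (Gen_II \<alpha>) = bvec (vpath (psrc \<alpha>), \<alpha>)"
| "gen_cochain Q (Gen_III \<alpha>) =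
     (\<lambda>y. \<Sum>i<period Q \<alpha>. bvec (vpath (psrc ((rot Q ^^ i) \<alpha>)), (rot Q ^^ i) \<alpha>) y)"
| "gen_cochain Q (Gen_IV c) = bvec (arrow Q c, arrow Q c)"
| "gen_cochain Q (Gen_V \<alpha>) = (let c = arrow Q (hd (snd \<alpha>)) in bvec (c, pcomp c \<alpha>))"
| "gen_cochain Q (Gen_VI \<gamma> \<alpha>) = bvec (\<gamma>, \<alpha>)"
| "gen_cochain Q (Gen_VII C) =
     (\<lambda>y. \<Sum>i<period Q C. bvec ((rot Q ^^ i) C, vpath (psrc ((rot Q ^^ i) C))) y)"
| "gen_cochain Q (Gen_VIII C) = (let b = arrow Q (hd (snd C)) in bvec (pcomp b C, b))"

end

theory Submission
  imports Defs
begin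

text \<open>
  The Bardzell complex is contracted on one side by moving the last arrow of the right factor into the
  middle one, which gives the resolution and hence the identification of the Hochschild complex with
  the complex of parallel paths.

  A pair \<open>(\<gamma>, \<alpha>)\<close> whose components share their last (or first) arrow is matched with the pair
  in which this arrow is deleted from both; since an arrow extends \<open>\<gamma>\<close> and \<open>\<alpha>\<close>
  simultaneously in at most one way unless both are vertices, this matching is a homotopy that reduces
  every cocycle to one supported on critical pairs. These are the vertex pairs \<open>(e\<^sub>i, e\<^sub>i)\<close>, the
  diagonal pairs \<open>(c, c)\<close>, the pairs involving a maximal path without common arrows at the ends, and the
  pairs \<open>(e, \<alpha>)\<close>, \<open>(c, c\<alpha>)\<close>, \<open>(C, e)\<close>, \<open>(bC, b)\<close> attached to cycles. On the
  diagonal part the differential is the coboundary map of the graph, which is solved along the spanning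
  tree; on the cyclic parts it is the identity minus plus or minus the rotation.

  The proof of linear independence and of generation uses a family of functionals that vanish on
  coboundaries, are dual to the given cocycles, and detect coboundaries among cocycles.
\<close>

section \<open>Linear maps between free vector spaces\<close>

text \<open>Gentleness acts through one mechanism. The relations \<open>rel\<close> and
  \<open>nrel\<close> between consecutive arrows are partial injections, and a composable pair of
  arrows lies in exactly one of them. So if two different arrows end where b starts, b is related to
  one and unrelated to the other. Hence for parallel nonempty paths \<gamma> and \<alpha> with
  different last arrows, b extends \<gamma> in \<Gamma> exactly when it extends \<alpha> in \<B>.
  This ties the maximality of one component to the absence of extensions of the pair. The obstacle
  to the matching is that a pair may be extended or shortened at both ends, so one end must take
  precedence. Circuits are where the scheme closes on itself: for a cocomplete cycle \<alpha> with
  first arrow c, the pair (c, c\<alpha>) has the same arrow at all four ends and is reached from two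
  rotations of \<alpha>. Such pairs stay unmatched and are treated by linear algebra on rotation
  orbits. As A may be infinite-dimensional, one degree can have infinitely many generators, so
  dimensions cannot be counted; this is why dual functionals are used, with a separate check that
  each cochain is seen by finitely many of them.\<close>

lemma free_space_induct [consumes 1, case_names zero step]:
  fixes f :: "'x \<Rightarrow> 'k::field"
  assumes f: "f \<in> free_space X"
    and zero: "P (\<lambda>_. 0)"
    and step: "\<And>c x f. x \<in> X \<Longrightarrow> f \<in> free_space X \<Longrightarrow> P f \<Longrightarrow> P (\<lambda>y. c * bvec x y + f y)"
  shows "P f"
proof -
  have "P (\<lambda>y. if y \<in> S then f y else 0) \<and> (\<lambda>y. if y \<in> S then f y else 0) \<in> free_space X"
    if "finite S" "S \<subseteq> X" for S
    using that
  proof (induction S)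
    case empty
    then show ?case using zero by simp
  next
    case (insert x S)
    have "(\<lambda>y. if y \<in> insert x S then f y else 0) =
        (\<lambda>y. f x * bvec x y + (if y \<in> S then f y else 0))"
      using insert.hyps by (auto simp: bvec_def fun_eq_iff)
    then show ?case
      using insert step[of x "\<lambda>y. if y \<in> S then f y else 0" "f x"]
        add_free_space[OF scale_free_space[of "bvec x" X "f x"], of "\<lambda>y. if y \<in> S then f y else 0"]
      by simp
  qed
  from this[of "{x. f x \<noteq> 0}"] f have "P (\<lambda>y. if y \<in> {x. f x \<noteq> 0} then f y else 0)"
    by (simp add: free_space_def)
  moreover have "(\<lambda>y. if y \<in> {x. f x \<noteq> 0} then f y else 0) = f" by auto
  ultimately show ?thesis by simp
qed

lemma lin_comb_free_space:
  "f \<in> free_space X \<Longrightarrow> g \<in> free_space X \<Longrightarrow> (\<lambda>x. c * f x + g x) \<in> free_space X"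
  by (intro add_free_space scale_free_space)

lemma diff_free_space:
  "f \<in> free_space X \<Longrightarrow> g \<in> free_space X \<Longrightarrow> (\<lambda>x. f x - g x) \<in> free_space X"
  using lin_comb_free_space[of g X f "- 1"] by (simp add: algebra_simps)

lemma sum_free_space:
  "(\<And>i. i \<in> S \<Longrightarrow> f i \<in> free_space X) \<Longrightarrow> (\<lambda>x. \<Sum>i\<in>S. f i x) \<in> free_space X"
  by (induction S rule: infinite_finite_induct) (auto intro: add_free_space)

lemma lin_ext_scale: "lin_ext \<phi> (\<lambda>x. c * f x) = (\<lambda>y. c * lin_ext \<phi> f y)"
  by (cases "c = 0") (simp_all add: lin_ext_def fun_eq_iff sum_distrib_left mult.assoc)

lemma lin_ext_scale_map: "lin_ext (\<lambda>x y. c * \<phi> x y) f = (\<lambda>y. c * lin_ext \<phi> f y)"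
  by (simp add: lin_ext_def fun_eq_iff sum_distrib_left mult.assoc mult.left_commute)

lemma scaled_finite: "finite {x. f x \<noteq> 0} \<Longrightarrow> finite {x. c * f x \<noteq> (0::'k::field)}"
  by (erule finite_subset[rotated]) auto

lemma lin_ext_lin_comb:
  assumes "finite {x. f x \<noteq> 0}" "finite {x. g x \<noteq> 0}"
  shows "lin_ext \<phi> (\<lambda>x. c * f x + g x) = (\<lambda>y. c * lin_ext \<phi> f y + lin_ext \<phi> g y)"
  using lin_ext_add[OF scaled_finite[OF assms(1)] assms(2)] by (simp add: lin_ext_scale)

text \<open>Linearity is asked only for finitely supported arguments: the sum in
  \<open>lin_ext\<close> over an infinite support is 0, so additivity fails beyond them.\<close>

definition lin_on :: "'x set \<Rightarrow> (('x \<Rightarrow> 'k::field) \<Rightarrow> ('y \<Rightarrow> 'k)) \<Rightarrow> bool" where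
  "lin_on X \<Phi> \<longleftrightarrow> (\<forall>f\<in>free_space X. \<forall>g\<in>free_space X. \<forall>c.
     \<Phi> (\<lambda>x. c * f x + g x) = (\<lambda>y. c * \<Phi> f y + \<Phi> g y))"

lemma lin_onD:
  "lin_on X \<Phi> \<Longrightarrow> f \<in> free_space X \<Longrightarrow> g \<in> free_space X
    \<Longrightarrow> \<Phi> (\<lambda>x. c * f x + g x) = (\<lambda>y. c * \<Phi> f y + \<Phi> g y)"
  by (simp add: lin_on_def)

lemma lin_on_zero: "lin_on X \<Phi> \<Longrightarrow> \<Phi> (\<lambda>_. 0) = (\<lambda>_. 0)"
  using lin_onD[of X \<Phi> "\<lambda>_. 0" "\<lambda>_. 0" "- 1"] by simp

lemma lin_on_add:
  "lin_on X \<Phi> \<Longrightarrow> f \<in> free_space X \<Longrightarrow> g \<in> free_space X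
    \<Longrightarrow> \<Phi> (\<lambda>x. f x + g x) = (\<lambda>y. \<Phi> f y + \<Phi> g y)"
  using lin_onD[of X \<Phi> f g 1] by simp

lemma lin_on_scale: "lin_on X \<Phi> \<Longrightarrow> f \<in> free_space X \<Longrightarrow> \<Phi> (\<lambda>x. c * f x) = (\<lambda>y. c * \<Phi> f y)"
  using lin_onD[of X \<Phi> f "\<lambda>_. 0" c] by (simp add: lin_on_zero)

lemma lin_on_diff:
  "lin_on X \<Phi> \<Longrightarrow> f \<in> free_space X \<Longrightarrow> g \<in> free_space X
    \<Longrightarrow> \<Phi> (\<lambda>x. f x - g x) = (\<lambda>y. \<Phi> f y - \<Phi> g y)"
  using lin_onD[of X \<Phi> g f "- 1"] by simp

lemma lin_on_sum:
  assumes "lin_on X \<Phi>" "\<And>i. i \<in> S \<Longrightarrow> f i \<in> free_space X"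
  shows "\<Phi> (\<lambda>x. \<Sum>i\<in>S. f i x) = (\<lambda>y. \<Sum>i\<in>S. \<Phi> (f i) y)"
  using assms(2)
proof (induction S rule: infinite_finite_induct)
  case (insert i S)
  then show ?case using lin_on_add[OF assms(1), of "f i" "\<lambda>x. \<Sum>i\<in>S. f i x"]
    by (simp add: sum_free_space)
qed (auto simp: lin_on_zero[OF assms(1)])

text \<open>The tool for almost all identities between the maps below: both sides are linear, so
  they are compared on basis vectors, where \<open>lin_ext\<close> can be evaluated.\<close>

lemma lin_on_eqI:
  assumes "lin_on X \<Phi>" "lin_on X \<Psi>" "\<And>x. x \<in> X \<Longrightarrow> \<Phi> (bvec x) = \<Psi> (bvec x)"
    and "f \<in> free_space X"
  shows "\<Phi> f = \<Psi> f"
  using assms(4)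
proof (induction rule: free_space_induct)
  case zero
  then show ?case using assms by (simp add: lin_on_zero)
next
  case (step c x f)
  then show ?case
    using lin_onD[OF assms(1), of "bvec x" f c] lin_onD[OF assms(2), of "bvec x" f c] assms(3)
    by simp
qed

lemma lin_on_lin_ext: "lin_on X (lin_ext \<phi>)"
  by (auto simp: lin_on_def free_space_def intro!: lin_ext_lin_comb)

lemma lin_on_id: "lin_on X (\<lambda>f. f)"
  by (simp add: lin_on_def)

lemma lin_on_const_zero: "lin_on X (\<lambda>_ _. 0)"
  by (simp add: lin_on_def)

lemma lin_on_comp:
  assumes "lin_on X \<Phi>" "lin_on Y \<Psi>" "\<And>f. f \<in> free_space X \<Longrightarrow> \<Phi> f \<in> free_space Y"
  shows "lin_on X (\<lambda>f. \<Psi> (\<Phi> f))"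
  using assms by (auto simp: lin_on_def)

lemma lin_on_plus: "lin_on X \<Phi> \<Longrightarrow> lin_on X \<Psi> \<Longrightarrow> lin_on X (\<lambda>f y. \<Phi> f y + \<Psi> f y)"
  by (simp add: lin_on_def algebra_simps)

lemma lin_on_smult: "lin_on X \<Phi> \<Longrightarrow> lin_on X (\<lambda>f y. c * \<Phi> f y)"
  by (simp add: lin_on_def algebra_simps)

lemma lin_on_bilin_left: "lin_on X (\<lambda>f. bilin_ext \<phi> f g)"
  by (simp add: bilin_ext_def lin_on_lin_ext)

lemma lin_on_bilin_right: "lin_on X (\<lambda>g. bilin_ext \<phi> f g)"
  unfolding lin_on_def bilin_ext_def
proof (intro ballI allI)
  fix g h :: "_ \<Rightarrow> 'b" and c
  assume "g \<in> free_space X" "h \<in> free_space X"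
  then have "finite {x. g x \<noteq> 0}" "finite {x. h x \<noteq> 0}" by (auto simp: free_space_def)
  then show "lin_ext (\<lambda>x. lin_ext (\<phi> x) (\<lambda>x. c * g x + h x)) f =
      (\<lambda>y. c * lin_ext (\<lambda>x. lin_ext (\<phi> x) g) f y + lin_ext (\<lambda>x. lin_ext (\<phi> x) h) f y)"
    by (simp add: lin_ext_lin_comb lin_ext_add_map lin_ext_scale_map)
qed

lemma bilin_ext_bvec [simp]: "bilin_ext \<phi> (bvec x) (bvec y) = \<phi> x y"
  by (simp add: bilin_ext_def)

lemma bilin_ext_zero [simp]:
  "bilin_ext \<phi> (\<lambda>_. 0) g = (\<lambda>_. 0)" "bilin_ext \<phi> f (\<lambda>_. 0) = (\<lambda>_. 0)"
  by (simp_all add: bilin_ext_def)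

lemma bilin_ext_closed:
  assumes "f \<in> free_space X" "g \<in> free_space Y"
    and "\<And>x y. x \<in> X \<Longrightarrow> y \<in> Y \<Longrightarrow> \<phi> x y \<in> free_space Z"
  shows "bilin_ext \<phi> f g \<in> free_space Z"
  unfolding bilin_ext_def
  by (rule lin_ext_closed[OF assms(1)], rule lin_ext_closed[OF assms(2)], rule assms(3))

lemmas lin_on_intros = lin_on_lin_ext lin_on_id lin_on_const_zero lin_on_bilin_left
  lin_on_bilin_right lin_on_plus lin_on_smult

section \<open>Paths as words with prescribed successors\<close>

section \<open>Paths in a gentle quiver\<close>

text \<open>All paths, the paths in \<B> and the paths in \<Gamma> differ only in the condition on
  consecutive arrows (composable, \<open>nrel\<close>, \<open>rel\<close>), so one predicate serves
  all three. The vertex v carries information only for the empty word.\<close>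

definition chain_path :: "('v, 'a) pre_digraph \<Rightarrow> ('a \<Rightarrow> 'a \<Rightarrow> bool) \<Rightarrow> 'v \<Rightarrow> 'a list \<Rightarrow> bool" where
  "chain_path Q P v w \<longleftrightarrow> v \<in> verts Q \<and> set w \<subseteq> arcs Q \<and> (w \<noteq> [] \<longrightarrow> v = tail Q (hd w)) \<and>
     successively P w"

lemma ptgt_eq: "ptgt Q (v, w) = (if w = [] then v else head Q (last w))"
  by (simp add: ptgt_def pre_digraph.awalk_verts_conv)

lemma psrc_eq [simp]: "psrc (v, w) = v"
  by (simp add: psrc_def)

lemma plen_eq [simp]: "plen (v, w) = length w"
  by (simp add: plen_def)

lemma pcomp_eq: "pcomp (v, w) (v', w') = (v', w' @ w)"
  by (simp add: pcomp_def)

lemma pcomp_arrow_left: "pcomp (arrow Q b) (v, w) = (v, w @ [b])"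
  by (simp add: pcomp_def arrow_def)

lemma pcomp_arrow_right: "pcomp (v, w) (arrow Q a) = (tail Q a, a # w)"
  by (simp add: pcomp_def arrow_def)

lemma vpath_eq: "vpath v = (v, [])"
  by (simp add: vpath_def)

lemma chain_path_append:
  assumes "\<And>a b. P a b \<Longrightarrow> head Q a = tail Q b" "wf_digraph Q"
  shows "chain_path Q P v (w1 @ w2) \<longleftrightarrow> chain_path Q P v w1 \<and> chain_path Q P (ptgt Q (v, w1)) w2 \<and>
    (w1 \<noteq> [] \<longrightarrow> w2 \<noteq> [] \<longrightarrow> P (last w1) (hd w2))"
proof (cases "w1 = [] \<or> w2 = []")
  case True
  interpret wf_digraph Q by fact
  have "w1 \<noteq> [] \<Longrightarrow> set w1 \<subseteq> arcs Q \<Longrightarrow> head Q (last w1) \<in> verts Q" using last_in_set[of w1]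
    by (intro head_in_verts) auto
  then show ?thesis using True by (auto simp: chain_path_def ptgt_eq)
next
  case False
  interpret wf_digraph Q by fact
  have "last w1 \<in> arcs Q \<Longrightarrow> head Q (last w1) \<in> verts Q" by simp
  moreover have "tail Q (hd w2) \<in> verts Q" if "set w2 \<subseteq> arcs Q"
    using False that hd_in_set[of w2] by (intro tail_in_verts) blast
  moreover have "P (last w1) (hd w2) \<Longrightarrow> head Q (last w1) = tail Q (hd w2)" by (rule assms(1))
  ultimately show ?thesis using False
    by (auto simp: chain_path_def ptgt_eq successively_append_iff)
qed

lemma qpaths_chain_path:
  assumes "wf_digraph Q"
  shows "(v, w) \<in> qpaths Q \<longleftrightarrow> chain_path Q (\<lambda>a b. head Q a = tail Q b) v w"
proof -
  interpret wf_digraph Q by fact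
  have "(\<exists>u. cas v w u) \<longleftrightarrow> (w \<noteq> [] \<longrightarrow> v = tail Q (hd w)) \<and> successively (\<lambda>a b. head Q a = tail Q b) w"
    for v
  proof (induction w arbitrary: v)
    case (Cons a w)
    then show ?case by (auto simp: successively_Cons)
  qed (auto intro: exI[of _ v])
  then show ?thesis by (auto simp: qpaths_def awalk_def chain_path_def)
qed

locale gentle = fin_digraph Q
  for Q :: "('v, 'a) pre_digraph" +
  fixes I :: "(('v, 'a) path \<Rightarrow> 'k::field) set"
  assumes gentle: "gentle_presentation Q I"
begin

lemma wf: "wf_digraph Q"
  by (rule wf_digraph_axioms)

text \<open>Words are listed in the order of traversal, so [a, b] stands for the path written ba.
  Composability is part of both \<open>nrel\<close> and \<open>rel\<close>, which makes them
  complementary on the composable pairs of arrows.\<close>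

definition nrel :: "'a \<Rightarrow> 'a \<Rightarrow> bool" where
  "nrel a b \<longleftrightarrow> a \<in> arcs Q \<and> b \<in> arcs Q \<and> head Q a = tail Q b \<and> bvec (tail Q a, [a, b]) \<notin> I"

definition rel :: "'a \<Rightarrow> 'a \<Rightarrow> bool" where
  "rel a b \<longleftrightarrow> a \<in> arcs Q \<and> b \<in> arcs Q \<and> head Q a = tail Q b \<and> bvec (tail Q a, [a, b]) \<in> I"

lemma nrelD: "nrel a b \<Longrightarrow> a \<in> arcs Q \<and> b \<in> arcs Q \<and> head Q a = tail Q b \<and> \<not> rel a b"
  by (auto simp: nrel_def rel_def)

lemma relD: "rel a b \<Longrightarrow> a \<in> arcs Q \<and> b \<in> arcs Q \<and> head Q a = tail Q b \<and> \<not> nrel a b"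
  by (auto simp: nrel_def rel_def)

lemma rel_or_nrel: "a \<in> arcs Q \<Longrightarrow> b \<in> arcs Q \<Longrightarrow> head Q a = tail Q b \<Longrightarrow> \<not> rel a b \<Longrightarrow> nrel a b"
  by (auto simp: nrel_def rel_def)

text \<open>The four uniqueness clauses of gentleness say that \<open>rel\<close> and
  \<open>nrel\<close> are graphs of injective partial maps on the arrows. They are applied only in
  this form, through the four lemmas that follow.\<close>

lemma gentle_arc:
  assumes "a \<in> arcs Q"
  shows "\<exists>\<^sub>\<le>\<^sub>1 b. nrel b a" "\<exists>\<^sub>\<le>\<^sub>1 b. nrel a b" "\<exists>\<^sub>\<le>\<^sub>1 b. rel b a" "\<exists>\<^sub>\<le>\<^sub>1 b. rel a b"
proof -
  note g = gentle[unfolded gentle_presentation_def, THEN conjunct2, THEN conjunct2, THEN conjunct2,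
      THEN conjunct2, rule_format, OF assms]
  have "nrel b a \<longleftrightarrow> b \<in> arcs Q \<and> head Q b = tail Q a \<and> bvec (pcomp (arrow Q a) (arrow Q b)) \<notin> I"
       "nrel a b \<longleftrightarrow> b \<in> arcs Q \<and> head Q a = tail Q b \<and> bvec (pcomp (arrow Q b) (arrow Q a)) \<notin> I"
       "rel b a \<longleftrightarrow> b \<in> arcs Q \<and> head Q b = tail Q a \<and> bvec (pcomp (arrow Q a) (arrow Q b)) \<in> I"
       "rel a b \<longleftrightarrow> b \<in> arcs Q \<and> head Q a = tail Q b \<and> bvec (pcomp (arrow Q b) (arrow Q a)) \<in> I" for b
    using assms by (auto simp: nrel_def rel_def pcomp_def arrow_def)
  then show "\<exists>\<^sub>\<le>\<^sub>1 b. nrel b a" "\<exists>\<^sub>\<le>\<^sub>1 b. nrel a b" "\<exists>\<^sub>\<le>\<^sub>1 b. rel b a" "\<exists>\<^sub>\<le>\<^sub>1 b. rel a b"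
    using g by simp_all
qed

lemma nrel_det: "nrel a b \<Longrightarrow> nrel a b' \<Longrightarrow> b = b'"
  using gentle_arc(2)[of a] nrelD[of a b] unfolding Uniq_def by blast

lemma nrel_inj: "nrel a b \<Longrightarrow> nrel a' b \<Longrightarrow> a = a'"
  using gentle_arc(1)[of b] nrelD[of a b] unfolding Uniq_def by blast

lemma rel_det: "rel a b \<Longrightarrow> rel a b' \<Longrightarrow> b = b'"
  using gentle_arc(4)[of a] relD[of a b] unfolding Uniq_def by blast

lemma rel_inj: "rel a b \<Longrightarrow> rel a' b \<Longrightarrow> a = a'"
  using gentle_arc(3)[of b] relD[of a b] unfolding Uniq_def by blast

lemma relations_iff: "(v, w) \<in> relations Q I \<longleftrightarrow> (\<exists>a b. w = [a, b] \<and> v = tail Q a \<and> rel a b)"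
  by (auto simp: relations_def qpaths_chain_path[OF wf] chain_path_def rel_def length_Suc_conv numeral_2_eq_2)

lemma subpath_iff:
  assumes "(v', w') \<in> qpaths Q"
  shows "subpath Q (v, w) (v', w') \<longleftrightarrow> (\<exists>x y. w' = x @ w @ y \<and> v = ptgt Q (v', x))"
proof
  assume "subpath Q (v, w) (v', w')"
  then show "\<exists>x y. w' = x @ w @ y \<and> v = ptgt Q (v', x)"
    unfolding subpath_def by (force simp: pcomp_eq)
next
  assume "\<exists>x y. w' = x @ w @ y \<and> v = ptgt Q (v', x)"
  then obtain x y where xy: "w' = x @ w @ y" "v = ptgt Q (v', x)" by blast
  let ?P = "\<lambda>a b. head Q a = tail Q b"
  have "chain_path Q ?P v' x \<and> chain_path Q ?P (ptgt Q (v, w)) y"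
    using assms unfolding qpaths_chain_path[OF wf] xy
    by (simp add: chain_path_append wf)
  then show "subpath Q (v, w) (v', w')" unfolding subpath_def
    by (intro bexI[of _ "(ptgt Q (v, w), y)"] bexI[of _ "(v', x)"])
       (auto simp: qpaths_chain_path[OF wf] pcomp_eq xy)
qed

text \<open>Connects conditions on subpaths of length 2, as in the definitions of \<B> and \<Gamma>,
  with conditions on neighbouring letters.\<close>

lemma successively_iff_infix:
  "successively P w \<longleftrightarrow> (\<forall>x a b y. w = x @ [a, b] @ y \<longrightarrow> P a b)"
proof (induction w rule: induct_list012)
  case (3 a b w)
  have "(\<exists>x c d y. a # b # w = x @ [c, d] @ y \<and> \<not> P c d) \<longleftrightarrow>
      \<not> P a b \<or> (\<exists>x c d y. b # w = x @ [c, d] @ y \<and> \<not> P c d)" (is "?L \<longleftrightarrow> ?R")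
  proof
    assume ?L
    then obtain x c d y where "a # b # w = x @ [c, d] @ y" "\<not> P c d" by blast
    then show ?R by (cases x) auto
  next
    assume ?R
    then show ?L
    proof
      assume "\<exists>x c d y. b # w = x @ [c, d] @ y \<and> \<not> P c d"
      then obtain x c d y where "b # w = x @ [c, d] @ y" "\<not> P c d" by blast
      then show ?L by (intro exI[of _ "a # x"]) auto
    qed (intro exI[of _ "[]"], auto)
  qed
  then have "(\<forall>x c d y. a # b # w = x @ [c, d] @ y \<longrightarrow> P c d) \<longleftrightarrow>
      P a b \<and> (\<forall>x c d y. b # w = x @ [c, d] @ y \<longrightarrow> P c d)" by blast
  then show ?case using 3 by simp
qed (auto simp: Cons_eq_append_conv)

text \<open>Relations have length 2, so avoiding them as subpaths is a local condition: neighbouring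
  arrows are composable and not related, which is \<open>nrel\<close>.\<close>

lemma \<B>_iff: "(v, w) \<in> \<B> Q I \<longleftrightarrow> chain_path Q nrel v w"
proof -
  let ?P = "\<lambda>a b. head Q a = tail Q b"
  have "(v, w) \<in> \<B> Q I \<longleftrightarrow> (v, w) \<in> qpaths Q \<and> (\<forall>x a b y. w = x @ [a, b] @ y \<longrightarrow> \<not> rel a b)"
  proof -
    have "(\<exists>r\<in>relations Q I. subpath Q r (v, w)) \<longleftrightarrow> (\<exists>x a b y. w = x @ [a, b] @ y \<and> rel a b)"
      if q: "(v, w) \<in> qpaths Q"
    proof
      assume "\<exists>r\<in>relations Q I. subpath Q r (v, w)"
      then show "\<exists>x a b y. w = x @ [a, b] @ y \<and> rel a b"
        using subpath_iff[OF q] by (auto simp: relations_iff) metis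
    next
      assume "\<exists>x a b y. w = x @ [a, b] @ y \<and> rel a b"
      then obtain x a b y where w: "w = x @ [a, b] @ y" "rel a b" by blast
      have "chain_path Q ?P (ptgt Q (v, x)) ([a, b] @ y)"
        using q unfolding qpaths_chain_path[OF wf] w by (simp add: chain_path_append wf del: append.simps)
      then have "ptgt Q (v, x) = tail Q a" by (simp add: chain_path_def)
      then have "subpath Q (tail Q a, [a, b]) (v, w)" using subpath_iff[OF q] w by metis
      then show "\<exists>r\<in>relations Q I. subpath Q r (v, w)" using w relations_iff by blast
    qed
    then show ?thesis unfolding \<B>_def by blast
  qed
  also have "\<dots> \<longleftrightarrow> chain_path Q nrel v w"
  proof -
    have "(\<forall>x a b y. w = x @ [a, b] @ y \<longrightarrow> ?P a b) \<and> (\<forall>x a b y. w = x @ [a, b] @ y \<longrightarrow> \<not> rel a b) \<longleftrightarrow>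
        (\<forall>x a b y. w = x @ [a, b] @ y \<longrightarrow> nrel a b)" if "set w \<subseteq> arcs Q"
    proof -
      have "a \<in> arcs Q \<and> b \<in> arcs Q" if "w = x @ [a, b] @ y" for x a b y
        using that \<open>set w \<subseteq> arcs Q\<close> by simp
      note arcs = this
      have nr: "nrel a b \<longleftrightarrow> ?P a b \<and> \<not> rel a b" if "w = x @ [a, b] @ y" for x a b y
        using nrelD[of a b] rel_or_nrel[of a b] arcs[OF that] by blast
      have "(\<forall>x a b y. S x a b y \<longrightarrow> A a b) \<and> (\<forall>x a b y. S x a b y \<longrightarrow> \<not> B a b) \<longleftrightarrow>
          (\<forall>x a b y. S x a b y \<longrightarrow> C a b)"
        if "\<And>x a b y. S x a b y \<Longrightarrow> C a b \<longleftrightarrow> A a b \<and> \<not> B a b"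
        for S :: "'a list \<Rightarrow> 'a \<Rightarrow> 'a \<Rightarrow> 'a list \<Rightarrow> bool" and A B C
        using that by blast
      from this[of "\<lambda>x a b y. w = x @ [a, b] @ y" nrel ?P rel, OF nr] show ?thesis .
    qed
    note key = this
    show ?thesis
    proof (cases "set w \<subseteq> arcs Q")
      case True
      show ?thesis unfolding qpaths_chain_path[OF wf] chain_path_def successively_iff_infix
          key[OF True, symmetric] by (simp only: conj_assoc)
    qed (simp add: qpaths_chain_path[OF wf] chain_path_def)
  qed
  finally show ?thesis .
qed

lemma \<Gamma>_iff: "(v, w) \<in> \<Gamma> Q I \<longleftrightarrow> chain_path Q rel v w"
proof -
  let ?P = "\<lambda>a b. head Q a = tail Q b"
  have "(v, w) \<in> \<Gamma> Q I \<longleftrightarrow> (v, w) \<in> qpaths Q \<and> (\<forall>x a b y. w = x @ [a, b] @ y \<longrightarrow> rel a b)"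
  proof -
    have "(\<forall>r\<in>qpaths Q. plen r = 2 \<and> subpath Q r (v, w) \<longrightarrow> r \<in> relations Q I) \<longleftrightarrow>
        (\<forall>x a b y. w = x @ [a, b] @ y \<longrightarrow> rel a b)"
      if q: "(v, w) \<in> qpaths Q"
    proof (intro iffI allI impI ballI)
      fix x a b y
      assume A: "\<forall>r\<in>qpaths Q. plen r = 2 \<and> subpath Q r (v, w) \<longrightarrow> r \<in> relations Q I" and w: "w = x @ [a, b] @ y"
      have "chain_path Q ?P (ptgt Q (v, x)) ([a, b] @ y)"
        using q unfolding qpaths_chain_path[OF wf] w by (simp add: chain_path_append wf del: append.simps)
      then have c: "ptgt Q (v, x) = tail Q a" "(tail Q a, [a, b]) \<in> qpaths Q"
        by (auto simp: chain_path_def qpaths_chain_path[OF wf])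
      then have "subpath Q (tail Q a, [a, b]) (v, w)" using subpath_iff[OF q] w by metis
      then have "(tail Q a, [a, b]) \<in> relations Q I" using A c by auto
      then show "rel a b" by (simp add: relations_iff)
    next
      fix r assume A: "\<forall>x a b y. w = x @ [a, b] @ y \<longrightarrow> rel a b" and r: "r \<in> qpaths Q"
        "plen r = 2 \<and> subpath Q r (v, w)"
      obtain u a b where u: "r = (u, [a, b])" using r(2)
        by (cases r) (auto simp: length_Suc_conv numeral_2_eq_2)
      have "u = tail Q a" using r(1) by (simp add: u qpaths_chain_path[OF wf] chain_path_def)
      then show "r \<in> relations Q I" using r subpath_iff[OF q] A unfolding u relations_iff by blast
    qed
    then show ?thesis unfolding \<Gamma>_def by blast
  qed
  also have "\<dots> \<longleftrightarrow> chain_path Q rel v w"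
    unfolding qpaths_chain_path[OF wf] chain_path_def successively_iff_infix
    using relD by blast
  finally show ?thesis .
qed

lemma parallel_iff:
  "((v, w), (v', w')) \<in> parallel Q I m \<longleftrightarrow> chain_path Q rel v w \<and> length w = m \<and>
     chain_path Q nrel v' w' \<and> v = v' \<and> ptgt Q (v, w) = ptgt Q (v', w')"
  by (auto simp: parallel_def \<Gamma>m_def \<Gamma>_iff \<B>_iff parallel_paths_def)

lemma nrel_append: "chain_path Q nrel v (w1 @ w2) \<longleftrightarrow> chain_path Q nrel v w1 \<and>
    chain_path Q nrel (ptgt Q (v, w1)) w2 \<and> (w1 \<noteq> [] \<longrightarrow> w2 \<noteq> [] \<longrightarrow> nrel (last w1) (hd w2))"
  by (rule chain_path_append[OF _ wf]) (auto simp: nrel_def)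

lemma rel_append: "chain_path Q rel v (w1 @ w2) \<longleftrightarrow> chain_path Q rel v w1 \<and>
    chain_path Q rel (ptgt Q (v, w1)) w2 \<and> (w1 \<noteq> [] \<longrightarrow> w2 \<noteq> [] \<longrightarrow> rel (last w1) (hd w2))"
  by (rule chain_path_append[OF _ wf]) (auto simp: rel_def)

lemma chain_path_Nil [simp]: "chain_path Q P v [] \<longleftrightarrow> v \<in> verts Q"
  by (auto simp: chain_path_def)

lemma chain_path_single [simp]: "chain_path Q P v [a] \<longleftrightarrow> a \<in> arcs Q \<and> v = tail Q a"
  by (auto simp: chain_path_def)

lemma nrel_Cons: "chain_path Q nrel v (a # w) \<longleftrightarrow> a \<in> arcs Q \<and> v = tail Q a \<and>
    chain_path Q nrel (head Q a) w \<and> (w \<noteq> [] \<longrightarrow> nrel a (hd w))"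
  using nrel_append[of v "[a]" w] by (auto simp: ptgt_eq)

lemma rel_Cons: "chain_path Q rel v (a # w) \<longleftrightarrow> a \<in> arcs Q \<and> v = tail Q a \<and>
    chain_path Q rel (head Q a) w \<and> (w \<noteq> [] \<longrightarrow> rel a (hd w))"
  using rel_append[of v "[a]" w] by (auto simp: ptgt_eq)

lemma nrel_snoc: "chain_path Q nrel v (w @ [a]) \<longleftrightarrow> chain_path Q nrel v w \<and> a \<in> arcs Q \<and>
    ptgt Q (v, w) = tail Q a \<and> (w \<noteq> [] \<longrightarrow> nrel (last w) a)"
  using nrel_append[of v w "[a]"] by auto

lemma rel_snoc: "chain_path Q rel v (w @ [a]) \<longleftrightarrow> chain_path Q rel v w \<and> a \<in> arcs Q \<and>
    ptgt Q (v, w) = tail Q a \<and> (w \<noteq> [] \<longrightarrow> rel (last w) a)"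
  using rel_append[of v w "[a]"] by auto

end

section \<open>The Bardzell resolution\<close>

text \<open>Every structure constant below is a basis vector if some product survives and 0
  otherwise. This bracket allows \<open>lin_ext\<close> to be evaluated before the cases are
  split.\<close>

definition ind :: "bool \<Rightarrow> 'x \<Rightarrow> 'x \<Rightarrow> 'k::field" where
  "ind C x = (if C then bvec x else (\<lambda>_. 0))"

lemma ind_simps [simp]: "ind True x = bvec x" "ind False x = (\<lambda>_. 0)"
  by (simp_all add: ind_def)

lemma ind_free_space: "(C \<Longrightarrow> x \<in> X) \<Longrightarrow> ind C x \<in> free_space X"
  by (simp add: ind_def)

lemma ind_finite: "finite {y. ind C x y \<noteq> 0}"
  by (simp add: ind_def bvec_supp)

lemma lin_ext_ind: "lin_ext \<phi> (ind C x) = (if C then \<phi> x else (\<lambda>_. 0))"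
  by (simp add: ind_def)

lemma lin_ext_ind2:
  fixes c :: "'k::field"
  shows "lin_ext \<phi> (\<lambda>y. ind C x y + c * ind D z y) =
    (\<lambda>y. (if C then \<phi> x y else 0) + c * (if D then \<phi> z y else 0))"
proof -
  have "finite {y. (ind C x y :: 'k) \<noteq> 0}" "finite {y. (ind D z y :: 'k) \<noteq> 0}"
    by (rule ind_finite)+
  from lin_ext_lin_comb[OF this(2,1), of \<phi> c] show ?thesis
    by (simp add: lin_ext_ind add.commute fun_eq_iff)
qed

lemma bilin_eqI:
  assumes "\<And>g. g \<in> free_space Y \<Longrightarrow> lin_on X (\<lambda>f. \<Phi> f g)" "\<And>g. g \<in> free_space Y \<Longrightarrow> lin_on X (\<lambda>f. \<Psi> f g)"
    and "\<And>x. x \<in> X \<Longrightarrow> lin_on Y (\<Phi> (bvec x))" "\<And>x. x \<in> X \<Longrightarrow> lin_on Y (\<Psi> (bvec x))"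
    and "\<And>x y. x \<in> X \<Longrightarrow> y \<in> Y \<Longrightarrow> \<Phi> (bvec x) (bvec y) = \<Psi> (bvec x) (bvec y)"
    and "f \<in> free_space X" "g \<in> free_space Y"
  shows "\<Phi> f g = \<Psi> f g"
proof (rule lin_on_eqI[OF assms(1,2)[OF assms(7)] _ assms(6)])
  fix x assume x: "x \<in> X"
  show "\<Phi> (bvec x) g = \<Psi> (bvec x) g"
    by (rule lin_on_eqI[OF assms(3)[OF x] assms(4)[OF x] assms(5)[OF x] assms(7)])
qed

lemma trilin_eqI:
  assumes "\<And>g h. g \<in> free_space Y \<Longrightarrow> h \<in> free_space Z \<Longrightarrow> lin_on X (\<lambda>f. \<Phi> f g h)"
    "\<And>g h. g \<in> free_space Y \<Longrightarrow> h \<in> free_space Z \<Longrightarrow> lin_on X (\<lambda>f. \<Psi> f g h)"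
    and "\<And>x h. x \<in> X \<Longrightarrow> h \<in> free_space Z \<Longrightarrow> lin_on Y (\<lambda>g. \<Phi> (bvec x) g h)"
    "\<And>x h. x \<in> X \<Longrightarrow> h \<in> free_space Z \<Longrightarrow> lin_on Y (\<lambda>g. \<Psi> (bvec x) g h)"
    and "\<And>x y. x \<in> X \<Longrightarrow> y \<in> Y \<Longrightarrow> lin_on Z (\<Phi> (bvec x) (bvec y))"
    "\<And>x y. x \<in> X \<Longrightarrow> y \<in> Y \<Longrightarrow> lin_on Z (\<Psi> (bvec x) (bvec y))"
    and "\<And>x y z. x \<in> X \<Longrightarrow> y \<in> Y \<Longrightarrow> z \<in> Z \<Longrightarrow> \<Phi> (bvec x) (bvec y) (bvec z) = \<Psi> (bvec x) (bvec y) (bvec z)"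
    and "f \<in> free_space X" "g \<in> free_space Y" "h \<in> free_space Z"
  shows "\<Phi> f g h = \<Psi> f g h"
proof (rule lin_on_eqI[OF assms(1,2)[OF assms(9,10)] _ assms(8)])
  fix x assume x: "x \<in> X"
  show "\<Phi> (bvec x) g h = \<Psi> (bvec x) g h"
    by (rule bilin_eqI[of Z Y "\<Phi> (bvec x)" "\<Psi> (bvec x)"])
       (use x assms(3-7,9,10) in auto)
qed

lemma abelian_group_pointwise:
  fixes M :: "('x \<Rightarrow> 'k::field, 'm) ring_scheme"
  assumes "carrier M = free_space X" "zero M = (\<lambda>_. 0)" "add M = (\<lambda>F G y. F y + G y)"
  shows "abelian_group M"
proof (rule abelian_groupI)
  fix x assume "x \<in> carrier M"
  then show "\<exists>y\<in>carrier M. y \<oplus>\<^bsub>M\<^esub> x = \<zero>\<^bsub>M\<^esub>"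
    using scale_free_space[of x X "- 1"] assms by (intro bexI[of _ "\<lambda>p. - x p"]) auto
qed (use assms in \<open>auto simp: add_free_space algebra_simps\<close>)

section \<open>The algebra A and the bimodules of the resolution\<close>

context gentle
begin

abbreviation "A \<equiv> gentle_algebra Q I"
abbreviation "BB \<equiv> \<B> Q I"
abbreviation "bbasis \<equiv> bardzell_basis Q I"
abbreviation "unit_sc \<equiv> gentle_unit Q I"

definition one_fn :: "('v, 'a) path \<Rightarrow> 'k" where
  "one_fn = (\<lambda>p. if p \<in> vpath ` verts Q then 1 else 0)"

lemma A_simps [simp]:
  "carrier A = free_space BB" "mult A = bilin_ext (path_mult Q BB)" "one A = one_fn"
  "zero A = (\<lambda>_. 0)" "add A = (\<lambda>f g p. f p + g p)"
  by (simp_all add: gentle_algebra_def path_ring_def one_fn_def)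

lemma unit_eq: "unit_sc c = (\<lambda>p. c * one_fn p)"
  by (simp add: scalar_def)

lemma fin_dig: "fin_digraph Q"
  by (rule fin_digraph_axioms)

lemma ring_A: "ring A"
  unfolding gentle_algebra_def by (rule ring_path_ring[OF fin_dig factor_closed_\<B>[OF wf]])

lemma one_fn_sum: "one_fn = (\<lambda>y. \<Sum>i\<in>verts Q. bvec (vpath i) y)"
proof
  fix y :: "('v, 'a) path"
  have "(\<Sum>i\<in>verts Q. bvec (vpath i) y) = (\<Sum>i\<in>verts Q. if fst y = i then (if snd y = [] then 1 else 0) else (0::'k))"
    by (intro sum.cong) (auto simp: bvec_def vpath_def prod_eq_iff)
  then show "one_fn y = (\<Sum>i\<in>verts Q. bvec (vpath i) y :: 'k)"
    by (cases y) (auto simp: one_fn_def vpath_def image_def)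
qed

lemma BB_vpath: "i \<in> verts Q \<Longrightarrow> vpath i \<in> BB"
  by (simp add: vpath_eq \<B>_iff)

lemma one_fn_closed: "one_fn \<in> free_space BB"
  unfolding one_fn_sum by (intro sum_free_space) (simp add: BB_vpath)

lemma unit_closed: "unit_sc c \<in> free_space BB"
  unfolding unit_eq by (rule scale_free_space[OF one_fn_closed])

lemma unit_add: "unit_sc (c + d) = (\<lambda>p. unit_sc c p + unit_sc d p)"
  by (simp add: unit_eq algebra_simps)

lemma unit_mult_left: "f \<in> free_space BB \<Longrightarrow> bilin_ext (path_mult Q BB) (unit_sc c) f = (\<lambda>p. c * f p)"
  using ring.ring_simprules(12)[OF ring_A, of f]
    lin_on_scale[OF lin_on_bilin_left[where \<phi> = "path_mult Q BB" and g = f] one_fn_closed, of c]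
  by (simp add: unit_eq)

lemma unit_mult_right: "f \<in> free_space BB \<Longrightarrow> bilin_ext (path_mult Q BB) f (unit_sc c) = (\<lambda>p. c * f p)"
  using monoid.r_one[OF ring.is_monoid[OF ring_A], of f]
    lin_on_scale[OF lin_on_bilin_right[where \<phi> = "path_mult Q BB" and f = f] one_fn_closed, of c]
  by (simp add: unit_eq)

lemma unit_mult: "bilin_ext (path_mult Q BB) (unit_sc c) (unit_sc d) = unit_sc (c * d)"
  by (simp add: unit_mult_left[OF unit_closed]) (simp add: unit_eq mult.assoc)

lemma env_module_regular: "env_module A unit_sc (gentle_bimodule Q I)"
proof -
  interpret ring A by (rule ring_A)
  have "abelian_group (gentle_bimodule Q I)"
    by (rule abelian_group_pointwise[of _ BB]) (simp_all add: regular_bimodule_def)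
  moreover have "env_module_axioms A unit_sc (gentle_bimodule Q I)"
    by (rule env_module_axioms.intro)
       (use m_closed l_distr r_distr m_assoc unit_mult_left unit_mult_right l_one r_one
         in \<open>simp_all add: regular_bimodule_def\<close>)
  ultimately show ?thesis by (intro env_module.intro ring_axioms)
qed

lemma BB_factors: "psrc \<beta> = ptgt Q \<alpha> \<Longrightarrow> pcomp \<beta> \<alpha> \<in> BB \<Longrightarrow> \<alpha> \<in> BB \<and> \<beta> \<in> BB"
  using factor_closed_\<B>[OF wf] unfolding factor_closed_def by blast

definition lact :: "('v, 'a) path \<Rightarrow> ('v, 'a) path \<times> ('v, 'a) path \<times> ('v, 'a) path
    \<Rightarrow> ('v, 'a) path \<times> ('v, 'a) path \<times> ('v, 'a) path \<Rightarrow> 'k" where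
  "lact p = (\<lambda>(u, \<gamma>, v). ind (psrc p = ptgt Q u \<and> pcomp p u \<in> BB) (pcomp p u, \<gamma>, v))"

definition ract :: "('v, 'a) path \<times> ('v, 'a) path \<times> ('v, 'a) path \<Rightarrow> ('v, 'a) path
    \<Rightarrow> ('v, 'a) path \<times> ('v, 'a) path \<times> ('v, 'a) path \<Rightarrow> 'k" where
  "ract = (\<lambda>(u, \<gamma>, v) p. ind (psrc v = ptgt Q p \<and> pcomp v p \<in> BB) (u, \<gamma>, pcomp v p))"

lemma bardzell_simps [simp]:
  "carrier (bardzell Q I m) = free_space (bbasis m)" "zero (bardzell Q I m) = (\<lambda>_. 0)"
  "add (bardzell Q I m) = (\<lambda>F G y. F y + G y)"
  "smult (bardzell Q I m) = bilin_ext lact"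
  "rsmult (bardzell Q I m) = bilin_ext ract"
  by (simp_all add: bardzell_def lact_def[abs_def] ract_def ind_def fun_eq_iff)

lemma bbasis_iff: "((a, wu), (s, g), (b, wv)) \<in> bbasis m \<longleftrightarrow> chain_path Q nrel a wu \<and>
    chain_path Q rel s g \<and> length g = m \<and> chain_path Q nrel b wv \<and>
    a = ptgt Q (s, g) \<and> s = ptgt Q (b, wv)"
  by (auto simp: bardzell_basis_def \<Gamma>m_def \<B>_iff \<Gamma>_iff)

lemma lact_closed: "p \<in> BB \<Longrightarrow> x \<in> bbasis m \<Longrightarrow> lact p x \<in> free_space (bbasis m)"
  by (cases x) (auto simp: lact_def bardzell_basis_def intro!: ind_free_space)

lemma ract_closed: "p \<in> BB \<Longrightarrow> x \<in> bbasis m \<Longrightarrow> ract x p \<in> free_space (bbasis m)"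
  by (cases x) (auto simp: ract_def bardzell_basis_def ptgt_pcomp[OF wf] intro!: ind_free_space)

lemma lact_space: "f \<in> free_space BB \<Longrightarrow> F \<in> free_space (bbasis m) \<Longrightarrow> bilin_ext lact f F \<in> free_space (bbasis m)"
  by (rule bilin_ext_closed) (auto intro: lact_closed)

lemma ract_space: "f \<in> free_space BB \<Longrightarrow> F \<in> free_space (bbasis m) \<Longrightarrow> bilin_ext ract F f \<in> free_space (bbasis m)"
  by (rule bilin_ext_closed) (auto intro: ract_closed)

lemma mult_space: "f \<in> free_space BB \<Longrightarrow> g \<in> free_space BB \<Longrightarrow> bilin_ext (path_mult Q BB) f g \<in> free_space BB"
  by (rule path_prod_closed)

text \<open>If one of the two iterated products is nonzero, the whole concatenation lies in
  \<open>BB\<close>, and then so do all its factors. Therefore both sides vanish under the same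
  conditions. The other compatibilities of this kind, up to \<open>phom_ract\<close>, hold for this
  reason too.\<close>

lemma lact_assoc:
  assumes "f \<in> free_space BB" "g \<in> free_space BB" "F \<in> free_space (bbasis m)"
  shows "bilin_ext lact (bilin_ext (path_mult Q BB) f g) F = bilin_ext lact f (bilin_ext lact g F)"
proof (rule trilin_eqI[where \<Phi> = "\<lambda>f g F. bilin_ext lact (bilin_ext (path_mult Q BB) f g) F", OF _ _ _ _ _ _ _ assms])
  fix p q and x assume pq: "p \<in> BB" "q \<in> BB" and x: "x \<in> bbasis m"
  obtain u \<gamma> v where [simp]: "x = (u, \<gamma>, v)" by (cases x)
  have 1: "bilin_ext \<phi> (bvec p) F = lin_ext (\<phi> p) F"
    for \<phi> :: "('v, 'a) path \<Rightarrow> 'z \<Rightarrow> 'z \<Rightarrow> 'k" and F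
    by (simp add: bilin_ext_def)
  have 2: "bilin_ext \<phi> f (bvec x) = lin_ext (\<lambda>p. \<phi> p x) f"
    for \<phi> :: "('v, 'a) path \<Rightarrow> 'z \<Rightarrow> 'z \<Rightarrow> 'k" and f and x :: 'z
    by (simp add: bilin_ext_def)
  have "path_mult Q BB p q = (ind (psrc p = ptgt Q q \<and> pcomp p q \<in> BB) (pcomp p q) :: _ \<Rightarrow> 'k)"
    by (simp add: path_mult_def ind_def)
  then show "bilin_ext lact (bilin_ext (path_mult Q BB) (bvec p) (bvec q)) (bvec x) =
      bilin_ext lact (bvec p) (bilin_ext lact (bvec q) (bvec x))"
    using BB_factors[of "pcomp p q" u] BB_factors[of p "pcomp q u"] ptgt_pcomp[OF wf, of q u]
      pcomp_assoc[of p q u]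
    by (auto simp: bilin_ext_def lin_ext_ind lact_def ind_def)
qed (auto intro!: lin_on_intros lin_on_comp[OF lin_on_bilin_left lin_on_bilin_left mult_space]
      lin_on_comp[OF lin_on_bilin_right lin_on_bilin_left mult_space]
      lin_on_comp[OF lin_on_bilin_left lin_on_bilin_right lact_space]
      lin_on_comp[OF lin_on_bilin_right lin_on_bilin_right lact_space])

lemma ract_assoc:
  assumes "F \<in> free_space (bbasis m)" "f \<in> free_space BB" "g \<in> free_space BB"
  shows "bilin_ext ract F (bilin_ext (path_mult Q BB) f g) = bilin_ext ract (bilin_ext ract F f) g"
proof (rule trilin_eqI[where \<Phi> = "\<lambda>F f g. bilin_ext ract F (bilin_ext (path_mult Q BB) f g)", OF _ _ _ _ _ _ _ assms])
  fix p q and x assume pq: "p \<in> BB" "q \<in> BB" and x: "x \<in> bbasis m"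
  obtain u \<gamma> v where [simp]: "x = (u, \<gamma>, v)" by (cases x)
  have "path_mult Q BB p q = (ind (psrc p = ptgt Q q \<and> pcomp p q \<in> BB) (pcomp p q) :: _ \<Rightarrow> 'k)"
    by (simp add: path_mult_def ind_def)
  then show "bilin_ext ract (bvec x) (bilin_ext (path_mult Q BB) (bvec p) (bvec q)) =
      bilin_ext ract (bilin_ext ract (bvec x) (bvec p)) (bvec q)"
    using BB_factors[of v "pcomp p q"] BB_factors[of "pcomp v p" q] ptgt_pcomp[OF wf, of p q]
      pcomp_assoc[of v p q]
    by (auto simp: bilin_ext_def lin_ext_ind ract_def ind_def)
qed (auto intro!: lin_on_intros lin_on_comp[OF lin_on_bilin_left lin_on_bilin_left ract_space]
      lin_on_comp[OF lin_on_bilin_left lin_on_bilin_right mult_space]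
      lin_on_comp[OF lin_on_bilin_right lin_on_bilin_right mult_space]
      lin_on_comp[OF lin_on_bilin_right lin_on_bilin_left ract_space])

lemma lact_ract:
  assumes "f \<in> free_space BB" "F \<in> free_space (bbasis m)" "g \<in> free_space BB"
  shows "bilin_ext ract (bilin_ext lact f F) g = bilin_ext lact f (bilin_ext ract F g)"
proof (rule trilin_eqI[where \<Phi> = "\<lambda>f F g. bilin_ext ract (bilin_ext lact f F) g", OF _ _ _ _ _ _ _ assms])
  fix p q and x assume pq: "p \<in> BB" "q \<in> BB" and x: "x \<in> bbasis m"
  obtain u \<gamma> v where [simp]: "x = (u, \<gamma>, v)" by (cases x)
  show "bilin_ext ract (bilin_ext lact (bvec p) (bvec x)) (bvec q) =
      bilin_ext lact (bvec p) (bilin_ext ract (bvec x) (bvec q))"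
    by (auto simp: bilin_ext_def lin_ext_ind ract_def lact_def ind_def)
qed (auto intro!: lin_on_intros lin_on_comp[OF lin_on_bilin_left lin_on_bilin_left lact_space]
      lin_on_comp[OF lin_on_bilin_right lin_on_bilin_left lact_space]
      lin_on_comp[OF lin_on_bilin_left lin_on_bilin_right ract_space]
      lin_on_comp[OF lin_on_bilin_right lin_on_bilin_right ract_space])

lemma lact_one:
  assumes "F \<in> free_space (bbasis m)"
  shows "bilin_ext lact one_fn F = F"
proof (rule lin_on_eqI[OF lin_on_bilin_right lin_on_id _ assms])
  fix x assume x: "x \<in> bbasis m"
  obtain u \<gamma> v where [simp]: "x = (u, \<gamma>, v)" by (cases x)
  have u: "u \<in> BB" "ptgt Q u \<in> verts Q"
    using x ends_in_verts[OF wf, of u] by (auto simp: bardzell_basis_def \<B>_def)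
  have "bilin_ext lact one_fn (bvec x) = (\<lambda>y. \<Sum>i\<in>verts Q. lact (vpath i) x y)"
    unfolding one_fn_sum using lin_on_sum[OF lin_on_bilin_left[where \<phi> = lact and g = "bvec x" and X = BB], of "verts Q" "\<lambda>i. bvec (vpath i)"]
    by (simp add: BB_vpath)
  also have "\<dots> = (\<lambda>y. \<Sum>i\<in>verts Q. if ptgt Q u = i then bvec x y else 0)"
    using u by (intro ext sum.cong) (auto simp: lact_def)
  also have "\<dots> = bvec x" using u by simp
  finally show "bilin_ext lact one_fn (bvec x) = bvec x" .
qed

lemma ract_one:
  assumes "F \<in> free_space (bbasis m)"
  shows "bilin_ext ract F one_fn = F"
proof (rule lin_on_eqI[OF lin_on_bilin_left lin_on_id _ assms])
  fix x assume x: "x \<in> bbasis m"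
  obtain u \<gamma> v where [simp]: "x = (u, \<gamma>, v)" by (cases x)
  have v: "v \<in> BB" "psrc v \<in> verts Q"
    using x ends_in_verts[OF wf, of v] by (auto simp: bardzell_basis_def \<B>_def)
  have "bilin_ext ract (bvec x) one_fn = (\<lambda>y. \<Sum>i\<in>verts Q. ract x (vpath i) y)"
    unfolding one_fn_sum using lin_on_sum[OF lin_on_bilin_right[where \<phi> = ract and f = "bvec x" and X = BB], of "verts Q" "\<lambda>i. bvec (vpath i)"]
    by (simp add: BB_vpath)
  also have "\<dots> = (\<lambda>y. \<Sum>i\<in>verts Q. if psrc v = i then bvec x y else 0)"
    using v by (intro ext sum.cong) (auto simp: ract_def)
  also have "\<dots> = bvec x" using v by simp
  finally show "bilin_ext ract (bvec x) one_fn = bvec x" .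
qed

lemma lact_unit: "F \<in> free_space (bbasis m) \<Longrightarrow> bilin_ext lact (unit_sc c) F = (\<lambda>y. c * F y)"
  using lin_on_scale[OF lin_on_bilin_left[where \<phi> = lact and g = F] one_fn_closed, of c] by (simp add: unit_eq lact_one)

lemma ract_unit: "F \<in> free_space (bbasis m) \<Longrightarrow> bilin_ext ract F (unit_sc c) = (\<lambda>y. c * F y)"
  using lin_on_scale[OF lin_on_bilin_right[where \<phi> = ract and f = F] one_fn_closed, of c] by (simp add: unit_eq ract_one)

lemma env_module_bardzell: "env_module A unit_sc (bardzell Q I m)"
proof (intro env_module.intro ring_A)
  show "abelian_group (bardzell Q I m)" by (rule abelian_group_pointwise[of _ "bbasis m"]) simp_all
  show "env_module_axioms A unit_sc (bardzell Q I m)"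
    by (rule env_module_axioms.intro)
       (auto simp: lact_space ract_space lin_on_add[OF lin_on_bilin_left] lin_on_add[OF lin_on_bilin_right]
         lact_assoc ract_assoc lact_one ract_one lact_ract lact_unit ract_unit)
qed

subsection \<open>Projectivity\<close>

text \<open>The counterpart of \<open>lin_on\<close> for values in an arbitrary bimodule. Such a
  bimodule has no scalar multiplication of its own; the field acts through
  \<open>unit_sc\<close>.\<close>

definition mlin_on :: "'x set \<Rightarrow> (('v, 'a) path \<Rightarrow> 'k, 'n) bimodule \<Rightarrow> (('x \<Rightarrow> 'k) \<Rightarrow> 'n) \<Rightarrow> bool" where
  "mlin_on X M \<Phi> \<longleftrightarrow> (\<forall>f\<in>free_space X. \<Phi> f \<in> carrier M) \<and>
     (\<forall>f\<in>free_space X. \<forall>g\<in>free_space X. \<forall>c.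
       \<Phi> (\<lambda>x. c * f x + g x) = smult M (unit_sc c) (\<Phi> f) \<oplus>\<^bsub>M\<^esub> \<Phi> g)"

lemma mlin_onD:
  "mlin_on X M \<Phi> \<Longrightarrow> f \<in> free_space X \<Longrightarrow> g \<in> free_space X \<Longrightarrow>
    \<Phi> (\<lambda>x. c * f x + g x) = smult M (unit_sc c) (\<Phi> f) \<oplus>\<^bsub>M\<^esub> \<Phi> g"
  by (simp add: mlin_on_def)

lemma mlin_on_closed: "mlin_on X M \<Phi> \<Longrightarrow> f \<in> free_space X \<Longrightarrow> \<Phi> f \<in> carrier M"
  by (simp add: mlin_on_def)

lemma smult_zero:
  assumes "env_module A unit_sc M" "f \<in> free_space BB"
  shows "smult M f \<zero>\<^bsub>M\<^esub> = \<zero>\<^bsub>M\<^esub>" "rsmult M \<zero>\<^bsub>M\<^esub> f = \<zero>\<^bsub>M\<^esub>"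
proof -
  interpret M: env_module A unit_sc M by fact
  have "smult M f \<zero>\<^bsub>M\<^esub> \<oplus>\<^bsub>M\<^esub> smult M f \<zero>\<^bsub>M\<^esub> = smult M f \<zero>\<^bsub>M\<^esub>"
    using M.left_add[of f "\<zero>\<^bsub>M\<^esub>" "\<zero>\<^bsub>M\<^esub>"] assms(2) by simp
  then show "smult M f \<zero>\<^bsub>M\<^esub> = \<zero>\<^bsub>M\<^esub>"
    using M.left_closed[of f "\<zero>\<^bsub>M\<^esub>"] assms(2) by (simp add: M.M.add.l_cancel_one)
  have "rsmult M \<zero>\<^bsub>M\<^esub> f \<oplus>\<^bsub>M\<^esub> rsmult M \<zero>\<^bsub>M\<^esub> f = rsmult M \<zero>\<^bsub>M\<^esub> f"
    using M.right_add[of f "\<zero>\<^bsub>M\<^esub>" "\<zero>\<^bsub>M\<^esub>"] assms(2) by simp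
  then show "rsmult M \<zero>\<^bsub>M\<^esub> f = \<zero>\<^bsub>M\<^esub>"
    using M.right_closed[of f "\<zero>\<^bsub>M\<^esub>"] assms(2) by (simp add: M.M.add.l_cancel_one)
qed

lemma zero_smult:
  assumes "env_module A unit_sc M" "x \<in> carrier M"
  shows "smult M (\<lambda>_. 0) x = \<zero>\<^bsub>M\<^esub>" "rsmult M x (\<lambda>_. 0) = \<zero>\<^bsub>M\<^esub>"
proof -
  interpret M: env_module A unit_sc M by fact
  show "smult M (\<lambda>_. 0) x = \<zero>\<^bsub>M\<^esub>"
    using M.left_add_scalar[of "\<lambda>_. 0" "\<lambda>_. 0" x] assms(2) M.left_closed[of "\<lambda>_. 0" x]
    by (simp add: M.M.add.l_cancel_one)
  show "rsmult M x (\<lambda>_. 0) = \<zero>\<^bsub>M\<^esub>"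
    using M.right_add_scalar[of "\<lambda>_. 0" "\<lambda>_. 0" x] assms(2) M.right_closed[of "\<lambda>_. 0" x]
    by (simp add: M.M.add.l_cancel_one)
qed

lemma mlin_on_zero:
  assumes "env_module A unit_sc M" "mlin_on X M \<Phi>"
  shows "\<Phi> (\<lambda>_. 0) = \<zero>\<^bsub>M\<^esub>"
proof -
  interpret M: env_module A unit_sc M by fact
  have c: "\<Phi> (\<lambda>_. 0) \<in> carrier M" using assms(2) by (simp add: mlin_on_def)
  have one: "unit_sc 1 = one A" by (simp add: unit_eq)
  have "\<Phi> (\<lambda>x. 1 * 0 + 0) = smult M (unit_sc 1) (\<Phi> (\<lambda>_. 0)) \<oplus>\<^bsub>M\<^esub> \<Phi> (\<lambda>_. 0)"
    using mlin_onD[OF assms(2) zero_free_space zero_free_space, of 1] by simp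
  then have "\<Phi> (\<lambda>_. 0) \<oplus>\<^bsub>M\<^esub> \<Phi> (\<lambda>_. 0) = \<Phi> (\<lambda>_. 0)"
    unfolding one M.left_one[OF c] by simp
  then show ?thesis using c by (simp add: M.M.add.l_cancel_one)
qed

lemma mlin_on_eqI:
  assumes M: "env_module A unit_sc M" and "mlin_on X M \<Phi>" "mlin_on X M \<Psi>"
    and "\<And>x. x \<in> X \<Longrightarrow> \<Phi> (bvec x) = \<Psi> (bvec x)" and "f \<in> free_space X"
  shows "\<Phi> f = \<Psi> f"
  using assms(5)
proof (induction rule: free_space_induct)
  case zero
  show ?case using mlin_on_zero[OF M assms(2)] mlin_on_zero[OF M assms(3)] by simp
next
  case (step c x f)
  then have "bvec x \<in> free_space X" by simp
  then have "\<Phi> (\<lambda>y. c * bvec x y + f y) = smult M (unit_sc c) (\<Phi> (bvec x)) \<oplus>\<^bsub>M\<^esub> \<Phi> f"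
    "\<Psi> (\<lambda>y. c * bvec x y + f y) = smult M (unit_sc c) (\<Psi> (bvec x)) \<oplus>\<^bsub>M\<^esub> \<Psi> f"
    using mlin_onD[OF assms(2)] mlin_onD[OF assms(3)] step(2) by blast+
  then show ?case using step assms(4) by simp
qed

definition mlin_ext :: "(('v, 'a) path \<Rightarrow> 'k, 'n) bimodule \<Rightarrow> ('x \<Rightarrow> 'n) \<Rightarrow> ('x \<Rightarrow> 'k) \<Rightarrow> 'n" where
  "mlin_ext M \<phi> F = (\<Oplus>\<^bsub>M\<^esub>x\<in>{x. F x \<noteq> 0}. smult M (unit_sc (F x)) (\<phi> x))"

lemma mlin_ext:
  fixes \<phi> :: "'x \<Rightarrow> 'n"
  assumes M: "env_module A unit_sc M" and \<phi>: "\<And>x. x \<in> X \<Longrightarrow> \<phi> x \<in> carrier M"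
  shows "mlin_on X M (mlin_ext M \<phi>)" and "x \<in> X \<Longrightarrow> mlin_ext M \<phi> (bvec x) = \<phi> x"
proof -
  interpret M: env_module A unit_sc M by fact
  have cl: "smult M (unit_sc c) (\<phi> x) \<in> carrier M" if "x \<in> X" for c x
    by (rule M.left_closed) (simp_all add: unit_closed \<phi> that)
  \<comment> \<open>The index set may be any finite set between the support and X, so that F, G and
    their combination can be summed over the same set.\<close>
  have sup: "mlin_ext M \<phi> F = (\<Oplus>\<^bsub>M\<^esub>x\<in>S. smult M (unit_sc (F x)) (\<phi> x))"
    if "finite S" "{x. F x \<noteq> 0} \<subseteq> S" "S \<subseteq> X" for F S
    unfolding mlin_ext_def
  proof (rule M.M.add.finprod_mono_neutral_cong_left)
    fix x assume "x \<in> S - {x. F x \<noteq> 0}"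
    then show "smult M (unit_sc (F x)) (\<phi> x) = \<zero>\<^bsub>M\<^esub>"
      using zero_smult(1)[OF M \<phi>] that by (auto simp: unit_eq)
  qed (use that cl in auto)
  show "mlin_ext M \<phi> (bvec x) = \<phi> x" if "x \<in> X"
  proof -
    have "unit_sc 1 = one A" by (simp add: unit_eq)
    then show ?thesis
      using that \<phi>[OF that] M.left_one[OF \<phi>[OF that]]
      by (subst sup[of "{x}"]) (auto simp: bvec_def)
  qed
  show "mlin_on X M (mlin_ext M \<phi>)" unfolding mlin_on_def
  proof (intro conjI ballI allI)
    fix F :: "'x \<Rightarrow> 'k" assume "F \<in> free_space X"
    then show "mlin_ext M \<phi> F \<in> carrier M" unfolding mlin_ext_def
      by (intro M.M.finsum_closed) (use cl in \<open>auto simp: free_space_def\<close>)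
  next
    fix F G :: "'x \<Rightarrow> 'k" and c assume FG: "F \<in> free_space X" "G \<in> free_space X"
    let ?S = "{x. F x \<noteq> 0} \<union> {x. G x \<noteq> 0}"
    have S: "finite ?S" "?S \<subseteq> X" using FG by (auto simp: free_space_def)
    have cS: "(\<lambda>x. smult M (unit_sc (f x)) (\<phi> x)) \<in> ?S \<rightarrow> carrier M" for f using cl S by blast
    have "mlin_ext M \<phi> (\<lambda>x. c * F x + G x) = (\<Oplus>\<^bsub>M\<^esub>x\<in>?S. smult M (unit_sc (c * F x + G x)) (\<phi> x))"
      by (rule sup) (use S in auto)
    also have "\<dots> = (\<Oplus>\<^bsub>M\<^esub>x\<in>?S. smult M (unit_sc c) (smult M (unit_sc (F x)) (\<phi> x)) \<oplus>\<^bsub>M\<^esub> smult M (unit_sc (G x)) (\<phi> x))"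
    proof (rule M.M.finsum_cong')
      fix x assume "x \<in> ?S"
      then have x: "\<phi> x \<in> carrier M" using S \<phi> by blast
      show "smult M (unit_sc (c * F x + G x)) (\<phi> x) =
          smult M (unit_sc c) (smult M (unit_sc (F x)) (\<phi> x)) \<oplus>\<^bsub>M\<^esub> smult M (unit_sc (G x)) (\<phi> x)"
        using M.left_assoc[of "unit_sc c" "unit_sc (F x)" "\<phi> x"] x
          M.left_add_scalar[of "unit_sc (c * F x)" "unit_sc (G x)" "\<phi> x"]
        by (simp add: unit_mult unit_closed flip: unit_add)
    next
      show "(\<lambda>x. smult M (unit_sc c) (smult M (unit_sc (F x)) (\<phi> x)) \<oplus>\<^bsub>M\<^esub> smult M (unit_sc (G x)) (\<phi> x))
          \<in> ?S \<rightarrow> carrier M"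
        using cl S M.left_closed[of "unit_sc c"] unit_closed by (intro Pi_I M.M.a_closed) auto
    qed simp
    also have "\<dots> = (\<Oplus>\<^bsub>M\<^esub>x\<in>?S. smult M (unit_sc c) (smult M (unit_sc (F x)) (\<phi> x))) \<oplus>\<^bsub>M\<^esub> mlin_ext M \<phi> G"
      using cl S M.left_closed[of "unit_sc c"] unit_closed
      by (subst sup[of ?S G]) (auto intro!: M.M.finsum_addf)
    also have "(\<Oplus>\<^bsub>M\<^esub>x\<in>?S. smult M (unit_sc c) (smult M (unit_sc (F x)) (\<phi> x))) =
        smult M (unit_sc c) (\<Oplus>\<^bsub>M\<^esub>x\<in>?S. smult M (unit_sc (F x)) (\<phi> x))"
    proof -
      have "(\<Oplus>\<^bsub>M\<^esub>x\<in>U. smult M (unit_sc c) (smult M (unit_sc (F x)) (\<phi> x))) =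
          smult M (unit_sc c) (\<Oplus>\<^bsub>M\<^esub>x\<in>U. smult M (unit_sc (F x)) (\<phi> x))" if "finite U" "U \<subseteq> X" for U
        using that
      proof (induction U)
        case empty
        then show ?case using smult_zero(1)[OF M unit_closed] by simp
      next
        case (insert x U)
        have U: "(\<lambda>x. smult M (unit_sc (F x)) (\<phi> x)) \<in> U \<rightarrow> carrier M" using insert.prems cl by blast
        have U': "(\<lambda>x. smult M (unit_sc c) (smult M (unit_sc (F x)) (\<phi> x))) \<in> U \<rightarrow> carrier M"
          using U M.left_closed[of "unit_sc c"] unit_closed by auto
        have x: "smult M (unit_sc (F x)) (\<phi> x) \<in> carrier M" using insert.prems cl by blast
        show ?case
          using insert U U' x M.left_closed[of "unit_sc c", OF _ x] unit_closed
            M.left_add[of "unit_sc c", OF _ x M.M.finsum_closed[OF U]]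
          by (simp add: M.M.finsum_insert)
      qed
      then show ?thesis using S by blast
    qed
    also have "(\<Oplus>\<^bsub>M\<^esub>x\<in>?S. smult M (unit_sc (F x)) (\<phi> x)) = mlin_ext M \<phi> F"
      by (rule sup[symmetric]) (use S in auto)
    finally show "mlin_ext M \<phi> (\<lambda>x. c * F x + G x) = smult M (unit_sc c) (mlin_ext M \<phi> F) \<oplus>\<^bsub>M\<^esub> mlin_ext M \<phi> G" .
  qed
qed

lemma mlin_on_comp:
  assumes "lin_on X L" "mlin_on Y M H" "\<And>f. f \<in> free_space X \<Longrightarrow> L f \<in> free_space Y"
  shows "mlin_on X M (\<lambda>f. H (L f))"
  using assms unfolding mlin_on_def lin_on_def by simp

lemma mlin_on_smult:
  assumes M: "env_module A unit_sc M" and H: "mlin_on X M H" and a: "a \<in> free_space BB"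
  shows "mlin_on X M (\<lambda>x. smult M a (H x))"
proof -
  interpret M: env_module A unit_sc M by fact
  have "smult M a (smult M (unit_sc c) y) = smult M (unit_sc c) (smult M a y)" if "y \<in> carrier M" for c y
    using M.left_assoc[of a "unit_sc c" y] M.left_assoc[of "unit_sc c" a y] a that
    by (simp add: unit_closed unit_mult_left unit_mult_right)
  moreover have "smult M (unit_sc c) y \<in> carrier M" if "y \<in> carrier M" for c y
    using M.left_closed[of "unit_sc c" y] that by (simp add: unit_closed)
  ultimately show ?thesis
    using H a M.left_closed[of a] M.left_add[of a] unfolding mlin_on_def by simp
qed

lemma mlin_on_rsmult:
  assumes M: "env_module A unit_sc M" and H: "mlin_on X M H" and a: "a \<in> free_space BB"
  shows "mlin_on X M (\<lambda>x. rsmult M (H x) a)"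
proof -
  interpret M: env_module A unit_sc M by fact
  have "smult M (unit_sc c) y \<in> carrier M" if "y \<in> carrier M" for c y
    using M.left_closed[of "unit_sc c" y] that by (simp add: unit_closed)
  then show ?thesis
    using H a M.right_closed[of a] M.right_add[of a] M.left_right[of "unit_sc _" a] unit_closed
    unfolding mlin_on_def by simp
qed

lemma mlin_on_scalars:
  assumes M: "env_module A unit_sc M" and x: "x \<in> carrier M"
  shows "mlin_on BB M (\<lambda>a. smult M a x)" "mlin_on BB M (\<lambda>a. rsmult M x a)"
proof -
  interpret M: env_module A unit_sc M by fact
  have 1: "smult M (\<lambda>p. c * a p + b p) x = smult M (unit_sc c) (smult M a x) \<oplus>\<^bsub>M\<^esub> smult M b x"
    if "a \<in> free_space BB" "b \<in> free_space BB" for a b c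
    using that M.left_add_scalar[of "\<lambda>p. c * a p" b x] M.left_assoc[of "unit_sc c" a x] x
    by (simp add: unit_closed unit_mult_left scale_free_space)
  show "mlin_on BB M (\<lambda>a. smult M a x)"
    unfolding mlin_on_def using 1 M.left_closed[OF _ x] by simp
  \<comment> \<open>Centrality of the scalars enters here: x(ca) = (xc)a = (cx)a = c(xa).\<close>
  have 2: "rsmult M x (\<lambda>p. c * a p + b p) = smult M (unit_sc c) (rsmult M x a) \<oplus>\<^bsub>M\<^esub> rsmult M x b"
    if "a \<in> free_space BB" "b \<in> free_space BB" for a b c
    using that M.right_add_scalar[of "\<lambda>p. c * a p" b x] M.right_assoc[of "unit_sc c" a x] x
      M.central[of x c] M.left_right[of "unit_sc c" a x]
    by (simp add: unit_closed unit_mult_left scale_free_space)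
  show "mlin_on BB M (\<lambda>a. rsmult M x a)"
    unfolding mlin_on_def using 2 M.right_closed[OF _ x] by simp
qed

text \<open>Bimodule maps are not assumed to be linear over the field. They are, because the field
  acts through elements of A.\<close>

lemma mlin_on_hom:
  assumes M: "env_module A unit_sc M" and H: "mlin_on X M H" and g: "g \<in> env_hom A M N"
  shows "mlin_on X N (\<lambda>x. g (H x))"
proof -
  interpret M: env_module A unit_sc M by fact
  have "smult M (unit_sc c) y \<in> carrier M" if "y \<in> carrier M" for c y
    using M.left_closed[of "unit_sc c" y] that by (simp add: unit_closed)
  then show ?thesis
    using H g unit_closed unfolding mlin_on_def env_hom_def by auto
qed

lemma mlin_on_id: "mlin_on (bbasis m) (bardzell Q I m) (\<lambda>F. F)"
  by (simp add: mlin_on_def lact_unit)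

lemma env_hom_mlin:
  "f \<in> env_hom A (bardzell Q I m) N \<Longrightarrow> mlin_on (bbasis m) N f"
  by (rule mlin_on_hom[OF env_module_bardzell mlin_on_id])

text \<open>A bimodule map out of the resolution term is fixed by the images of the elements e
  \<otimes> \<gamma> \<otimes> e, so it is lifted by choosing preimages
  \<open>\<mu> \<gamma>\<close> of these. The preimages need not be fixed by the idempotents at the
  ends of \<gamma>: only products u \<mu> v with u starting at the target of \<gamma> and v ending
  at its source are formed, and these absorb the idempotents.\<close>

lemma env_projective_bardzell: "env_projective TYPE('x) A unit_sc (bardzell Q I m)"
  unfolding env_projective_def
proof (intro conjI env_module_bardzell allI impI, elim conjE)
  fix M N :: "(('v, 'a) path \<Rightarrow> 'k, 'x) bimodule" and g f
  assume M: "env_module A unit_sc M" and N: "env_module A unit_sc N" and g: "g \<in> env_hom A M N"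
    and surj: "g ` carrier M = carrier N" and f: "f \<in> env_hom A (bardzell Q I m) N"
  interpret M: env_module A unit_sc M by fact
  interpret N: env_module A unit_sc N by fact
  let ?X = "bbasis m"
  let ?e = "\<lambda>\<gamma>. (vpath (ptgt Q \<gamma>), \<gamma>, vpath (psrc \<gamma>))"
  define \<mu> where "\<mu> \<gamma> = (SOME y. y \<in> carrier M \<and> g y = f (bvec (?e \<gamma>)))" for \<gamma>
  have e: "?e \<gamma> \<in> ?X" if "(u, \<gamma>, v) \<in> ?X" for u \<gamma> v
  proof -
    have "\<gamma> \<in> qpaths Q" using that by (auto simp: bardzell_basis_def \<Gamma>m_def \<Gamma>_def)
    then show ?thesis using that ends_in_verts[OF wf, of \<gamma>]
      by (auto simp: bardzell_basis_def BB_vpath)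
  qed
  have \<mu>: "\<mu> \<gamma> \<in> carrier M" "g (\<mu> \<gamma>) = f (bvec (?e \<gamma>))" if "(u, \<gamma>, v) \<in> ?X" for u \<gamma> v
  proof -
    have "f (bvec (?e \<gamma>)) \<in> carrier N" using f e[OF that] by (auto simp: env_hom_def)
    then have "\<exists>y. y \<in> carrier M \<and> g y = f (bvec (?e \<gamma>))" using surj by (metis imageE)
    then show "\<mu> \<gamma> \<in> carrier M" "g (\<mu> \<gamma>) = f (bvec (?e \<gamma>))" unfolding \<mu>_def by (metis (mono_tags, lifting) someI_ex)+
  qed
  define \<phi> where "\<phi> = (\<lambda>(u, \<gamma>, v). smult M (bvec u) (rsmult M (\<mu> \<gamma>) (bvec v)))"
  have bas: "u \<in> BB" "v \<in> BB" "psrc u = ptgt Q \<gamma>" "psrc \<gamma> = ptgt Q v" if "(u, \<gamma>, v) \<in> ?X" for u \<gamma> v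
    using that by (auto simp: bardzell_basis_def)
  have \<phi>: "\<phi> x \<in> carrier M" if "x \<in> ?X" for x
    using that bas \<mu>(1) by (cases x) (auto simp: \<phi>_def intro!: M.left_closed M.right_closed)
  let ?H = "mlin_ext M \<phi>"
  have H: "mlin_on ?X M ?H" by (rule mlin_ext(1)[OF M \<phi>])
  have Hb: "?H (bvec x) = \<phi> x" if "x \<in> ?X" for x by (rule mlin_ext(2)[OF M \<phi> that])
  have Hc: "?H F \<in> carrier M" if "F \<in> free_space ?X" for F
    using mlin_on_closed[OF H that] by simp
  have l: "?H (bilin_ext lact a F) = smult M a (?H F)" if a: "a \<in> free_space BB" and F: "F \<in> free_space ?X" for a F
  proof (rule mlin_on_eqI[OF M _ _ _ a])
    show "mlin_on BB M (\<lambda>a. ?H (bilin_ext lact a F))"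
      by (rule mlin_on_comp[OF lin_on_bilin_left H lact_space]) (use F in auto)
    show "mlin_on BB M (\<lambda>a. smult M a (?H F))" by (rule mlin_on_scalars(1)[OF M Hc[OF F]])
    fix p assume p: "p \<in> BB"
    show "?H (bilin_ext lact (bvec p) F) = smult M (bvec p) (?H F)"
    proof (rule mlin_on_eqI[OF M _ _ _ F])
      show "mlin_on ?X M (\<lambda>F. ?H (bilin_ext lact (bvec p) F))"
        by (rule mlin_on_comp[OF lin_on_bilin_right H lact_space]) (use p in auto)
      show "mlin_on ?X M (\<lambda>F. smult M (bvec p) (?H F))"
        by (rule mlin_on_smult[OF M H]) (use p in auto)
      fix x assume x: "x \<in> ?X"
      obtain u \<gamma> v where [simp]: "x = (u, \<gamma>, v)" by (cases x)
      have xb: "(u, \<gamma>, v) \<in> ?X" using x by simp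
      note bx = bas[OF xb] and \<mu>x = \<mu>[OF xb]
      let ?y = "rsmult M (\<mu> \<gamma>) (bvec v)"
      have y: "?y \<in> carrier M" using \<mu>x(1) bx M.right_closed[of "bvec v" "\<mu> \<gamma>"] by simp_all
      have "smult M (bvec p) (\<phi> x) = smult M (path_mult Q BB p u) ?y"
        using M.left_assoc[of "bvec p" "bvec u" ?y] y p bx by (simp add: \<phi>_def)
      also have "\<dots> = ?H (lact p x)"
      proof (cases "psrc p = ptgt Q u \<and> pcomp p u \<in> BB")
        case True
        then have "(pcomp p u, \<gamma>, v) \<in> ?X" using x by (auto simp: bardzell_basis_def)
        then show ?thesis using True Hb by (simp add: path_mult_def lact_def \<phi>_def)
      next
        case False
        then show ?thesis using zero_smult[OF M y] mlin_on_zero[OF M H]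
          by (auto simp: path_mult_def lact_def)
      qed
      finally show "?H (bilin_ext lact (bvec p) (bvec x)) = smult M (bvec p) (?H (bvec x))"
        using x Hb by simp
    qed
  qed
  have r: "?H (bilin_ext ract F a) = rsmult M (?H F) a" if a: "a \<in> free_space BB" and F: "F \<in> free_space ?X" for a F
  proof (rule mlin_on_eqI[OF M _ _ _ a])
    show "mlin_on BB M (\<lambda>a. ?H (bilin_ext ract F a))"
      by (rule mlin_on_comp[OF lin_on_bilin_right H ract_space]) (use F in auto)
    show "mlin_on BB M (\<lambda>a. rsmult M (?H F) a)" by (rule mlin_on_scalars(2)[OF M Hc[OF F]])
    fix p assume p: "p \<in> BB"
    show "?H (bilin_ext ract F (bvec p)) = rsmult M (?H F) (bvec p)"
    proof (rule mlin_on_eqI[OF M _ _ _ F])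
      show "mlin_on ?X M (\<lambda>F. ?H (bilin_ext ract F (bvec p)))"
        by (rule mlin_on_comp[OF lin_on_bilin_left H ract_space]) (use p in auto)
      show "mlin_on ?X M (\<lambda>F. rsmult M (?H F) (bvec p))"
        by (rule mlin_on_rsmult[OF M H]) (use p in auto)
      fix x assume x: "x \<in> ?X"
      obtain u \<gamma> v where [simp]: "x = (u, \<gamma>, v)" by (cases x)
      have xb: "(u, \<gamma>, v) \<in> ?X" using x by simp
      note bx = bas[OF xb] and \<mu>x = \<mu>[OF xb]
      have \<mu>': "\<mu> \<gamma> \<in> carrier M" "rsmult M (\<mu> \<gamma>) (bvec v) \<in> carrier M"
        using \<mu>x(1) bx M.right_closed[of "bvec v" "\<mu> \<gamma>"] by simp_all
      have "rsmult M (\<phi> x) (bvec p) = smult M (bvec u) (rsmult M (\<mu> \<gamma>) (path_mult Q BB v p))"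
        using M.right_assoc[of "bvec v" "bvec p" "\<mu> \<gamma>"] \<mu>' p bx
          M.left_right[of "bvec u" "bvec p" "rsmult M (\<mu> \<gamma>) (bvec v)"] by (simp add: \<phi>_def)
      also have "\<dots> = ?H (ract x p)"
      proof (cases "psrc v = ptgt Q p \<and> pcomp v p \<in> BB")
        case True
        then have "(u, \<gamma>, pcomp v p) \<in> ?X" using x ptgt_pcomp[OF wf] by (auto simp: bardzell_basis_def)
        then show ?thesis using True Hb by (simp add: path_mult_def ract_def \<phi>_def)
      next
        case False
        then show ?thesis using zero_smult[OF M \<mu>'(1)] mlin_on_zero[OF M H] smult_zero[OF M, of "bvec u"] bx
          by (auto simp: path_mult_def ract_def)
      qed
      finally show "?H (bilin_ext ract (bvec x) (bvec p)) = rsmult M (?H (bvec x)) (bvec p)"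
        using x Hb by simp
    qed
  qed
  have unit_one: "unit_sc 1 = one A" by (simp add: unit_eq)
  have add: "?H (\<lambda>y. F y + G y) = ?H F \<oplus>\<^bsub>M\<^esub> ?H G" if "F \<in> free_space ?X" "G \<in> free_space ?X" for F G
    using mlin_onD[OF H that, of 1] M.left_one[OF Hc[OF that(1)]] by (simp add: unit_one)
  have gH: "g (?H F) = f F" if F: "F \<in> free_space ?X" for F
  proof (rule mlin_on_eqI[OF N mlin_on_hom[OF M H g] env_hom_mlin[OF f] _ F])
    fix x assume x: "x \<in> ?X"
    obtain u \<gamma> v where [simp]: "x = (u, \<gamma>, v)" by (cases x)
    have xb: "(u, \<gamma>, v) \<in> ?X" using x by simp
    note bx = bas[OF xb] and \<mu>x = \<mu>[OF xb]
    have c: "\<mu> \<gamma> \<in> carrier M" "rsmult M (\<mu> \<gamma>) (bvec v) \<in> carrier M" "bvec u \<in> carrier A" "bvec v \<in> carrier A"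
      using \<mu>x(1) bx M.right_closed[of "bvec v" "\<mu> \<gamma>"] by simp_all
    have b: "bvec (?e \<gamma>) \<in> carrier (bardzell Q I m)" using e[OF xb] by simp
    have b': "bilin_ext ract (bvec (?e \<gamma>)) (bvec v) = bvec (vpath (ptgt Q \<gamma>), \<gamma>, v)"
      "bilin_ext lact (bvec u) (bvec (vpath (ptgt Q \<gamma>), \<gamma>, v)) = bvec x"
      using bx by (simp_all add: ract_def lact_def)
    have "(vpath (ptgt Q \<gamma>), \<gamma>, v) \<in> ?X" using xb e[OF xb] by (simp add: bardzell_basis_def)
    then have b3: "bvec (vpath (ptgt Q \<gamma>), \<gamma>, v) \<in> carrier (bardzell Q I m)" by simp
    have "g (\<phi> x) = smult N (bvec u) (rsmult N (g (\<mu> \<gamma>)) (bvec v))"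
      using g c unfolding \<phi>_def env_hom_def by auto
    also have "\<dots> = smult N (bvec u) (rsmult N (f (bvec (?e \<gamma>))) (bvec v))"
      using \<mu>x(2) by simp
    also have "rsmult N (f (bvec (?e \<gamma>))) (bvec v) = f (bvec (vpath (ptgt Q \<gamma>), \<gamma>, v))"
    proof -
      have "f (rsmult (bardzell Q I m) (bvec (?e \<gamma>)) (bvec v)) = rsmult N (f (bvec (?e \<gamma>))) (bvec v)"
        using f b c unfolding env_hom_def by blast
      then show ?thesis using b'(1) by simp
    qed
    also have "smult N (bvec u) \<dots> = f (bvec x)"
    proof -
      have "f (smult (bardzell Q I m) (bvec u) (bvec (vpath (ptgt Q \<gamma>), \<gamma>, v))) =
          smult N (bvec u) (f (bvec (vpath (ptgt Q \<gamma>), \<gamma>, v)))"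
        using f b3 c unfolding env_hom_def by blast
      then show ?thesis using b'(2) by simp
    qed
    finally show "g (?H (bvec x)) = f (bvec x)" using Hb x by simp
  qed
  have "restrict ?H (carrier (bardzell Q I m)) \<in> env_hom A (bardzell Q I m) M"
    unfolding env_hom_def using Hc add l r
    by (auto simp: lact_space ract_space add_free_space)
  then show "\<exists>h\<in>env_hom A (bardzell Q I m) M. \<forall>x\<in>carrier (bardzell Q I m). g (h x) = f x"
    using gH by (intro bexI[of _ "restrict ?H (carrier (bardzell Q I m))"]) auto
qed

subsection \<open>The differential and exactness\<close>

definition bdiff :: "nat \<Rightarrow> ('v, 'a) path \<times> ('v, 'a) path \<times> ('v, 'a) path
    \<Rightarrow> ('v, 'a) path \<times> ('v, 'a) path \<times> ('v, 'a) path \<Rightarrow> 'k" where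
  "bdiff m = (\<lambda>(u, (s, g), v) y.
     ind (pcomp u (arrow Q (last g)) \<in> BB) (pcomp u (arrow Q (last g)), (s, butlast g), v) y
     + (-1) ^ m * ind (pcomp (arrow Q (hd g)) v \<in> BB) (u, (head Q (hd g), tl g), pcomp (arrow Q (hd g)) v) y)"

lemma bdiff_eq: "bdiff m (u, (s, g), v) = (\<lambda>y.
     ind (pcomp u (arrow Q (last g)) \<in> BB) (pcomp u (arrow Q (last g)), (s, butlast g), v) y
     + (-1) ^ m * ind (pcomp (arrow Q (hd g)) v \<in> BB) (u, (head Q (hd g), tl g), pcomp (arrow Q (hd g)) v) y)"
  by (simp add: bdiff_def)

lemma lact_eq: "lact p (u, \<gamma>, v) = ind (psrc p = ptgt Q u \<and> pcomp p u \<in> BB) (pcomp p u, \<gamma>, v)"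
  by (simp add: lact_def)

lemma ract_eq: "ract (u, \<gamma>, v) p = ind (psrc v = ptgt Q p \<and> pcomp v p \<in> BB) (u, \<gamma>, pcomp v p)"
  by (simp add: ract_def)

abbreviation "BD m \<equiv> lin_ext (bdiff m)"

lemma bardzell_diff_eq: "bardzell_diff Q I m = restrict (BD m) (free_space (bbasis m))"
proof -
  have "bdiff m = (\<lambda>(u, \<gamma>, v) y.
     (let c1 = hd (snd \<gamma>); cm = last (snd \<gamma>);
          uc = pcomp u (arrow Q cm); cv = pcomp (arrow Q c1) v
      in (if uc \<in> BB then bvec (uc, (psrc \<gamma>, butlast (snd \<gamma>)), v) y else 0)
         + (-1) ^ m * (if cv \<in> BB then bvec (u, (head Q c1, tl (snd \<gamma>)), cv) y else 0)))"
    by (intro ext) (simp add: bdiff_def Let_def ind_def split: prod.split)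
  then show ?thesis unfolding bardzell_diff_def by simp
qed

lemma bdiff_closed:
  assumes "x \<in> bbasis (Suc m)"
  shows "bdiff k x \<in> free_space (bbasis m)"
proof -
  obtain a wu s g b wv where x: "x = ((a, wu), (s, g), (b, wv))" by (metis surj_pair)
  have c: "chain_path Q nrel a wu" "chain_path Q rel s g" "length g = Suc m" "chain_path Q nrel b wv"
    "a = ptgt Q (s, g)" "s = ptgt Q (b, wv)" using assms unfolding x bbasis_iff by auto
  then have g: "g \<noteq> []" by auto
  have 1: "chain_path Q rel s (butlast g)" "ptgt Q (s, butlast g) = tail Q (last g)"
    using g c(2) rel_snoc[of s "butlast g" "last g"] by auto
  have 2: "chain_path Q rel (head Q (hd g)) (tl g)" "s = tail Q (hd g)"
    using g c(2) rel_Cons[of s "hd g" "tl g"] by auto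
  have 3: "ptgt Q (head Q (hd g), tl g) = ptgt Q (s, g)" using g by (cases g) (auto simp: ptgt_eq)
  show ?thesis unfolding x bdiff_def using c g 1 2 3
    by (auto intro!: add_free_space scale_free_space ind_free_space
        simp: bbasis_iff pcomp_arrow_left pcomp_arrow_right \<B>_iff ptgt_eq)
qed

lemma BD_space: "F \<in> free_space (bbasis (Suc m)) \<Longrightarrow> BD k F \<in> free_space (bbasis m)"
  by (rule lin_ext_closed) (auto intro: bdiff_closed)

lemma ind_if: "ind C x y = (if C then bvec x y else 0)"
  by (simp add: ind_def)

lemma BD_lact:
  assumes "f \<in> free_space BB" "F \<in> free_space (bbasis (Suc m))"
  shows "BD k (bilin_ext lact f F) = bilin_ext lact f (BD k F)"
proof (rule bilin_eqI[where \<Phi> = "\<lambda>f F. BD k (bilin_ext lact f F)", OF _ _ _ _ _ assms])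
  fix p x assume p: "p \<in> BB" and xb: "x \<in> bbasis (Suc m)"
  obtain a wu s g b wv where x: "x = ((a, wu), (s, g), (b, wv))" by (metis surj_pair)
  have g: "g \<noteq> []" using xb unfolding x bbasis_iff by auto
  have a: "a = head Q (last g)" using xb g unfolding x bbasis_iff by (auto simp: ptgt_eq)
  let ?u = "(a, wu)" and ?c = "arrow Q (last g)"
  have pt: "ptgt Q (pcomp ?u ?c) = ptgt Q ?u"
    by (rule ptgt_pcomp[OF wf]) (simp add: arrow_def ptgt_eq a)
  have tc: "ptgt Q ?c = head Q (last g)" by (simp add: arrow_def ptgt_eq)
  have 1: "pcomp ?u ?c \<in> BB" if "psrc p = ptgt Q ?u" "pcomp p (pcomp ?u ?c) \<in> BB"
    using BB_factors[of p "pcomp ?u ?c"] that pt by auto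
  have 2: "pcomp p ?u \<in> BB" if "psrc p = ptgt Q ?u" "pcomp p (pcomp ?u ?c) \<in> BB"
    using BB_factors[of "pcomp p ?u" ?c] that pcomp_assoc[of p ?u ?c] a tc by auto
  show "BD k (bilin_ext lact (bvec p) (bvec x)) = bilin_ext lact (bvec p) (BD k (bvec x))"
    using 1 2 unfolding x
    by (simp add: bilin_ext_def lin_ext_ind lin_ext_ind2 lact_eq bdiff_eq)
       (auto simp: lact_eq ind_if pt pcomp_assoc fun_eq_iff)
qed (auto intro!: lin_on_intros lin_on_comp[OF lin_on_bilin_left lin_on_lin_ext lact_space]
      lin_on_comp[OF lin_on_bilin_right lin_on_lin_ext lact_space]
      lin_on_comp[OF lin_on_lin_ext lin_on_bilin_right BD_space])

lemma BD_ract: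
  assumes "F \<in> free_space (bbasis (Suc m))" "f \<in> free_space BB"
  shows "BD k (bilin_ext ract F f) = bilin_ext ract (BD k F) f"
proof (rule bilin_eqI[where \<Phi> = "\<lambda>F f. BD k (bilin_ext ract F f)", OF _ _ _ _ _ assms])
  fix p x assume p: "p \<in> BB" and xb: "x \<in> bbasis (Suc m)"
  obtain a wu s g b wv where x: "x = ((a, wu), (s, g), (b, wv))" by (metis surj_pair)
  have g: "g \<noteq> []" using xb unfolding x bbasis_iff by auto
  have s: "s = ptgt Q (b, wv)" "s = tail Q (hd g)" using xb g unfolding x bbasis_iff by (auto simp: chain_path_def)
  let ?v = "(b, wv)" and ?c = "arrow Q (hd g)"
  have sc: "psrc ?c = ptgt Q ?v" using s by (simp add: arrow_def)
  have pt: "ptgt Q (pcomp ?v p) = ptgt Q ?v" if "b = ptgt Q p"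
    by (rule ptgt_pcomp[OF wf]) (simp add: that)
  have 1: "pcomp ?c ?v \<in> BB" if "b = ptgt Q p" "pcomp (pcomp ?c ?v) p \<in> BB"
    using BB_factors[of "pcomp ?c ?v" p] that by auto
  have 2: "pcomp ?v p \<in> BB" if "b = ptgt Q p" "pcomp (pcomp ?c ?v) p \<in> BB"
    using BB_factors[of ?c "pcomp ?v p"] that pcomp_assoc[of ?c ?v p] sc pt by auto
  have ps: "psrc (pcomp ?c ?v) = b" by simp
  show "BD k (bilin_ext ract (bvec x) (bvec p)) = bilin_ext ract (BD k (bvec x)) (bvec p)"
    using 1 2 unfolding x
    by (simp add: bilin_ext_def lin_ext_ind lin_ext_ind2 ract_eq bdiff_eq)
       (auto simp: ract_eq ind_if pcomp_assoc fun_eq_iff)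
qed (auto intro!: lin_on_intros lin_on_comp[OF lin_on_bilin_left lin_on_lin_ext ract_space]
      lin_on_comp[OF lin_on_bilin_right lin_on_lin_ext ract_space]
      lin_on_comp[OF lin_on_lin_ext lin_on_bilin_left BD_space])

lemma bardzell_diff_hom: "bardzell_diff Q I (Suc m) \<in> env_hom A (bardzell Q I (Suc m)) (bardzell Q I m)"
  unfolding env_hom_def bardzell_diff_eq
  by (auto simp: BD_space add_free_space lact_space ract_space lin_on_add[OF lin_on_lin_ext] BD_lact BD_ract)

lemma path_mult_ind: "path_mult Q BB p q = (ind (psrc p = ptgt Q q \<and> pcomp p q \<in> BB) (pcomp p q) :: _ \<Rightarrow> 'k)"
  by (simp add: path_mult_def ind_def)

abbreviation "aug \<equiv> lin_ext (\<lambda>(u, \<gamma> :: ('v, 'a) path, v). path_mult Q BB u v) :: _ \<Rightarrow> ('v, 'a) path \<Rightarrow> 'k"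

lemma bardzell_aug_eq: "bardzell_aug Q I = restrict aug (free_space (bbasis 0))"
  by (simp add: bardzell_aug_def)

lemma aug_space: "F \<in> free_space (bbasis m) \<Longrightarrow> aug F \<in> free_space BB"
  by (rule lin_ext_closed) (auto simp: path_mult_closed)

lemma aug_lact:
  assumes "f \<in> free_space BB" "F \<in> free_space (bbasis m)"
  shows "aug (bilin_ext lact f F) = bilin_ext (path_mult Q BB) f (aug F)"
proof (rule bilin_eqI[where \<Phi> = "\<lambda>f F. aug (bilin_ext lact f F)", OF _ _ _ _ _ assms])
  fix p x assume p: "p \<in> BB" and xb: "x \<in> bbasis m"
  obtain u \<gamma> v where x: "x = (u, \<gamma>, v)" by (metis surj_pair)
  have "psrc p = ptgt Q u \<and> pcomp p u \<in> BB \<and> psrc u = ptgt Q v \<and> pcomp (pcomp p u) v \<in> BB \<longleftrightarrow>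
      psrc u = ptgt Q v \<and> pcomp u v \<in> BB \<and> psrc p = ptgt Q (pcomp u v) \<and> pcomp p (pcomp u v) \<in> BB"
    using BB_factors[of "pcomp p u" v] BB_factors[of p "pcomp u v"] pcomp_assoc[of p u v]
      ptgt_pcomp[OF wf, of u v] by auto
  then show "aug (bilin_ext lact (bvec p) (bvec x)) = bilin_ext (path_mult Q BB) (bvec p) (aug (bvec x))"
    unfolding x by (auto simp: bilin_ext_def lact_eq path_mult_ind lin_ext_ind pcomp_assoc ind_def)
qed (auto intro!: lin_on_intros lin_on_comp[OF lin_on_bilin_left lin_on_lin_ext lact_space]
      lin_on_comp[OF lin_on_bilin_right lin_on_lin_ext lact_space]
      lin_on_comp[OF lin_on_lin_ext lin_on_bilin_right aug_space])

lemma aug_ract: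
  assumes "F \<in> free_space (bbasis m)" "f \<in> free_space BB"
  shows "aug (bilin_ext ract F f) = bilin_ext (path_mult Q BB) (aug F) f"
proof (rule bilin_eqI[where \<Phi> = "\<lambda>F f. aug (bilin_ext ract F f)", OF _ _ _ _ _ assms])
  fix p x assume p: "p \<in> BB" and xb: "x \<in> bbasis m"
  obtain u \<gamma> v where x: "x = (u, \<gamma>, v)" by (metis surj_pair)
  have "psrc v = ptgt Q p \<and> pcomp v p \<in> BB \<and> psrc u = ptgt Q (pcomp v p) \<and> pcomp u (pcomp v p) \<in> BB \<longleftrightarrow>
      psrc u = ptgt Q v \<and> pcomp u v \<in> BB \<and> psrc (pcomp u v) = ptgt Q p \<and> pcomp (pcomp u v) p \<in> BB"
    using BB_factors[of "pcomp u v" p] BB_factors[of u "pcomp v p"] pcomp_assoc[of u v p]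
      ptgt_pcomp[OF wf, of v p] by auto
  then show "aug (bilin_ext ract (bvec x) (bvec p)) = bilin_ext (path_mult Q BB) (aug (bvec x)) (bvec p)"
    unfolding x by (auto simp: bilin_ext_def ract_eq path_mult_ind lin_ext_ind pcomp_assoc ind_def)
qed (auto intro!: lin_on_intros lin_on_comp[OF lin_on_bilin_left lin_on_lin_ext ract_space]
      lin_on_comp[OF lin_on_bilin_right lin_on_lin_ext ract_space]
      lin_on_comp[OF lin_on_lin_ext lin_on_bilin_left aug_space])

lemma bardzell_aug_hom: "bardzell_aug Q I \<in> env_hom A (bardzell Q I 0) (gentle_bimodule Q I)"
  unfolding env_hom_def bardzell_aug_eq
  by (auto simp: regular_bimodule_def aug_space add_free_space lact_space ract_space
      lin_on_add[OF lin_on_lin_ext] aug_lact aug_ract)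

text \<open>Terms in which two arrows of \<gamma> pass to the same side vanish, since neighbouring
  arrows of \<gamma> form a relation. The two mixed terms carry opposite signs and cancel.\<close>

lemma BD_BD:
  assumes "F \<in> free_space (bbasis (Suc (Suc m)))"
  shows "BD (Suc m) (BD (Suc (Suc m)) F) = (\<lambda>_. 0)"
proof (rule lin_on_eqI[OF lin_on_comp[OF lin_on_lin_ext lin_on_lin_ext BD_space] lin_on_const_zero _ assms])
  fix x assume xb: "x \<in> bbasis (Suc (Suc m))"
  obtain a wu s g b wv where x: "x = ((a, wu), (s, g), (b, wv))" by (metis surj_pair)
  have c: "chain_path Q rel s g" "length g = Suc (Suc m)" using xb unfolding x bbasis_iff by auto
  obtain c1 c2 g1 where g1: "g = c1 # c2 # g1" using c(2) by (metis length_Suc_conv)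
  obtain d1 d2 g2 where g2: "g = g2 @ [d2, d1]"
    using c(2) by (cases g rule: rev_cases; simp) (metis append.assoc append_Cons append_Nil length_0_conv nat.distinct(1) rev_exhaust)
  have r: "rel c1 c2" "rel d2 d1" using c(1) unfolding g1 rel_Cons
    using c(1) unfolding g2 by (auto simp: rel_append rel_Cons)
  have z: "pcomp (pcomp (a, wu) (arrow Q d1)) (arrow Q d2) \<notin> BB"
    "pcomp (arrow Q c2) (pcomp (arrow Q c1) (b, wv)) \<notin> BB"
    using relD[OF r(1)] relD[OF r(2)]
    by (auto simp: pcomp_arrow_left pcomp_arrow_right pcomp_eq arrow_def \<B>_iff nrel_append nrel_Cons)
  have e: "last g = d1" "last (butlast g) = d2" "hd g = c1" "hd (tl g) = c2"
    "last (tl g) = d1" "hd (butlast g) = c1" "tl (butlast g) = butlast (tl g)"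
  proof -
    show "last (tl g) = d1" unfolding g2 by (cases g2) auto
    show "hd (butlast g) = c1" "tl (butlast g) = butlast (tl g)" unfolding g1 by auto
  qed (simp_all add: g2 butlast_append, simp_all add: g1 flip: g2)
  show "BD (Suc m) (BD (Suc (Suc m)) (bvec x)) = (\<lambda>_. 0)" unfolding x using z
    by (simp add: bdiff_eq lin_ext_ind2) (auto simp: bdiff_eq e ind_if fun_eq_iff)
qed

lemma lin_ext_ind_diff:
  fixes \<phi> :: "'x \<Rightarrow> 'y \<Rightarrow> 'k"
  shows "lin_ext \<phi> (\<lambda>y. ind C x y - ind D z y) =
    (\<lambda>y. (if C then \<phi> x y else 0) - (if D then \<phi> z y else 0))"
  using lin_ext_ind2[of \<phi> C x "-1" D z] by simp

text \<open>Both terms of the differential are mapped to ucv. If this path is in \<open>BB\<close>,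
  so are uc and cv, hence the two terms survive or vanish together.\<close>

lemma aug_BD:
  assumes "F \<in> free_space (bbasis (Suc 0))"
  shows "aug (BD (Suc 0) F) = (\<lambda>_. 0)"
proof (rule lin_on_eqI[OF lin_on_comp[OF lin_on_lin_ext lin_on_lin_ext BD_space] lin_on_const_zero _ assms])
  fix x assume xb: "x \<in> bbasis (Suc 0)"
  obtain a wu s g b wv where x: "x = ((a, wu), (s, g), (b, wv))" by (metis surj_pair)
  obtain c where g: "g = [c]" using xb unfolding x bbasis_iff by (auto simp: length_Suc_conv)
  have c: "chain_path Q nrel a wu" "chain_path Q nrel b wv" "a = head Q c" "tail Q c = ptgt Q (b, wv)"
    using xb unfolding x g bbasis_iff by (auto simp: ptgt_eq)
  have "chain_path Q nrel b (wv @ c # wu) \<Longrightarrow> chain_path Q nrel (tail Q c) (c # wu) \<and> chain_path Q nrel b (wv @ [c])"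
    using c by (auto simp: nrel_append nrel_Cons)
  moreover have "ptgt Q (b, wv @ [c]) = a" using c by (simp add: ptgt_eq)
  ultimately show "aug (BD (Suc 0) (bvec x)) = (\<lambda>_. 0)" unfolding x g
    using c by (simp add: bdiff_eq lin_ext_ind_diff) (auto simp: path_mult_ind ind_if fun_eq_iff pcomp_eq arrow_def \<B>_iff)
qed

section \<open>Exactness of the resolution\<close>

text \<open>A contracting homotopy: the last arrow of the right factor is moved into the middle one. In
  degree 0 this is always possible, and the remainder has to be moved as well.\<close>

definition hpos :: "nat \<Rightarrow> ('v, 'a) path \<times> ('v, 'a) path \<times> ('v, 'a) path
    \<Rightarrow> ('v, 'a) path \<times> ('v, 'a) path \<times> ('v, 'a) path \<Rightarrow> 'k" where
  "hpos m = (\<lambda>(u, (s, g), (b, wv)) y. (-1) ^ Suc m *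
     ind (wv \<noteq> [] \<and> rel (last wv) (hd g)) (u, (tail Q (last wv), last wv # g), (b, butlast wv)) y)"

definition hzero :: "('v, 'a) path \<times> ('v, 'a) path \<times> ('v, 'a) path
    \<Rightarrow> ('v, 'a) path \<times> ('v, 'a) path \<times> ('v, 'a) path \<Rightarrow> 'k" where
  "hzero = (\<lambda>(u, \<gamma>, (b, wv)) y. - (\<Sum>j<length wv.
     ind (chain_path Q nrel (head Q (wv ! j)) (drop (Suc j) wv @ snd u))
       ((head Q (wv ! j), drop (Suc j) wv @ snd u), (tail Q (wv ! j), [wv ! j]), (b, take j wv)) y))"

lemma hpos_eq: "hpos m (u, (s, g), (b, wv)) = (\<lambda>y. (-1) ^ Suc m *
     ind (wv \<noteq> [] \<and> rel (last wv) (hd g)) (u, (tail Q (last wv), last wv # g), (b, butlast wv)) y)"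
  by (simp add: hpos_def)

lemma lin_ext_scaled_ind: "lin_ext \<phi> (\<lambda>y. c * ind C x y) = (\<lambda>y. c * (if C then \<phi> x y else 0))"
  by (simp add: lin_ext_scale lin_ext_ind if_distribR)

lemma lin_ext_neg_sum_ind:
  fixes \<phi> :: "'x \<Rightarrow> 'y \<Rightarrow> 'k"
  shows "lin_ext \<phi> (\<lambda>y. - (\<Sum>j<(n::nat). ind (C j) (x j) y)) = (\<lambda>y. - (\<Sum>j<n. if C j then \<phi> (x j) y else 0))"
proof -
  have s: "(\<lambda>y. \<Sum>j<n. ind (C j) (x j) y) \<in> free_space (UNIV :: 'x set)"
    by (intro sum_free_space ind_free_space) simp
  show ?thesis
    using lin_on_scale[OF lin_on_lin_ext s, of \<phi> "-1"]
      lin_on_sum[OF lin_on_lin_ext, of "{..<n}" "\<lambda>j. ind (C j) (x j)" UNIV \<phi>]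
    by (simp add: ind_free_space lin_ext_ind if_distribR)
qed

lemma hpos_closed:
  assumes "x \<in> bbasis (Suc m)"
  shows "hpos k x \<in> free_space (bbasis (Suc (Suc m)))"
proof -
  obtain a wu s g b wv where x: "x = ((a, wu), (s, g), (b, wv))" by (metis surj_pair)
  have "(u, (tail Q (last wv), last wv # g), (b, butlast wv)) \<in> bbasis (Suc (Suc m))"
    if "wv \<noteq> []" "rel (last wv) (hd g)" and u: "u = (a, wu)" for u
  proof -
    obtain c w where w: "wv = w @ [c]" using \<open>wv \<noteq> []\<close> by (cases wv rule: rev_cases) auto
    show ?thesis using assms that relD[OF that(2)] unfolding x u bbasis_iff w
      by (auto simp: rel_Cons nrel_snoc ptgt_eq)
  qed
  then show ?thesis unfolding x hpos_eq by (intro scale_free_space ind_free_space) auto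
qed

lemma hzero_closed:
  assumes "x \<in> bbasis 0"
  shows "hzero x \<in> free_space (bbasis (Suc 0))"
proof -
  obtain a wu s g b wv where x: "x = ((a, wu), (s, g), (b, wv))" by (metis surj_pair)
  have c: "chain_path Q nrel a wu" "chain_path Q nrel b wv" "a = s" "s = ptgt Q (b, wv)" "g = []"
    using assms unfolding x bbasis_iff by (auto simp: ptgt_eq)
  have "(\<lambda>y. \<Sum>j<length wv.
     ind (chain_path Q nrel (head Q (wv ! j)) (drop (Suc j) wv @ wu))
       ((head Q (wv ! j), drop (Suc j) wv @ wu), (tail Q (wv ! j), [wv ! j]), (b, take j wv)) y)
     \<in> (free_space (bbasis (Suc 0)) :: (_ \<Rightarrow> 'k) set)"
  proof (intro sum_free_space ind_free_space)
    fix j assume j: "j \<in> {..<length wv}" and h: "chain_path Q nrel (head Q (wv ! j)) (drop (Suc j) wv @ wu)"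
    have "wv = take j wv @ wv ! j # drop (Suc j) wv" using j by (simp add: id_take_nth_drop)
    then have "chain_path Q nrel b (take j wv @ wv ! j # drop (Suc j) wv)" using c by simp
    then show "((head Q (wv ! j), drop (Suc j) wv @ wu), (tail Q (wv ! j), [wv ! j]), (b, take j wv)) \<in> bbasis (Suc 0)"
      using h by (auto simp: bbasis_iff nrel_append nrel_Cons ptgt_eq)
  qed
  from scale_free_space[OF this, of "-1"] show ?thesis unfolding x hzero_def by simp
qed

text \<open>The summand of \<open>hzero\<close> for the letter in position j has differential f j -
  f (j + 1) up to the global sign, where f j is obtained from u \<otimes> e \<otimes> v by moving
  all letters of v from position j on into the left factor. The sum telescopes between u \<otimes> e
  \<otimes> v itself and uv \<otimes> e \<otimes> e, and the latter is what the section of the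
  augmentation returns.\<close>

lemma homotopy_zero:
  assumes "x \<in> bbasis 0"
  shows "(\<lambda>y. BD (Suc 0) (hzero x) y
      + lin_ext (\<lambda>p. bvec (p, vpath (psrc p), vpath (psrc p))) (aug (bvec x)) y) = (bvec x :: _ \<Rightarrow> 'k)"
proof -
  obtain a wu s g b wv where x: "x = ((a, wu), (s, g), (b, wv))" by (metis surj_pair)
  have c: "chain_path Q nrel a wu" "chain_path Q nrel b wv" "a = s" "s = ptgt Q (b, wv)" "g = []"
    using assms unfolding x bbasis_iff by (auto simp: ptgt_eq)
  let ?vt = "\<lambda>j. ptgt Q (b, take j wv)"
  define f :: "nat \<Rightarrow> _ \<Rightarrow> 'k" where "f j = ind (chain_path Q nrel (?vt j) (drop j wv @ wu))
      ((?vt j, drop j wv @ wu), (?vt j, [] :: 'a list), (b, take j wv))" for j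
  have "BD (Suc 0) (hzero x) = (\<lambda>y. - (\<Sum>j<length wv. f j y - f (Suc j) y))"
  proof -
    have "(if chain_path Q nrel (head Q (wv ! j)) (drop (Suc j) wv @ wu)
        then bdiff (Suc 0) ((head Q (wv ! j), drop (Suc j) wv @ wu), (tail Q (wv ! j), [wv ! j]), (b, take j wv)) y else 0) =
        f j y - f (Suc j) y" if j: "j < length wv" for j y
    proof -
      have d: "drop j wv = wv ! j # drop (Suc j) wv" by (rule Cons_nth_drop_Suc[OF j, symmetric])
      have t: "take (Suc j) wv = take j wv @ [wv ! j]" by (rule take_Suc_conv_app_nth[OF j])
      have "wv = take j wv @ wv ! j # drop (Suc j) wv" using j by (simp add: id_take_nth_drop)
      then have w: "chain_path Q nrel b (take j wv @ wv ! j # drop (Suc j) wv)" using c by simp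
      then have v: "?vt j = tail Q (wv ! j)" "wv ! j \<in> arcs Q" by (auto simp: nrel_append nrel_Cons)
      have tk: "chain_path Q nrel b (take j wv @ [wv ! j])" using w by (auto simp: nrel_append nrel_Cons)
      have v2: "?vt (Suc j) = head Q (wv ! j)" unfolding t by (simp add: ptgt_eq)
      show ?thesis
        unfolding f_def d v2 v(1) using v(2) tk
        by (auto simp: bdiff_eq ind_if \<B>_iff pcomp_arrow_left pcomp_arrow_right nrel_Cons t)
    qed
    then show ?thesis unfolding x hzero_def by (simp add: lin_ext_neg_sum_ind)
  qed
  also have "\<dots> = (\<lambda>y. f (length wv) y - f 0 y)"
    using sum_lessThan_telescope'[of "\<lambda>j. f j _" "length wv"] by (simp add: fun_eq_iff)
  finally have "BD (Suc 0) (hzero x) = (\<lambda>y. f (length wv) y - f 0 y)" .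
  moreover have "f (length wv) = bvec x" unfolding f_def x using c by simp
  moreover have "lin_ext (\<lambda>p. bvec (p, vpath (psrc p), vpath (psrc p))) (aug (bvec x)) = f 0"
    unfolding f_def x using c by (simp add: path_mult_ind lin_ext_ind pcomp_eq \<B>_iff ind_def vpath_eq ptgt_eq)
  ultimately show ?thesis by simp
qed

text \<open>The sign in \<open>hpos\<close> equals the sign of the second term of the differential,
  which therefore gives x back. The first term is a remainder, to be cancelled by
  \<open>hpos\<close> applied to the differential of x.\<close>

lemma BD_hpos:
  assumes "x \<in> bbasis (Suc m)" "x = ((a, wu), (s, g), (b, wv))"
  shows "BD (Suc (Suc m)) (hpos (Suc m) x) = (\<lambda>y. if wv \<noteq> [] \<and> rel (last wv) (hd g)
    then (-1) ^ m * ind (chain_path Q nrel (tail Q (last g)) (last g # wu))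
      ((tail Q (last g), last g # wu), (tail Q (last wv), last wv # butlast g), (b, butlast wv)) y + bvec x y
    else 0)"
proof (cases "wv \<noteq> [] \<and> rel (last wv) (hd g)")
  case True
  obtain c w where w: "wv = w @ [c]" using True by (cases wv rule: rev_cases) auto
  have c: "g \<noteq> []" "chain_path Q nrel b wv" "s = ptgt Q (b, wv)" using assms(1) unfolding assms(2) bbasis_iff by auto
  have s: "(- 1) ^ m * ((- 1) ^ m * y) = (y::'k)" for y by (simp flip: power_add mult.assoc)
  then show ?thesis using True c unfolding assms(2) hpos_eq w
    by (auto simp: lin_ext_scale bdiff_eq s pcomp_arrow_left pcomp_arrow_right \<B>_iff ptgt_eq fun_eq_iff algebra_simps)
next
  case False
  then show ?thesis unfolding assms(2) hpos_eq by (auto simp: lin_ext_scaled_ind fun_eq_iff)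
qed

text \<open>At the joint between v and \<gamma> exactly one thing happens: either the last arrow of
  v is related to the first arrow of \<gamma> and \<open>hpos\<close> moves it, or the first arrow
  of \<gamma> prolongs v in \<open>BB\<close> and the second term of the differential
  survives.\<close>

lemma not_extend_iff:
  assumes "x \<in> bbasis (Suc m)" "x = ((a, wu), (s, g), (b, wv))"
  shows "chain_path Q nrel b (wv @ [hd g]) \<longleftrightarrow> \<not> (wv \<noteq> [] \<and> rel (last wv) (hd g))"
proof -
  have c: "g \<noteq> []" "chain_path Q nrel b wv" "s = ptgt Q (b, wv)" "chain_path Q rel s g"
    using assms(1) unfolding assms(2) bbasis_iff by auto
  have h: "hd g \<in> arcs Q" "s = tail Q (hd g)" using c(1,4) by (cases g; auto simp: rel_Cons)+
  have l: "last wv \<in> arcs Q" "head Q (last wv) = tail Q (hd g)" if "wv \<noteq> []"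
    using c(2,3) h that last_in_set[OF that] by (auto simp: chain_path_def ptgt_eq)
  show ?thesis using c h l rel_or_nrel[of "last wv" "hd g"] relD[of "last wv" "hd g"]
    by (auto simp: nrel_snoc)
qed

text \<open>If the joint between v and \<gamma> is a relation, x comes from the first summand, and
  the remainder cancels against the first term of the differential of x. If it is not, the first
  summand vanishes; in the differential of x the first arrow of \<gamma> has moved into v, and
  \<open>hpos\<close> moves it back. Two arrows in \<gamma> are needed, so that \<gamma> without its
  last arrow still has the same first arrow.\<close>

lemma homotopy_pos:
  assumes xb: "x \<in> bbasis (Suc (Suc m))"
  shows "(\<lambda>y. BD (Suc (Suc (Suc m))) (hpos (Suc (Suc m)) x) y
      + lin_ext (hpos (Suc m)) (BD (Suc (Suc m)) (bvec x)) y) = (bvec x :: _ \<Rightarrow> 'k)"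
proof -
  obtain a wu s g b wv where x: "x = ((a, wu), (s, g), (b, wv))" by (metis surj_pair)
  have c: "chain_path Q rel s g" "length g = Suc (Suc m)" using xb unfolding x bbasis_iff by auto
  obtain c1 c2 g1 where g1: "g = c1 # c2 # g1" using c(2) by (metis length_Suc_conv)
  have r: "rel c1 c2" "s = tail Q c1" using c(1) unfolding g1 by (auto simp: rel_Cons)
  have e: "hd (butlast g) = hd g" "g \<noteq> []" "hd g = c1" "hd (tl g) = c2" "c1 # tl g = g" by (simp_all add: g1)
  have s: "(- 1) ^ m * (- 1) ^ m = (1::'k)" by (simp flip: power_add)
  have s2: "(- 1) ^ m * ((- 1) ^ m * y) = (y::'k)" for y by (simp add: s flip: mult.assoc)
  show ?thesis
    unfolding BD_hpos[OF xb x] using not_extend_iff[OF xb x] r unfolding x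
    by (simp add: bdiff_eq lin_ext_ind2)
       (auto simp: hpos_eq e ind_if fun_eq_iff \<B>_iff pcomp_arrow_left pcomp_arrow_right s2)
qed

text \<open>Degree 1 is separate because the differential of x lies in degree 0, where
  \<open>hzero\<close> moves every letter of v and not only the last one.\<close>

lemma homotopy_one:
  assumes xb: "x \<in> bbasis (Suc 0)"
  shows "(\<lambda>y. BD (Suc (Suc 0)) (hpos (Suc 0) x) y
      + lin_ext hzero (BD (Suc 0) (bvec x)) y) = (bvec x :: _ \<Rightarrow> 'k)"
proof -
  obtain a wu s g b wv where x0: "x = ((a, wu), (s, g), (b, wv))" by (metis surj_pair)
  obtain c where g: "g = [c]" using xb unfolding x0 bbasis_iff by (auto simp: length_Suc_conv)
  have x: "x = ((a, wu), (s, [c]), (b, wv))" using x0 g by simp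
  have cc: "chain_path Q nrel a wu" "chain_path Q nrel b wv" "a = head Q c" "c \<in> arcs Q" "s = tail Q c" "tail Q c = ptgt Q (b, wv)"
    using xb unfolding x bbasis_iff by (auto simp: ptgt_eq)
  \<comment> \<open>Up to sign, S is \<open>hzero\<close> of uc \<otimes> e \<otimes> v. For u
    \<otimes> e \<otimes> cv the same terms occur, with one more for the letter c, and this one is
    x.\<close>
  define S where "S = (\<lambda>y. \<Sum>j<length wv. ind (chain_path Q nrel (head Q (wv ! j)) (drop (Suc j) wv @ c # wu))
       ((head Q (wv ! j), drop (Suc j) wv @ c # wu), (tail Q (wv ! j), [wv ! j]), (b, take j wv)) y :: 'k)"
  have S0: "S = (\<lambda>_. 0)" if "\<not> chain_path Q nrel (tail Q c) (c # wu)"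
  proof -
    have "\<not> chain_path Q nrel (head Q (wv ! j)) (drop (Suc j) wv @ c # wu)" for j
      using that by (auto simp: nrel_append nrel_Cons)
    then show ?thesis by (simp add: S_def)
  qed
  have h1: "hzero ((tail Q c, c # wu), (s, []), b, wv) = (\<lambda>y. - S y)"
    by (simp add: hzero_def S_def)
  have h2: "hzero ((a, wu), (head Q c, []), b, wv @ [c]) = (\<lambda>y. - S y - bvec x y)"
  proof -
    have "(\<Sum>j<length (wv @ [c]). ind (chain_path Q nrel (head Q ((wv @ [c]) ! j)) (drop (Suc j) (wv @ [c]) @ wu))
       ((head Q ((wv @ [c]) ! j), drop (Suc j) (wv @ [c]) @ wu), (tail Q ((wv @ [c]) ! j), [(wv @ [c]) ! j]), (b, take j (wv @ [c]))) y)
       = S y + (bvec x y :: 'k)" for y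
      unfolding S_def x using cc by (simp add: nth_append)
    then show ?thesis by (simp add: hzero_def)
  qed
  \<comment> \<open>Every term of S except that of the last letter of v contains the relation formed
    by this letter and c.\<close>
  have S1: "S = ind (chain_path Q nrel (tail Q c) (c # wu))
      ((tail Q c, c # wu), (tail Q (last wv), [last wv]), (b, butlast wv))" if R: "wv \<noteq> []" "rel (last wv) c"
  proof -
    obtain d w where w: "wv = w @ [d]" using R by (cases wv rule: rev_cases) auto
    have "\<not> chain_path Q nrel v (drop (Suc j) w @ d # c # wu)" for v j
      using relD[OF R(2)] unfolding w by (auto simp: nrel_append nrel_Cons)
    then show ?thesis using cc unfolding S_def w by (simp add: nth_append ptgt_eq)
  qed
  have t: "lin_ext hzero (BD (Suc 0) (bvec x)) = (\<lambda>y. - S y +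
      (if chain_path Q nrel b (wv @ [c]) then S y + bvec x y else 0))"
    using S0 h1 h2 unfolding x using cc
    by (simp add: bdiff_eq lin_ext_ind_diff) (auto simp: ind_if fun_eq_iff \<B>_iff pcomp_arrow_left pcomp_arrow_right)
  show ?thesis
    unfolding BD_hpos[OF xb x] t using not_extend_iff[OF xb x] S1 by (auto simp: fun_eq_iff)
qed

lemma bardzell_exact:
  assumes "F \<in> free_space (bbasis (Suc m))" "BD (Suc m) F = (\<lambda>_. 0)"
  shows "\<exists>G\<in>free_space (bbasis (Suc (Suc m))). F = BD (Suc (Suc m)) G"
proof -
  define h where "h = (case m of 0 \<Rightarrow> hzero | Suc n \<Rightarrow> hpos m)"
  have h: "lin_ext h F \<in> free_space (bbasis (Suc m))" if "F \<in> free_space (bbasis m)" for F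
    by (rule lin_ext_closed[OF that]) (auto simp: h_def hzero_closed hpos_closed split: nat.split)
  have hp: "lin_ext (hpos (Suc m)) F \<in> free_space (bbasis (Suc (Suc m)))" if "F \<in> free_space (bbasis (Suc m))" for F
    by (rule lin_ext_closed[OF that]) (auto simp: hpos_closed)
  have "(\<lambda>y. BD (Suc (Suc m)) (lin_ext (hpos (Suc m)) F) y + lin_ext h (BD (Suc m) F) y) = F"
  proof (rule lin_on_eqI[OF _ lin_on_id _ assms(1)])
    show "lin_on (bbasis (Suc m)) (\<lambda>F y. BD (Suc (Suc m)) (lin_ext (hpos (Suc m)) F) y + lin_ext h (BD (Suc m) F) y)"
      by (intro lin_on_plus lin_on_comp[OF lin_on_lin_ext lin_on_lin_ext BD_space]
          lin_on_comp[OF lin_on_lin_ext lin_on_lin_ext hp])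
    fix x assume "x \<in> bbasis (Suc m)"
    then show "(\<lambda>y. BD (Suc (Suc m)) (lin_ext (hpos (Suc m)) (bvec x)) y + lin_ext h (BD (Suc m) (bvec x)) y) = bvec x"
      using homotopy_one homotopy_pos by (cases m) (simp_all add: h_def)
  qed
  then show ?thesis using assms hp[OF assms(1)] by (intro bexI[of _ "lin_ext (hpos (Suc m)) F"]) simp_all
qed

lemma bardzell_exact_zero:
  assumes "F \<in> free_space (bbasis 0)" "aug F = (\<lambda>_. 0)"
  shows "\<exists>G\<in>free_space (bbasis (Suc 0)). F = BD (Suc 0) G"
proof -
  have hz: "lin_ext hzero F \<in> free_space (bbasis (Suc 0))" if "F \<in> free_space (bbasis 0)" for F
    by (rule lin_ext_closed[OF that]) (auto simp: hzero_closed)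
  let ?s = "lin_ext (\<lambda>p. bvec (p, vpath (psrc p), vpath (psrc p)))"
  have "(\<lambda>y. BD (Suc 0) (lin_ext hzero F) y + ?s (aug F) y) = F"
  proof (rule lin_on_eqI[OF _ lin_on_id _ assms(1)])
    show "lin_on (bbasis 0) (\<lambda>F y. BD (Suc 0) (lin_ext hzero F) y + ?s (aug F) y)"
      by (intro lin_on_plus lin_on_comp[OF lin_on_lin_ext lin_on_lin_ext aug_space]
          lin_on_comp[OF lin_on_lin_ext lin_on_lin_ext hz])
    fix x assume "x \<in> bbasis 0"
    then show "(\<lambda>y. BD (Suc 0) (lin_ext hzero (bvec x)) y + ?s (aug (bvec x)) y) = bvec x"
      using homotopy_zero by simp
  qed
  then show ?thesis using assms hz[OF assms(1)] by (intro bexI[of _ "lin_ext hzero F"]) simp_all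
qed

lemma aug_surj: "aug ` free_space (bbasis 0) = free_space BB"
proof
  show "aug ` free_space (bbasis 0) \<subseteq> free_space BB" using aug_space by auto
  show "free_space BB \<subseteq> aug ` free_space (bbasis 0)"
  proof
    fix f :: "('v, 'a) path \<Rightarrow> 'k" assume f: "f \<in> free_space BB"
    let ?s = "lin_ext (\<lambda>p. bvec (p, vpath (psrc p), vpath (psrc p)))"
    have b: "(p, vpath (psrc p), vpath (psrc p)) \<in> bbasis 0" if "p \<in> BB" for p
      using that ends_in_verts[OF wf, of p]
      by (cases p) (auto simp: vpath_eq bbasis_iff \<B>_iff ptgt_eq chain_path_def)
    have s: "?s f \<in> free_space (bbasis 0)" if "f \<in> free_space BB" for f :: "_ \<Rightarrow> 'k"
      by (rule lin_ext_closed[OF that]) (simp add: b)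
    have l: "lin_on BB (\<lambda>f. aug (?s f))" by (rule lin_on_comp[OF lin_on_lin_ext lin_on_lin_ext s])
    have "aug (?s f) = f"
      by (rule lin_on_eqI[OF l lin_on_id _ f]) (auto simp: path_mult_def)
    then show "f \<in> aug ` free_space (bbasis 0)" by (rule image_eqI[OF sym s[OF f]])
  qed
qed

theorem projective_resolution_bardzell:
  "projective_resolution TYPE('x) A unit_sc (bardzell Q I) (bardzell_diff Q I) (bardzell_aug Q I) (gentle_bimodule Q I)"
  unfolding projective_resolution_def
proof (intro conjI allI)
  show "env_module A unit_sc (gentle_bimodule Q I)" by (rule env_module_regular)
  show "env_projective TYPE('x) A unit_sc (bardzell Q I m)" for m by (rule env_projective_bardzell)
  show "bardzell_diff Q I (Suc m) \<in> env_hom A (bardzell Q I (Suc m)) (bardzell Q I m)" for m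
    by (rule bardzell_diff_hom)
  show "bardzell_aug Q I \<in> env_hom A (bardzell Q I 0) (gentle_bimodule Q I)" by (rule bardzell_aug_hom)
  show "bardzell_aug Q I ` carrier (bardzell Q I 0) = carrier (gentle_bimodule Q I)"
    using aug_surj by (simp add: bardzell_aug_eq regular_bimodule_def)
  show "{x \<in> carrier (bardzell Q I 0). bardzell_aug Q I x = \<zero>\<^bsub>gentle_bimodule Q I\<^esub>} =
      bardzell_diff Q I 1 ` carrier (bardzell Q I 1)"
    using bardzell_exact_zero aug_BD BD_space
    by (fastforce simp: bardzell_aug_eq bardzell_diff_eq regular_bimodule_def)
  show "{x \<in> carrier (bardzell Q I (Suc m)). bardzell_diff Q I (Suc m) x = \<zero>\<^bsub>bardzell Q I m\<^esub>} =
      bardzell_diff Q I (Suc (Suc m)) ` carrier (bardzell Q I (Suc (Suc m)))" for m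
    using bardzell_exact BD_BD BD_space
    by (fastforce simp: bardzell_diff_eq)
qed

end

section \<open>The complex of parallel paths\<close>

context gentle
begin

abbreviation "pbasis \<equiv> parallel Q I"

definition phom :: "('v, 'a) path \<times> ('v, 'a) path \<Rightarrow> ('v, 'a) path \<times> ('v, 'a) path \<times> ('v, 'a) path
    \<Rightarrow> ('v, 'a) path \<Rightarrow> 'k" where
  "phom = (\<lambda>(\<gamma>, \<alpha>) (u, \<gamma>', v).
     ind (\<gamma>' = \<gamma> \<and> pcomp u (pcomp \<alpha> v) \<in> BB) (pcomp u (pcomp \<alpha> v)))"

lemma phom_eq: "phom (\<gamma>, \<alpha>) (u, \<gamma>', v) =
     ind (\<gamma>' = \<gamma> \<and> pcomp u (pcomp \<alpha> v) \<in> BB) (pcomp u (pcomp \<alpha> v))"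
  by (simp add: phom_def)

lemma par_hom_eq: "par_hom Q I m x = restrict (bilin_ext phom x) (free_space (bbasis m))"
proof -
  have "phom = (\<lambda>(\<gamma>, \<alpha>) (u, \<gamma>', v).
     if \<gamma>' = \<gamma> \<and> pcomp u (pcomp \<alpha> v) \<in> \<B> Q I then bvec (pcomp u (pcomp \<alpha> v)) else (\<lambda>_. 0))"
    by (intro ext) (simp add: phom_def ind_def split: prod.split)
  then show ?thesis unfolding par_hom_def by simp
qed

definition pdiff :: "nat \<Rightarrow> ('v, 'a) path \<times> ('v, 'a) path \<Rightarrow> ('v, 'a) path \<times> ('v, 'a) path \<Rightarrow> 'k" where
  "pdiff m = (\<lambda>(\<gamma>, \<alpha>) y.
     (\<Sum>b | b \<in> arcs Q \<and> tail Q b = ptgt Q \<gamma> \<and>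
          (pcomp (arrow Q b) \<gamma>, pcomp (arrow Q b) \<alpha>) \<in> pbasis (Suc m).
        bvec (pcomp (arrow Q b) \<gamma>, pcomp (arrow Q b) \<alpha>) y)
     - (-1) ^ m *
     (\<Sum>a | a \<in> arcs Q \<and> head Q a = psrc \<gamma> \<and>
          (pcomp \<gamma> (arrow Q a), pcomp \<alpha> (arrow Q a)) \<in> pbasis (Suc m).
        bvec (pcomp \<gamma> (arrow Q a), pcomp \<alpha> (arrow Q a)) y))"

lemma par_diff_eq: "par_diff Q I m = lin_ext (pdiff m)"
  unfolding par_diff_def pdiff_def by simp

lemma pbasisD:
  assumes "(\<gamma>, \<alpha>) \<in> pbasis m"
  shows "\<gamma> \<in> \<Gamma>m Q I m" "\<alpha> \<in> BB" "psrc \<gamma> = psrc \<alpha>" "ptgt Q \<gamma> = ptgt Q \<alpha>"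
  using assms by (auto simp: parallel_def parallel_paths_def)

text \<open>Adding the same arrow to both components keeps them parallel, so only membership in
  \<Gamma> and \<B> remains to be tested.\<close>

lemma pdiff_left_iff:
  assumes "((v, w), (v', w')) \<in> pbasis m"
  shows "b \<in> arcs Q \<and> tail Q b = ptgt Q (v, w) \<and>
      (pcomp (arrow Q b) (v, w), pcomp (arrow Q b) (v', w')) \<in> pbasis (Suc m)
    \<longleftrightarrow> chain_path Q rel v (w @ [b]) \<and> chain_path Q nrel v (w' @ [b])"
  using assms by (auto simp: pcomp_arrow_left parallel_iff rel_snoc nrel_snoc ptgt_eq)

lemma pdiff_right_iff:
  assumes "((v, w), (v', w')) \<in> pbasis m"
  shows "a \<in> arcs Q \<and> head Q a = psrc (v, w) \<and>
      (pcomp (v, w) (arrow Q a), pcomp (v', w') (arrow Q a)) \<in> pbasis (Suc m)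
    \<longleftrightarrow> chain_path Q rel (tail Q a) (a # w) \<and> chain_path Q nrel (tail Q a) (a # w') \<and> head Q a = v"
  using assms by (auto simp: pcomp_arrow_right parallel_iff rel_Cons nrel_Cons ptgt_eq)

lemma pdiff_eq:
  assumes "((v, w), (v', w')) \<in> pbasis m"
  shows "pdiff m ((v, w), (v', w')) = (\<lambda>y.
     (\<Sum>b | chain_path Q rel v (w @ [b]) \<and> chain_path Q nrel v (w' @ [b]). bvec ((v, w @ [b]), (v, w' @ [b])) y)
     - (-1) ^ m *
     (\<Sum>a | chain_path Q rel (tail Q a) (a # w) \<and> chain_path Q nrel (tail Q a) (a # w') \<and> head Q a = v.
        bvec ((tail Q a, a # w), (tail Q a, a # w')) y))"
proof -
  have v: "v' = v" using assms by (simp add: parallel_iff)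
  show ?thesis unfolding pdiff_def prod.case pdiff_left_iff[OF assms] pdiff_right_iff[OF assms]
    by (simp add: pcomp_arrow_left pcomp_arrow_right v)
qed

lemma pbasis_left: "((v, w), (v', w')) \<in> pbasis m \<Longrightarrow> chain_path Q rel v (w @ [b]) \<Longrightarrow> chain_path Q nrel v (w' @ [b])
    \<Longrightarrow> ((v, w @ [b]), (v, w' @ [b])) \<in> pbasis (Suc m)"
  by (auto simp: parallel_iff ptgt_eq)

lemma pbasis_right: "((v, w), (v', w')) \<in> pbasis m \<Longrightarrow> chain_path Q rel (tail Q a) (a # w)
    \<Longrightarrow> chain_path Q nrel (tail Q a) (a # w') \<Longrightarrow> head Q a = v
    \<Longrightarrow> ((tail Q a, a # w), (tail Q a, a # w')) \<in> pbasis (Suc m)"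
  by (auto simp: parallel_iff ptgt_eq)

lemma finite_exts [simp]:
  "finite {b. chain_path Q rel v (w @ [b]) \<and> P b}"
  "finite {a. chain_path Q rel (tail Q a) (a # w) \<and> P a}"
  by (rule finite_subset[of _ "arcs Q"]; auto simp: chain_path_def)+

lemma pdiff_closed:
  assumes "x \<in> pbasis m"
  shows "pdiff m x \<in> free_space (pbasis (Suc m))"
proof -
  obtain v w v' w' where x: "x = ((v, w), (v', w'))" by (metis surj_pair)
  note a = assms[unfolded x]
  show ?thesis unfolding x pdiff_eq[OF a]
    by (intro diff_free_space scale_free_space sum_free_space)
       (use pbasis_left[OF a] pbasis_right[OF a] in auto)
qed

lemma pd_space: "F \<in> free_space (pbasis m) \<Longrightarrow> lin_ext (pdiff m) F \<in> free_space (pbasis (Suc m))"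
  by (rule lin_ext_closed) (auto intro: pdiff_closed)

lemma phom_closed: "phom x z \<in> free_space BB"
  unfolding phom_def by (auto split: prod.split intro: ind_free_space)

lemma phom_space: "x \<in> free_space X \<Longrightarrow> F \<in> free_space Y \<Longrightarrow> bilin_ext phom x F \<in> free_space BB"
  by (rule bilin_ext_closed) (auto intro: phom_closed)

lemma phom_ptgt:
  assumes "(\<gamma>, \<alpha>) \<in> pbasis m" "(u, \<gamma>, v) \<in> bbasis m"
  shows "psrc \<alpha> = ptgt Q v" "ptgt Q (pcomp \<alpha> v) = ptgt Q \<alpha>" "psrc u = ptgt Q (pcomp \<alpha> v)"
    "ptgt Q (pcomp u (pcomp \<alpha> v)) = ptgt Q u" "psrc (pcomp u (pcomp \<alpha> v)) = psrc v"
proof -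
  show 1: "psrc \<alpha> = ptgt Q v" using assms pbasisD[OF assms(1)] by (auto simp: bardzell_basis_def)
  then show 2: "ptgt Q (pcomp \<alpha> v) = ptgt Q \<alpha>" by (rule ptgt_pcomp[OF wf])
  then show 3: "psrc u = ptgt Q (pcomp \<alpha> v)" using assms pbasisD[OF assms(1)] by (auto simp: bardzell_basis_def)
  then show "ptgt Q (pcomp u (pcomp \<alpha> v)) = ptgt Q u" by (rule ptgt_pcomp[OF wf])
qed simp

lemma phom_lact:
  assumes "x \<in> free_space (pbasis m)" "f \<in> free_space BB" "F \<in> free_space (bbasis m)"
  shows "bilin_ext phom x (bilin_ext lact f F) = bilin_ext (path_mult Q BB) f (bilin_ext phom x F)"
proof (rule trilin_eqI[where \<Phi> = "\<lambda>x f F. bilin_ext phom x (bilin_ext lact f F)", OF _ _ _ _ _ _ _ assms])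
  fix x p z assume x: "x \<in> pbasis m" and p: "p \<in> BB" and z: "z \<in> bbasis m"
  obtain \<gamma> \<alpha> u \<gamma>' v where [simp]: "x = (\<gamma>, \<alpha>)" "z = (u, \<gamma>', v)" by (metis surj_pair)
  show "bilin_ext phom (bvec x) (bilin_ext lact (bvec p) (bvec z)) =
      bilin_ext (path_mult Q BB) (bvec p) (bilin_ext phom (bvec x) (bvec z))"
  proof (cases "\<gamma>' = \<gamma>")
    case True
    have m: "(\<gamma>, \<alpha>) \<in> pbasis m" "(u, \<gamma>, v) \<in> bbasis m" using x z True by auto
    note t = phom_ptgt[OF m]
    have "psrc p = ptgt Q u \<and> pcomp p u \<in> BB \<and> pcomp (pcomp p u) (pcomp \<alpha> v) \<in> BB \<longleftrightarrow>
        pcomp u (pcomp \<alpha> v) \<in> BB \<and> psrc p = ptgt Q (pcomp u (pcomp \<alpha> v)) \<and> pcomp p (pcomp u (pcomp \<alpha> v)) \<in> BB"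
      using t BB_factors[of "pcomp p u" "pcomp \<alpha> v"] BB_factors[of p "pcomp u (pcomp \<alpha> v)"]
      by (auto simp: pcomp_assoc)
    then show ?thesis using True
      by (auto simp: bilin_ext_def lact_eq phom_eq path_mult_ind lin_ext_ind ind_def pcomp_assoc)
  next
    case False
    then show ?thesis by (simp add: bilin_ext_def lact_eq phom_eq lin_ext_ind)
  qed
qed (auto intro!: lin_on_intros lin_on_comp[OF lin_on_bilin_left lin_on_bilin_right lact_space]
      lin_on_comp[OF lin_on_bilin_right lin_on_bilin_right lact_space]
      lin_on_comp[OF lin_on_bilin_left lin_on_bilin_right phom_space]
      lin_on_comp[OF lin_on_bilin_right lin_on_bilin_right phom_space])

lemma phom_ract:
  assumes "x \<in> free_space (pbasis m)" "F \<in> free_space (bbasis m)" "f \<in> free_space BB"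
  shows "bilin_ext phom x (bilin_ext ract F f) = bilin_ext (path_mult Q BB) (bilin_ext phom x F) f"
proof (rule trilin_eqI[where \<Phi> = "\<lambda>x F f. bilin_ext phom x (bilin_ext ract F f)", OF _ _ _ _ _ _ _ assms])
  fix x p z assume x: "x \<in> pbasis m" and p: "p \<in> BB" and z: "z \<in> bbasis m"
  obtain \<gamma> \<alpha> u \<gamma>' v where [simp]: "x = (\<gamma>, \<alpha>)" "z = (u, \<gamma>', v)" by (metis surj_pair)
  show "bilin_ext phom (bvec x) (bilin_ext ract (bvec z) (bvec p)) =
      bilin_ext (path_mult Q BB) (bilin_ext phom (bvec x) (bvec z)) (bvec p)"
  proof (cases "\<gamma>' = \<gamma>")
    case True
    have m: "(\<gamma>, \<alpha>) \<in> pbasis m" "(u, \<gamma>, v) \<in> bbasis m" using x z True by auto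
    note t = phom_ptgt[OF m]
    have vp: "ptgt Q (pcomp v p) = ptgt Q v" if "psrc v = ptgt Q p" using that by (rule ptgt_pcomp[OF wf])
    have avp: "ptgt Q (pcomp \<alpha> (pcomp v p)) = ptgt Q \<alpha>" if "psrc v = ptgt Q p"
      by (rule ptgt_pcomp[OF wf]) (use t vp[OF that] in simp)
    have "psrc v = ptgt Q p \<and> pcomp v p \<in> BB \<and> pcomp u (pcomp \<alpha> (pcomp v p)) \<in> BB \<longleftrightarrow>
        pcomp u (pcomp \<alpha> v) \<in> BB \<and> psrc (pcomp u (pcomp \<alpha> v)) = ptgt Q p \<and> pcomp (pcomp u (pcomp \<alpha> v)) p \<in> BB"
      using t vp avp BB_factors[of u "pcomp \<alpha> (pcomp v p)"] BB_factors[of \<alpha> "pcomp v p"]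
        BB_factors[of "pcomp u (pcomp \<alpha> v)" p]
      by (auto simp: pcomp_assoc)
    then show ?thesis using True
      by (auto simp: bilin_ext_def ract_eq phom_eq path_mult_ind lin_ext_ind ind_def pcomp_assoc)
  next
    case False
    then show ?thesis by (simp add: bilin_ext_def ract_eq phom_eq lin_ext_ind)
  qed
qed (auto intro!: lin_on_intros lin_on_comp[OF lin_on_bilin_left lin_on_bilin_right ract_space]
      lin_on_comp[OF lin_on_bilin_right lin_on_bilin_right ract_space]
      lin_on_comp[OF lin_on_bilin_left lin_on_bilin_left phom_space]
      lin_on_comp[OF lin_on_bilin_right lin_on_bilin_left phom_space])

lemma regular_simps [simp]:
  "carrier (gentle_bimodule Q I) = free_space BB" "zero (gentle_bimodule Q I) = (\<lambda>_. 0)"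
  "add (gentle_bimodule Q I) = (\<lambda>f g p. f p + g p)"
  "smult (gentle_bimodule Q I) = bilin_ext (path_mult Q BB)"
  "rsmult (gentle_bimodule Q I) = bilin_ext (path_mult Q BB)"
  by (simp_all add: regular_bimodule_def)

lemma par_hom_env_hom:
  assumes "x \<in> par_space Q I m"
  shows "par_hom Q I m x \<in> env_hom A (bardzell Q I m) (gentle_bimodule Q I)"
  using assms unfolding env_hom_def par_hom_eq par_space_def
  by (auto simp: phom_space add_free_space lact_space ract_space
      lin_on_add[OF lin_on_bilin_right] phom_lact phom_ract)

definition gen_elt :: "('v, 'a) path \<Rightarrow> ('v, 'a) path \<times> ('v, 'a) path \<times> ('v, 'a) path" where
  "gen_elt \<gamma> = (vpath (ptgt Q \<gamma>), \<gamma>, vpath (psrc \<gamma>))"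

lemma gen_elt_bbasis: "\<gamma> \<in> \<Gamma>m Q I m \<Longrightarrow> gen_elt \<gamma> \<in> bbasis m"
  using ends_in_verts[OF wf, of \<gamma>] by (auto simp: gen_elt_def bardzell_basis_def BB_vpath \<Gamma>m_def \<Gamma>_def)

text \<open>Evaluation at the generators e \<otimes> \<gamma> \<otimes> e recovers the cochain.
  Injectivity and surjectivity of \<open>par_hom\<close> both rest on this.\<close>

lemma phom_gen_elt:
  assumes "x \<in> free_space (pbasis m)"
  shows "bilin_ext phom x (bvec (gen_elt \<gamma>)) = (\<lambda>p. x (\<gamma>, p))"
proof (rule lin_on_eqI[OF lin_on_bilin_left _ _ assms])
  show "lin_on (pbasis m) (\<lambda>x p. x (\<gamma>, p))" by (simp add: lin_on_def)
  fix z assume z: "z \<in> pbasis m"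
  obtain \<gamma>' \<alpha> where [simp]: "z = (\<gamma>', \<alpha>)" by (cases z)
  note d = pbasisD[of \<gamma>' \<alpha> m]
  show "bilin_ext phom (bvec z) (bvec (gen_elt \<gamma>)) = (\<lambda>p. bvec z (\<gamma>, p) :: 'k)"
    using d z by (simp add: gen_elt_def phom_eq ind_def) (auto simp: bvec_def fun_eq_iff)
qed

lemma env_hom_eqI:
  assumes N: "env_module A unit_sc N" and f: "f \<in> env_hom A (bardzell Q I m) N" and g: "g \<in> env_hom A (bardzell Q I m) N"
    and eq: "\<And>\<gamma>. \<gamma> \<in> \<Gamma>m Q I m \<Longrightarrow> f (bvec (gen_elt \<gamma>)) = g (bvec (gen_elt \<gamma>))"
  shows "f = g"
proof -
  have ext: "f \<in> extensional (free_space (bbasis m))" "g \<in> extensional (free_space (bbasis m))"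
    using f g by (auto simp: env_hom_def PiE_def)
  have "f F = g F" if F: "F \<in> free_space (bbasis m)" for F
  proof (rule mlin_on_eqI[OF N env_hom_mlin[OF f] env_hom_mlin[OF g] _ F])
    fix x assume x: "x \<in> bbasis m"
    obtain u \<gamma> v where xe: "x = (u, \<gamma>, v)" by (metis surj_pair)
    have b: "\<gamma> \<in> \<Gamma>m Q I m" "u \<in> BB" "v \<in> BB" "psrc u = ptgt Q \<gamma>" "psrc \<gamma> = ptgt Q v"
      using x unfolding xe by (auto simp: bardzell_basis_def)
    let ?y = "(vpath (ptgt Q \<gamma>), \<gamma>, v)"
    have y: "?y \<in> bbasis m" using gen_elt_bbasis[OF b(1)] b by (auto simp: gen_elt_def bardzell_basis_def)
    have e: "rsmult (bardzell Q I m) (bvec (gen_elt \<gamma>)) (bvec v) = bvec ?y"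
      "smult (bardzell Q I m) (bvec u) (bvec ?y) = bvec x"
      using b by (simp_all add: gen_elt_def ract_eq lact_eq xe)
    have c: "bvec (gen_elt \<gamma>) \<in> carrier (bardzell Q I m)" "bvec ?y \<in> carrier (bardzell Q I m)"
      "bvec u \<in> carrier A" "bvec v \<in> carrier A" using gen_elt_bbasis[OF b(1)] y b by simp_all
    have "h (bvec x) = smult N (bvec u) (rsmult N (h (bvec (gen_elt \<gamma>))) (bvec v))"
      if h: "h \<in> env_hom A (bardzell Q I m) N" for h
    proof -
      have "h (smult (bardzell Q I m) (bvec u) (bvec ?y)) = smult N (bvec u) (h (bvec ?y))"
        "h (rsmult (bardzell Q I m) (bvec (gen_elt \<gamma>)) (bvec v)) = rsmult N (h (bvec (gen_elt \<gamma>))) (bvec v)"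
        using h c unfolding env_hom_def by blast+
      then show ?thesis unfolding e by simp
    qed
    from this[OF f] this[OF g] show "f (bvec x) = g (bvec x)" using eq[OF b(1)] by simp
  qed
  then show ?thesis using ext by (intro extensionalityI) auto
qed

text \<open>\<B> may be infinite, but a bimodule map on the resolution term is determined by its
  values on finitely many generators, each of finite support. This is why it comes from a finitely
  supported cochain.\<close>

lemma finite_\<Gamma>m: "finite (\<Gamma>m Q I m)"
proof (rule finite_subset)
  show "\<Gamma>m Q I m \<subseteq> verts Q \<times> {w. set w \<subseteq> arcs Q \<and> length w = m}"
    by (auto simp: \<Gamma>m_def \<Gamma>_iff chain_path_def)
  show "finite (verts Q \<times> {w. set w \<subseteq> arcs Q \<and> length w = m})"
    by (intro finite_cartesian_product finite_lists_length_eq) auto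
qed

lemma mult_vpath_left:
  assumes "f \<in> free_space BB"
  shows "bilin_ext (path_mult Q BB) (bvec (vpath i)) f = (\<lambda>p. if ptgt Q p = i then f p else 0)"
proof (rule lin_on_eqI[OF lin_on_bilin_right _ _ assms])
  show "lin_on BB (\<lambda>f p. if ptgt Q p = i then f p else 0)" by (auto simp: lin_on_def)
qed (simp add: path_mult_def, auto simp: bvec_def fun_eq_iff)

lemma mult_vpath_right:
  assumes "f \<in> free_space BB"
  shows "bilin_ext (path_mult Q BB) f (bvec (vpath i)) = (\<lambda>p. if psrc p = i then f p else 0)"
proof (rule lin_on_eqI[OF lin_on_bilin_left _ _ assms])
  show "lin_on BB (\<lambda>f p. if psrc p = i then f p else 0)" by (auto simp: lin_on_def)
qed (simp add: path_mult_def, auto simp: bvec_def fun_eq_iff)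

lemma par_hom_surj:
  assumes f: "f \<in> env_hom A (bardzell Q I m) (gentle_bimodule Q I)"
  shows "\<exists>x\<in>par_space Q I m. f = par_hom Q I m x"
proof -
  define x where "x = (\<lambda>(\<gamma>, \<alpha>). if \<gamma> \<in> \<Gamma>m Q I m then f (bvec (gen_elt \<gamma>)) \<alpha> else 0)"
  have fc: "f (bvec (gen_elt \<gamma>)) \<in> free_space BB" if "\<gamma> \<in> \<Gamma>m Q I m" for \<gamma>
    using f gen_elt_bbasis[OF that] by (auto simp: env_hom_def)
  \<comment> \<open>The vertices at the ends of \<gamma> fix the generator, hence also its image,
    which is therefore a combination of paths parallel to \<gamma>.\<close>
  have supp: "parallel_paths Q \<gamma> \<alpha>" if \<gamma>: "\<gamma> \<in> \<Gamma>m Q I m" and nz: "f (bvec (gen_elt \<gamma>)) \<alpha> \<noteq> 0" for \<gamma> \<alpha>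
  proof -
    let ?e = "bvec (gen_elt \<gamma>) :: _ \<Rightarrow> 'k"
    have v: "vpath (ptgt Q \<gamma>) \<in> BB" "vpath (psrc \<gamma>) \<in> BB"
      using gen_elt_bbasis[OF \<gamma>] by (auto simp: gen_elt_def bardzell_basis_def)
    have "smult (bardzell Q I m) (bvec (vpath (ptgt Q \<gamma>))) ?e = ?e"
      "rsmult (bardzell Q I m) ?e (bvec (vpath (psrc \<gamma>))) = ?e"
      using v by (simp_all add: gen_elt_def lact_eq ract_eq)
    moreover have "f (smult (bardzell Q I m) (bvec (vpath (ptgt Q \<gamma>))) ?e) = bilin_ext (path_mult Q BB) (bvec (vpath (ptgt Q \<gamma>))) (f ?e)"
      "f (rsmult (bardzell Q I m) ?e (bvec (vpath (psrc \<gamma>)))) = bilin_ext (path_mult Q BB) (f ?e) (bvec (vpath (psrc \<gamma>)))"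
      using f v gen_elt_bbasis[OF \<gamma>] by (simp_all add: env_hom_def del: bilin_ext_bvec)
    ultimately have "f ?e = (\<lambda>p. if ptgt Q p = ptgt Q \<gamma> then f ?e p else 0)"
      "f ?e = (\<lambda>p. if psrc p = psrc \<gamma> then f ?e p else 0)"
      unfolding mult_vpath_left[OF fc[OF \<gamma>]] mult_vpath_right[OF fc[OF \<gamma>]] by argo+
    then have "f ?e \<alpha> = (if ptgt Q \<alpha> = ptgt Q \<gamma> then f ?e \<alpha> else 0)"
      "f ?e \<alpha> = (if psrc \<alpha> = psrc \<gamma> then f ?e \<alpha> else 0)"
      by (blast dest: fun_cong)+
    then show ?thesis using nz unfolding parallel_paths_def by (metis (mono_tags))
  qed
  have "x \<in> free_space (pbasis m)" unfolding free_space_def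
  proof (intro CollectI conjI)
    have "{z. x z \<noteq> 0} \<subseteq> (SIGMA \<gamma>:\<Gamma>m Q I m. {\<alpha>. f (bvec (gen_elt \<gamma>)) \<alpha> \<noteq> 0})"
      by (auto simp: x_def split: if_splits)
    moreover have "finite (SIGMA \<gamma>:\<Gamma>m Q I m. {\<alpha>. f (bvec (gen_elt \<gamma>)) \<alpha> \<noteq> 0})"
      using finite_\<Gamma>m fc by (intro finite_SigmaI) (auto simp: free_space_def)
    ultimately show "finite {z. x z \<noteq> 0}" by (rule finite_subset)
    show "{z. x z \<noteq> 0} \<subseteq> pbasis m"
    proof
      fix z assume "z \<in> {z. x z \<noteq> 0}"
      then obtain \<gamma> \<alpha> where z: "z = (\<gamma>, \<alpha>)" "\<gamma> \<in> \<Gamma>m Q I m" "f (bvec (gen_elt \<gamma>)) \<alpha> \<noteq> 0"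
        by (cases z) (auto simp: x_def split: if_splits)
      then show "z \<in> pbasis m"
        using supp[OF z(2,3)] free_spaceD(2)[OF fc[OF z(2)] z(3)] by (simp add: parallel_def)
    qed
  qed
  then have x: "x \<in> par_space Q I m" by (simp add: par_space_def)
  have "f = par_hom Q I m x"
  proof (rule env_hom_eqI[OF env_module_regular f par_hom_env_hom[OF x]])
    fix \<gamma> assume \<gamma>: "\<gamma> \<in> \<Gamma>m Q I m"
    show "f (bvec (gen_elt \<gamma>)) = par_hom Q I m x (bvec (gen_elt \<gamma>))"
      using phom_gen_elt[OF x[unfolded par_space_def], of \<gamma>] gen_elt_bbasis[OF \<gamma>] \<gamma>
      by (simp add: par_hom_eq x_def)
  qed
  then show ?thesis using x by blast
qed

lemma par_hom_inj: "inj_on (par_hom Q I m) (par_space Q I m)"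
proof (rule inj_onI)
  fix x y assume x: "x \<in> par_space Q I m" and y: "y \<in> par_space Q I m" and e: "par_hom Q I m x = par_hom Q I m y"
  have "x (\<gamma>, \<alpha>) = y (\<gamma>, \<alpha>)" for \<gamma> \<alpha>
  proof (cases "\<gamma> \<in> \<Gamma>m Q I m")
    case True
    have "par_hom Q I m z (bvec (gen_elt \<gamma>)) = (\<lambda>p. z (\<gamma>, p))" if "z \<in> par_space Q I m" for z
      using phom_gen_elt[OF that[unfolded par_space_def]] gen_elt_bbasis[OF True] by (simp add: par_hom_eq)
    then have "(\<lambda>p. x (\<gamma>, p)) = (\<lambda>p. y (\<gamma>, p))" using x y e by metis
    then show ?thesis by (rule fun_cong)
  next
    case False
    then have "(\<gamma>, \<alpha>) \<notin> pbasis m" by (auto simp: parallel_def)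
    then have "z (\<gamma>, \<alpha>) = 0" if "z \<in> par_space Q I m" for z :: "_ \<Rightarrow> 'k"
      using that free_spaceD(2)[of z "pbasis m" "(\<gamma>, \<alpha>)"] unfolding par_space_def by blast
    from this[OF x] this[OF y] show ?thesis by simp
  qed
  then show "x = y" by auto
qed

text \<open>At u \<otimes> g \<otimes> v only two summands of the differential can contribute: the
  one whose new arrow is the last arrow of g and the one whose new arrow is the first. They
  correspond to the two terms of the Bardzell differential. The side conditions agree because a
  product of paths that lies in \<open>BB\<close> has all its factors there.\<close>

lemma phom_pdiff:
  assumes x: "x \<in> pbasis m" and z: "z \<in> bbasis (Suc m)"
  shows "bilin_ext phom (pdiff m x) (bvec z) = bilin_ext phom (bvec x) (bdiff (Suc m) z)"
proof -
  obtain p w p' w' where xe: "x = ((p, w), (p', w'))" by (metis surj_pair)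
  obtain a wu s g b wv where ze: "z = ((a, wu), (s, g), (b, wv))" by (metis surj_pair)
  note x' = x[unfolded xe]
  have p: "p' = p" "chain_path Q rel p w" "chain_path Q nrel p w'" "ptgt Q (p, w) = ptgt Q (p, w')" "length w = m"
    using x' by (auto simp: parallel_iff)
  have zc: "chain_path Q nrel a wu" "chain_path Q rel s g" "length g = Suc m" "chain_path Q nrel b wv"
    "a = ptgt Q (s, g)" "s = ptgt Q (b, wv)" using z unfolding ze bbasis_iff by auto
  have g: "g \<noteq> []" using zc by auto
  let ?L = "{b. chain_path Q rel p (w @ [b]) \<and> chain_path Q nrel p (w' @ [b])}"
  let ?R = "{a. chain_path Q rel (tail Q a) (a # w) \<and> chain_path Q nrel (tail Q a) (a # w') \<and> head Q a = p}"
  have "bilin_ext phom (pdiff m x) (bvec z) = lin_ext (\<lambda>x. phom x z) (pdiff m x)"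
    by (simp add: bilin_ext_def)
  also have "\<dots> = (\<lambda>y. (\<Sum>b\<in>?L. phom ((p, w @ [b]), (p, w' @ [b])) z y)
      - (-1) ^ m * (\<Sum>a\<in>?R. phom ((tail Q a, a # w), (tail Q a, a # w')) z y))"
  proof -
    have fs: "(\<lambda>y. \<Sum>i\<in>S. bvec (f i) y) \<in> free_space UNIV" for S and f :: "'a \<Rightarrow> ('v, 'a) path \<times> ('v, 'a) path"
      by (intro sum_free_space) simp
    have ls: "lin_ext (\<lambda>x. phom x z) (\<lambda>y. \<Sum>i\<in>S. bvec (f i) y) = (\<lambda>y. \<Sum>i\<in>S. phom (f i) z y)"
      for S and f :: "'a \<Rightarrow> ('v, 'a) path \<times> ('v, 'a) path"
      using lin_on_sum[OF lin_on_lin_ext, of S "\<lambda>i. bvec (f i)" UNIV "\<lambda>x. phom x z"] by simp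
    show ?thesis unfolding xe pdiff_eq[OF x']
      using lin_on_diff[OF lin_on_lin_ext fs scale_free_space[OF fs], of "\<lambda>x. phom x z"]
        lin_on_scale[OF lin_on_lin_ext fs, of "\<lambda>x. phom x z"] ls by simp
  qed
  finally have L: "bilin_ext phom (pdiff m x) (bvec z) = (\<lambda>y. (\<Sum>b\<in>?L. phom ((p, w @ [b]), (p, w' @ [b])) z y)
      - (-1) ^ m * (\<Sum>a\<in>?R. phom ((tail Q a, a # w), (tail Q a, a # w')) z y))" .
  have R: "bilin_ext phom (bvec x) (bdiff (Suc m) z) = (\<lambda>y.
      (if chain_path Q nrel (tail Q (last g)) (last g # wu) then phom x ((tail Q (last g), last g # wu), (s, butlast g), (b, wv)) y else 0)
      + (-1) ^ Suc m * (if chain_path Q nrel b (wv @ [hd g]) then phom x ((a, wu), (head Q (hd g), tl g), (b, wv @ [hd g])) y else 0))"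
    unfolding ze bilin_ext_def lin_ext_bvec bdiff_eq lin_ext_ind2
    by (simp add: pcomp_eq arrow_def \<B>_iff cong: if_cong)
  have 1: "(\<Sum>b\<in>?L. phom ((p, w @ [b]), (p, w' @ [b])) z y) =
      (if chain_path Q nrel (tail Q (last g)) (last g # wu) then phom x ((tail Q (last g), last g # wu), (s, butlast g), (b, wv)) y else 0)" for y
  proof -
    obtain g0 c where gs: "g = g0 @ [c]" using g by (cases g rule: rev_cases) auto
    have a: "a = head Q c" using zc by (simp add: gs ptgt_eq)
    show ?thesis
    proof (cases "s = p \<and> g0 = w")
      case False
      then have "phom ((p, w @ [b]), (p, w' @ [b])) z y = 0" for b by (auto simp: ze phom_eq gs ind_def)
      then show ?thesis using False by (auto simp: xe phom_eq gs ind_def)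
    next
      case True
      have cr: "chain_path Q rel p (w @ [c])" using zc True gs by simp
      have "(\<Sum>b\<in>?L. phom ((p, w @ [b]), (p, w' @ [b])) z y) = (\<Sum>b\<in>?L \<inter> {c}. phom ((p, w @ [b]), (p, w' @ [b])) z y)"
        by (rule sum.mono_neutral_right) (auto simp: ze phom_eq gs ind_def True)
      also have "\<dots> = (if chain_path Q nrel p (w' @ [c]) then phom ((p, w @ [c]), (p, w' @ [c])) z y else 0)"
        using cr by auto
      also have "\<dots> = (if chain_path Q nrel (tail Q c) (c # wu) then phom x ((tail Q c, c # wu), (s, butlast g), (b, wv)) y else 0)"
      proof -
        have "chain_path Q nrel b (wv @ w' @ [c] @ wu) \<Longrightarrow> chain_path Q nrel p (w' @ [c]) \<and> chain_path Q nrel (tail Q c) (c # wu)"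
        proof -
          assume h: "chain_path Q nrel b (wv @ w' @ [c] @ wu)"
          then have h2: "chain_path Q nrel p (w' @ [c] @ wu)" using zc True by (auto simp: nrel_append)
          have "chain_path Q nrel (tail Q c) (c # wu)" using h2 by (auto simp: nrel_append nrel_Cons)
          moreover have "chain_path Q nrel p ((w' @ [c]) @ wu)" using h2 by simp
          ultimately show "chain_path Q nrel p (w' @ [c]) \<and> chain_path Q nrel (tail Q c) (c # wu)"
            using nrel_append by blast
        qed
        then show ?thesis unfolding xe ze p(1) phom_eq ind_if pcomp_eq \<B>_iff using True
          by (auto simp: gs)
      qed
      finally show ?thesis by (simp add: gs)
    qed
  qed
  have 2: "(\<Sum>a\<in>?R. phom ((tail Q a, a # w), (tail Q a, a # w')) z y) =
      (if chain_path Q nrel b (wv @ [hd g]) then phom x ((a, wu), (head Q (hd g), tl g), (b, wv @ [hd g])) y else 0)" for y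
  proof -
    obtain g0 c where gs: "g = c # g0" using g by (cases g) auto
    have s: "s = tail Q c" "c \<in> arcs Q" using zc by (auto simp: gs rel_Cons)
    show ?thesis
    proof (cases "head Q c = p \<and> g0 = w")
      case False
      then have "(\<Sum>a\<in>?R. phom ((tail Q a, a # w), (tail Q a, a # w')) z y) = 0"
        by (intro sum.neutral) (auto simp: ze phom_eq gs ind_def)
      then show ?thesis using False by (auto simp: xe phom_eq gs ind_def)
    next
      case True
      have cr: "chain_path Q rel (tail Q c) (c # w)" using zc True gs s by simp
      have "(\<Sum>a\<in>?R. phom ((tail Q a, a # w), (tail Q a, a # w')) z y) = (\<Sum>a\<in>?R \<inter> {c}. phom ((tail Q a, a # w), (tail Q a, a # w')) z y)"
        by (rule sum.mono_neutral_right) (auto simp: ze phom_eq gs ind_def True)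
      also have "\<dots> = (if chain_path Q nrel (tail Q c) (c # w') then phom ((tail Q c, c # w), (tail Q c, c # w')) z y else 0)"
        using cr True by auto
      also have "\<dots> = (if chain_path Q nrel b (wv @ [c]) then phom x ((a, wu), (head Q c, tl g), (b, wv @ [c])) y else 0)"
      proof -
        have "chain_path Q nrel (tail Q c) (c # w') \<and> chain_path Q nrel b (wv @ [c])"
          if h: "chain_path Q nrel b (wv @ c # w' @ wu)"
        proof -
          have "chain_path Q nrel b (wv @ (c # w') @ wu)" "chain_path Q nrel b ((wv @ [c]) @ w' @ wu)" using h by simp_all
          then show ?thesis using s zc(6) by (auto simp: nrel_append nrel_Cons)
        qed
        then show ?thesis unfolding xe ze p(1) phom_eq ind_if pcomp_eq \<B>_iff using True s
          by (auto simp: gs)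
      qed
      finally show ?thesis by (simp add: gs)
    qed
  qed
  show ?thesis unfolding L R using 1 2 by simp
qed

lemma phom_par_diff:
  assumes "x \<in> free_space (pbasis m)" "F \<in> free_space (bbasis (Suc m))"
  shows "bilin_ext phom (lin_ext (pdiff m) x) F = bilin_ext phom x (BD (Suc m) F)"
  by (rule bilin_eqI[where \<Phi> = "\<lambda>x F. bilin_ext phom (lin_ext (pdiff m) x) F", OF _ _ _ _ _ assms])
     (auto intro!: lin_on_intros lin_on_comp[OF lin_on_lin_ext lin_on_bilin_left pd_space]
        lin_on_comp[OF lin_on_lin_ext lin_on_bilin_right BD_space] simp: phom_pdiff[simplified bilin_ext_bvec])

theorem par_hom_iso: "par_hom_iso Q I"
  unfolding par_hom_iso_def
proof (intro allI conjI ballI)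
  fix m
  show "bij_betw (par_hom Q I m) (par_space Q I m) (env_hom A (bardzell Q I m) (gentle_bimodule Q I))"
    using par_hom_inj par_hom_env_hom par_hom_surj unfolding bij_betw_def by blast
  fix x assume x: "x \<in> par_space Q I m"
  show "par_hom Q I m (\<lambda>z. c * x z + y z) F = (\<lambda>p. c * par_hom Q I m x F p + par_hom Q I m y F p)"
    if "y \<in> par_space Q I m" "F \<in> carrier (bardzell Q I m)" for y c F
    using that x lin_onD[OF lin_on_bilin_left] by (simp add: par_hom_eq par_space_def)
  show "par_diff Q I m x \<in> par_space Q I (Suc m)"
    using x pd_space by (simp add: par_space_def par_diff_eq)
  show "par_hom Q I (Suc m) (par_diff Q I m x) F = par_hom Q I m x (bardzell_diff Q I (Suc m) F)"
    if "F \<in> carrier (bardzell Q I (Suc m))" for F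
    using that x phom_par_diff BD_space by (simp add: par_hom_eq par_space_def par_diff_eq bardzell_diff_eq)
qed

end

section \<open>Cohomology classes as cosets, and a criterion for bases\<close>

section \<open>Bases of the Hochschild cohomology\<close>

context gentle
begin

fun coboundaries :: "nat \<Rightarrow> (('v, 'a) path \<times> ('v, 'a) path \<Rightarrow> 'k) set" where
  "coboundaries 0 = {\<lambda>_. 0}"
| "coboundaries (Suc m) = lin_ext (pdiff m) ` free_space (pbasis m)"

abbreviation "cocycles m \<equiv> par_cocycles Q I m"

lemma cocycles_iff: "z \<in> cocycles m \<longleftrightarrow> z \<in> free_space (pbasis m) \<and> lin_ext (pdiff m) z = (\<lambda>_. 0)"
  by (simp add: par_cocycles_def par_space_def par_diff_eq)

lemma cocycles_space: "z \<in> cocycles m \<Longrightarrow> z \<in> free_space (pbasis m)"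
  by (simp add: cocycles_iff)

lemma cocycles_lin: "y \<in> cocycles m \<Longrightarrow> z \<in> cocycles m \<Longrightarrow> (\<lambda>p. c * y p + z p) \<in> cocycles m"
  by (simp add: cocycles_iff lin_comb_free_space lin_onD[where X = "pbasis m", OF lin_on_lin_ext])

lemma cocycles_zero: "(\<lambda>_. 0) \<in> cocycles m"
  by (simp add: cocycles_iff)

lemma cocycles_scale: "z \<in> cocycles m \<Longrightarrow> (\<lambda>p. c * z p) \<in> cocycles m"
  using cocycles_lin[OF _ cocycles_zero, of z m c] by simp

lemma cocycles_add: "y \<in> cocycles m \<Longrightarrow> z \<in> cocycles m \<Longrightarrow> (\<lambda>p. y p + z p) \<in> cocycles m"
  using cocycles_lin[of y m z 1] by simp

lemma cocycles_diff: "y \<in> cocycles m \<Longrightarrow> z \<in> cocycles m \<Longrightarrow> (\<lambda>p. y p - z p) \<in> cocycles m"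
  using cocycles_lin[of z m y "-1"] by simp

lemma cocycles_sum: "(\<And>i. i \<in> S \<Longrightarrow> f i \<in> cocycles m) \<Longrightarrow> (\<lambda>p. \<Sum>i\<in>S. f i p) \<in> cocycles m"
  by (induction S rule: infinite_finite_induct) (auto intro: cocycles_add cocycles_zero)

lemma coboundaries_lin: "y \<in> coboundaries m \<Longrightarrow> z \<in> coboundaries m \<Longrightarrow> (\<lambda>p. c * y p + z p) \<in> coboundaries m"
proof (cases m)
  case (Suc n)
  assume "y \<in> coboundaries m" "z \<in> coboundaries m"
  then obtain y' z' where e: "y = lin_ext (pdiff n) y'" "z = lin_ext (pdiff n) z'"
    and s: "y' \<in> free_space (pbasis n)" "z' \<in> free_space (pbasis n)" using Suc by auto
  have "(\<lambda>p. c * y p + z p) = lin_ext (pdiff n) (\<lambda>p. c * y' p + z' p)"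
    unfolding e by (rule lin_onD[OF lin_on_lin_ext s, symmetric])
  then show ?thesis using Suc s by (auto intro!: imageI lin_comb_free_space)
qed simp

lemma coboundaries_zero: "(\<lambda>_. 0) \<in> coboundaries m"
  by (cases m) (auto intro!: image_eqI[of _ _ "\<lambda>_. 0"])

lemma coboundaries_scale: "z \<in> coboundaries m \<Longrightarrow> (\<lambda>p. c * z p) \<in> coboundaries m"
  using coboundaries_lin[OF _ coboundaries_zero, of z m c] by simp

lemma coboundaries_add: "y \<in> coboundaries m \<Longrightarrow> z \<in> coboundaries m \<Longrightarrow> (\<lambda>p. y p + z p) \<in> coboundaries m"
  using coboundaries_lin[of y m z 1] by simp

lemma coboundaries_diff: "y \<in> coboundaries m \<Longrightarrow> z \<in> coboundaries m \<Longrightarrow> (\<lambda>p. y p - z p) \<in> coboundaries m"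
  using coboundaries_lin[of z m y "-1"] by simp

lemma coboundaries_space: "z \<in> coboundaries m \<Longrightarrow> z \<in> free_space (pbasis m)"
  by (cases m) (auto intro: pd_space)

lemma par_hom_lin:
  assumes "x \<in> free_space (pbasis m)" "y \<in> free_space (pbasis m)" "F \<in> free_space (bbasis m)"
  shows "par_hom Q I m (\<lambda>z. c * x z + y z) F = (\<lambda>p. c * par_hom Q I m x F p + par_hom Q I m y F p)"
  using assms lin_onD[OF lin_on_bilin_left] by (simp add: par_hom_eq)

lemma par_hom_pdiff:
  assumes "x \<in> free_space (pbasis m)" "F \<in> free_space (bbasis (Suc m))"
  shows "par_hom Q I (Suc m) (lin_ext (pdiff m) x) F = par_hom Q I m x (bardzell_diff Q I (Suc m) F)"
  using par_hom_iso assms unfolding par_hom_iso_def by (simp add: par_diff_eq par_space_def)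

abbreviation "Hom m \<equiv> hom_space A unit_sc (bardzell Q I m) (gentle_bimodule Q I)"

lemma par_hom_image: "env_hom A (bardzell Q I m) (gentle_bimodule Q I) = par_hom Q I m ` free_space (pbasis m)"
  using par_hom_iso unfolding par_hom_iso_def bij_betw_def par_space_def by blast

lemma par_hom_cong: "x \<in> free_space (pbasis m) \<Longrightarrow> y \<in> free_space (pbasis m)
    \<Longrightarrow> par_hom Q I m x = par_hom Q I m y \<longleftrightarrow> x = y"
  using par_hom_inj[of m] unfolding inj_on_def par_space_def by blast

lemma par_hom_zero: "par_hom Q I m (\<lambda>_. 0) = (\<lambda>x\<in>free_space (bbasis m). \<lambda>_. 0)"
  by (auto simp: par_hom_eq restrict_def fun_eq_iff)

lemma hom_cocycles_eq:
  "hom_cocycles A (bardzell Q I) (bardzell_diff Q I) (gentle_bimodule Q I) m = par_hom Q I m ` cocycles m"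
proof -
  have "(\<forall>F\<in>free_space (bbasis (Suc m)). par_hom Q I m x (bardzell_diff Q I (Suc m) F) = (\<lambda>_. 0)) \<longleftrightarrow>
      lin_ext (pdiff m) x = (\<lambda>_. 0)" if x: "x \<in> free_space (pbasis m)" for x
  proof -
    have "(\<forall>F\<in>free_space (bbasis (Suc m)). par_hom Q I m x (bardzell_diff Q I (Suc m) F) = (\<lambda>_. 0)) \<longleftrightarrow>
      (\<forall>F\<in>free_space (bbasis (Suc m)). par_hom Q I (Suc m) (lin_ext (pdiff m) x) F = par_hom Q I (Suc m) (\<lambda>_. 0) F)"
      using par_hom_pdiff[OF x] by (simp add: par_hom_zero)
    also have "\<dots> \<longleftrightarrow> par_hom Q I (Suc m) (lin_ext (pdiff m) x) = par_hom Q I (Suc m) (\<lambda>_. 0)"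
      by (auto simp: par_hom_eq fun_eq_iff restrict_def)
    also have "\<dots> \<longleftrightarrow> lin_ext (pdiff m) x = (\<lambda>_. 0)"
      by (rule par_hom_cong[OF pd_space[OF x] zero_free_space])
    finally show ?thesis .
  qed
  note key = this
  let ?P = "\<lambda>f. \<forall>F\<in>free_space (bbasis (Suc m)). f (bardzell_diff Q I (Suc m) F) = (\<lambda>_. 0)"
  have "{f \<in> par_hom Q I m ` free_space (pbasis m). ?P f} =
      par_hom Q I m ` {x \<in> free_space (pbasis m). ?P (par_hom Q I m x)}" by blast
  also have "{x \<in> free_space (pbasis m). ?P (par_hom Q I m x)} = cocycles m"
    using key unfolding set_eq_iff mem_Collect_eq cocycles_iff by blast
  finally show ?thesis unfolding hom_cocycles_def par_hom_image by simp
qed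

lemma hom_coboundaries_eq:
  "hom_coboundaries A (bardzell Q I) (bardzell_diff Q I) (gentle_bimodule Q I) m = par_hom Q I m ` coboundaries m"
proof (cases m)
  case 0
  then show ?thesis by (simp add: par_hom_zero restrict_def)
next
  case (Suc n)
  have "(\<lambda>F\<in>free_space (bbasis (Suc n)). par_hom Q I n x (bardzell_diff Q I (Suc n) F)) =
      par_hom Q I (Suc n) (lin_ext (pdiff n) x)" if "x \<in> free_space (pbasis n)" for x
    using par_hom_pdiff[OF that] by (auto simp: fun_eq_iff par_hom_eq[of "Suc n"])
  then show ?thesis unfolding Suc by (simp add: par_hom_image image_image cong: image_cong)
qed

lemma Hom_add:
  assumes "x \<in> free_space (pbasis m)" "y \<in> free_space (pbasis m)"
  shows "par_hom Q I m x \<oplus>\<^bsub>Hom m\<^esub> par_hom Q I m y = par_hom Q I m (\<lambda>p. x p + y p)"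
  using par_hom_lin[OF assms, of _ 1] by (auto simp: hom_space_def fun_eq_iff par_hom_eq)

lemma Hom_smult:
  assumes "x \<in> free_space (pbasis m)"
  shows "c \<odot>\<^bsub>Hom m\<^esub> par_hom Q I m x = par_hom Q I m (\<lambda>p. c * x p)"
proof -
  have "bilin_ext phom x F \<in> free_space BB" if "F \<in> free_space (bbasis m)" for F
    using phom_space[OF assms that] .
  then show ?thesis
    using par_hom_lin[OF assms zero_free_space, of _ c]
    by (auto simp: hom_space_def fun_eq_iff par_hom_eq unit_mult_left)
qed

text \<open>The coset of a cochain, described by coboundaries of the complex of parallel paths. The
  lemmas below transport the vector space structure of \<open>HH\<close> to this description, after
  which the resolution is no longer looked at.\<close>

definition hclass :: "nat \<Rightarrow> (('v, 'a) path \<times> ('v, 'a) path \<Rightarrow> 'k) \<Rightarrow> _" where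
  "hclass m z = par_hom Q I m ` {y \<in> free_space (pbasis m). (\<lambda>p. y p - z p) \<in> coboundaries m}"

lemma HH_class_eq:
  assumes z: "z \<in> free_space (pbasis m)"
  shows "HH_class Q I m (par_hom Q I m z) = hclass m z"
proof -
  have "HH_class Q I m (par_hom Q I m z) = (\<lambda>b. par_hom Q I m (\<lambda>p. b p + z p)) ` coboundaries m"
    unfolding HH_class_def ext_class_def hom_coboundaries_eq a_r_coset_def r_coset_def
    using Hom_add[OF coboundaries_space z] by auto
  also have "\<dots> = hclass m z"
  proof -
    have "{y \<in> free_space (pbasis m). (\<lambda>p. y p - z p) \<in> coboundaries m} = (\<lambda>b p. b p + z p) ` coboundaries m"
    proof (intro equalityI subsetI)
      fix y assume "y \<in> {y \<in> free_space (pbasis m). (\<lambda>p. y p - z p) \<in> coboundaries m}"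
      then show "y \<in> (\<lambda>b p. b p + z p) ` coboundaries m"
        by (intro image_eqI[of _ _ "\<lambda>p. y p - z p"]) auto
    qed (use z coboundaries_space in \<open>auto intro!: add_free_space\<close>)
    then show ?thesis unfolding hclass_def by (simp add: image_image)
  qed
  finally show ?thesis .
qed

lemma hclass_eq_iff:
  assumes y: "y \<in> free_space (pbasis m)" and z: "z \<in> free_space (pbasis m)"
  shows "hclass m y = hclass m z \<longleftrightarrow> (\<lambda>p. y p - z p) \<in> coboundaries m"
proof
  assume e: "hclass m y = hclass m z"
  have "par_hom Q I m y \<in> hclass m y" unfolding hclass_def using y coboundaries_zero by auto
  then have "par_hom Q I m y \<in> hclass m z" using e by simp
  then obtain y' where y': "par_hom Q I m y = par_hom Q I m y'" "y' \<in> free_space (pbasis m)"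
    "(\<lambda>p. y' p - z p) \<in> coboundaries m" unfolding hclass_def by blast
  then show "(\<lambda>p. y p - z p) \<in> coboundaries m" using par_hom_cong[OF y y'(2)] by simp
next
  assume d: "(\<lambda>p. y p - z p) \<in> coboundaries m"
  have "(\<lambda>p. x p - y p) \<in> coboundaries m \<longleftrightarrow> (\<lambda>p. x p - z p) \<in> coboundaries m" for x
    using coboundaries_add[OF _ d, of "\<lambda>p. x p - y p"] coboundaries_diff[OF _ d, of "\<lambda>p. x p - z p"]
    by (auto simp: algebra_simps)
  then show "hclass m y = hclass m z" unfolding hclass_def by simp
qed

lemma HH_carrier: "carrier (HH Q I m) = hclass m ` cocycles m"
  unfolding HH_def ext_space_def
  by (simp add: hom_cocycles_eq image_image HH_class_eq[unfolded HH_class_def] cocycles_space cong: image_cong)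

lemma HH_zero: "\<zero>\<^bsub>HH Q I m\<^esub> = hclass m (\<lambda>_. 0)"
proof -
  have "{y \<in> free_space (pbasis m). (\<lambda>p. y p - 0) \<in> coboundaries m} = coboundaries m"
    using coboundaries_space by auto
  then show ?thesis unfolding HH_def ext_space_def by (simp add: hom_coboundaries_eq hclass_def)
qed

lemma HH_add:
  assumes y: "y \<in> free_space (pbasis m)" and z: "z \<in> free_space (pbasis m)"
  shows "hclass m y \<oplus>\<^bsub>HH Q I m\<^esub> hclass m z = hclass m (\<lambda>p. y p + z p)"
proof -
  let ?S = "\<lambda>z. {y \<in> free_space (pbasis m). (\<lambda>p. y p - z p) \<in> coboundaries m}"
  have "hclass m y \<oplus>\<^bsub>HH Q I m\<^esub> hclass m z = (\<Union>a\<in>?S y. \<Union>b\<in>?S z. {par_hom Q I m (\<lambda>p. a p + b p)})"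
    unfolding HH_def ext_space_def hclass_def set_add_def set_mult_def
    by (auto simp: Hom_add)
  also have "\<dots> = hclass m (\<lambda>p. y p + z p)"
    unfolding hclass_def
  proof (intro equalityI subsetI)
    fix f assume "f \<in> (\<Union>a\<in>?S y. \<Union>b\<in>?S z. {par_hom Q I m (\<lambda>p. a p + b p)})"
    then obtain a b where ab: "a \<in> ?S y" "b \<in> ?S z" "f = par_hom Q I m (\<lambda>p. a p + b p)" by blast
    have "(\<lambda>p. (a p - y p) + (b p - z p)) \<in> coboundaries m" using ab by (intro coboundaries_add) auto
    then have "(\<lambda>p. a p + b p - (y p + z p)) \<in> coboundaries m" by (simp add: algebra_simps)
    then show "f \<in> par_hom Q I m ` ?S (\<lambda>p. y p + z p)" using ab add_free_space by auto
  next
    fix f assume "f \<in> par_hom Q I m ` ?S (\<lambda>p. y p + z p)"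
    then obtain x where x: "x \<in> free_space (pbasis m)" "(\<lambda>p. x p - (y p + z p)) \<in> coboundaries m" "f = par_hom Q I m x" by blast
    have "(\<lambda>p. x p - z p) \<in> ?S y" "z \<in> ?S z"
      using x z diff_free_space coboundaries_zero by (auto simp: algebra_simps)
    moreover have "f = par_hom Q I m (\<lambda>p. (x p - z p) + z p)" using x by simp
    ultimately show "f \<in> (\<Union>a\<in>?S y. \<Union>b\<in>?S z. {par_hom Q I m (\<lambda>p. a p + b p)})" by blast
  qed
  finally show ?thesis .
qed

lemma HH_smult:
  assumes z: "z \<in> free_space (pbasis m)"
  shows "c \<odot>\<^bsub>HH Q I m\<^esub> hclass m z = hclass m (\<lambda>p. c * z p)"
proof -
  let ?S = "{y \<in> free_space (pbasis m). (\<lambda>p. y p - z p) \<in> coboundaries m}"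
  have cl: "HH_class Q I m (c \<odot>\<^bsub>Hom m\<^esub> par_hom Q I m y) = hclass m (\<lambda>p. c * z p)" if "y \<in> ?S" for y
  proof -
    have y: "y \<in> free_space (pbasis m)" "(\<lambda>p. y p - z p) \<in> coboundaries m" using that by auto
    have "(\<lambda>p. c * y p - c * z p) \<in> coboundaries m"
      using coboundaries_scale[OF y(2), of c] by (simp add: algebra_simps)
    then have "hclass m (\<lambda>p. c * y p) = hclass m (\<lambda>p. c * z p)"
      using hclass_eq_iff[OF scale_free_space[OF y(1)] scale_free_space[OF z], of c c] by simp
    then show ?thesis by (simp add: Hom_smult[OF y(1)] HH_class_eq[OF scale_free_space[OF y(1)]])
  qed
  have "z \<in> ?S" using z coboundaries_zero by simp
  have "c \<odot>\<^bsub>HH Q I m\<^esub> hclass m z = (\<Union>f\<in>hclass m z. HH_class Q I m (c \<odot>\<^bsub>Hom m\<^esub> f))"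
    unfolding HH_def ext_space_def HH_class_def by simp
  also have "\<dots> = (\<Union>y\<in>?S. HH_class Q I m (c \<odot>\<^bsub>Hom m\<^esub> par_hom Q I m y))"
    unfolding hclass_def by simp
  also have "\<dots> = (\<Union>y\<in>?S. hclass m (\<lambda>p. c * z p))" using cl by simp
  also have "\<dots> = hclass m (\<lambda>p. c * z p)" using \<open>z \<in> ?S\<close> by blast
  finally show ?thesis .
qed

lemma HH_abelian_monoid: "abelian_monoid (HH Q I m)"
proof (rule abelian_monoidI)
  show "\<zero>\<^bsub>HH Q I m\<^esub> \<in> carrier (HH Q I m)"
    by (simp add: HH_carrier HH_zero cocycles_zero)
qed (auto simp: HH_carrier HH_zero HH_add cocycles_space cocycles_add add_free_space algebra_simps)

lemma HH_finsum:
  assumes "finite S" "\<And>j. j \<in> S \<Longrightarrow> f j \<in> cocycles m"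
  shows "(\<Oplus>\<^bsub>HH Q I m\<^esub>j\<in>S. c j \<odot>\<^bsub>HH Q I m\<^esub> hclass m (f j)) = hclass m (\<lambda>p. \<Sum>j\<in>S. c j * f j p)"
  using assms
proof (induction S)
  case empty
  interpret abelian_monoid "HH Q I m" by (rule HH_abelian_monoid)
  show ?case by (simp add: HH_zero)
next
  case (insert j S)
  interpret abelian_monoid "HH Q I m" by (rule HH_abelian_monoid)
  have c: "c i \<odot>\<^bsub>HH Q I m\<^esub> hclass m (f i) \<in> carrier (HH Q I m)" if "i \<in> insert j S" for i
    using insert.prems[OF that] by (auto simp: HH_carrier HH_smult cocycles_space cocycles_scale)
  have fs: "(\<lambda>p. \<Sum>j\<in>S. c j * f j p) \<in> free_space (pbasis m)"
    using insert.prems by (intro sum_free_space scale_free_space cocycles_space) auto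
  show ?case using insert c fs
    by (simp add: finsum_insert Pi_def HH_smult cocycles_space HH_add scale_free_space)
qed

lemma HH_basisI:
  assumes gens: "\<And>g. g \<in> J \<Longrightarrow> f g \<in> cocycles m"
    and uniq: "\<And>z. z \<in> cocycles m \<Longrightarrow>
      \<exists>!c. c \<in> free_space J \<and> (\<lambda>p. z p - (\<Sum>g | c g \<noteq> 0. c g * f g p)) \<in> coboundaries m"
  shows "is_basis (HH Q I m) J (\<lambda>g. HH_class Q I m (par_hom Q I m (f g)))"
  unfolding is_basis_def
proof (intro conjI ballI)
  have cl: "HH_class Q I m (par_hom Q I m (f g)) = hclass m (f g)" if "g \<in> J" for g
    using HH_class_eq[OF cocycles_space[OF gens[OF that]]] .
  show "(\<lambda>g. HH_class Q I m (par_hom Q I m (f g))) \<in> J \<rightarrow> carrier (HH Q I m)"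
    using cl gens by (auto simp: HH_carrier)
  fix \<xi> assume "\<xi> \<in> carrier (HH Q I m)"
  then obtain z where z: "z \<in> cocycles m" "\<xi> = hclass m z" by (auto simp: HH_carrier)
  have "\<xi> = (\<Oplus>\<^bsub>HH Q I m\<^esub>j\<in>{j. c j \<noteq> 0}. c j \<odot>\<^bsub>HH Q I m\<^esub> HH_class Q I m (par_hom Q I m (f j))) \<longleftrightarrow>
      (\<lambda>p. z p - (\<Sum>g | c g \<noteq> 0. c g * f g p)) \<in> coboundaries m" if c: "c \<in> free_space J" for c
  proof -
    interpret abelian_monoid "HH Q I m" by (rule HH_abelian_monoid)
    have J: "finite {j. c j \<noteq> 0}" "{j. c j \<noteq> 0} \<subseteq> J" using c by (auto simp: free_space_def)
    have g: "f j \<in> cocycles m" if "j \<in> {j. c j \<noteq> 0}" for j using gens J that by blast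
    have "(\<Oplus>\<^bsub>HH Q I m\<^esub>j\<in>{j. c j \<noteq> 0}. c j \<odot>\<^bsub>HH Q I m\<^esub> HH_class Q I m (par_hom Q I m (f j))) =
        (\<Oplus>\<^bsub>HH Q I m\<^esub>j\<in>{j. c j \<noteq> 0}. c j \<odot>\<^bsub>HH Q I m\<^esub> hclass m (f j))"
    proof (rule finsum_cong')
      show "(\<lambda>j. c j \<odot>\<^bsub>HH Q I m\<^esub> hclass m (f j)) \<in> {j. c j \<noteq> 0} \<rightarrow> carrier (HH Q I m)"
        using g by (auto simp: HH_carrier HH_smult cocycles_space cocycles_scale)
    qed (use cl J in auto)
    also have "\<dots> = hclass m (\<lambda>p. \<Sum>j | c j \<noteq> 0. c j * f j p)"
      by (rule HH_finsum[OF J(1) g])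
    finally have e: "(\<Oplus>\<^bsub>HH Q I m\<^esub>j\<in>{j. c j \<noteq> 0}. c j \<odot>\<^bsub>HH Q I m\<^esub> HH_class Q I m (par_hom Q I m (f j))) =
        hclass m (\<lambda>p. \<Sum>j | c j \<noteq> 0. c j * f j p)" .
    have fs: "(\<lambda>p. \<Sum>j | c j \<noteq> 0. c j * f j p) \<in> free_space (pbasis m)"
      using g by (intro sum_free_space scale_free_space cocycles_space) auto
    show ?thesis unfolding e z(2) by (rule hclass_eq_iff[OF cocycles_space[OF z(1)] fs])
  qed
  then have "(\<lambda>c. c \<in> free_space J \<and> \<xi> = (\<Oplus>\<^bsub>HH Q I m\<^esub>j\<in>{j. c j \<noteq> 0}. c j \<odot>\<^bsub>HH Q I m\<^esub> HH_class Q I m (par_hom Q I m (f j)))) =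
      (\<lambda>c. c \<in> free_space J \<and> (\<lambda>p. z p - (\<Sum>g | c g \<noteq> 0. c g * f g p)) \<in> coboundaries m)"
    by (intro ext) blast
  then show "\<exists>!c. c \<in> free_space J \<and> \<xi> = (\<Oplus>\<^bsub>HH Q I m\<^esub>j\<in>{j. c j \<noteq> 0}. c j \<odot>\<^bsub>HH Q I m\<^esub> HH_class Q I m (par_hom Q I m (f j)))"
    using uniq[OF z(1)] by simp
qed

text \<open>The coefficients of a class can only be its values under the functionals, by duality and
  vanishing on coboundaries. Subtracting the combination with these coefficients leaves a cocycle
  killed by all functionals, hence a coboundary by \<open>faithful\<close>. The condition
  \<open>fin\<close> makes the coefficients finitely supported when J is infinite.\<close>

lemma HH_basis_dualI:
  fixes lam :: "'j \<Rightarrow> (('v, 'a) path \<times> ('v, 'a) path \<Rightarrow> 'k) \<Rightarrow> 'k"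
  assumes gens: "\<And>g. g \<in> J \<Longrightarrow> f g \<in> cocycles m"
    and lin: "\<And>g c y z. g \<in> J \<Longrightarrow> y \<in> free_space (pbasis m) \<Longrightarrow> z \<in> free_space (pbasis m) \<Longrightarrow>
      lam g (\<lambda>p. c * y p + z p) = c * lam g y + lam g z"
    and cob: "\<And>g z. g \<in> J \<Longrightarrow> z \<in> coboundaries m \<Longrightarrow> lam g z = 0"
    and dual: "\<And>g h. g \<in> J \<Longrightarrow> h \<in> J \<Longrightarrow> lam g (f h) = (if g = h then 1 else 0)"
    and fin: "\<And>z. z \<in> free_space (pbasis m) \<Longrightarrow> finite {g \<in> J. lam g z \<noteq> 0}"
    and faithful: "\<And>z. z \<in> cocycles m \<Longrightarrow> (\<And>g. g \<in> J \<Longrightarrow> lam g z = 0) \<Longrightarrow> z \<in> coboundaries m"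
  shows "is_basis (HH Q I m) J (\<lambda>g. HH_class Q I m (par_hom Q I m (f g)))"
proof (rule HH_basisI[OF gens])
  fix z assume z: "z \<in> cocycles m"
  have lsum: "lam g (\<lambda>p. y p - (\<Sum>h\<in>S. c h * f h p)) = lam g y - (if g \<in> S then c g else 0)"
    if g: "g \<in> J" and "finite S" "S \<subseteq> J" and y: "y \<in> free_space (pbasis m)" for g S c y
    using that(2,3)
  proof (induction S)
    case (insert h S)
    have fs: "(\<lambda>p. y p - (\<Sum>h\<in>S. c h * f h p)) \<in> free_space (pbasis m)"
      using insert.prems gens by (intro diff_free_space y sum_free_space scale_free_space cocycles_space) auto
    have "(\<lambda>p. y p - (\<Sum>h\<in>insert h S. c h * f h p)) = (\<lambda>p. - c h * f h p + (y p - (\<Sum>h\<in>S. c h * f h p)))"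
      using insert.hyps by (simp add: algebra_simps)
    then have "lam g (\<lambda>p. y p - (\<Sum>h\<in>insert h S. c h * f h p)) = - c h * lam g (f h) + lam g (\<lambda>p. y p - (\<Sum>h\<in>S. c h * f h p))"
      using lin[OF g cocycles_space[OF gens] fs, of h "- c h"] insert.prems by simp
    then show ?case using insert dual[OF g, of h] by auto
  qed simp
  let ?c = "\<lambda>g. if g \<in> J then lam g z else 0"
  have c: "?c \<in> free_space J"
    using fin[OF cocycles_space[OF z]] unfolding free_space_def
    by (auto intro: finite_subset[of _ "{g \<in> J. lam g z \<noteq> 0}"])
  have cs: "finite {g. c g \<noteq> 0}" "{g. c g \<noteq> 0} \<subseteq> J" if "c \<in> free_space J" for c :: "'j \<Rightarrow> 'k"
    using that by (auto simp: free_space_def)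
  have cz: "(\<lambda>p. z p - (\<Sum>g\<in>S. c g * f g p)) \<in> cocycles m" if "S \<subseteq> J" for S c
    using that gens by (intro cocycles_diff z cocycles_sum cocycles_scale) auto
  have cob_c: "(\<lambda>p. z p - (\<Sum>g | ?c g \<noteq> 0. ?c g * f g p)) \<in> coboundaries m"
    by (rule faithful[OF cz[OF cs(2)[OF c]]]) (subst lsum[OF _ cs[OF c] cocycles_space[OF z]], auto)
  show "\<exists>!c. c \<in> free_space J \<and> (\<lambda>p. z p - (\<Sum>g | c g \<noteq> 0. c g * f g p)) \<in> coboundaries m"
  proof (intro ex1I[of _ ?c] conjI c cob_c, elim conjE)
    fix c assume c': "c \<in> free_space J" and b: "(\<lambda>p. z p - (\<Sum>g | c g \<noteq> 0. c g * f g p)) \<in> coboundaries m"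
    show "c = ?c"
    proof
      fix g
      show "c g = ?c g"
      proof (cases "g \<in> J")
        case True
        then show ?thesis using cob[OF True b] lsum[OF True cs[OF c'] cocycles_space[OF z], of c] by (auto split: if_splits)
      next
        case False
        then show ?thesis using cs(2)[OF c'] by auto
      qed
    qed
  qed
qed

end

section \<open>An acyclic matching on the pairs of parallel paths\<close>

section \<open>Reduction to critical pairs\<close>

definition same_end :: "'x list \<Rightarrow> 'x list \<Rightarrow> bool" where
  "same_end w w' \<longleftrightarrow> w \<noteq> [] \<and> w' \<noteq> [] \<and> last w = last w'"

definition same_start :: "'x list \<Rightarrow> 'x list \<Rightarrow> bool" where
  "same_start w w' \<longleftrightarrow> w \<noteq> [] \<and> w' \<noteq> [] \<and> hd w = hd w'"

abbreviation pr :: "'v \<Rightarrow> 'a list \<Rightarrow> 'a list \<Rightarrow> ('v, 'a) path \<times> ('v, 'a) path" where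
  "pr v w w' \<equiv> ((v, w), (v, w'))"

context gentle
begin

definition lext :: "'v \<Rightarrow> 'a list \<Rightarrow> 'a list \<Rightarrow> 'a set" where
  "lext v w w' = {b. chain_path Q rel v (w @ [b]) \<and> chain_path Q nrel v (w' @ [b])}"

definition rext :: "'v \<Rightarrow> 'a list \<Rightarrow> 'a list \<Rightarrow> 'a set" where
  "rext v w w' = {a. chain_path Q rel (tail Q a) (a # w) \<and> chain_path Q nrel (tail Q a) (a # w') \<and> head Q a = v}"

lemma finite_lext [simp]: "finite (lext v w w')" and finite_rext [simp]: "finite (rext v w w')"
  unfolding lext_def rext_def by simp_all

lemma pbasis_pr: "pr v w w' \<in> pbasis m \<longleftrightarrow> chain_path Q rel v w \<and> length w = m \<and>
     chain_path Q nrel v w' \<and> ptgt Q (v, w) = ptgt Q (v, w')"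
  by (simp add: parallel_iff)

lemma pbasisE:
  assumes "x \<in> pbasis m"
  obtains v w w' where "x = pr v w w'" "pr v w w' \<in> pbasis m"
  using assms by (cases x) (auto simp: parallel_iff)

lemma lin_ext_pdiff:
  fixes \<phi> :: "('v, 'a) path \<times> ('v, 'a) path \<Rightarrow> 'y \<Rightarrow> 'k"
  assumes "pr v w w' \<in> pbasis m"
  shows "lin_ext \<phi> (pdiff m (pr v w w')) = (\<lambda>y. (\<Sum>b\<in>lext v w w'. \<phi> (pr v (w @ [b]) (w' @ [b])) y)
      - (-1) ^ m * (\<Sum>a\<in>rext v w w'. \<phi> (pr (tail Q a) (a # w) (a # w')) y))"
proof -
  have fs: "(\<lambda>y. \<Sum>i\<in>S. bvec (f i) y) \<in> free_space UNIV" for S and f :: "'a \<Rightarrow> ('v, 'a) path \<times> ('v, 'a) path"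
    by (intro sum_free_space) simp
  have ls: "lin_ext \<phi> (\<lambda>y. \<Sum>i\<in>S. bvec (f i) y) = (\<lambda>y. \<Sum>i\<in>S. \<phi> (f i) y)"
    for S and f :: "'a \<Rightarrow> ('v, 'a) path \<times> ('v, 'a) path"
    using lin_on_sum[OF lin_on_lin_ext, of S "\<lambda>i. bvec (f i)" UNIV \<phi>] by simp
  show ?thesis unfolding pdiff_eq[OF assms] lext_def[symmetric] rext_def[symmetric]
    using lin_on_diff[OF lin_on_lin_ext fs scale_free_space[OF fs], of \<phi>]
      lin_on_scale[OF lin_on_lin_ext fs, of \<phi>] ls by simp
qed

lemma pdiff_pr:
  assumes "pr v w w' \<in> pbasis m"
  shows "pdiff m (pr v w w') = (\<lambda>y. (\<Sum>b\<in>lext v w w'. bvec (pr v (w @ [b]) (w' @ [b])) y)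
      - (-1) ^ m * (\<Sum>a\<in>rext v w w'. bvec (pr (tail Q a) (a # w) (a # w')) y))"
  unfolding pdiff_eq[OF assms] lext_def rext_def ..

text \<open>An arrow following the common last arrow is either related to it or not, so it can
  prolong only one of the two components.\<close>

lemma lext_same_end: "same_end w w' \<Longrightarrow> lext v w w' = {}"
  using relD nrelD by (auto simp: lext_def same_end_def rel_snoc nrel_snoc)

lemma rext_same_start: "same_start w w' \<Longrightarrow> rext v w w' = {}"
  using relD nrelD by (auto simp: rext_def same_start_def rel_Cons nrel_Cons)

text \<open>A nonempty component determines the next arrow through its last one. If both components
  are vertices every arrow starting there is an extension; this is why vertex pairs cannot be
  matched and lead to the graph coboundary.\<close>

lemma lext_uniq: "w \<noteq> [] \<or> w' \<noteq> [] \<Longrightarrow> b \<in> lext v w w' \<Longrightarrow> b' \<in> lext v w w' \<Longrightarrow> b' = b"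
  using rel_det nrel_det by (auto simp: lext_def rel_snoc nrel_snoc)

lemma rext_uniq: "w \<noteq> [] \<or> w' \<noteq> [] \<Longrightarrow> a \<in> rext v w w' \<Longrightarrow> a' \<in> rext v w w' \<Longrightarrow> a' = a"
  using rel_inj nrel_inj by (auto simp: rext_def rel_Cons nrel_Cons)

lemma lext_single: "w \<noteq> [] \<or> w' \<noteq> [] \<Longrightarrow> b \<in> lext v w w' \<Longrightarrow> lext v w w' = {b}"
  using lext_uniq by blast

lemma rext_single: "w \<noteq> [] \<or> w' \<noteq> [] \<Longrightarrow> a \<in> rext v w w' \<Longrightarrow> rext v w w' = {a}"
  using rext_uniq by blast

lemma pbasis_snocD:
  assumes "pr v (w @ [c]) (w' @ [c]) \<in> pbasis (Suc m)"
  shows "pr v w w' \<in> pbasis m" "c \<in> lext v w w'" "\<not> same_end w w'"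
  using assms relD nrelD
  by (auto simp: pbasis_pr lext_def rel_snoc nrel_snoc same_end_def)

lemma pbasis_ConsD:
  assumes "pr v (c # w) (c # w') \<in> pbasis (Suc m)"
  shows "pr (head Q c) w w' \<in> pbasis m" "c \<in> rext (head Q c) w w'" "\<not> same_start w w'" "v = tail Q c"
  using assms relD nrelD
  by (auto simp: pbasis_pr rext_def rel_Cons nrel_Cons same_start_def ptgt_eq split: if_splits)

text \<open>Only an empty component has its beginning changed by the added arrow c. In that case the
  other component starts with an arrow different from c, and a has at most one related and at most
  one unrelated successor; so a stands to c in the opposite relation, which is the required
  one.\<close>

lemma rext_snoc:
  assumes p: "pr v w w' \<in> pbasis m" and c: "c \<in> lext v w w'" and ne: "w \<noteq> [] \<or> w' \<noteq> []"
    and ns: "\<not> same_start (w @ [c]) (w' @ [c])"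
  shows "rext v (w @ [c]) (w' @ [c]) = rext v w w'"
proof
  show "rext v (w @ [c]) (w' @ [c]) \<subseteq> rext v w w'"
    unfolding rext_def append_Cons[symmetric] by (auto simp: rel_snoc nrel_snoc simp del: append_Cons)
  show "rext v w w' \<subseteq> rext v (w @ [c]) (w' @ [c])"
  proof
    fix a assume a: "a \<in> rext v w w'"
    then have a': "a \<in> arcs Q" "head Q a = v" by (auto simp: rext_def chain_path_def)
    have cc: "chain_path Q rel v (w @ [c])" "chain_path Q nrel v (w' @ [c])" "c \<in> arcs Q"
      using c by (auto simp: lext_def rel_snoc)
    have 1: "rel a (hd (w @ [c]))"
    proof (cases "w = []")
      case True
      then have "w' \<noteq> []" "tail Q c = v" "hd w' \<noteq> c" using ne ns cc by (auto simp: same_start_def)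
      moreover have "nrel a (hd w')" using a \<open>w' \<noteq> []\<close> by (auto simp: rext_def nrel_Cons)
      ultimately show ?thesis using True rel_or_nrel[of a c] nrel_det[of a c "hd w'"] a' cc by auto
    qed (use a in \<open>auto simp: rext_def rel_Cons\<close>)
    have 2: "nrel a (hd (w' @ [c]))"
    proof (cases "w' = []")
      case True
      then have "w \<noteq> []" "tail Q c = v" "hd w \<noteq> c" using ne ns cc by (auto simp: same_start_def)
      moreover have "rel a (hd w)" using a \<open>w \<noteq> []\<close> by (auto simp: rext_def rel_Cons)
      ultimately show ?thesis using True rel_or_nrel[of a c] rel_det[of a c "hd w"] a' cc by auto
    qed (use a in \<open>auto simp: rext_def nrel_Cons\<close>)
    show "a \<in> rext v (w @ [c]) (w' @ [c])" using 1 2 cc a' by (simp add: rext_def rel_Cons nrel_Cons)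
  qed
qed

lemma lext_Cons:
  assumes p: "pr v w w' \<in> pbasis m" and c: "c \<in> rext v w w'" and ne: "w \<noteq> [] \<or> w' \<noteq> []"
    and ns: "\<not> same_end (c # w) (c # w')"
  shows "lext (tail Q c) (c # w) (c # w') = lext v w w'"
proof
  have hc: "head Q c = v" "c \<in> arcs Q" using c by (auto simp: rext_def chain_path_def)
  show "lext (tail Q c) (c # w) (c # w') \<subseteq> lext v w w'"
    using hc by (auto simp: lext_def rel_Cons nrel_Cons)
  show "lext v w w' \<subseteq> lext (tail Q c) (c # w) (c # w')"
  proof
    fix b assume b: "b \<in> lext v w w'"
    have b': "b \<in> arcs Q" "tail Q b = ptgt Q (v, w)" "ptgt Q (v, w) = ptgt Q (v, w')"
      using b p by (auto simp: lext_def rel_snoc pbasis_pr)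
    have cc: "chain_path Q rel (tail Q c) (c # w)" "chain_path Q nrel (tail Q c) (c # w')"
      using c by (auto simp: rext_def)
    have tg: "ptgt Q (tail Q c, c # w) = ptgt Q (v, w)" "ptgt Q (tail Q c, c # w') = ptgt Q (v, w')"
      using hc by (auto simp: ptgt_eq)
    have 1: "rel (last (c # w)) b"
    proof (cases "w = []")
      case True
      then have w': "w' \<noteq> []" "last w' \<noteq> c" using ne ns by (auto simp: same_end_def)
      moreover have "nrel (last w') b" using b w' by (auto simp: lext_def nrel_snoc)
      ultimately show ?thesis using True rel_or_nrel[of c b] nrel_inj[of c b "last w'"] b' hc by (auto simp: ptgt_eq)
    qed (use b in \<open>auto simp: lext_def rel_snoc\<close>)
    have 2: "nrel (last (c # w')) b"
    proof (cases "w' = []")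
      case True
      then have w: "w \<noteq> []" "last w \<noteq> c" using ne ns by (auto simp: same_end_def)
      moreover have "rel (last w) b" using b w by (auto simp: lext_def rel_snoc)
      ultimately show ?thesis using True rel_or_nrel[of c b] rel_inj[of c b "last w"] b' hc by (auto simp: ptgt_eq)
    qed (use b in \<open>auto simp: lext_def nrel_snoc\<close>)
    show "b \<in> lext (tail Q c) (c # w) (c # w')"
      unfolding lext_def mem_Collect_eq rel_snoc nrel_snoc using 1 2 cc b' tg by simp
  qed
qed

text \<open>A pair with the same last arrow in both components is matched with the pair obtained by deleting
  it, and a pair with the same first arrow is matched likewise unless the deleted pair is already
  matched on the other side. The pairs that remain are critical.\<close>

definition crit :: "'v \<Rightarrow> 'a list \<Rightarrow> 'a list \<Rightarrow> bool" where
  "crit v w w' \<longleftrightarrow> (w = [] \<and> w' = [])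
     \<or> (same_end w w' \<and> same_start w w' \<and> (length w = 1 \<or> length w' = 1))
     \<or> (w = [] \<and> w' \<noteq> [] \<and> nrel (last w') (hd w'))
     \<or> (w' = [] \<and> w \<noteq> [] \<and> rel (last w) (hd w))
     \<or> (\<not> same_end w w' \<and> \<not> same_start w w' \<and> lext v w w' = {} \<and> rext v w w' = {})"

text \<open>Here m is the degree of the argument, and \<open>(-1) ^ m\<close> is the coefficient
  with which the differential from degree m - 1 adds an arrow at the beginning. The condition on
  \<open>lext\<close> excludes pairs that are already reached by deleting a last arrow. The
  exception in the first branch leaves alone the pairs with a component of length 1 and common
  arrows at both ends.\<close>

definition hmt :: "nat \<Rightarrow> ('v, 'a) path \<times> ('v, 'a) path \<Rightarrow> ('v, 'a) path \<times> ('v, 'a) path \<Rightarrow> 'k" where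
  "hmt m = (\<lambda>((v, w), (v', w')) y.
     if same_end w w' \<and> \<not> (same_start w w' \<and> (length w = 1 \<or> length w' = 1))
     then bvec (pr v (butlast w) (butlast w')) y
     else if same_start w w' \<and> \<not> same_end w w' \<and> lext (head Q (hd w)) (tl w) (tl w') = {}
     then (-1) ^ m * bvec (pr (head Q (hd w)) (tl w) (tl w')) y
     else 0)"

lemma hmt_end: "\<not> (same_start (w @ [c]) (w' @ [c]) \<and> (w = [] \<or> w' = [])) \<Longrightarrow>
    hmt m (pr v (w @ [c]) (w' @ [c])) = bvec (pr v w w')"
  by (auto simp: hmt_def same_end_def)

lemma hmt_start: "\<not> same_end (c # w) (c # w') \<Longrightarrow>
    hmt m (pr v (c # w) (c # w')) = (\<lambda>y. if lext (head Q c) w w' = {} then (-1) ^ m * bvec (pr (head Q c) w w') y else 0)"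
  by (auto simp: hmt_def same_start_def)

lemma hmt_zero: "\<not> same_end w w' \<and> \<not> same_start w w' \<or> same_end w w' \<and> same_start w w' \<and> (length w = 1 \<or> length w' = 1)
    \<Longrightarrow> hmt m (pr v w w') = (\<lambda>_. 0)"
  by (auto simp: hmt_def)

lemma same_endE:
  assumes "same_end w w'"
  obtains w0 w0' c where "w = w0 @ [c]" "w' = w0' @ [c]"
  using assms unfolding same_end_def by (metis append_butlast_last_id)

lemma same_startE:
  assumes "same_start w w'"
  obtains w0 w0' c where "w = c # w0" "w' = c # w0'"
  using assms unfolding same_start_def by (metis list.collapse)

lemma hmt_closed:
  assumes "x \<in> pbasis (Suc m)"
  shows "hmt k x \<in> free_space (pbasis m)"
proof -
  obtain v w w' where x: "x = pr v w w'" "pr v w w' \<in> pbasis (Suc m)" using assms by (rule pbasisE)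
  have 1: "pr v (butlast w) (butlast w') \<in> pbasis m" if se: "same_end w w'"
  proof -
    obtain w0 w0' c where "w = w0 @ [c]" "w' = w0' @ [c]" using se by (rule same_endE)
    then show ?thesis using pbasis_snocD(1)[of v w0 c w0' m] x by simp
  qed
  have 2: "pr (head Q (hd w)) (tl w) (tl w') \<in> pbasis m" if ss: "same_start w w'"
  proof -
    obtain w0 w0' c where "w = c # w0" "w' = c # w0'" using ss by (rule same_startE)
    then show ?thesis using pbasis_ConsD(1)[of v c w0 w0' m] x by simp
  qed
  let ?e = "same_end w w' \<and> \<not> (same_start w w' \<and> (length w = 1 \<or> length w' = 1))"
  let ?s = "same_start w w' \<and> \<not> same_end w w' \<and> lext (head Q (hd w)) (tl w) (tl w') = {}"
  have "hmt k x = (if ?e then bvec (pr v (butlast w) (butlast w'))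
      else if ?s then (\<lambda>y. (-1) ^ k * bvec (pr (head Q (hd w)) (tl w) (tl w')) y) else (\<lambda>_. 0))"
  proof -
    have "(\<lambda>y. if P then f y else if R then g y else 0) = (if P then f else if R then g else (\<lambda>_. 0 :: 'k))"
      for P R and f g :: "('v, 'a) path \<times> ('v, 'a) path \<Rightarrow> 'k" by simp
    then show ?thesis unfolding x(1) hmt_def prod.case .
  qed
  then show ?thesis using 1 2 scale_free_space[of "bvec (pr (head Q (hd w)) (tl w) (tl w'))"] by auto
qed

lemma sum_lext_single: "b \<in> lext v w w' \<Longrightarrow> w \<noteq> [] \<or> w' \<noteq> [] \<Longrightarrow> (\<Sum>b\<in>lext v w w'. f b) = f b"
  by (simp add: lext_single)

lemma sum_rext_single: "b \<in> rext v w w' \<Longrightarrow> w \<noteq> [] \<or> w' \<noteq> [] \<Longrightarrow> (\<Sum>b\<in>rext v w w'. f b) = f b"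
  by (simp add: rext_single)

lemma square_sign: "(-1) ^ n * ((-1) ^ n * y) = (y :: 'k)"
  by (simp flip: power_add mult.assoc)

text \<open>Deleting the last arrow and differentiating gives the pair back, together with
  extensions at the beginning. By \<open>rext_snoc\<close> these are the extensions of the pair
  itself with the last arrow deleted, and they appear with the opposite sign in the second summand,
  since the sign in the differential alternates with the degree.\<close>

lemma crit_homotopy_end:
  assumes p: "pr v (w @ [c]) (w' @ [c]) \<in> pbasis (Suc m)"
  shows "(\<lambda>y. lin_ext (pdiff m) (hmt (Suc m) (pr v (w @ [c]) (w' @ [c]))) y
      + lin_ext (hmt (Suc (Suc m))) (pdiff (Suc m) (pr v (w @ [c]) (w' @ [c]))) y) =
    (\<lambda>y. if crit v (w @ [c]) (w' @ [c]) then 0 else bvec (pr v (w @ [c]) (w' @ [c])) y)"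
proof -
  note r = pbasis_snocD[OF p]
  have se: "same_end (w @ [c]) (w' @ [c])" by (simp add: same_end_def)
  note L = lext_same_end[OF se]
  show ?thesis
  proof (cases "same_start (w @ [c]) (w' @ [c])")
    case True
    note R = rext_same_start[OF True]
    have dz: "lin_ext (hmt (Suc (Suc m))) (pdiff (Suc m) (pr v (w @ [c]) (w' @ [c]))) = (\<lambda>_. 0)"
      by (simp add: lin_ext_pdiff[OF p] L R)
    show ?thesis
    proof (cases "w = [] \<or> w' = []")
      case w: True
      then have "crit v (w @ [c]) (w' @ [c])" using se True by (auto simp: crit_def)
      moreover have "hmt (Suc m) (pr v (w @ [c]) (w' @ [c])) = (\<lambda>_. 0)" by (rule hmt_zero) (use se True w in auto)
      ultimately show ?thesis using dz by simp
    next
      case w: False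
      then have nc: "\<not> crit v (w @ [c]) (w' @ [c])" using se by (auto simp: crit_def)
      have ss: "same_start w w'" using True w by (auto simp: same_start_def)
      have "hmt (Suc m) (pr v (w @ [c]) (w' @ [c])) = bvec (pr v w w')" by (rule hmt_end) (use w in auto)
      then show ?thesis using nc w dz
        by (simp add: pdiff_pr[OF r(1)] rext_same_start[OF ss] sum_lext_single[OF r(2)])
    qed
  next
    case ns: False
    then have ne: "w \<noteq> [] \<or> w' \<noteq> []" by (auto simp: same_start_def)
    have nc: "\<not> crit v (w @ [c]) (w' @ [c])" using se ns by (auto simp: crit_def)
    have h: "hmt (Suc m) (pr v (w @ [c]) (w' @ [c])) = bvec (pr v w w')" by (rule hmt_end) (use ns in auto)
    note R = rext_snoc[OF r(1,2) ne ns]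
    have ha: "hmt k (pr (tail Q a) (a # w @ [c]) (a # w' @ [c])) = bvec (pr (tail Q a) (a # w) (a # w'))" for a k
      using hmt_end[of "a # w" c "a # w'" k "tail Q a"] by simp
    show ?thesis
      using nc by (simp add: h lin_ext_pdiff[OF p] pdiff_pr[OF r(1)] L R sum_lext_single[OF r(2) ne] ha)
  qed
qed

text \<open>If the shortened pair has no extension at the end, differentiating it gives the pair
  back. Otherwise \<open>hmt\<close> vanishes on the pair; but by \<open>lext_Cons\<close> the pair
  has the same extension at the end, and \<open>hmt\<close> deletes that arrow again.\<close>

lemma crit_homotopy_start:
  assumes p: "pr v (c # w) (c # w') \<in> pbasis (Suc m)" and ns: "\<not> same_end (c # w) (c # w')"
  shows "(\<lambda>y. lin_ext (pdiff m) (hmt (Suc m) (pr v (c # w) (c # w'))) y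
      + lin_ext (hmt (Suc (Suc m))) (pdiff (Suc m) (pr v (c # w) (c # w'))) y) =
    (\<lambda>y. if crit v (c # w) (c # w') then 0 else bvec (pr v (c # w) (c # w')) y)"
proof -
  note r = pbasis_ConsD[OF p]
  have ss: "same_start (c # w) (c # w')" by (simp add: same_start_def)
  have ne: "w \<noteq> [] \<or> w' \<noteq> []" using ns by (auto simp: same_end_def)
  have nc: "\<not> crit v (c # w) (c # w')" using ss ns by (auto simp: crit_def)
  note R = rext_same_start[OF ss]
  have L: "lext v (c # w) (c # w') = lext (head Q c) w w'"
    using lext_Cons[OF r(1,2) ne ns] r(4) by simp
  have nse: "\<not> same_end w w'" using ns by (auto simp: same_end_def)
  have hb: "hmt k (pr v (c # w @ [b]) (c # w' @ [b])) = bvec (pr v (c # w) (c # w'))" for b k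
    using hmt_end[of "c # w" b "c # w'" k v] by simp
  show ?thesis
  proof (cases "lext (head Q c) w w' = {}")
    case True
    have "lin_ext (pdiff m) (hmt (Suc m) (pr v (c # w) (c # w'))) = (\<lambda>y. (-1) ^ Suc m * pdiff m (pr (head Q c) w w') y)"
      using True by (simp add: hmt_start[OF ns] lin_ext_scale[of _ "(-1) ^ m"] lin_ext_scale[of _ "- ((-1) ^ m)"] flip: mult_minus_left)
    also have "\<dots> = bvec (pr v (c # w) (c # w'))"
      using True r(4) by (simp add: pdiff_pr[OF r(1)] sum_rext_single[OF r(2) ne] square_sign)
    finally show ?thesis using nc True by (simp add: lin_ext_pdiff[OF p] L R)
  next
    case False
    then obtain b where b: "b \<in> lext (head Q c) w w'" by blast
    show ?thesis using nc False
      by (simp add: hmt_start[OF ns] lin_ext_pdiff[OF p] L R lext_single[OF ne b] hb)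
  qed
qed

lemma crit_homotopy_top:
  assumes p: "pr v w w' \<in> pbasis m" and se: "\<not> same_end w w'" and ss: "\<not> same_start w w'"
  shows "lin_ext (hmt (Suc m)) (pdiff m (pr v w w')) = (\<lambda>y. if crit v w w' then 0 else bvec (pr v w w') y)"
proof (cases "w = [] \<and> w' = []")
  case True
  have "hmt (Suc m) (pr u [b] [b]) = (\<lambda>_. 0)" for u b
    by (rule hmt_zero) (simp add: same_end_def same_start_def)
  then show ?thesis unfolding lin_ext_pdiff[OF p] using True by (simp add: crit_def)
next
  case ne: False
  then have ne': "w \<noteq> [] \<or> w' \<noteq> []" by blast
  show ?thesis
  \<comment> \<open>The cyclic case: one component is a vertex and the other closes up. Any
    extension then has a component of length 1 and common arrows at both ends, and
    \<open>hmt\<close> is 0 on it.\<close>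
  proof (cases "w = [] \<and> nrel (last w') (hd w') \<or> w' = [] \<and> rel (last w) (hd w)")
    case True
    have "hmt (Suc m) (pr v (w @ [b]) (w' @ [b])) = (\<lambda>_. 0)" if b: "b \<in> lext v w w'" for b
    proof (rule hmt_zero)
      have "w = [] \<and> b = hd w' \<or> w' = [] \<and> b = hd w"
        using True b ne' nrel_det rel_det by (auto simp: lext_def rel_snoc nrel_snoc)
      then show "\<not> same_end (w @ [b]) (w' @ [b]) \<and> \<not> same_start (w @ [b]) (w' @ [b]) \<or>
          same_end (w @ [b]) (w' @ [b]) \<and> same_start (w @ [b]) (w' @ [b]) \<and> (length (w @ [b]) = 1 \<or> length (w' @ [b]) = 1)"
        using ne' by (auto simp: same_end_def same_start_def)
    qed
    moreover have "hmt (Suc m) (pr (tail Q a) (a # w) (a # w')) = (\<lambda>_. 0)" if a: "a \<in> rext v w w'" for a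
    proof (rule hmt_zero)
      have "w = [] \<and> a = last w' \<or> w' = [] \<and> a = last w"
        using True a ne' nrel_inj rel_inj by (auto simp: rext_def rel_Cons nrel_Cons)
      then show "\<not> same_end (a # w) (a # w') \<and> \<not> same_start (a # w) (a # w') \<or>
          same_end (a # w) (a # w') \<and> same_start (a # w) (a # w') \<and> (length (a # w) = 1 \<or> length (a # w') = 1)"
        using ne' by (auto simp: same_end_def same_start_def)
    qed
    ultimately show ?thesis unfolding lin_ext_pdiff[OF p] using True ne' by (auto simp: crit_def)
  next
    case nc: False
    have cr: "crit v w w' \<longleftrightarrow> lext v w w' = {} \<and> rext v w w' = {}"
      using se ss nc ne by (auto simp: crit_def)
    have hb: "hmt (Suc m) (pr v (w @ [b]) (w' @ [b])) = bvec (pr v w w')" if b: "b \<in> lext v w w'" for b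
    proof (rule hmt_end)
      show "\<not> (same_start (w @ [b]) (w' @ [b]) \<and> (w = [] \<or> w' = []))"
        using b nc ne' by (auto simp: same_start_def lext_def rel_snoc nrel_snoc hd_append)
    qed
    \<comment> \<open>An extension at the beginning is matched back only when there is none at the
      end, so that exactly one term returns the pair.\<close>
    have ha: "hmt (Suc m) (pr (tail Q a) (a # w) (a # w')) = (\<lambda>y. if lext v w w' = {} then (-1) ^ Suc m * bvec (pr v w w') y else 0)"
      if a: "a \<in> rext v w w'" for a
    proof -
      have "head Q a = v" using a by (simp add: rext_def)
      moreover have "\<not> same_end (a # w) (a # w')"
        using a nc ne' se by (auto simp: same_end_def rext_def rel_Cons nrel_Cons split: if_splits)
      ultimately show ?thesis using hmt_start[of a w w'] by (simp add: fun_eq_iff)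
    qed
    show ?thesis
    proof (cases "lext v w w' = {}")
      case False
      then obtain b where b: "b \<in> lext v w w'" by blast
      show ?thesis unfolding lin_ext_pdiff[OF p] using False cr ha
        by (simp add: sum_lext_single[OF b ne'] hb[OF b])
    next
      case True
      show ?thesis
      proof (cases "rext v w w' = {}")
        case False
        then obtain a where a: "a \<in> rext v w w'" by blast
        show ?thesis unfolding lin_ext_pdiff[OF p] using True False cr
          by (simp add: sum_rext_single[OF a ne'] ha[OF a] square_sign)
      qed (use True cr in \<open>simp add: lin_ext_pdiff[OF p]\<close>)
    qed
  qed
qed

definition cut :: "'x set \<Rightarrow> ('x \<Rightarrow> 'k) \<Rightarrow> 'x \<Rightarrow> 'k" where
  "cut S f = (\<lambda>p. if p \<in> S then f p else 0)"

definition crit_pairs :: "(('v, 'a) path \<times> ('v, 'a) path) set" where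
  "crit_pairs = {pr v w w' | v w w'. crit v w w'}"

lemma crit_pairs_iff: "pr v w w' \<in> crit_pairs \<longleftrightarrow> crit v w w'"
  by (auto simp: crit_pairs_def)

lemma cut_bvec: "cut S (bvec x) = (if x \<in> S then bvec x else (\<lambda>_. 0))"
  by (auto simp: cut_def bvec_def fun_eq_iff)

lemma lin_on_cut: "lin_on X (cut S)"
  by (auto simp: lin_on_def cut_def fun_eq_iff)

lemma crit_homotopy:
  assumes "x \<in> pbasis (Suc m)"
  shows "(\<lambda>y. lin_ext (pdiff m) (hmt (Suc m) x) y + lin_ext (hmt (Suc (Suc m))) (pdiff (Suc m) x) y) =
    (\<lambda>y. bvec x y + (-1) * cut crit_pairs (bvec x) y :: 'k)"
proof -
  obtain v w w' where x: "x = pr v w w'" "pr v w w' \<in> pbasis (Suc m)" using assms by (rule pbasisE)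
  have "(\<lambda>y. lin_ext (pdiff m) (hmt (Suc m) x) y + lin_ext (hmt (Suc (Suc m))) (pdiff (Suc m) x) y) =
     (\<lambda>y. if crit v w w' then 0 else bvec (pr v w w') y)"
  proof (cases "same_end w w'")
    case True
    then obtain w0 w0' c where "w = w0 @ [c]" "w' = w0' @ [c]" by (rule same_endE)
    then show ?thesis using crit_homotopy_end x by (simp cong: if_cong)
  next
    case se: False
    show ?thesis
    proof (cases "same_start w w'")
      case True
      then obtain w0 w0' c where "w = c # w0" "w' = c # w0'" by (rule same_startE)
      then show ?thesis using crit_homotopy_start x se by (simp cong: if_cong)
    next
      case False
      then show ?thesis using crit_homotopy_top[OF x(2) se False] hmt_zero[of w w' "Suc m" v] se x by simp
    qed
  qed
  then show ?thesis by (auto simp: x cut_bvec crit_pairs_iff)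
qed

lemma crit_homotopy_zero:
  assumes "x \<in> pbasis 0"
  shows "lin_ext (hmt (Suc 0)) (pdiff 0 x) = (\<lambda>y. bvec x y + (-1) * cut crit_pairs (bvec x) y :: 'k)"
proof -
  obtain v w w' where x: "x = pr v w w'" "pr v w w' \<in> pbasis 0" using assms by (rule pbasisE)
  have "w = []" using x by (simp add: pbasis_pr)
  then show ?thesis using crit_homotopy_top[OF x(2)]
    by (auto simp: x cut_bvec crit_pairs_iff same_end_def same_start_def)
qed

lemma crit_reduce:
  assumes z: "z \<in> cocycles m"
  shows "(\<lambda>p. z p - cut crit_pairs z p) \<in> coboundaries m"
proof -
  have zs: "z \<in> free_space (pbasis m)" "lin_ext (pdiff m) z = (\<lambda>_. 0)" using z by (auto simp: cocycles_iff)
  have hp: "lin_ext (hmt k) F \<in> free_space (pbasis m)" if "F \<in> free_space (pbasis (Suc m))" for F k m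
    by (rule lin_ext_closed[OF that hmt_closed])
  have l: "lin_on (pbasis m) (\<lambda>z y. z y + (-1) * cut crit_pairs z y :: 'k)"
    by (intro lin_on_plus lin_on_id lin_on_smult lin_on_cut)
  show ?thesis
  proof (cases m)
    case 0
    have "lin_ext (hmt (Suc 0)) (lin_ext (pdiff 0) z) = (\<lambda>y. z y + (-1) * cut crit_pairs z y)"
    proof (rule lin_on_eqI[OF _ l _ zs(1)])
      show "lin_on (pbasis m) (\<lambda>z. lin_ext (hmt (Suc 0)) (lin_ext (pdiff 0) z))"
        unfolding 0 by (rule lin_on_comp[OF lin_on_lin_ext lin_on_lin_ext pd_space])
    qed (simp add: 0 crit_homotopy_zero)
    then show ?thesis using zs 0 by simp
  next
    case (Suc n)
    have "(\<lambda>y. lin_ext (pdiff n) (lin_ext (hmt (Suc n)) z) y + lin_ext (hmt (Suc (Suc n))) (lin_ext (pdiff (Suc n)) z) y) =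
        (\<lambda>y. z y + (-1) * cut crit_pairs z y)"
    proof (rule lin_on_eqI[OF _ l _ zs(1)])
      show "lin_on (pbasis m) (\<lambda>z y. lin_ext (pdiff n) (lin_ext (hmt (Suc n)) z) y + lin_ext (hmt (Suc (Suc n))) (lin_ext (pdiff (Suc n)) z) y)"
        unfolding Suc by (intro lin_on_plus lin_on_comp[OF lin_on_lin_ext lin_on_lin_ext pd_space]
            lin_on_comp[OF lin_on_lin_ext lin_on_lin_ext hp])
    qed (simp add: Suc crit_homotopy)
    then have "(\<lambda>y. z y - cut crit_pairs z y) = lin_ext (pdiff n) (lin_ext (hmt (Suc n)) z)"
      using zs Suc by simp
    then show ?thesis using Suc hp zs by auto
  qed
qed

end

section \<open>Invariants and coinvariants of rotation\<close>

section \<open>Permutations with finite orbits\<close>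

text \<open>The map is not assumed to be bijective: periodicity makes the forward orbit of a point
  its full orbit, so that one representative per forward orbit is a transversal. X may be infinite;
  the orbits are finite.\<close>

locale cyclic_system =
  fixes X :: "'x set" and \<rho> :: "'x \<Rightarrow> 'x" and R :: "'x set"
  assumes closed: "x \<in> X \<Longrightarrow> \<rho> x \<in> X"
    and periodic: "x \<in> X \<Longrightarrow> \<exists>i. 1 \<le> i \<and> (\<rho> ^^ i) x = x"
    and reps: "R \<subseteq> X"
    and uniq: "x \<in> X \<Longrightarrow> \<exists>!p. p \<in> R \<and> (\<exists>i. p = (\<rho> ^^ i) x)"
begin

definition per :: "'x \<Rightarrow> nat" where
  "per x = (LEAST i. 1 \<le> i \<and> (\<rho> ^^ i) x = x)"

definition rep :: "'x \<Rightarrow> 'x" where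
  "rep x = (THE p. p \<in> R \<and> (\<exists>i. p = (\<rho> ^^ i) x))"

lemma per: "x \<in> X \<Longrightarrow> 1 \<le> per x" "x \<in> X \<Longrightarrow> (\<rho> ^^ per x) x = x"
  using LeastI_ex[OF periodic[of x]] unfolding per_def by auto

lemma per_least: "1 \<le> i \<Longrightarrow> (\<rho> ^^ i) x = x \<Longrightarrow> per x \<le> i"
  unfolding per_def by (rule Least_le) simp

lemma pow_closed: "x \<in> X \<Longrightarrow> (\<rho> ^^ i) x \<in> X"
  by (induction i) (auto intro: closed)

lemma per_dvd:
  assumes "x \<in> X" "(\<rho> ^^ n) x = x" shows "per x dvd n"
proof -
  have "n mod per x < per x" using per(1)[OF assms(1)] by (intro mod_less_divisor) simp
  moreover have "(\<rho> ^^ (n mod per x)) x = x" using funpow_mod_eq[OF per(2)[OF assms(1)], of n] assms(2) by simp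
  ultimately have "\<not> 1 \<le> n mod per x" using per_least[of "n mod per x" x] by linarith
  then show ?thesis by (simp add: dvd_eq_mod_eq_0)
qed

text \<open>The inverse of the i-th power as a nonnegative power: the two exponents add up to a
  multiple of the period.\<close>

lemma pow_back: "x \<in> X \<Longrightarrow> (\<rho> ^^ (i * per x - i)) ((\<rho> ^^ i) x) = x"
proof -
  assume x: "x \<in> X"
  have "i * per x - i + i = i * per x" using per(1)[OF x] by simp
  then have "(\<rho> ^^ (i * per x - i)) ((\<rho> ^^ i) x) = (\<rho> ^^ (i * per x)) x"
    by (metis comp_apply funpow_add)
  also have "\<dots> = x" using funpow_mod_eq[OF per(2)[OF x], of "i * per x"] by simp
  finally show ?thesis .
qed

lemma pow_inj:
  assumes x: "x \<in> X" and ij: "i < j" "j < per x" shows "(\<rho> ^^ i) x \<noteq> (\<rho> ^^ j) x"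
proof
  assume e: "(\<rho> ^^ i) x = (\<rho> ^^ j) x"
  have "(\<rho> ^^ (per x - j + i)) x = (\<rho> ^^ (per x - j + j)) x" using e by (simp add: funpow_add)
  then have "(\<rho> ^^ (per x - j + i)) x = x" using ij per[OF x] by simp
  then have "per x \<le> per x - j + i" using ij by (intro per_least) auto
  then show False using ij by simp
qed

lemma inj_on_pow: "x \<in> X \<Longrightarrow> inj_on (\<lambda>i. (\<rho> ^^ i) x) {..<per x}"
  unfolding inj_on_def by (metis lessThan_iff linorder_neqE_nat pow_inj)

lemma rep: "x \<in> X \<Longrightarrow> rep x \<in> R" "x \<in> X \<Longrightarrow> \<exists>i. rep x = (\<rho> ^^ i) x"
  using theI'[OF uniq[of x]] unfolding rep_def by auto

lemma rep_eqI: "x \<in> X \<Longrightarrow> p \<in> R \<Longrightarrow> p = (\<rho> ^^ i) x \<Longrightarrow> rep x = p"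
  using uniq[of x] rep[of x] by blast

lemma rep_pow: "x \<in> X \<Longrightarrow> rep ((\<rho> ^^ i) x) = rep x"
proof -
  assume x: "x \<in> X"
  obtain j where j: "rep x = (\<rho> ^^ j) x" using rep(2)[OF x] by blast
  have "rep x = (\<rho> ^^ (j + (i * per x - i))) ((\<rho> ^^ i) x)"
    using j pow_back[OF x, of i] by (simp add: funpow_add)
  then show ?thesis by (rule rep_eqI[OF pow_closed[OF x] rep(1)[OF x]])
qed

lemma rep_rep: "p \<in> R \<Longrightarrow> rep p = p"
  using rep_eqI[of p p 0] reps by auto

lemma orbit_iff:
  assumes p: "p \<in> R" and x: "x \<in> X"
  shows "rep x = p \<longleftrightarrow> (\<exists>i<per p. (\<rho> ^^ i) p = x)"
proof
  have pX: "p \<in> X" using p reps by auto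
  assume "rep x = p"
  then obtain j where j: "p = (\<rho> ^^ j) x" using rep(2)[OF x] by auto
  let ?k = "j * per x - j"
  have "x = (\<rho> ^^ ?k) p" using pow_back[OF x, of j] j by simp
  then have "x = (\<rho> ^^ (?k mod per p)) p" using funpow_mod_eq[OF per(2)[OF pX]] by simp
  then show "\<exists>i<per p. (\<rho> ^^ i) p = x" using per(1)[OF pX] by (intro exI[of _ "?k mod per p"]) auto
next
  assume "\<exists>i<per p. (\<rho> ^^ i) p = x"
  then show "rep x = p" using rep_pow[of p] rep_rep[OF p] reps p by auto
qed

lemma sum_shift:
  fixes f :: "'x \<Rightarrow> 'c::ab_group_add"
  assumes "x \<in> X"
  shows "(\<Sum>i<per x. f ((\<rho> ^^ Suc i) x)) = (\<Sum>i<per x. f ((\<rho> ^^ i) x))"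
  using sum.lessThan_Suc_shift[of "\<lambda>i. f ((\<rho> ^^ i) x)" "per x"] per(2)[OF assms] by simp

lemma sum_orbit_bvec:
  assumes p: "p \<in> R" and x: "x \<in> X"
  shows "(\<Sum>i<per p. bvec x ((\<rho> ^^ i) p)) = (bvec (rep x) p :: 'k::field)"
proof (cases "rep x = p")
  case True
  then obtain i where i: "i < per p" "(\<rho> ^^ i) p = x" using orbit_iff[OF p x] by blast
  have pX: "p \<in> X" using p reps by auto
  have "(\<Sum>j<per p. bvec x ((\<rho> ^^ j) p)) = (\<Sum>j<per p. if j = i then 1 else (0::'k))"
    using inj_on_pow[OF pX] i by (intro sum.cong) (auto simp: bvec_def inj_on_def)
  then show ?thesis using i True by (simp add: bvec_def)
next
  case False
  then have "(\<rho> ^^ i) p \<noteq> x" if "i < per p" for i using orbit_iff[OF p x] that by blast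
  then show ?thesis using False by (simp add: bvec_def)
qed

text \<open>Sending each point to its representative is the projection to the coinvariants; in the
  basis of representatives its coordinates are the orbit sums.\<close>

lemma orbit_sums:
  fixes y :: "'x \<Rightarrow> 'k::field"
  assumes "y \<in> free_space X"
  shows "lin_ext (\<lambda>x. bvec (rep x)) y = (\<lambda>p. if p \<in> R then \<Sum>i<per p. y ((\<rho> ^^ i) p) else 0)"
proof (rule lin_on_eqI[OF lin_on_lin_ext _ _ assms])
  show "lin_on X (\<lambda>y p. if p \<in> R then \<Sum>i<per p. y ((\<rho> ^^ i) p) else (0::'k))"
    by (auto simp: lin_on_def fun_eq_iff sum.distrib sum_distrib_left)
  fix x assume x: "x \<in> X"
  show "lin_ext (\<lambda>x. bvec (rep x)) (bvec x) = (\<lambda>p. if p \<in> R then \<Sum>i<per p. bvec x ((\<rho> ^^ i) p) else (0::'k))"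
  proof
    fix p
    show "lin_ext (\<lambda>x. bvec (rep x)) (bvec x) p = (if p \<in> R then \<Sum>i<per p. bvec x ((\<rho> ^^ i) p) else (0::'k))"
    proof (cases "p \<in> R")
      case False
      then have "p \<noteq> rep x" using rep(1)[OF x] by auto
      then show ?thesis using False by simp (simp add: bvec_def)
    qed (simp add: sum_orbit_bvec[OF _ x])
  qed
qed

lemma pow_bvec_free_space: "x \<in> X \<Longrightarrow> (\<lambda>q. \<Sum>j<n. c j * bvec ((\<rho> ^^ j) x) q) \<in> free_space X"
  by (intro sum_free_space scale_free_space) (simp add: pow_closed)

lemma lin_image_step:
  fixes \<phi> :: "'x \<Rightarrow> 'y \<Rightarrow> 'k::field"
  assumes "w \<in> free_space X" "w' \<in> free_space X"
  shows "(\<lambda>q. c * lin_ext \<phi> w q + lin_ext \<phi> w' q) = lin_ext \<phi> (\<lambda>x. c * w x + w' x)"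
  using lin_onD[OF lin_on_lin_ext assms, of \<phi> c] by simp

text \<open>For a basis vector the difference between x and its representative is a telescoping sum
  of differences along the orbit.\<close>

lemma mod_rep:
  fixes y :: "'x \<Rightarrow> 'k::field"
  assumes "y \<in> free_space X"
  shows "\<exists>w\<in>free_space X. (\<lambda>q. y q - lin_ext (\<lambda>x. bvec (rep x)) y q) = lin_ext (\<lambda>x q. bvec x q - bvec (\<rho> x) q) w"
  using assms
proof (induction rule: free_space_induct)
  case zero
  show ?case by (intro bexI[of _ "\<lambda>_. 0"]) auto
next
  case (step c x f)
  let ?\<phi> = "\<lambda>x q. bvec x q - bvec (\<rho> x) q :: 'k"
  obtain w where w: "w \<in> free_space X" "(\<lambda>q. f q - lin_ext (\<lambda>x. bvec (rep x)) f q) = lin_ext ?\<phi> w"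
    using step by blast
  obtain i where i: "rep x = (\<rho> ^^ i) x" using rep(2)[OF step(1)] by blast
  let ?v = "\<lambda>q. \<Sum>j<i. bvec ((\<rho> ^^ j) x) q :: 'k"
  have v: "?v \<in> free_space X" using pow_bvec_free_space[OF step(1), of "\<lambda>_. 1" i] by simp
  have "lin_ext ?\<phi> ?v = (\<lambda>q. \<Sum>j<i. ?\<phi> ((\<rho> ^^ j) x) q)"
    using lin_on_sum[OF lin_on_lin_ext, of "{..<i}" "\<lambda>j. bvec ((\<rho> ^^ j) x)" X ?\<phi>] pow_closed[OF step(1)] by simp
  also have "\<dots> = (\<lambda>q. bvec x q - bvec (rep x) q)"
    using sum_lessThan_telescope'[of "\<lambda>j. bvec ((\<rho> ^^ j) x) _ :: 'k" i] by (simp add: i)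
  finally have lv: "lin_ext ?\<phi> ?v = (\<lambda>q. bvec x q - bvec (rep x) q)" .
  have bx: "bvec x \<in> free_space X" using step(1) by simp
  have "(\<lambda>q. c * bvec x q + f q - lin_ext (\<lambda>x. bvec (rep x)) (\<lambda>y. c * bvec x y + f y) q)
      = (\<lambda>q. c * lin_ext ?\<phi> ?v q + lin_ext ?\<phi> w q)"
    unfolding lv w(2)[symmetric] lin_onD[OF lin_on_lin_ext bx step(2)] by (simp add: algebra_simps)
  also have "\<dots> = lin_ext ?\<phi> (\<lambda>x. c * ?v x + w x)" by (rule lin_image_step[OF v w(1)])
  finally show ?case using lin_comb_free_space[OF v w(1), of c] by blast
qed

lemma difference_image:
  fixes y :: "'x \<Rightarrow> 'k::field"
  assumes y: "y \<in> free_space X" and "\<And>p. p \<in> R \<Longrightarrow> (\<Sum>i<per p. y ((\<rho> ^^ i) p)) = 0"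
  shows "\<exists>w\<in>free_space X. y = lin_ext (\<lambda>x q. bvec x q - bvec (\<rho> x) q) w"
proof -
  have "lin_ext (\<lambda>x. bvec (rep x)) y = (\<lambda>_. 0)" using assms by (auto simp: orbit_sums)
  then show ?thesis using mod_rep[OF y] by simp
qed

text \<open>On an orbit of odd length, applying 1 + \<rho> to the alternating sum over the orbit of
  x gives 2x. Hence 1 + \<rho> is onto as soon as 2 is invertible.\<close>

lemma sum_image:
  fixes y :: "'x \<Rightarrow> 'k::field"
  assumes "y \<in> free_space X" and odd: "\<And>x. x \<in> X \<Longrightarrow> odd (per x)" and two: "(2::'k) \<noteq> 0"
  shows "\<exists>w\<in>free_space X. y = lin_ext (\<lambda>x q. bvec x q + bvec (\<rho> x) q) w"
  using assms(1)
proof (induction rule: free_space_induct)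
  case zero
  show ?case by (intro bexI[of _ "\<lambda>_. 0"]) auto
next
  case (step c x f)
  let ?\<phi> = "\<lambda>x q. bvec x q + bvec (\<rho> x) q :: 'k"
  obtain w where w: "w \<in> free_space X" "f = lin_ext ?\<phi> w"
    using step by blast
  let ?v = "\<lambda>q. \<Sum>j<per x. (-1) ^ j * bvec ((\<rho> ^^ j) x) q :: 'k"
  have v: "?v \<in> free_space X" by (rule pow_bvec_free_space[OF step(1)])
  have "lin_ext ?\<phi> ?v = (\<lambda>q. \<Sum>j<per x. (-1) ^ j * ?\<phi> ((\<rho> ^^ j) x) q)"
    using lin_on_sum[OF lin_on_lin_ext, of "{..<per x}" "\<lambda>j q. (-1) ^ j * bvec ((\<rho> ^^ j) x) q" X ?\<phi>] pow_closed[OF step(1)]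
    by (simp add: lin_ext_scale scale_free_space)
  also have "\<dots> = (\<lambda>q. 2 * bvec x q)"
  proof
    fix q
    have "(\<Sum>j<per x. (-1) ^ j * ?\<phi> ((\<rho> ^^ j) x) q) =
        (\<Sum>j<per x. (-1) ^ j * bvec ((\<rho> ^^ j) x) q - (-1) ^ Suc j * bvec ((\<rho> ^^ Suc j) x) q)"
      by (simp add: algebra_simps)
    also have "\<dots> = bvec x q - (-1) ^ per x * bvec ((\<rho> ^^ per x) x) q"
      by (subst sum_lessThan_telescope'[of "\<lambda>j. (-1) ^ j * bvec ((\<rho> ^^ j) x) q"]) simp
    finally show "(\<Sum>j<per x. (-1) ^ j * ?\<phi> ((\<rho> ^^ j) x) q) = 2 * bvec x q"
      using odd[OF step(1)] per(2)[OF step(1)] by simp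
  qed
  finally have lv: "lin_ext ?\<phi> ?v = (\<lambda>q. 2 * bvec x q)" .
  have "(\<lambda>y. c * bvec x y + f y) = (\<lambda>q. c / 2 * lin_ext ?\<phi> ?v q + lin_ext ?\<phi> w q)"
    unfolding lv w(2)[symmetric] using two by simp
  also have "\<dots> = lin_ext ?\<phi> (\<lambda>x. c / 2 * ?v x + w x)" by (rule lin_image_step[OF v w(1)])
  finally show ?case using lin_comb_free_space[OF v w(1), of "c / 2"] by blast
qed

lemma invariant_zero:
  assumes "\<And>x. x \<in> X \<Longrightarrow> f (\<rho> x) = f x" "\<And>p. p \<in> R \<Longrightarrow> f p = 0" "x \<in> X"
  shows "f x = 0"
proof -
  have "f ((\<rho> ^^ i) x) = f x" for i by (induction i) (auto simp: assms pow_closed)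
  then show ?thesis using assms(2) rep[OF assms(3)] by metis
qed

text \<open>Going once around an orbit of odd length shows f x = - f x.\<close>

lemma alternating_zero:
  fixes f :: "'x \<Rightarrow> 'k::field"
  assumes "\<And>x. x \<in> X \<Longrightarrow> f (\<rho> x) = - f x" "odd (per x)" "(2::'k) \<noteq> 0" "x \<in> X"
  shows "f x = 0"
proof -
  have "f ((\<rho> ^^ i) x) = (-1) ^ i * f x" for i by (induction i) (auto simp: assms pow_closed)
  from this[of "per x"] have "f x = - f x" using assms(2) per(2)[OF assms(4)] by simp
  then have "2 * f x = 0" by (simp add: eq_neg_iff_add_eq_0 flip: mult_2)
  then show ?thesis using assms(3) by simp
qed

end

section \<open>Roots of cyclic words and one representative per circuit\<close>

section \<open>Cyclic words\<close>

text \<open>Rotations and powers of a word are compared through the periodic sequence that the word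
  generates: rotation shifts it and powers leave it unchanged.\<close>

definition cnth :: "'x list \<Rightarrow> nat \<Rightarrow> 'x" where
  "cnth w i = w ! (i mod length w)"

lemma nth_concat_replicate:
  assumes "i < k * length u"
  shows "concat (replicate k u) ! i = u ! (i mod length u)"
  using assms
proof (induction k arbitrary: i)
  case (Suc k)
  show ?case
  proof (cases "i < length u")
    case False
    then have "(i - length u) mod length u = i mod length u" by (simp add: le_mod_geq)
    then show ?thesis using Suc.IH[of "i - length u"] Suc.prems False by (simp add: nth_append)
  qed (simp add: nth_append)
qed simp

lemma length_concat_replicate: "length (concat (replicate k u)) = k * length u"
  by (induction k) auto

lemma cnth_concat_replicate:
  assumes "0 < k" "u \<noteq> []"
  shows "cnth (concat (replicate k u)) i = cnth u i"
  using assms nth_concat_replicate[of "i mod (k * length u)" k u]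
  by (simp add: cnth_def length_concat_replicate mod_mod_cancel)

lemma rotate_eq_cnth:
  assumes "length w = length w'" "\<And>k. cnth w (i + k) = cnth w' (j + k)"
  shows "rotate i w = rotate j w'"
proof (rule nth_equalityI)
  fix k assume "k < length (rotate i w)"
  then show "rotate i w ! k = rotate j w' ! k" using assms by (simp add: nth_rotate cnth_def)
qed (use assms in simp)

lemma cnth_rotate: "w \<noteq> [] \<Longrightarrow> cnth (rotate k w) i = cnth w (k + i)"
  by (simp add: cnth_def nth_rotate mod_add_right_eq)

lemma cnth_add_mult: "cnth w (i + k * length w) = cnth w i"
  by (simp add: cnth_def)

text \<open>Complete and cocomplete circuits are treated together, P being \<open>rel\<close> or
  \<open>nrel\<close>. The combinatorics rests on each arrow having at most one successor.\<close>

locale arrow_step = fin_digraph Q for Q :: "('v, 'a) pre_digraph" +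
  fixes P :: "'a \<Rightarrow> 'a \<Rightarrow> bool"
  assumes P_arcs: "P a b \<Longrightarrow> a \<in> arcs Q \<and> b \<in> arcs Q \<and> head Q a = tail Q b"
    and P_det: "P a b \<Longrightarrow> P a b' \<Longrightarrow> b = b'"
begin

definition cyc :: "'a list \<Rightarrow> bool" where
  "cyc w \<longleftrightarrow> w \<noteq> [] \<and> (\<forall>i. P (cnth w i) (cnth w (Suc i)))"

definition wd :: "'a list \<Rightarrow> ('v, 'a) path" where
  "wd w = (tail Q (hd w), w)"

text \<open>The cycles whose square satisfies P, by \<open>square_cyc\<close> and
  \<open>cyc_square\<close>: squaring adds only the condition at the joint.\<close>

definition cyc_paths :: "('v, 'a) path set" where
  "cyc_paths = {(v, w). w \<noteq> [] \<and> chain_path Q P v w \<and> P (last w) (hd w)}"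

lemma cyc_iff: "cyc w \<longleftrightarrow> w \<noteq> [] \<and> successively P w \<and> P (last w) (hd w)"
proof (cases "w = []")
  case ne: False
  have "(\<forall>i. P (cnth w i) (cnth w (Suc i))) \<longleftrightarrow> (\<forall>i<length w. P (cnth w i) (cnth w (Suc i)))"
  proof (intro iffI allI impI)
    fix i assume h: "\<forall>i<length w. P (cnth w i) (cnth w (Suc i))"
    have "cnth w (i mod length w) = cnth w i" "cnth w (Suc (i mod length w)) = cnth w (Suc i)"
      by (simp_all add: cnth_def mod_Suc_eq)
    then show "P (cnth w i) (cnth w (Suc i))" using h ne by (metis length_greater_0_conv mod_less_divisor)
  qed simp
  also have "\<dots> \<longleftrightarrow> (\<forall>i. Suc i < length w \<longrightarrow> P (w ! i) (w ! Suc i)) \<and> P (last w) (hd w)"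
  proof -
    obtain n where n: "length w = Suc n" using ne by (cases w) auto
    have split: "(\<forall>i<length w. S i) \<longleftrightarrow> (\<forall>i. Suc i < length w \<longrightarrow> S i) \<and> S (length w - 1)" for S
      unfolding n by (metis Suc_less_eq diff_Suc_1 less_Suc_eq)
    have "cnth w (length w - 1) = last w" "cnth w (Suc (length w - 1)) = hd w"
      using ne by (simp_all add: cnth_def last_conv_nth hd_conv_nth)
    moreover have "cnth w i = w ! i" "cnth w (Suc i) = w ! Suc i" if "Suc i < length w" for i
      using that by (simp_all add: cnth_def)
    ultimately show ?thesis unfolding split by auto
  qed
  also have "(\<forall>i. Suc i < length w \<longrightarrow> P (w ! i) (w ! Suc i)) \<longleftrightarrow> successively P w"
    by (induction w rule: induct_list012) (auto simp: less_Suc_eq_0_disj nth_Cons' split: if_splits)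
  finally show ?thesis using ne by (simp add: cyc_def)
qed (simp add: cyc_def)

lemma cyc_arcs: "cyc w \<Longrightarrow> set w \<subseteq> arcs Q"
proof
  fix a assume c: "cyc w" and "a \<in> set w"
  then obtain i where "i < length w" "a = w ! i" by (metis in_set_conv_nth)
  then have "a = cnth w i" by (simp add: cnth_def)
  then show "a \<in> arcs Q" using c P_arcs unfolding cyc_def by blast
qed

lemma cyc_paths_iff: "(v, w) \<in> cyc_paths \<longleftrightarrow> cyc w \<and> v = tail Q (hd w)"
proof -
  have "tail Q (hd w) \<in> verts Q" if "cyc w"
    using cyc_arcs[OF that] that hd_in_set[of w] by (intro tail_in_verts) (auto simp: cyc_def)
  then show ?thesis using cyc_arcs[of w] by (auto simp: cyc_paths_def chain_path_def cyc_iff)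
qed

lemma cyc_pathsE:
  assumes "x \<in> cyc_paths"
  obtains w where "x = wd w" "cyc w"
  using assms cyc_paths_iff by (cases x) (auto simp: wd_def)

lemma wd_cyc_paths [simp]: "wd w \<in> cyc_paths \<longleftrightarrow> cyc w"
  by (simp add: wd_def cyc_paths_iff)

text \<open>\<open>rot\<close> brings the last arrow to the front, so it is inverse to the list
  operation \<open>rotate\<close>. Exponents of the form i * length w - i below turn a power of one
  into a nonnegative power of the other.\<close>

lemma rot_rotate: "w \<noteq> [] \<Longrightarrow> (rot Q ^^ i) (wd (rotate i w)) = wd w"
proof (induction i)
  case (Suc i)
  have "rot Q (wd (rotate1 u)) = wd u" if "u \<noteq> []" for u
    using that by (cases u) (auto simp: rot_def wd_def)
  from this[of "rotate i w"] show ?case using Suc by (simp add: funpow_swap1)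
qed simp

lemma rot_pow: "w \<noteq> [] \<Longrightarrow> (rot Q ^^ i) (wd w) = wd (rotate (i * length w - i) w)"
proof -
  assume w: "w \<noteq> []"
  have "1 \<le> length w" using w by (cases w) auto
  then have "i + (i * length w - i) = i * length w" by simp
  then have "rotate i (rotate (i * length w - i) w) = rotate (i * length w) w" by (simp add: rotate_rotate)
  also have "\<dots> = w" by (simp add: rotate_id)
  finally show ?thesis using rot_rotate[of "rotate (i * length w - i) w" i] w by simp
qed

lemma rotate_rot: "w \<noteq> [] \<Longrightarrow> \<exists>i. wd (rotate k w) = (rot Q ^^ i) (wd w)"
proof
  assume w: "w \<noteq> []"
  let ?i = "k * length w - k"
  have "1 \<le> length w" using w by (cases w) auto
  then have "?i + k = k * length w" by simp
  then have "rotate ?i (rotate k w) = w" by (simp add: rotate_rotate rotate_id)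
  then show "wd (rotate k w) = (rot Q ^^ ?i) (wd w)" using rot_rotate[of "rotate k w" ?i] w by simp
qed

lemma rot_length: "w \<noteq> [] \<Longrightarrow> (rot Q ^^ length w) (wd w) = wd w"
  using rot_rotate[of w "length w"] by simp

lemma cyc_rotate: "cyc w \<Longrightarrow> cyc (rotate k w)"
  by (simp add: cyc_def cnth_rotate)

lemma rot_cyc_paths: "x \<in> cyc_paths \<Longrightarrow> rot Q x \<in> cyc_paths"
  using rot_pow[of _ 1] cyc_rotate by (auto elim!: cyc_pathsE simp: cyc_def)

lemma cnth_det:
  assumes "cyc w" "cyc w'" "cnth w i = cnth w' j"
  shows "cnth w (i + k) = cnth w' (j + k)"
proof (induction k)
  case (Suc k)
  have "P (cnth w (i + k)) (cnth w (i + Suc k))" "P (cnth w' (j + k)) (cnth w' (j + Suc k))"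
    using assms by (auto simp: cyc_def)
  then show ?case using Suc P_det by metis
qed (use assms in simp)

text \<open>An arrow determines its successor in a cyclic word, so the first return of the first arrow
  is already a period of the whole word.\<close>

definition root_length :: "'a list \<Rightarrow> nat" where
  "root_length w = (LEAST s. 1 \<le> s \<and> cnth w s = cnth w 0)"

lemma root_length:
  assumes "cyc w"
  shows "1 \<le> root_length w" "cnth w (i + root_length w) = cnth w i" "root_length w dvd length w"
    and "1 \<le> s \<Longrightarrow> cnth w s = cnth w 0 \<Longrightarrow> root_length w \<le> s"
proof -
  have "1 \<le> length w \<and> cnth w (length w) = cnth w 0" using assms by (cases w) (auto simp: cyc_def cnth_def)
  then have 1: "1 \<le> root_length w \<and> cnth w (root_length w) = cnth w 0"
    unfolding root_length_def by (rule LeastI)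
  then show "1 \<le> root_length w" by simp
  have per: "cnth w (i + root_length w) = cnth w i" for i
    using cnth_det[OF assms assms, of "root_length w" 0 i] 1 by (simp add: add.commute)
  then show "cnth w (i + root_length w) = cnth w i" .
  show least: "root_length w \<le> s" if "1 \<le> s" "cnth w s = cnth w 0" for s
    unfolding root_length_def by (rule Least_le) (use that in simp)
  have "cnth w (i + k * root_length w) = cnth w i" for i k
  proof (induction k)
    case (Suc k)
    then show ?case using per[of "i + k * root_length w"] by (simp add: algebra_simps)
  qed simp
  \<comment> \<open>The remainder of the length modulo the first return is again a return and
    smaller, so it must be 0.\<close>
  from this[of "length w mod root_length w" "length w div root_length w"]
  have "cnth w (length w mod root_length w) = cnth w 0" by (simp add: cnth_def)
  moreover have "length w mod root_length w < root_length w" using 1 by (intro mod_less_divisor) simp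
  ultimately have "\<not> 1 \<le> length w mod root_length w" using least[of "length w mod root_length w"] by linarith
  then show "root_length w dvd length w" by (simp add: dvd_eq_mod_eq_0)
qed

lemma root_length_mult: "cyc w \<Longrightarrow> cnth w (i + k * root_length w) = cnth w i"
proof (induction k)
  case (Suc k)
  then show ?case using root_length(2)[of w "i + k * root_length w"] by (simp add: algebra_simps)
qed simp

lemma root_power:
  assumes "cyc w"
  defines "u \<equiv> take (root_length w) w"
  shows "cyc u" "cnth u i = cnth w i" "length u = root_length w"
    "w = concat (replicate (length w div root_length w) u)" "1 \<le> length w div root_length w"
proof -
  let ?s = "root_length w"
  have w: "w \<noteq> []" using assms by (simp add: cyc_def)
  have s: "1 \<le> ?s" "?s \<le> length w" using root_length(1,3)[OF assms(1)] w by (auto intro: dvd_imp_le)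
  show lu: "length u = ?s" using s by (simp add: u_def)
  show au: "cnth u i = cnth w i" for i
  proof -
    have m: "i mod ?s < ?s" "i mod ?s < length w" using s mod_less_divisor[of ?s i] by linarith+
    have "cnth u i = w ! (i mod ?s)" using s by (simp add: cnth_def u_def min_absorb2)
    also have "\<dots> = cnth w (i mod ?s)" using m(2) by (simp add: cnth_def)
    also have "\<dots> = cnth w i" using root_length_mult[OF assms(1), of "i mod ?s" "i div ?s"] by simp
    finally show ?thesis .
  qed
  show "cyc u" using assms(1) lu s by (auto simp: cyc_def au)
  show d: "1 \<le> length w div ?s" using s by (simp add: div_greater_zero_iff Suc_leI)
  show "w = concat (replicate (length w div ?s) u)"
  proof (rule nth_equalityI)
    show l: "length w = length (concat (replicate (length w div ?s) u))"
      using root_length(3)[OF assms(1)] by (simp add: length_concat_replicate lu)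
    fix i assume i: "i < length w"
    then have "concat (replicate (length w div ?s) u) ! i = cnth u i"
      using l by (subst nth_concat_replicate) (auto simp: cnth_def length_concat_replicate)
    then show "w ! i = concat (replicate (length w div ?s) u) ! i" using i by (simp add: au) (simp add: cnth_def)
  qed
qed

lemma cyc_cycles: "cyc w \<Longrightarrow> wd w \<in> cycles Q"
proof -
  assume c: "cyc w"
  then have p: "(tail Q (hd w), w) \<in> cyc_paths" by (simp add: cyc_paths_iff)
  then have h: "head Q (last w) = tail Q (hd w)" "w \<noteq> []" "chain_path Q P (tail Q (hd w)) w"
    using P_arcs by (auto simp: cyc_paths_def)
  have "successively (\<lambda>a b. head Q a = tail Q b) w"
    using h(3) P_arcs by (auto simp: chain_path_def intro: successively_mono)
  then have "wd w \<in> qpaths Q" using h by (simp add: wd_def qpaths_chain_path[OF wf_digraph_axioms] chain_path_def)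
  then show "wd w \<in> cycles Q" using h by (simp add: cycles_def wd_def ptgt_eq)
qed

lemma square_cyc: "chain_path Q P v (w @ w) \<Longrightarrow> w \<noteq> [] \<Longrightarrow> (v, w) \<in> cyc_paths"
  using P_arcs by (auto simp: cyc_paths_def chain_path_append[OF _ wf_digraph_axioms])

lemma cyc_square:
  assumes "cyc w" shows "chain_path Q P (tail Q (hd w)) (w @ w)"
proof -
  have p: "(tail Q (hd w), w) \<in> cyc_paths" using assms by (simp add: cyc_paths_iff)
  then have "head Q (last w) = tail Q (hd w)" "w \<noteq> []" using P_arcs by (auto simp: cyc_paths_def)
  then have "ptgt Q (tail Q (hd w), w) = tail Q (hd w)" by (simp add: ptgt_eq)
  then show ?thesis using p P_arcs
    by (subst chain_path_append[OF _ wf_digraph_axioms]) (auto simp: cyc_paths_def)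
qed

lemma ppow_wd: "w \<noteq> [] \<Longrightarrow> 1 \<le> k \<Longrightarrow> ppow (wd w) k = wd (concat (replicate k w))"
  by (cases k) (auto simp: ppow_def wd_def hd_append)

lemma primitive_root_length:
  assumes "cyc w" "primitive Q (wd w)"
  shows "root_length w = length w"
proof (rule ccontr)
  assume ne: "root_length w \<noteq> length w"
  let ?s = "root_length w" and ?u = "take (root_length w) w"
  note r = root_power[OF assms(1)]
  have "length w = length w div ?s * ?s" using root_length(3)[OF assms(1)] by simp
  then have "length w div ?s \<noteq> 1" using ne by auto
  then have k: "2 \<le> length w div ?s" using r(5) by simp
  have "wd w = ppow (wd ?u) (length w div ?s)"
    using ppow_wd[of ?u "length w div ?s"] r by (simp add: cyc_def)
  then show False using assms(2) k cyc_cycles[OF r(1)] unfolding primitive_def by blast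
qed

text \<open>A decomposition of the prefix as a proper power would bring the first arrow back earlier
  than its first return.\<close>

lemma root_primitive:
  assumes "cyc w" shows "primitive Q (wd (take (root_length w) w))"
  unfolding primitive_def
proof (intro conjI notI)
  let ?s = "root_length w" and ?u = "take (root_length w) w"
  note r = root_power[OF assms]
  show "wd ?u \<in> cycles Q" by (rule cyc_cycles[OF r(1)])
  assume "\<exists>D\<in>cycles Q. \<exists>n\<ge>2. wd ?u = ppow D n"
  then obtain v e n where D: "(v, e) \<in> cycles Q" "n \<ge> 2" "wd ?u = ppow (v, e) n" by (metis surj_pair)
  have e: "e \<noteq> []" using D(1) by (auto simp: cycles_def)
  have u: "?u = concat (replicate n e)" using D(3) by (simp add: wd_def ppow_def)
  have "?s = n * length e" using r(3) unfolding u by (simp add: length_concat_replicate)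
  moreover have "1 \<le> length e" using e by (cases e) auto
  ultimately have l: "1 \<le> length e" "length e < ?s" using D(2) by auto
  have "cnth w i = cnth e i" for i using r(2)[of i] unfolding u using cnth_concat_replicate[of n e i] e D(2) by simp
  note e_eq = this
  have "cnth w (length e) = cnth w 0" unfolding e_eq by (simp add: cnth_def)
  then show False using root_length(4)[OF assms l(1)] l(2) by simp
qed

text \<open>Existence: the root of w is primitive, some rotation of it is a chosen representative,
  and a power of this is a rotation of w. Uniqueness: two primitive words with powers that are
  rotations of w generate shifts of one periodic sequence, so they have equal first returns, that is
  equal lengths, and are rotations of each other. Hence they are the same representative, and the
  length of w determines the exponent.\<close>

lemma cyclic_system_powers:
  assumes reps: "circuit_reps Q S C" and S: "\<And>v w. (v, w) \<in> S \<longleftrightarrow> chain_path Q P v w"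
  shows "cyclic_system cyc_paths (rot Q) (powers C)"
proof
  have cw: "\<exists>c. x = wd c \<and> cyc c \<and> primitive Q x" if "x \<in> C" for x
  proof -
    have x: "primitive Q x" "ppow x 2 \<in> S" using reps that by (auto simp: circuit_reps_def)
    obtain v c where c: "x = (v, c)" by (cases x)
    have "c \<noteq> []" using x(1) by (auto simp: c primitive_def cycles_def)
    moreover have "chain_path Q P v (c @ c)" using x(2) by (simp add: c ppow_def numeral_2_eq_2 S)
    ultimately have "(v, c) \<in> cyc_paths" by (rule square_cyc[rotated])
    then show ?thesis using x c by (auto simp: cyc_paths_iff wd_def)
  qed
  have pw: "\<exists>c k. wd c \<in> C \<and> cyc c \<and> primitive Q (wd c) \<and> 1 \<le> k \<and> p = wd (concat (replicate k c))" if "p \<in> powers C" for p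
  proof -
    obtain x k where x: "x \<in> C" "1 \<le> k" "p = ppow x k" using \<open>p \<in> powers C\<close> by (auto simp: powers_def)
    obtain c where "x = wd c" "cyc c" "primitive Q x" using cw[OF x(1)] by blast
    then show ?thesis using x ppow_wd[of c k] by (auto simp: cyc_def)
  qed
  show "rot Q x \<in> cyc_paths" if "x \<in> cyc_paths" for x by (rule rot_cyc_paths[OF that])
  show "\<exists>i. 1 \<le> i \<and> (rot Q ^^ i) x = x" if x: "x \<in> cyc_paths" for x
  proof -
    obtain w where w: "x = wd w" "cyc w" using x by (rule cyc_pathsE)
    then show ?thesis using rot_length[of w] by (intro exI[of _ "length w"]) (cases w; auto simp: cyc_def)
  qed
  show "powers C \<subseteq> cyc_paths"
  proof
    fix p assume "p \<in> powers C"
    then obtain c k where c: "cyc c" "1 \<le> k" "p = wd (concat (replicate k c))" using pw by blast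
    then have "concat (replicate k c) \<noteq> []" by (cases k) (auto simp: cyc_def)
    then show "p \<in> cyc_paths" using c cnth_concat_replicate[of k c] by (auto simp: cyc_def)
  qed
  fix x assume "x \<in> cyc_paths"
  then obtain w where w: "x = wd w" "cyc w" by (rule cyc_pathsE)
  have wne: "w \<noteq> []" using w by (simp add: cyc_def)
  show "\<exists>!p. p \<in> powers C \<and> (\<exists>i. p = (rot Q ^^ i) x)"
  proof (rule ex_ex1I)
    let ?u = "take (root_length w) w" and ?k = "length w div root_length w"
    note r = root_power[OF w(2)]
    have une: "?u \<noteq> []" using r(1) by (simp add: cyc_def)
    have "ppow (wd ?u) 2 \<in> S"
      using cyc_square[OF r(1)] by (simp add: wd_def ppow_def numeral_2_eq_2 S)
    then have "\<exists>!D. D \<in> C \<and> (\<exists>i. D = (rot Q ^^ i) (wd ?u))"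
      using reps root_primitive[OF w(2)] unfolding circuit_reps_def by blast
    then obtain i where D: "(rot Q ^^ i) (wd ?u) \<in> C" by blast
    let ?j = "i * length ?u - i"
    have D': "wd (rotate ?j ?u) \<in> C" using D rot_pow[OF une, of i] by simp
    have "concat (replicate ?k (rotate ?j ?u)) = rotate ?j w"
    proof -
      have "rotate 0 (concat (replicate ?k (rotate ?j ?u))) = rotate ?j w"
      proof (rule rotate_eq_cnth)
        show "length (concat (replicate ?k (rotate ?j ?u))) = length w"
          using r(3) root_length(3)[OF w(2)] by (simp add: length_concat_replicate)
        show "cnth (concat (replicate ?k (rotate ?j ?u))) (0 + k) = cnth w (?j + k)" for k
          using r(2,5) une by (subst cnth_concat_replicate) (auto simp: cnth_rotate)
      qed
      then show ?thesis by simp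
    qed
    then have "ppow (wd (rotate ?j ?u)) ?k = wd (rotate ?j w)"
      using ppow_wd[of "rotate ?j ?u" ?k] r(5) une by simp
    then have "wd (rotate ?j w) \<in> powers C" using D' r(5) unfolding powers_def
      by (intro CollectI exI[of _ "wd (rotate ?j ?u)"] exI[of _ ?k]) simp
    then show "\<exists>p. p \<in> powers C \<and> (\<exists>i. p = (rot Q ^^ i) x)" using rotate_rot[OF wne] w by blast
  next
    fix p q assume "p \<in> powers C \<and> (\<exists>i. p = (rot Q ^^ i) x)" "q \<in> powers C \<and> (\<exists>i. q = (rot Q ^^ i) x)"
    then obtain i0 j0 where pq: "p \<in> powers C" "q \<in> powers C"
      and ij: "p = wd (rotate i0 w)" "q = wd (rotate j0 w)"
      using rot_pow[OF wne] w by metis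
    obtain c a where c: "wd c \<in> C" "cyc c" "primitive Q (wd c)" "1 \<le> a" "p = wd (concat (replicate a c))"
      using pw[OF pq(1)] by blast
    obtain d b where d: "wd d \<in> C" "cyc d" "primitive Q (wd d)" "1 \<le> b" "q = wd (concat (replicate b d))"
      using pw[OF pq(2)] by blast
    have ne: "c \<noteq> []" "d \<noteq> []" using c d by (auto simp: cyc_def)
    have wc: "rotate i0 w = concat (replicate a c)" "rotate j0 w = concat (replicate b d)"
      using ij c d by (auto simp: wd_def)
    have ac: "cnth c i = cnth w (i0 + i)" for i using cnth_rotate[OF wne, of i0 i] wc cnth_concat_replicate[of a c i] c ne by simp
    have ad: "cnth d i = cnth w (j0 + i)" for i using cnth_rotate[OF wne, of j0 i] wc cnth_concat_replicate[of b d i] d ne by simp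
    \<comment> \<open>k and l are j0 - i0 and i0 - j0 modulo the length of w, written as natural
      numbers.\<close>
    define k where "k = j0 + (i0 * length w - i0)"
    define l where "l = i0 + (j0 * length w - j0)"
    have "1 \<le> length w" using wne by (cases w) auto
    then have "i0 \<le> i0 * length w" "j0 \<le> j0 * length w" by simp_all
    then have kl: "i0 + k = j0 + i0 * length w" "j0 + l = i0 + j0 * length w" unfolding k_def l_def by linarith+
    have ck: "cnth c (k + i) = cnth d i" for i
    proof -
      have "i0 + (k + i) = j0 + i + i0 * length w" using kl(1) by linarith
      then show ?thesis unfolding ac ad by (simp only: cnth_add_mult)
    qed
    have dl: "cnth d (l + i) = cnth c i" for i
    proof -
      have "j0 + (l + i) = i0 + i + j0 * length w" using kl(2) by linarith
      then show ?thesis unfolding ac ad by (simp only: cnth_add_mult)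
    qed
    have "root_length c \<le> root_length d"
    proof (rule root_length(4)[OF c(2) root_length(1)[OF d(2)]])
      show "cnth c (root_length d) = cnth c 0"
        using dl[of "root_length d"] dl[of 0] root_length(2)[OF d(2), of l] by simp
    qed
    moreover have "root_length d \<le> root_length c"
    proof (rule root_length(4)[OF d(2) root_length(1)[OF c(2)]])
      show "cnth d (root_length c) = cnth d 0"
        using ck[of "root_length c"] ck[of 0] root_length(2)[OF c(2), of k] by simp
    qed
    ultimately have len: "length c = length d"
      using primitive_root_length[OF c(2,3)] primitive_root_length[OF d(2,3)] by simp
    have "rotate k c = rotate 0 d" by (rule rotate_eq_cnth[OF len]) (simp add: ck)
    then have dk: "wd d = wd (rotate k c)" by simp
    have "\<exists>!D. D \<in> C \<and> (\<exists>i. D = (rot Q ^^ i) (wd c))"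
      using reps c(1) unfolding circuit_reps_def by blast
    moreover have "\<exists>i. wd c = (rot Q ^^ i) (wd c)" by (intro exI[of _ 0]) simp
    moreover have "\<exists>i. wd d = (rot Q ^^ i) (wd c)" using rotate_rot[OF ne(1), of k] dk by simp
    ultimately have "wd c = wd d" using c(1) d(1) by blast
    then have "c = d" by (simp add: wd_def)
    moreover have "a = b"
    proof -
      have "length w = a * length c" "length w = b * length d"
        using arg_cong[OF wc(1), of length] arg_cong[OF wc(2), of length] by (simp_all add: length_concat_replicate)
      then show ?thesis using len ne by auto
    qed
    ultimately show "p = q" using c d by simp
  qed
qed

end

section \<open>Fundamental cuts of a spanning tree\<close>

section \<open>Spanning trees\<close>

lemma connected_constant:
  assumes "connected G" and f: "\<And>a. a \<in> arcs G \<Longrightarrow> f (tail G a) = f (head G a)"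
    and "u \<in> verts G" "v \<in> verts G"
  shows "f u = f v"
proof -
  have "u \<rightarrow>\<^sup>*\<^bsub>with_proj (mk_symmetric G)\<^esub> v"
    using assms(1,3,4) by (simp add: connected_def strongly_connected_def)
  from reachable_rtranclI[OF this] have "(u, v) \<in> (parcs (mk_symmetric G))\<^sup>*" by simp
  then show ?thesis
  proof induction
    case (step y z)
    then show ?case using f by (auto simp: parcs_mk_symmetric)
  qed simp
qed

context wf_digraph
begin

abbreviation "dbl T \<equiv> double_quiver (G\<lparr>arcs := T\<rparr>)"

lemma dbl_simps [simp]:
  "verts (dbl T) = verts G" "arcs (dbl T) = T \<times> UNIV"
  "tail (dbl T) (c, b) = (if b then tail G c else head G c)"
  "head (dbl T) (c, b) = (if b then head G c else tail G c)"
  by (simp_all add: double_quiver_def)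

lemma wf_dbl: "T \<subseteq> arcs G \<Longrightarrow> wf_digraph (dbl T)"
  by (rule wf_digraph.intro) auto

text \<open>An arrow and its formal inverse have the same two ends, so using either of them later
  would bring the walk back to the vertex where the arrow was first entered.\<close>

lemma distinct_arcs_path:
  assumes "pre_digraph.cas (dbl T) u p v" "distinct (pre_digraph.awalk_verts (dbl T) u p)"
  shows "distinct (map fst p)"
  using assms
proof (induction p arbitrary: u)
  case (Cons e p)
  interpret D: pre_digraph "dbl T" .
  have c: "D.cas (head (dbl T) e) p v" "u = tail (dbl T) e" using Cons.prems(1) by auto
  have d: "distinct (D.awalk_verts (head (dbl T) e) p)" "tail (dbl T) e \<notin> set (D.awalk_verts (head (dbl T) e) p)"
    using Cons.prems(2) by auto
  have "fst e \<notin> fst ` set p"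
  proof
    assume "fst e \<in> fst ` set p"
    then obtain e' where e': "e' \<in> set p" "fst e' = fst e" by auto
    have "tail (dbl T) e' \<in> set (D.awalk_verts (head (dbl T) e) p)"
      using e'(1) by (auto simp: D.awalk_verts_conv)
    moreover have "head (dbl T) e' \<in> set (D.awalk_verts (head (dbl T) e) p)"
      using e'(1) by (auto simp: D.awalk_verts_conv'[OF c(1)])
    moreover have "tail (dbl T) e \<in> {tail (dbl T) e', head (dbl T) e'}"
      using e'(2) by (cases e; cases e') (auto split: if_splits)
    ultimately show False using d(2) by auto
  qed
  then show ?case using Cons.IH[OF c(1) d(1)] by simp
qed simp

text \<open>U is the component of the tail of t after the removal of t. If it contained the head of
  t, a path from tail to head followed by t backwards would be an undirected cycle in T.\<close>

lemma tree_cut: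
  assumes T: "T \<subseteq> arcs G" and ac: "undirected_acyclic (G\<lparr>arcs := T\<rparr>)" and t: "t \<in> T"
  shows "\<exists>g :: 'a \<Rightarrow> 'k::zero_neq_one. g (tail G t) = 1 \<and> g (head G t) = 0 \<and>
    (\<forall>t'\<in>T - {t}. g (tail G t') = g (head G t'))"
proof -
  let ?D = "dbl (T - {t})"
  interpret D: wf_digraph ?D by (rule wf_dbl) (use T in auto)
  interpret DT: wf_digraph "dbl T" by (rule wf_dbl[OF T])
  define U where "U = {v. tail G t \<rightarrow>\<^sup>*\<^bsub>?D\<^esub> v}"
  have "tail G t \<in> U" using T t by (auto simp: U_def)
  moreover have "head G t \<notin> U"
  proof
    assume "head G t \<in> U"
    then obtain p0 where "D.awalk (tail G t) p0 (head G t)" by (auto simp: U_def D.reachable_awalk)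
    then obtain p where p: "D.apath (tail G t) p (head G t)" using D.apath_awalk_to_apath by blast
    then have c: "D.cas (tail G t) p (head G t)" "distinct (D.awalk_verts (tail G t) p)" "set p \<subseteq> (T - {t}) \<times> UNIV"
      by (auto simp: D.apath_def D.awalk_def)
    \<comment> \<open>For a loop t the path p is empty and this is a cycle of length 1.\<close>
    let ?q = "p @ [(t, False)]"
    have th: "tail (dbl T) = tail ?D" "head (dbl T) = head ?D" by (simp_all add: double_quiver_def fun_eq_iff)
    have cas: "DT.cas u w v \<longleftrightarrow> D.cas u w v" for u w v
      by (induction w arbitrary: u) (simp_all only: DT.cas.simps D.cas.simps th)
    have vs: "DT.awalk_verts u w = D.awalk_verts u w" for u w
      by (induction w arbitrary: u) (simp_all only: DT.awalk_verts.simps D.awalk_verts.simps th)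
    have cT: "DT.cas (tail G t) p (head G t)" using c(1) by (simp only: cas)
    have aw: "DT.awalk (tail G t) ?q (tail G t)"
      unfolding DT.awalk_def using cT c(3) t T DT.awlast_if_cas[OF cT] by (auto simp: DT.cas_append_iff)
    have hd: "hd (DT.awalk_verts (tail G t) p) = tail G t" using cT by (cases p) auto
    obtain x xs where x: "DT.awalk_verts (tail G t) p = x # xs" by (cases "DT.awalk_verts (tail G t) p") auto
    have "DT.awalk_verts (tail G t) ?q = DT.awalk_verts (tail G t) p @ [tail G t]"
    proof (cases "p = []")
      case False
      have "head (dbl T) (last p) = head G t"
        using False DT.awlast_if_cas[OF cT] by (simp add: DT.awalk_verts_conv)
      then show ?thesis using False by (simp add: DT.awalk_verts_conv)
    qed (use cT in \<open>simp add: DT.awalk_verts_conv\<close>)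
    then have "distinct (tl (DT.awalk_verts (tail G t) ?q))"
      using c(2) hd x by (auto simp: vs)
    then have "DT.cycle ?q" unfolding DT.cycle_def using aw by blast
    moreover have "distinct (map fst ?q)"
      using distinct_arcs_path[OF c(1,2)] c(3) by auto
    ultimately show False using ac unfolding undirected_acyclic_def by blast
  qed
  moreover have "tail G t' \<in> U \<longleftrightarrow> head G t' \<in> U" if t': "t' \<in> T - {t}" for t'
  proof -
    have a: "(t', True) \<in> arcs ?D" "(t', False) \<in> arcs ?D" using t' by auto
    have "tail G t' \<rightarrow>\<^sup>*\<^bsub>?D\<^esub> head G t'" "head G t' \<rightarrow>\<^sup>*\<^bsub>?D\<^esub> tail G t'"
      using D.reachable_adjI[OF D.in_arcs_imp_in_arcs_ends[OF a(1)]] D.reachable_adjI[OF D.in_arcs_imp_in_arcs_ends[OF a(2)]] by auto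
    then show ?thesis unfolding U_def using D.reachable_trans by blast
  qed
  ultimately show ?thesis by (intro exI[of _ "\<lambda>v. if v \<in> U then 1 else 0"]) auto
qed

end

text \<open>The functions g t are dual to the arrows of the tree. Subtracting from f the combination
  of the g t weighted by the jumps of f along the tree leaves a function without jumps there; it is
  constant because the tree is connected and contains all vertices. So the jumps of f on all arrows
  are determined by those on T.\<close>

lemma (in fin_digraph) tree_potential:
  assumes T: "T \<subseteq> arcs G" and con: "connected (G\<lparr>arcs := T\<rparr>)" and ac: "undirected_acyclic (G\<lparr>arcs := T\<rparr>)"
  obtains g :: "'b \<Rightarrow> 'a \<Rightarrow> 'k::comm_ring_1" where
    "\<And>t t'. t \<in> T \<Longrightarrow> t' \<in> T \<Longrightarrow> g t (tail G t') - g t (head G t') = (if t' = t then 1 else 0)"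
    "\<And>f c. c \<in> arcs G \<Longrightarrow> f (tail G c) - f (head G c) =
       (\<Sum>t\<in>T. (f (tail G t) - f (head G t)) * (g t (tail G c) - g t (head G c)))"
proof -
  have "\<forall>t. \<exists>g :: 'a \<Rightarrow> 'k. t \<in> T \<longrightarrow> g (tail G t) = 1 \<and> g (head G t) = 0 \<and>
    (\<forall>t'\<in>T - {t}. g (tail G t') = g (head G t'))"
    using tree_cut[OF T ac] by blast
  then obtain g :: "'b \<Rightarrow> 'a \<Rightarrow> 'k" where g: "\<And>t. t \<in> T \<Longrightarrow> g t (tail G t) = 1 \<and> g t (head G t) = 0 \<and>
    (\<forall>t'\<in>T - {t}. g t (tail G t') = g t (head G t'))" by metis
  have d: "g t (tail G t') - g t (head G t') = (if t' = t then 1 else 0)" if "t \<in> T" "t' \<in> T" for t t'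
    using g[OF that(1)] that by auto
  have fT: "finite T" using T finite_arcs finite_subset by blast
  have "f (tail G c) - f (head G c) =
       (\<Sum>t\<in>T. (f (tail G t) - f (head G t)) * (g t (tail G c) - g t (head G c)))" if c: "c \<in> arcs G" for f c
  proof -
    let ?h = "\<lambda>v. f v - (\<Sum>t\<in>T. (f (tail G t) - f (head G t)) * g t v)"
    have "?h (tail G c) = ?h (head G c)"
    proof (rule connected_constant[OF con])
      fix a assume "a \<in> arcs (G\<lparr>arcs := T\<rparr>)"
      then have a: "a \<in> T" by simp
      have "(\<Sum>t\<in>T. (f (tail G t) - f (head G t)) * (g t (tail G a) - g t (head G a))) =
          (\<Sum>t\<in>T. if t = a then f (tail G t) - f (head G t) else 0)"
        using d a by (intro sum.cong) auto
      also have "\<dots> = f (tail G a) - f (head G a)" using a fT by simp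
      finally show "?h (tail (G\<lparr>arcs := T\<rparr>) a) = ?h (head (G\<lparr>arcs := T\<rparr>) a)"
        by (simp add: right_diff_distrib sum_subtractf) (simp add: algebra_simps)
    qed (use c in auto)
    then show ?thesis by (simp add: right_diff_distrib sum_subtractf) (simp add: algebra_simps)
  qed
  with d show thesis by (rule that)
qed

section \<open>Pairs attached to circuits\<close>

context gentle
begin

lemma pdiff_nonzero:
  assumes "pr v w w' \<in> pbasis m" "pdiff m (pr v w w') q \<noteq> 0"
  shows "(\<exists>b\<in>lext v w w'. q = pr v (w @ [b]) (w' @ [b])) \<or> (\<exists>a\<in>rext v w w'. q = pr (tail Q a) (a # w) (a # w'))"
proof (rule ccontr)
  assume "\<not> ?thesis"
  then have "(\<Sum>b\<in>lext v w w'. bvec (pr v (w @ [b]) (w' @ [b])) q) = (0::'k)"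
    "(\<Sum>a\<in>rext v w w'. bvec (pr (tail Q a) (a # w) (a # w')) q) = (0::'k)"
    by (auto intro!: sum.neutral simp: bvec_def)
  then show False using assms(2) by (simp add: pdiff_pr[OF assms(1)])
qed

text \<open>Each term of a differential shares the arrow just added. Pairs without a common first or
  last arrow therefore never occur in a coboundary, which settles the functionals of (VI) and
  (VII).\<close>

lemma pdiff_same_end_or_start:
  assumes "p \<in> pbasis m" "pdiff m p (pr u x x') \<noteq> 0"
  shows "same_end x x' \<or> same_start x x'"
proof -
  obtain v w w' where p: "p = pr v w w'" "pr v w w' \<in> pbasis m" using assms(1) by (rule pbasisE)
  show ?thesis using pdiff_nonzero[OF p(2), of "pr u x x'"] assms(2)
    by (auto simp: p(1) same_end_def same_start_def)
qed

lemma lin_ext_eval_zero: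
  assumes "y \<in> free_space X" "\<And>p. p \<in> X \<Longrightarrow> \<phi> p q = 0"
  shows "lin_ext \<phi> y q = 0"
  using assms unfolding lin_ext_def by (intro sum.neutral) (auto simp: free_space_def)

text \<open>A functional is treated as a map into the functions on a one-point set, so that
  \<open>lin_on_eqI\<close> applies to it.\<close>

lemma lin_on_eval: "lin_on X (\<lambda>y (_::unit). lin_ext \<phi> y q)"
  unfolding lin_on_def by (auto simp: lin_onD[where X = X, OF lin_on_lin_ext])

lemma coboundary_top_zero:
  assumes "b \<in> coboundaries (Suc n)" "\<not> same_end x x'" "\<not> same_start x x'"
  shows "b (pr u x x') = 0"
proof -
  obtain y where y: "y \<in> free_space (pbasis n)" "b = lin_ext (pdiff n) y" using assms(1) by auto
  show ?thesis unfolding y(2)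
    by (rule lin_ext_eval_zero[OF y(1)]) (use pdiff_same_end_or_start assms(2,3) in blast)
qed

lemma cut_image:
  fixes Y :: "'x \<Rightarrow> 'y" and z :: "'y \<Rightarrow> 'k"
  assumes inj: "inj_on Y X" and fin: "finite {q. z q \<noteq> 0}"
  shows "(\<lambda>x. if x \<in> X then z (Y x) else 0) \<in> free_space X"
    "lin_ext (\<lambda>x. bvec (Y x)) (\<lambda>x. if x \<in> X then z (Y x) else 0) = cut (Y ` X) z"
proof -
  let ?y = "\<lambda>x. if x \<in> X then z (Y x) else 0"
  let ?S = "{x \<in> X. z (Y x) \<noteq> 0}"
  have S: "{x. ?y x \<noteq> 0} = ?S" by auto
  have "finite (Y ` ?S)" by (rule finite_subset[OF _ fin]) auto
  then have fS: "finite ?S" by (rule finite_imageD) (use inj in \<open>auto simp: inj_on_def\<close>)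
  then have "finite {x. ?y x \<noteq> 0}" by (simp only: S)
  moreover have "{x. ?y x \<noteq> 0} \<subseteq> X" by auto
  ultimately show "?y \<in> free_space X" unfolding free_space_def by blast
  show "lin_ext (\<lambda>x. bvec (Y x)) ?y = cut (Y ` X) z"
  proof
    fix q
    have l: "lin_ext (\<lambda>x. bvec (Y x)) ?y q = (\<Sum>x\<in>?S. z (Y x) * bvec (Y x) q)"
      unfolding lin_ext_def S by (intro sum.cong) auto
    show "lin_ext (\<lambda>x. bvec (Y x)) ?y q = cut (Y ` X) z q"
    proof (cases "q \<in> Y ` X \<and> z q \<noteq> 0")
      case True
      then obtain x0 where x0: "x0 \<in> ?S" "q = Y x0" by auto
      have "(\<Sum>x\<in>?S. z (Y x) * bvec (Y x) q) = (\<Sum>x\<in>?S. if x = x0 then z q else 0)"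
        using inj x0 by (intro sum.cong) (auto simp: bvec_def inj_on_def)
      then show ?thesis using True x0 fS l by (simp add: cut_def)
    next
      case False
      then have "(\<Sum>x\<in>?S. z (Y x) * bvec (Y x) q) = 0" by (intro sum.neutral) (auto simp: bvec_def)
      then show ?thesis using False l by (auto simp: cut_def)
    qed
  qed
qed

end

text \<open>On the span of the pairs \<open>E x\<close> attached to the cycles \<open>x\<close>, the differential is
  \<open>id - \<epsilon> rot\<close> followed by \<open>x \<mapsto> Y x\<close>. So the kernel and the cokernel are read off the
  rotation orbits: each has one class per circuit if \<open>\<epsilon> = 1\<close>, and both vanish if \<open>\<epsilon> = -1 \<noteq> 1\<close>
  and all periods are odd.\<close>

locale circuit_pairs = gentle Q I + cyclic_system X "rot Q" R
  for Q :: "('v, 'a) pre_digraph" and I :: "(('v, 'a) path \<Rightarrow> 'k::field) set" and X R +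
  fixes n :: nat and E Y :: "('v, 'a) path \<Rightarrow> ('v, 'a) path \<times> ('v, 'a) path" and \<epsilon> :: 'k
  assumes E_pbasis: "x \<in> X \<Longrightarrow> E x \<in> pbasis n"
    and pdiff_E: "x \<in> X \<Longrightarrow> pdiff n (E x) = (\<lambda>q. bvec (Y x) q - \<epsilon> * bvec (Y (rot Q x)) q)"
    and pdiff_Y: "x \<in> X \<Longrightarrow> p \<in> pbasis n \<Longrightarrow> pdiff n p (Y x) \<noteq> 0 \<Longrightarrow> p \<in> E ` X"
    and inj_E: "inj_on E X" and inj_Y: "inj_on Y X"
begin

lemma rot_inj: "x \<in> X \<Longrightarrow> x' \<in> X \<Longrightarrow> rot Q x = rot Q x' \<longleftrightarrow> x = x'"
proof
  assume x: "x \<in> X" "x' \<in> X" and e: "rot Q x = rot Q x'"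
  \<comment> \<open>A common multiple of both periods, so the power with exponent ?k - 1 undoes one
    rotation on both points.\<close>
  let ?k = "per x * per x'"
  have "(rot Q ^^ ?k) x = x" "(rot Q ^^ ?k) x' = x'"
    using funpow_mod_eq[OF per(2)[OF x(1)], of ?k] funpow_mod_eq[OF per(2)[OF x(2)], of ?k] by simp_all
  moreover have "?k = Suc (?k - 1)" using per(1)[OF x(1)] per(1)[OF x(2)] by (cases ?k) auto
  then have "(rot Q ^^ ?k) x = (rot Q ^^ ?k) x'" using e by (metis comp_apply funpow_Suc_right)
  ultimately show "x = x'" by simp
qed simp

lemma bvec_Y: "x \<in> X \<Longrightarrow> x' \<in> X \<Longrightarrow> bvec (Y x) (Y x') = (bvec x x' :: 'k)"
  using inj_Y by (auto simp: bvec_def inj_on_def)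

lemma bvec_E: "x \<in> X \<Longrightarrow> x' \<in> X \<Longrightarrow> bvec (E x) (E x') = (bvec x x' :: 'k)"
  using inj_E by (auto simp: bvec_def inj_on_def)

lemma pdiff_E_Y: "x \<in> X \<Longrightarrow> x' \<in> X \<Longrightarrow> pdiff n (E x) (Y x') = bvec x x' - \<epsilon> * bvec (rot Q x) x'"
  by (simp add: pdiff_E bvec_Y closed)

text \<open>The coefficient of the differential of z at Y (rot x) receives z (E (rot x)) with
  coefficient 1, z (E x) with coefficient - \<epsilon>, and by \<open>pdiff_Y\<close> nothing
  else.\<close>

lemma cocycle_E:
  assumes z: "z \<in> cocycles n" and x: "x \<in> X"
  shows "z (E (rot Q x)) = \<epsilon> * z (E x)"
proof -
  have zs: "z \<in> free_space (pbasis n)" "lin_ext (pdiff n) z = (\<lambda>_. 0)" using z by (auto simp: cocycles_iff)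
  have "(\<lambda>_::unit. lin_ext (pdiff n) z (Y (rot Q x))) = (\<lambda>_. z (E (rot Q x)) - \<epsilon> * z (E x))"
  proof (rule lin_on_eqI[where \<Phi> = "\<lambda>z _. lin_ext (pdiff n) z (Y (rot Q x))", OF _ _ _ zs(1)])
    show "lin_on (pbasis n) (\<lambda>z (_::unit). lin_ext (pdiff n) z (Y (rot Q x)))"
      by (rule lin_on_eval)
    show "lin_on (pbasis n) (\<lambda>z (_::unit). z (E (rot Q x)) - \<epsilon> * z (E x))"
      unfolding lin_on_def by (simp add: algebra_simps)
    fix p assume p: "p \<in> pbasis n"
    show "(\<lambda>_. lin_ext (pdiff n) (bvec p) (Y (rot Q x))) = (\<lambda>_::unit. bvec p (E (rot Q x)) - \<epsilon> * bvec p (E x))"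
    proof (cases "p \<in> E ` X")
      case True
      then obtain x' where x': "x' \<in> X" "p = E x'" by auto
      have "bvec (rot Q x') (rot Q x) = (bvec x' x :: 'k)" using rot_inj[OF x' (1) x] by (auto simp: bvec_def)
      then show ?thesis using x' x by (simp add: pdiff_E_Y bvec_E closed)
    next
      case False
      then have "pdiff n p (Y (rot Q x)) = 0" using pdiff_Y[OF closed[OF x] p] by blast
      moreover have "bvec p (E (rot Q x)) = (0::'k)" "bvec p (E x) = (0::'k)"
        using False x closed[OF x] by (auto simp: bvec_def)
      ultimately show ?thesis by simp
    qed
  qed
  then show ?thesis using zs(2) by (simp add: fun_eq_iff)
qed

text \<open>The sum over an orbit kills every difference between a point and its rotation. Pairs
  other than the E x do not reach the Y x at all.\<close>

lemma coboundary_Y: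
  assumes b: "b \<in> coboundaries (Suc n)" and p: "p \<in> R" and e: "\<epsilon> = 1"
  shows "(\<Sum>i<per p. b (Y ((rot Q ^^ i) p))) = 0"
proof -
  have pX: "p \<in> X" using p reps by auto
  obtain y where y: "y \<in> free_space (pbasis n)" "b = lin_ext (pdiff n) y" using b by auto
  let ?\<phi> = "\<lambda>q (_::unit). \<Sum>i<per p. pdiff n q (Y ((rot Q ^^ i) p))"
  have "(\<Sum>i<per p. b (Y ((rot Q ^^ i) p))) = lin_ext ?\<phi> y ()"
    unfolding y(2) lin_ext_def by (subst sum.swap) (simp add: sum_distrib_left)
  also have "\<dots> = 0"
  proof (rule lin_ext_eval_zero[OF y(1)])
    fix q assume q: "q \<in> pbasis n"
    show "?\<phi> q () = 0"
    proof (cases "q \<in> E ` X")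
      case True
      then obtain x where x: "x \<in> X" "q = E x" by auto
      have "?\<phi> q () = (\<Sum>i<per p. bvec x ((rot Q ^^ i) p)) - (\<Sum>i<per p. bvec (rot Q x) ((rot Q ^^ i) p))"
        by (simp add: x pdiff_E_Y pow_closed[OF pX] e sum_subtractf)
      also have "\<dots> = bvec (rep x) p - bvec (rep (rot Q x)) p"
        using x by (simp add: sum_orbit_bvec[OF p] closed)
      also have "rep (rot Q x) = rep x" using rep_pow[OF x(1), of 1] by simp
      finally show ?thesis by simp
    next
      case False
      then have "pdiff n q (Y ((rot Q ^^ i) p)) = 0" for i using pdiff_Y[OF pow_closed[OF pX] q] by blast
      then show ?thesis by simp
    qed
  qed
  finally show ?thesis .
qed

lemma push_coboundary:
  assumes "w \<in> free_space X"
  shows "lin_ext (\<lambda>x. bvec (Y x)) (lin_ext (\<lambda>x q. bvec x q - \<epsilon> * bvec (rot Q x) q) w) \<in> coboundaries (Suc n)"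
proof -
  have fw: "finite {x. w x \<noteq> 0}" "\<And>x. w x \<noteq> 0 \<Longrightarrow> x \<in> X" using assms by (auto simp: free_space_def)
  have f: "finite {q. bvec x q - \<epsilon> * bvec (rot Q x) q \<noteq> 0}" for x
    by (rule finite_subset[of _ "{x, rot Q x}"]) (auto simp: bvec_def)
  have ly: "lin_ext (\<lambda>x. bvec (Y x)) (\<lambda>q. bvec x q - \<epsilon> * bvec (rot Q x) q) = (\<lambda>q. bvec (Y x) q - \<epsilon> * bvec (Y (rot Q x)) q)" for x
    using lin_on_diff[OF lin_on_lin_ext, of "bvec x" UNIV "\<lambda>q. \<epsilon> * bvec (rot Q x) q" "\<lambda>x. bvec (Y x)"]
    by (simp add: scale_free_space lin_ext_scale)
  have "lin_ext (\<lambda>x. bvec (Y x)) (lin_ext (\<lambda>x q. bvec x q - \<epsilon> * bvec (rot Q x) q) w) =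
      lin_ext (\<lambda>x. lin_ext (pdiff n) (bvec (E x))) w"
    unfolding lin_ext_comp[OF fw(1) f] ly by (rule lin_ext_cong) (simp add: pdiff_E fw(2))
  also have "\<dots> = lin_ext (pdiff n) (lin_ext (\<lambda>x. bvec (E x)) w)"
    by (rule lin_ext_comp[OF fw(1), symmetric]) (simp add: bvec_supp)
  finally show ?thesis
    using lin_ext_closed[OF assms, of "\<lambda>x. bvec (E x)" "pbasis n"] E_pbasis by auto
qed

lemma cut_Y_coboundary:
  assumes z: "z \<in> free_space (pbasis k)" and e: "\<epsilon> = 1"
    and sums: "\<And>p. p \<in> R \<Longrightarrow> (\<Sum>i<per p. z (Y ((rot Q ^^ i) p))) = 0"
  shows "cut (Y ` X) z \<in> coboundaries (Suc n)"
proof -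
  have fz: "finite {q. z q \<noteq> 0}" using z by (simp add: free_space_def)
  let ?y = "\<lambda>x. if x \<in> X then z (Y x) else 0"
  have "\<exists>w\<in>free_space X. ?y = lin_ext (\<lambda>x q. bvec x q - bvec (rot Q x) q) w"
  proof (rule difference_image[OF cut_image(1)[OF inj_Y fz]])
    fix p assume p: "p \<in> R"
    then have "p \<in> X" using reps by auto
    then show "(\<Sum>i<per p. ?y ((rot Q ^^ i) p)) = 0" using sums[OF p] by (simp add: pow_closed)
  qed
  then obtain w where "w \<in> free_space X" "?y = lin_ext (\<lambda>x q. bvec x q - bvec (rot Q x) q) w" by blast
  then show ?thesis using push_coboundary[of w] e cut_image(2)[OF inj_Y fz] by simp
qed

lemma cut_Y_coboundary_odd:
  assumes z: "z \<in> free_space (pbasis k)" and e: "\<epsilon> = - 1"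
    and odd: "\<And>x. x \<in> X \<Longrightarrow> odd (per x)" and two: "(2::'k) \<noteq> 0"
  shows "cut (Y ` X) z \<in> coboundaries (Suc n)"
proof -
  have fz: "finite {q. z q \<noteq> 0}" using z by (simp add: free_space_def)
  obtain w where "w \<in> free_space X"
    "(\<lambda>x. if x \<in> X then z (Y x) else 0) = lin_ext (\<lambda>x q. bvec x q + bvec (rot Q x) q) w"
    using sum_image[OF cut_image(1)[OF inj_Y fz] odd two] by blast
  then show ?thesis using push_coboundary[of w] e cut_image(2)[OF inj_Y fz] by simp
qed

lemma sum_E_cocycle:
  assumes x: "x \<in> X" and e: "\<epsilon> = 1"
  shows "(\<lambda>q. \<Sum>i<per x. bvec (E ((rot Q ^^ i) x)) q) \<in> cocycles n"
proof -
  have "(\<lambda>q. \<Sum>i<per x. bvec (E ((rot Q ^^ i) x)) q) \<in> free_space (pbasis n)"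
    by (intro sum_free_space) (simp add: E_pbasis pow_closed x)
  moreover have "lin_ext (pdiff n) (\<lambda>q. \<Sum>i<per x. bvec (E ((rot Q ^^ i) x)) q) =
      (\<lambda>q. (\<Sum>i<per x. bvec (Y ((rot Q ^^ i) x)) q) - (\<Sum>i<per x. bvec (Y ((rot Q ^^ Suc i) x)) q))"
    using lin_on_sum[OF lin_on_lin_ext, of "{..<per x}" "\<lambda>i. bvec (E ((rot Q ^^ i) x))" "pbasis n" "pdiff n"]
    by (simp add: E_pbasis pow_closed x pdiff_E e sum_subtractf)
  ultimately show ?thesis
    using sum_shift[OF x, of "\<lambda>x. bvec (Y x) _ :: 'k"] by (simp add: cocycles_iff fun_eq_iff)
qed

lemma dual_E:
  assumes "p \<in> R" "q \<in> R"
  shows "(\<Sum>i<per p. bvec (E ((rot Q ^^ i) p)) (E q)) = (if q = p then 1 else (0::'k))"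
proof -
  have X: "p \<in> X" "q \<in> X" using assms reps by auto
  have "(\<Sum>i<per p. bvec (E ((rot Q ^^ i) p)) (E q)) = (\<Sum>i<per p. bvec q ((rot Q ^^ i) p) :: 'k)"
    by (intro sum.cong) (auto simp: bvec_E pow_closed X, auto simp: bvec_def)
  then show ?thesis using sum_orbit_bvec[OF assms(1) X(2)] rep_rep[OF assms(2)] by (auto simp: bvec_def)
qed

lemma dual_Y:
  assumes "p \<in> R" "q \<in> R"
  shows "(\<Sum>i<per p. bvec (Y q) (Y ((rot Q ^^ i) p))) = (if p = q then 1 else (0::'k))"
proof -
  have X: "p \<in> X" "q \<in> X" using assms reps by auto
  have "(\<Sum>i<per p. bvec (Y q) (Y ((rot Q ^^ i) p))) = (\<Sum>i<per p. bvec q ((rot Q ^^ i) p) :: 'k)"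
    by (intro sum.cong) (auto simp: bvec_Y pow_closed X)
  then show ?thesis using sum_orbit_bvec[OF assms(1) X(2)] rep_rep[OF assms(2)] by (auto simp: bvec_def)
qed

end

text \<open>In the role of E the pairs \<open>pair_EB\<close> and \<open>pair_EG\<close> underlie
  the families (III) and (VII). In the role of Y, one degree higher, \<open>pair_YB\<close> and
  \<open>pair_YG\<close> underlie (V) and (VIII).\<close>

definition pair_EB :: "('v, 'a) path \<Rightarrow> ('v, 'a) path \<times> ('v, 'a) path" where
  "pair_EB x = (vpath (psrc x), x)"

definition pair_YB :: "('v, 'a) pre_digraph \<Rightarrow> ('v, 'a) path \<Rightarrow> ('v, 'a) path \<times> ('v, 'a) path" where
  "pair_YB Q x = (arrow Q (hd (snd x)), pcomp (arrow Q (hd (snd x))) x)"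

definition pair_EG :: "('v, 'a) path \<Rightarrow> ('v, 'a) path \<times> ('v, 'a) path" where
  "pair_EG x = (x, vpath (psrc x))"

definition pair_YG :: "('v, 'a) pre_digraph \<Rightarrow> ('v, 'a) path \<Rightarrow> ('v, 'a) path \<times> ('v, 'a) path" where
  "pair_YG Q x = (pcomp (arrow Q (hd (snd x))) x, arrow Q (hd (snd x)))"

section \<open>Cocomplete and complete circuits as instances\<close>

context gentle
begin

sublocale N: arrow_step Q nrel
  by unfold_locales (use nrelD nrel_det in blast)+

sublocale L: arrow_step Q rel
  by unfold_locales (use relD rel_det in blast)+

lemma pair_eqs:
  "pair_EB (v, w) = pr v [] w"
  "pair_EG (v, w) = pr v w []"
  "v = tail Q (hd w) \<Longrightarrow> pair_YB Q (v, w) = pr v [hd w] (w @ [hd w])"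
  "v = tail Q (hd w) \<Longrightarrow> pair_YG Q (v, w) = pr v (w @ [hd w]) [hd w]"
  by (simp_all add: pair_EB_def pair_EG_def pair_YB_def pair_YG_def vpath_eq arrow_def pcomp_eq)

lemma cyc_path_facts:
  assumes "(v, w) \<in> arrow_step.cyc_paths Q P" "P = nrel \<or> P = rel"
  shows "w \<noteq> []" "chain_path Q P v w" "P (last w) (hd w)" "v = tail Q (hd w)" "head Q (last w) = v"
    "hd w \<in> arcs Q" "last w \<in> arcs Q" "v \<in> verts Q"
proof -
  have "arrow_step Q P" using assms(2) N.arrow_step_axioms L.arrow_step_axioms by auto
  then interpret arrow_step Q P .
  show h: "w \<noteq> []" "chain_path Q P v w" "P (last w) (hd w)" using assms(1) by (auto simp: cyc_paths_def)
  then show "v = tail Q (hd w)" "v \<in> verts Q" by (auto simp: chain_path_def)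
  then show "head Q (last w) = v" "hd w \<in> arcs Q" "last w \<in> arcs Q" using P_arcs[OF h(3)] by auto
qed

lemma rot_snoc: "rot Q (v, w @ [l]) = (tail Q l, l # w)"
  by (simp add: rot_def)

text \<open>A cycle x can be prolonged only by its own first arrow at the end, which gives the
  Y-pair of x, and by its own last arrow at the beginning, which gives the Y-pair of its
  rotation.\<close>

lemma circuit_pairs_B:
  assumes "cyclic_system N.cyc_paths (rot Q) R"
  shows "circuit_pairs Q I N.cyc_paths R 0 pair_EB (pair_YB Q) 1"
proof (intro circuit_pairs.intro gentle_axioms assms circuit_pairs_axioms.intro)
  fix x assume x: "x \<in> N.cyc_paths"
  obtain v w where xv: "x = (v, w)" by (cases x)
  note c = cyc_path_facts[OF x[unfolded xv], simplified]
  show E: "pair_EB x \<in> pbasis 0"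
    using c by (simp add: xv pair_eqs pbasis_pr ptgt_eq)
  have L: "lext v [] w = {hd w}"
  proof (rule lext_single)
    show "hd w \<in> lext v [] w" using c by (simp add: lext_def nrel_snoc ptgt_eq)
  qed (use c in simp)
  have R: "rext v [] w = {last w}"
  proof (rule rext_single)
    show "last w \<in> rext v [] w" using c by (simp add: rext_def nrel_Cons)
  qed (use c in simp)
  obtain u l where w: "w = u @ [l]" using c(1) by (cases w rule: rev_cases) auto
  have Y: "pair_YB Q x = pr v [hd w] (w @ [hd w])" using c(4) by (simp add: xv pair_eqs)
  have Y': "pair_YB Q (rot Q x) = pr (tail Q (last w)) [last w] (last w # w)"
    by (simp add: xv w rot_snoc pair_eqs)
  show "pdiff 0 (pair_EB x) = (\<lambda>q. bvec (pair_YB Q x) q - 1 * bvec (pair_YB Q (rot Q x)) q)"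
    using E unfolding Y Y' unfolding xv pair_eqs by (simp add: pdiff_pr L R)
  fix p assume p: "p \<in> pbasis 0" and nz: "pdiff 0 p (pair_YB Q x) \<noteq> 0"
  obtain v1 w1 w1' where p1: "p = pr v1 w1 w1'" "pr v1 w1 w1' \<in> pbasis 0" using p by (rule pbasisE)
  have w1: "w1 = []" using p1 by (simp add: pbasis_pr)
  have "(v1, w1') \<in> N.cyc_paths"
    using pdiff_nonzero[OF p1(2) nz[unfolded p1(1)]] unfolding Y
  proof
    assume "\<exists>b\<in>lext v1 w1 w1'. pr v [hd w] (w @ [hd w]) = pr v1 (w1 @ [b]) (w1' @ [b])"
    then show ?thesis using x xv by auto
  next
    assume "\<exists>a\<in>rext v1 w1 w1'. pr v [hd w] (w @ [hd w]) = pr (tail Q a) (a # w1) (a # w1')"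
    then obtain a where a: "a \<in> rext v1 w1 w1'" "hd w = a" "w @ [hd w] = a # w1'" by auto
    have ne: "w1' \<noteq> []" "last w1' = a" using a(2,3) c(1) by (cases w; auto)+
    have "nrel a (hd w1')" using a(1) ne by (auto simp: rext_def nrel_Cons)
    then show ?thesis using ne p1(2) by (simp add: N.cyc_paths_def pbasis_pr)
  qed
  then show "p \<in> pair_EB ` N.cyc_paths" by (intro image_eqI[of _ _ "(v1, w1')"]) (simp_all add: pair_eqs p1(1) w1)
next
  show "inj_on pair_EB N.cyc_paths" by (simp add: inj_on_def pair_EB_def)
  show "inj_on (pair_YB Q) N.cyc_paths"
    by (auto simp: inj_on_def pair_YB_def pcomp_def arrow_def prod_eq_iff)
qed

text \<open>The length of a complete cycle is the degree of its E-pair and fixes the sign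
  \<epsilon>, so complete circuits are treated one length at a time. All cocomplete ones sit in
  degree 0.\<close>

lemma cyclic_system_restrict:
  assumes "cyclic_system X (rot Q) R" and pl: "\<And>x. x \<in> X \<Longrightarrow> plen (rot Q x) = plen x"
  shows "cyclic_system {x \<in> X. plen x = n} (rot Q) {p \<in> R. plen p = n}"
proof -
  interpret cyclic_system X "rot Q" R by fact
  have pl': "plen ((rot Q ^^ i) x) = plen x" if "x \<in> X" for i x
    using that pl pow_closed by (induction i) auto
  show ?thesis
  proof
    show "rot Q x \<in> {x \<in> X. plen x = n}" if "x \<in> {x \<in> X. plen x = n}" for x using that closed pl by auto
    show "\<exists>i. 1 \<le> i \<and> (rot Q ^^ i) x = x" if "x \<in> {x \<in> X. plen x = n}" for x using that periodic by auto
    show "{p \<in> R. plen p = n} \<subseteq> {x \<in> X. plen x = n}" using reps by auto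
    fix x assume x: "x \<in> {x \<in> X. plen x = n}"
    have "p \<in> {p \<in> R. plen p = n} \<and> (\<exists>i. p = (rot Q ^^ i) x) \<longleftrightarrow> p \<in> R \<and> (\<exists>i. p = (rot Q ^^ i) x)" for p
    proof -
      have "plen p = n" if "p = (rot Q ^^ i) x" for i using that pl'[of x i] x by simp
      then show ?thesis by blast
    qed
    then show "\<exists>!p. p \<in> {p \<in> R. plen p = n} \<and> (\<exists>i. p = (rot Q ^^ i) x)" using uniq x by simp
  qed
qed

lemma plen_rot: "x \<in> arrow_step.cyc_paths Q P \<Longrightarrow> P = nrel \<or> P = rel \<Longrightarrow> plen (rot Q x) = plen x"
  using cyc_path_facts(1)[of "fst x" "snd x" P] by (cases x) (auto simp: rot_def plen_def)

lemma circuit_pairs_G: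
  assumes S: "cyclic_system L.cyc_paths (rot Q) R" and n: "1 \<le> n"
  shows "circuit_pairs Q I {x \<in> L.cyc_paths. plen x = n} {p \<in> R. plen p = n} n pair_EG (pair_YG Q) ((-1) ^ n)"
proof (intro circuit_pairs.intro gentle_axioms circuit_pairs_axioms.intro cyclic_system_restrict[OF S])
  fix x assume "x \<in> {x \<in> L.cyc_paths. plen x = n}"
  then have x: "x \<in> L.cyc_paths" "plen x = n" by auto
  obtain v w where xv: "x = (v, w)" by (cases x)
  have lw: "length w = n" using x(2) xv by simp
  note c = cyc_path_facts[OF x(1)[unfolded xv], simplified]
  show E: "pair_EG x \<in> pbasis n"
    using c lw by (simp add: xv pair_eqs pbasis_pr ptgt_eq)
  have L: "lext v w [] = {hd w}"
  proof (rule lext_single)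
    show "hd w \<in> lext v w []" using c by (simp add: lext_def rel_snoc ptgt_eq)
  qed (use c in simp)
  have R: "rext v w [] = {last w}"
  proof (rule rext_single)
    show "last w \<in> rext v w []" using c by (simp add: rext_def rel_Cons)
  qed (use c in simp)
  obtain u l where w: "w = u @ [l]" using c(1) by (cases w rule: rev_cases) auto
  have Y: "pair_YG Q x = pr v (w @ [hd w]) [hd w]" using c(4) by (simp add: xv pair_eqs)
  have Y': "pair_YG Q (rot Q x) = pr (tail Q (last w)) (last w # w) [last w]"
    by (simp add: xv w rot_snoc pair_eqs)
  show "pdiff n (pair_EG x) = (\<lambda>q. bvec (pair_YG Q x) q - (-1) ^ n * bvec (pair_YG Q (rot Q x)) q)"
    using E unfolding Y Y' unfolding xv pair_eqs by (simp add: pdiff_pr L R)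
  fix p assume p: "p \<in> pbasis n" and nz: "pdiff n p (pair_YG Q x) \<noteq> 0"
  obtain v1 w1 w1' where p1: "p = pr v1 w1 w1'" "pr v1 w1 w1' \<in> pbasis n" using p by (rule pbasisE)
  have lw1: "length w1 = n" using p1 by (simp add: pbasis_pr)
  have "(v1, w1) \<in> L.cyc_paths \<and> w1' = []"
    using pdiff_nonzero[OF p1(2) nz[unfolded p1(1)]] unfolding Y
  proof
    assume "\<exists>b\<in>lext v1 w1 w1'. pr v (w @ [hd w]) [hd w] = pr v1 (w1 @ [b]) (w1' @ [b])"
    then show ?thesis using x xv by auto
  next
    assume "\<exists>a\<in>rext v1 w1 w1'. pr v (w @ [hd w]) [hd w] = pr (tail Q a) (a # w1) (a # w1')"
    then obtain a where a: "a \<in> rext v1 w1 w1'" "hd w = a" "w @ [hd w] = a # w1" "w1' = []" by auto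
    have ne: "w1 \<noteq> []" "last w1 = a" using a(2,3) c(1) by (cases w; auto)+
    have "rel a (hd w1)" using a(1) ne by (auto simp: rext_def rel_Cons)
    then show ?thesis using ne p1(2) a(4) by (simp add: L.cyc_paths_def pbasis_pr)
  qed
  then show "p \<in> pair_EG ` {x \<in> L.cyc_paths. plen x = n}"
    by (intro image_eqI[of _ _ "(v1, w1)"]) (simp_all add: pair_eqs p1(1) lw1)
next
  show "plen (rot Q x) = plen x" if "x \<in> L.cyc_paths" for x using plen_rot[OF that] by simp
  show "inj_on pair_EG {x \<in> L.cyc_paths. plen x = n}" by (simp add: inj_on_def pair_EG_def)
  show "inj_on (pair_YG Q) {x \<in> L.cyc_paths. plen x = n}"
    by (auto simp: inj_on_def pair_YG_def pcomp_def arrow_def prod_eq_iff)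
qed

section \<open>Maximal paths and the diagonal\<close>

text \<open>A set given by a condition on consecutive arrows is closed under subpaths, so a proper
  extension within it contains an extension by a single arrow.\<close>

lemma maximal_in_iff:
  assumes S: "\<And>v w. (v, w) \<in> S \<longleftrightarrow> chain_path Q P v w" and P: "\<And>a b. P a b \<Longrightarrow> head Q a = tail Q b"
  shows "maximal_in Q S (v, w) \<longleftrightarrow> chain_path Q P v w \<and> (\<forall>b. \<not> chain_path Q P v (w @ [b])) \<and>
    (\<forall>a. head Q a = v \<longrightarrow> \<not> chain_path Q P (tail Q a) (a # w))" (is "_ \<longleftrightarrow> ?c \<and> ?l \<and> ?r")
proof -
  have app: "chain_path Q P v (w1 @ w2) \<longleftrightarrow> chain_path Q P v w1 \<and> chain_path Q P (ptgt Q (v, w1)) w2 \<and>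
      (w1 \<noteq> [] \<longrightarrow> w2 \<noteq> [] \<longrightarrow> P (last w1) (hd w2))" for v w1 w2
    by (rule chain_path_append[OF P wf])
  have qp: "(v', w') \<in> qpaths Q" if "chain_path Q P v' w'" for v' w'
    using that P unfolding qpaths_chain_path[OF wf] chain_path_def by (auto intro: successively_mono)
  have "(\<exists>q\<in>S. q \<noteq> (v, w) \<and> subpath Q (v, w) q) \<longleftrightarrow> \<not> (?l \<and> ?r)" if c: ?c
  proof
    assume "\<exists>q\<in>S. q \<noteq> (v, w) \<and> subpath Q (v, w) q"
    then obtain v' w' where q: "chain_path Q P v' w'" "(v', w') \<noteq> (v, w)" "subpath Q (v, w) (v', w')"
      by (metis S surj_pair)
    then obtain x y where xy: "w' = x @ w @ y" "v = ptgt Q (v', x)" using subpath_iff[OF qp[OF q(1)]] by auto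
    have ch: "chain_path Q P v' x" "chain_path Q P v (w @ y)" "x \<noteq> [] \<longrightarrow> w @ y \<noteq> [] \<longrightarrow> P (last x) (hd (w @ y))"
      using q(1) unfolding xy(1) app[of v' x] using xy(2) by auto
    show "\<not> (?l \<and> ?r)"
    proof (cases y)
      case (Cons b y')
      have "chain_path Q P v ((w @ [b]) @ y')" using ch(2) Cons by simp
      then show ?thesis using app[of v "w @ [b]" y'] by blast
    next
      case Nil
      then have xne: "x \<noteq> []" using q(2) xy by (auto simp: ptgt_eq)
      then obtain x0 a where x0: "x = x0 @ [a]" by (cases x rule: rev_cases) auto
      have hv: "head Q a = v" using xy(2) x0 by (simp add: ptgt_eq)
      have "chain_path Q P (tail Q a) [a]" using ch(1) unfolding x0 app[of v' x0] by (auto simp: chain_path_def)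
      moreover have "ptgt Q (tail Q a, [a]) = v" using hv by (simp add: ptgt_eq)
      ultimately have "chain_path Q P (tail Q a) ([a] @ w)" using c ch(3) Nil x0
        unfolding app[of "tail Q a" "[a]" w] by auto
      then show ?thesis using hv by auto
    qed
  next
    assume "\<not> (?l \<and> ?r)"
    then consider b where "chain_path Q P v (w @ [b])" | a where "head Q a = v" "chain_path Q P (tail Q a) (a # w)" by blast
    then show "\<exists>q\<in>S. q \<noteq> (v, w) \<and> subpath Q (v, w) q"
    proof cases
      case 1
      have "subpath Q (v, w) (v, w @ [b])" unfolding subpath_iff[OF qp[OF 1]]
        by (intro exI[of _ "[]"] exI[of _ "[b]"]) (simp add: ptgt_eq)
      then show ?thesis using 1 by (intro bexI[of _ "(v, w @ [b])"]) (auto simp: S)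
    next
      case 2
      have "subpath Q (v, w) (tail Q a, a # w)" unfolding subpath_iff[OF qp[OF 2(2)]]
        using 2(1) by (intro exI[of _ "[a]"] exI[of _ "[]"]) (simp add: ptgt_eq)
      then show ?thesis using 2 by (intro bexI[of _ "(tail Q a, a # w)"]) (auto simp: S)
    qed
  qed
  then show ?thesis unfolding maximal_in_def S by blast
qed

text \<open>If the last arrows of the components differ and both end where b starts, b is related to
  exactly one of them and unrelated to the other. So an arrow that prolongs one component prolongs
  both. This turns maximality of a single component into a property of the pair.\<close>

lemma lext_rext_iff:
  assumes p: "pr v w w' \<in> pbasis m" and se: "\<not> same_end w w'" and ss: "\<not> same_start w w'"
  shows "w \<noteq> [] \<Longrightarrow> b \<in> lext v w w' \<longleftrightarrow> chain_path Q rel v (w @ [b])"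
    and "w' \<noteq> [] \<Longrightarrow> b \<in> lext v w w' \<longleftrightarrow> chain_path Q nrel v (w' @ [b])"
    and "w \<noteq> [] \<Longrightarrow> a \<in> rext v w w' \<longleftrightarrow> chain_path Q rel (tail Q a) (a # w) \<and> head Q a = v"
    and "w' \<noteq> [] \<Longrightarrow> a \<in> rext v w w' \<longleftrightarrow> chain_path Q nrel (tail Q a) (a # w') \<and> head Q a = v"
proof -
  have c: "chain_path Q rel v w" "chain_path Q nrel v w'" "ptgt Q (v, w) = ptgt Q (v, w')"
    using p by (auto simp: pbasis_pr)
  have la: "last u \<in> arcs Q \<and> head Q (last u) = ptgt Q (v, u) \<and> hd u \<in> arcs Q \<and> tail Q (hd u) = v"
    if "u \<noteq> []" "chain_path Q P v u" for u P
    using that last_in_set[of u] hd_in_set[of u] by (auto simp: chain_path_def ptgt_eq)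
  have 1: "rel (last w) b \<longleftrightarrow> nrel (last w') b" if "w \<noteq> []" "w' \<noteq> []" "b \<in> arcs Q" "tail Q b = ptgt Q (v, w)" for b
  proof -
    have "last w \<in> arcs Q" "head Q (last w) = tail Q b" "last w' \<in> arcs Q" "head Q (last w') = tail Q b" "last w \<noteq> last w'"
      using that c la[of w rel] la[of w' nrel] se by (auto simp: same_end_def)
    then show ?thesis using that(3) rel_or_nrel[of "last w" b] rel_or_nrel[of "last w'" b]
        rel_inj[of "last w" b "last w'"] nrel_inj[of "last w" b "last w'"] by blast
  qed
  have 2: "rel a (hd w) \<longleftrightarrow> nrel a (hd w')" if "w \<noteq> []" "w' \<noteq> []" "a \<in> arcs Q" "head Q a = v" for a
  proof -
    have "hd w \<in> arcs Q" "tail Q (hd w) = head Q a" "hd w' \<in> arcs Q" "tail Q (hd w') = head Q a" "hd w \<noteq> hd w'"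
      using that c la[of w rel] la[of w' nrel] ss by (auto simp: same_start_def)
    then show ?thesis using that(3) rel_or_nrel[of a "hd w"] rel_or_nrel[of a "hd w'"]
        rel_det[of a "hd w" "hd w'"] nrel_det[of a "hd w" "hd w'"] by metis
  qed
  show "b \<in> lext v w w' \<longleftrightarrow> chain_path Q rel v (w @ [b])" if "w \<noteq> []"
    using that c 1[of b] by (auto simp: lext_def rel_snoc nrel_snoc)
  show "b \<in> lext v w w' \<longleftrightarrow> chain_path Q nrel v (w' @ [b])" if "w' \<noteq> []"
    using that c 1[of b] by (auto simp: lext_def rel_snoc nrel_snoc)
  show "a \<in> rext v w w' \<longleftrightarrow> chain_path Q rel (tail Q a) (a # w) \<and> head Q a = v" if "w \<noteq> []"
    using that c 2[of a] by (auto simp: rext_def rel_Cons nrel_Cons)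
  show "a \<in> rext v w w' \<longleftrightarrow> chain_path Q nrel (tail Q a) (a # w') \<and> head Q a = v" if "w' \<noteq> []"
    using that c 2[of a] by (auto simp: rext_def rel_Cons nrel_Cons)
qed

lemma maximal_\<Gamma>_iff:
  assumes p: "pr v w w' \<in> pbasis m" and "\<not> same_end w w'" "\<not> same_start w w'" and "w \<noteq> []"
  shows "maximal_in Q (\<Gamma> Q I) (v, w) \<longleftrightarrow> lext v w w' = {} \<and> rext v w w' = {}"
proof -
  have "maximal_in Q (\<Gamma> Q I) (v, w) \<longleftrightarrow> chain_path Q rel v w \<and> (\<forall>b. \<not> chain_path Q rel v (w @ [b])) \<and>
    (\<forall>a. head Q a = v \<longrightarrow> \<not> chain_path Q rel (tail Q a) (a # w))"
    by (rule maximal_in_iff[OF \<Gamma>_iff]) (simp add: relD)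
  then show ?thesis using lext_rext_iff(1,3)[OF assms(1-3,4)] p by (auto simp: pbasis_pr)
qed

lemma maximal_\<B>_iff:
  assumes p: "pr v w w' \<in> pbasis m" and "\<not> same_end w w'" "\<not> same_start w w'" and "w' \<noteq> []"
  shows "maximal_in Q BB (v, w') \<longleftrightarrow> lext v w w' = {} \<and> rext v w w' = {}"
proof -
  have "maximal_in Q BB (v, w') \<longleftrightarrow> chain_path Q nrel v w' \<and> (\<forall>b. \<not> chain_path Q nrel v (w' @ [b])) \<and>
    (\<forall>a. head Q a = v \<longrightarrow> \<not> chain_path Q nrel (tail Q a) (a # w'))"
    by (rule maximal_in_iff[OF \<B>_iff]) (simp add: nrelD)
  then show ?thesis using lext_rext_iff(2,4)[OF assms(1-3,4)] p by (auto simp: pbasis_pr)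
qed

lemma lext_Nil: "lext v [] [] = {b \<in> arcs Q. tail Q b = v}" and rext_Nil: "rext v [] [] = {a \<in> arcs Q. head Q a = v}"
  by (auto simp: lext_def rext_def)

abbreviation "dpair c \<equiv> pr (tail Q c) [c] [c]"

text \<open>A pair (c, c) arises from the vertex pair at its tail by adding c at the end, and from
  the one at its head by adding c at the beginning with coefficient -1. For a loop the two
  cancel.\<close>

lemma diag_coefficient:
  assumes y: "y \<in> free_space (pbasis 0)" and c: "c \<in> arcs Q"
  shows "lin_ext (pdiff 0) y (dpair c) = y (pr (tail Q c) [] []) - y (pr (head Q c) [] [])"
proof -
  have "(\<lambda>_::unit. lin_ext (pdiff 0) y (dpair c)) = (\<lambda>_. y (pr (tail Q c) [] []) - y (pr (head Q c) [] []))"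
  proof (rule lin_on_eqI[where \<Phi> = "\<lambda>y _. lin_ext (pdiff 0) y (dpair c)", OF _ _ _ y])
    show "lin_on (pbasis 0) (\<lambda>y (_::unit). lin_ext (pdiff 0) y (dpair c))"
      by (rule lin_on_eval)
    show "lin_on (pbasis 0) (\<lambda>y (_::unit). y (pr (tail Q c) [] []) - y (pr (head Q c) [] []) :: 'k)"
      unfolding lin_on_def by (simp add: algebra_simps)
    fix p assume "p \<in> pbasis 0"
    then obtain v w w' where p: "p = pr v w w'" "pr v w w' \<in> pbasis 0" by (rule pbasisE)
    have w: "w = []" using p by (simp add: pbasis_pr)
    have "pdiff 0 p (dpair c) = bvec p (pr (tail Q c) [] []) - bvec p (pr (head Q c) [] [])"
    proof (cases "w' = []")
      case True
      have "(\<Sum>b\<in>lext v [] []. bvec (pr v [b] [b]) (dpair c)) = (if tail Q c = v then 1 else (0::'k))"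
        using c by (subst sum.mono_neutral_cong_right[of _ "{b. b = c \<and> tail Q c = v}" _ "\<lambda>_. 1"])
          (auto simp: lext_Nil bvec_def)
      moreover have "(\<Sum>a\<in>rext v [] []. bvec (dpair a) (dpair c)) = (if head Q c = v then 1 else (0::'k))"
        using c by (subst sum.mono_neutral_cong_right[of _ "{a. a = c \<and> head Q c = v}" _ "\<lambda>_. 1"])
          (auto simp: rext_Nil bvec_def)
      ultimately show ?thesis using p(2) unfolding p(1) w True
        by (simp add: pdiff_pr) (auto simp: bvec_def)
    next
      case False
      then have "pdiff 0 p (dpair c) = 0"
        using pdiff_nonzero[OF p(2), of "dpair c"] unfolding p(1) by auto
      then show ?thesis using False by (simp add: p(1) bvec_def)
    qed
    then show "(\<lambda>_. lin_ext (pdiff 0) (bvec p) (dpair c)) =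
        (\<lambda>_::unit. bvec p (pr (tail Q c) [] []) - bvec p (pr (head Q c) [] []))" by simp
  qed
  then show ?thesis by (simp add: fun_eq_iff)
qed

lemma diag_differential:
  "lin_ext (pdiff 0) (\<lambda>p. \<Sum>v\<in>verts Q. f v * bvec (pr v [] []) p) =
    (\<lambda>q. \<Sum>c\<in>arcs Q. (f (tail Q c) - f (head Q c)) * bvec (dpair c) q :: 'k)"
proof
  fix q
  have p: "pr v [] [] \<in> pbasis 0" if "v \<in> verts Q" for v using that by (simp add: pbasis_pr)
  have "lin_ext (pdiff 0) (\<lambda>p. \<Sum>v\<in>verts Q. f v * bvec (pr v [] []) p) q = (\<Sum>v\<in>verts Q. f v * pdiff 0 (pr v [] []) q)"
    using lin_on_sum[OF lin_on_lin_ext, of "verts Q" "\<lambda>v p. f v * bvec (pr v [] []) p" "pbasis 0" "pdiff 0"] p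
    by (simp add: scale_free_space lin_ext_scale)
  also have "\<dots> = (\<Sum>v\<in>verts Q. \<Sum>c\<in>arcs Q. (if tail Q c = v then f v * bvec (dpair c) q else 0) - (if head Q c = v then f v * bvec (dpair c) q else 0))"
  proof (rule sum.cong)
    fix v assume "v \<in> verts Q"
    have "(\<Sum>b\<in>lext v [] []. bvec (pr v [b] [b]) q) = (\<Sum>c\<in>arcs Q. if tail Q c = v then bvec (dpair c) q else (0::'k))"
      unfolding lext_Nil by (subst sum.inter_filter) (auto intro!: sum.cong)
    moreover have "(\<Sum>a\<in>rext v [] []. bvec (dpair a) q) = (\<Sum>c\<in>arcs Q. if head Q c = v then bvec (dpair c) q else (0::'k))"
      unfolding rext_Nil by (subst sum.inter_filter) (auto intro!: sum.cong)
    ultimately show "f v * pdiff 0 (pr v [] []) q = (\<Sum>c\<in>arcs Q. (if tail Q c = v then f v * bvec (dpair c) q else 0) - (if head Q c = v then f v * bvec (dpair c) q else 0))"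
      using p[OF \<open>v \<in> verts Q\<close>] by (simp add: pdiff_pr sum_subtractf right_diff_distrib sum_distrib_left if_distrib[of "\<lambda>x. f v * x"] cong: if_cong)
  qed simp
  also have "\<dots> = (\<Sum>c\<in>arcs Q. (f (tail Q c) - f (head Q c)) * bvec (dpair c) q)"
    by (subst sum.swap) (auto intro!: sum.cong simp: sum_subtractf left_diff_distrib)
  finally show "lin_ext (pdiff 0) (\<lambda>p. \<Sum>v\<in>verts Q. f v * bvec (pr v [] []) p) q =
    (\<Sum>c\<in>arcs Q. (f (tail Q c) - f (head Q c)) * bvec (dpair c) q)" .
qed

end

section \<open>The dual family of functionals\<close>

text \<open>The function \<open>g t\<close> is the indicator of the component of \<open>tail Q t\<close> in the forest
  \<open>T - {t}\<close>; the differences \<open>g t (tail Q c) - g t (head Q c)\<close> are the coefficients of the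
  fundamental cut of \<open>t\<close>.\<close>

locale gentle_basis = gentle Q I
  for Q :: "('v, 'a) pre_digraph" and I :: "(('v, 'a) path \<Rightarrow> 'k::field) set" +
  fixes T :: "'a set" and RB RG :: "('v, 'a) path set" and g :: "'a \<Rightarrow> 'v \<Rightarrow> 'k"
  assumes T_arcs: "T \<subseteq> arcs Q"
    and tree_constant: "\<And>(f :: 'v \<Rightarrow> 'k) u v. (\<And>t. t \<in> T \<Longrightarrow> f (tail Q t) = f (head Q t)) \<Longrightarrow>
      u \<in> verts Q \<Longrightarrow> v \<in> verts Q \<Longrightarrow> f u = f v"
    and touching: "\<And>v. v \<in> verts Q \<Longrightarrow> \<exists>a\<in>arcs Q. tail Q a = v \<or> head Q a = v"
    and verts_ne: "verts Q \<noteq> {}"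
    and cut_tree: "\<And>t t'. t \<in> T \<Longrightarrow> t' \<in> T \<Longrightarrow> g t (tail Q t') - g t (head Q t') = (if t' = t then 1 else 0)"
    and potential: "\<And>f c. c \<in> arcs Q \<Longrightarrow> f (tail Q c) - f (head Q c) =
       (\<Sum>t\<in>T. (f (tail Q t) - f (head Q t)) * (g t (tail Q c) - g t (head Q c)))"
    and reps_B: "circuit_reps Q (\<B> Q I) RB"
    and reps_G: "circuit_reps Q (\<Gamma> Q I) RG"
begin

lemma cyclic_B: "cyclic_system N.cyc_paths (rot Q) (powers RB)"
  by (rule N.cyclic_system_powers[OF reps_B \<B>_iff])

lemma cyclic_G: "cyclic_system L.cyc_paths (rot Q) (powers RG)"
  by (rule L.cyclic_system_powers[OF reps_G \<Gamma>_iff])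

sublocale SB: circuit_pairs Q I N.cyc_paths "powers RB" 0 pair_EB "pair_YB Q" 1
  by (rule circuit_pairs_B[OF cyclic_B])

sublocale CG: cyclic_system L.cyc_paths "rot Q" "powers RG"
  by (rule cyclic_G)

abbreviation "LX n \<equiv> {x \<in> L.cyc_paths. plen x = n}"
abbreviation "LR n \<equiv> {p \<in> powers RG. plen p = n}"

lemma SG: "1 \<le> n \<Longrightarrow> circuit_pairs Q I (LX n) (LR n) n pair_EG (pair_YG Q) ((-1) ^ n)"
  by (rule circuit_pairs_G[OF cyclic_G])

lemma period_per: "period Q x = SB.per x" "period Q x = CG.per x"
  by (simp_all add: period_def SB.per_def CG.per_def)

lemma per_SG: "1 \<le> (n :: nat) \<Longrightarrow> cyclic_system.per (rot Q) x = period Q x"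
proof -
  assume "1 \<le> n"
  then interpret S: circuit_pairs Q I "LX n" "LR n" n pair_EG "pair_YG Q" "(-1) ^ n" by (rule SG)
  show ?thesis by (simp add: S.per_def period_def)
qed

lemma char_two: "CHAR('k) = 2 \<longleftrightarrow> (2 :: 'k) = 0"
proof
  assume "CHAR('k) = 2"
  then show "(2 :: 'k) = 0" using of_nat_CHAR[where 'a = 'k] by simp
next
  assume "(2 :: 'k) = 0"
  then have "CHAR('k) dvd 2" using of_nat_eq_0_iff_char_dvd[of 2, where 'a = 'k] by simp
  moreover have "CHAR('k) \<noteq> 1" using of_nat_CHAR[where 'a = 'k] by (metis of_nat_1 zero_neq_one)
  moreover have "CHAR('k) \<le> 2" using \<open>CHAR('k) dvd 2\<close> by (rule dvd_imp_le) simp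
  moreover have "CHAR('k) \<noteq> 0" using \<open>CHAR('k) dvd 2\<close> by (metis dvd_0_left_iff zero_neq_numeral)
  ultimately show "CHAR('k) = 2" by linarith
qed

lemma sign_one: "even m \<or> CHAR('k) = 2 \<Longrightarrow> (-1) ^ m = (1 :: 'k)"
proof (erule disjE)
  assume "CHAR('k) = 2"
  then have "(1::'k) + 1 = 0" using char_two by simp
  then have "- 1 = (1::'k)" by (rule add.inverse_unique)
  then show ?thesis by (simp only: power_one)
qed simp

text \<open>Rotating by the full length fixes a cycle, so the period divides the length.\<close>

lemma odd_period:
  assumes "x \<in> L.cyc_paths" "odd (plen x)" shows "odd (period Q x)"
proof -
  obtain w where w: "x = L.wd w" "L.cyc w" using assms(1) by (rule L.cyc_pathsE)
  then have "(rot Q ^^ plen x) x = x" using L.rot_length[of w] by (simp add: L.cyc_def L.wd_def)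
  then have "period Q x dvd plen x" using CG.per_dvd[OF assms(1)] by (simp add: period_per)
  then show ?thesis using assms(2) by (meson dvd_trans)
qed

abbreviation "J \<equiv> generators Q I T RB RG"

text \<open>A circuit contributes a sum over its rotations to one of the two dual families: (III) and (VII)
  are orbit sums tested at the representative, (V) and (VIII) are representatives tested by the
  orbit sum. For (IV), the part of a diagonal cochain carried by \<open>T\<close> is first removed by a
  coboundary.\<close>

definition lam :: "('v, 'a) generator \<Rightarrow> (('v, 'a) path \<times> ('v, 'a) path \<Rightarrow> 'k) \<Rightarrow> 'k" where
  "lam h z = (case h of
      Gen_I \<Rightarrow> z (pr (SOME v. v \<in> verts Q) [] [])
    | Gen_II \<alpha> \<Rightarrow> z (pair_EB \<alpha>)
    | Gen_III \<alpha> \<Rightarrow> z (pair_EB \<alpha>)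
    | Gen_IV c \<Rightarrow> z (dpair c) - (\<Sum>t\<in>T. z (dpair t) * (g t (tail Q c) - g t (head Q c)))
    | Gen_V \<alpha> \<Rightarrow> \<Sum>i<period Q \<alpha>. z (pair_YB Q ((rot Q ^^ i) \<alpha>))
    | Gen_VI \<gamma> \<alpha> \<Rightarrow> z (\<gamma>, \<alpha>)
    | Gen_VII C \<Rightarrow> z (pair_EG C)
    | Gen_VIII C \<Rightarrow> \<Sum>i<period Q C. z (pair_YG Q ((rot Q ^^ i) C)))"

lemma lam_lin: "lam h (\<lambda>p. c * y p + z p) = c * lam h y + lam h z"
  by (cases h) (simp_all add: lam_def sum.distrib sum_distrib_left sum_subtractf algebra_simps)

lemma lam_zero: "lam h (\<lambda>_. 0) = 0"
  by (cases h) (simp_all add: lam_def)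

lemma some_vert: "(SOME v. v \<in> verts Q) \<in> verts Q"
  using verts_ne by (simp add: some_in_eq)

lemma gen_cochain_eqs:
  "gen_cochain Q Gen_I = (\<lambda>y. \<Sum>i\<in>verts Q. bvec (pr i [] []) y :: 'k)"
  "gen_cochain Q (Gen_II \<alpha>) = (bvec (pair_EB \<alpha>) :: _ \<Rightarrow> 'k)"
  "gen_cochain Q (Gen_III \<alpha>) = (\<lambda>y. \<Sum>i<period Q \<alpha>. bvec (pair_EB ((rot Q ^^ i) \<alpha>)) y :: 'k)"
  "gen_cochain Q (Gen_IV c) = (bvec (dpair c) :: _ \<Rightarrow> 'k)"
  "gen_cochain Q (Gen_V \<alpha>) = (bvec (pair_YB Q \<alpha>) :: _ \<Rightarrow> 'k)"
  "gen_cochain Q (Gen_VI \<gamma> \<alpha>) = (bvec (\<gamma>, \<alpha>) :: _ \<Rightarrow> 'k)"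
  "gen_cochain Q (Gen_VII C) = (\<lambda>y. \<Sum>i<period Q C. bvec (pair_EG ((rot Q ^^ i) C)) y :: 'k)"
  "gen_cochain Q (Gen_VIII C) = (bvec (pair_YG Q C) :: _ \<Rightarrow> 'k)"
  by (simp_all add: vpath_eq pair_EB_def pair_EG_def pair_YB_def pair_YG_def Let_def arrow_def)

lemma J_iffs:
  "Gen_I \<in> J m \<longleftrightarrow> m = 0"
  "Gen_II \<alpha> \<in> J m \<longleftrightarrow> m = 0 \<and> maximal_in Q BB \<alpha> \<and> pair_EB \<alpha> \<in> pbasis 0"
  "Gen_III \<alpha> \<in> J m \<longleftrightarrow> m = 0 \<and> \<alpha> \<in> powers RB"
  "Gen_IV c \<in> J m \<longleftrightarrow> m = 1 \<and> c \<in> arcs Q - T"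
  "Gen_V \<alpha> \<in> J m \<longleftrightarrow> m = 1 \<and> \<alpha> \<in> powers RB"
  "Gen_VI \<gamma> \<alpha> \<in> J m \<longleftrightarrow> (\<gamma>, \<alpha>) \<in> pbasis m \<and> maximal_in Q (\<Gamma> Q I) \<gamma> \<and> \<not> same_start (snd \<gamma>) (snd \<alpha>) \<and> \<not> same_end (snd \<gamma>) (snd \<alpha>)"
  "Gen_VII C \<in> J m \<longleftrightarrow> 1 \<le> m \<and> (even m \<or> CHAR('k) = 2) \<and> C \<in> powers RG \<and> plen C = m"
  "Gen_VIII C \<in> J m \<longleftrightarrow> 2 \<le> m \<and> (odd m \<or> CHAR('k) = 2) \<and> C \<in> powers RG \<and> plen C = m - 1"
  by (auto simp: generators_def pair_EB_def same_first_def same_start_def same_last_def same_end_def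
      simp del: split_paired_Ex split_paired_All)

text \<open>The existence of an arrow enters here: every vertex is an end of some arrow, so a vertex
  is never a maximal path. This keeps (e, e) out of the families (II) and (VI).\<close>

lemma nonmaximal_vertex:
  assumes "v \<in> verts Q" shows "\<not> maximal_in Q BB (v, [])" "\<not> maximal_in Q (\<Gamma> Q I) (v, [])"
proof -
  obtain a where a: "a \<in> arcs Q" "tail Q a = v \<or> head Q a = v" using touching[OF assms] by blast
  have "maximal_in Q BB (v, []) \<longleftrightarrow> chain_path Q nrel v [] \<and> (\<forall>b. \<not> chain_path Q nrel v ([] @ [b])) \<and>
    (\<forall>a. head Q a = v \<longrightarrow> \<not> chain_path Q nrel (tail Q a) (a # []))"
    by (rule maximal_in_iff[OF \<B>_iff]) (simp add: nrelD)
  then show "\<not> maximal_in Q BB (v, [])" using a by auto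
  have "maximal_in Q (\<Gamma> Q I) (v, []) \<longleftrightarrow> chain_path Q rel v [] \<and> (\<forall>b. \<not> chain_path Q rel v ([] @ [b])) \<and>
    (\<forall>a. head Q a = v \<longrightarrow> \<not> chain_path Q rel (tail Q a) (a # []))"
    by (rule maximal_in_iff[OF \<Gamma>_iff]) (simp add: relD)
  then show "\<not> maximal_in Q (\<Gamma> Q I) (v, [])" using a by auto
qed

lemma J_II_pair:
  assumes "Gen_II \<alpha> \<in> J m"
  obtains v w where "\<alpha> = (v, w)" "pair_EB \<alpha> = pr v [] w" "w \<noteq> []" "pr v [] w \<in> pbasis 0"
    "lext v [] w = {}" "rext v [] w = {}"
proof -
  obtain v w where vw: "\<alpha> = (v, w)" by (cases \<alpha>)
  have p: "pr v [] w \<in> pbasis 0" "maximal_in Q BB (v, w)" using assms by (auto simp: J_iffs vw pair_eqs)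
  then have "v \<in> verts Q" by (simp add: pbasis_pr)
  then have w: "w \<noteq> []" using p nonmaximal_vertex by auto
  have "lext v [] w = {}" "rext v [] w = {}"
    using maximal_\<B>_iff[OF p(1) _ _ w] p(2) by (auto simp: same_end_def same_start_def)
  then show thesis using that vw w p by (simp add: pair_eqs)
qed

lemma J_VI_pair:
  assumes "Gen_VI \<gamma> \<alpha> \<in> J m"
  obtains v w w' where "(\<gamma>, \<alpha>) = pr v w w'" "w \<noteq> []" "pr v w w' \<in> pbasis m"
    "lext v w w' = {}" "rext v w w' = {}" "\<not> same_start w w'" "\<not> same_end w w'"
proof -
  have a: "(\<gamma>, \<alpha>) \<in> pbasis m" "maximal_in Q (\<Gamma> Q I) \<gamma>" "\<not> same_start (snd \<gamma>) (snd \<alpha>)" "\<not> same_end (snd \<gamma>) (snd \<alpha>)"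
    using assms by (auto simp: J_iffs)
  obtain v w w' where p: "(\<gamma>, \<alpha>) = pr v w w'" "pr v w w' \<in> pbasis m" using a(1) by (rule pbasisE)
  then have "v \<in> verts Q" by (auto simp: pbasis_pr chain_path_def)
  then have w: "w \<noteq> []" using p a nonmaximal_vertex by auto
  show thesis using that[OF p(1) w p(2)] maximal_\<Gamma>_iff[OF p(2) _ _ w] a p(1) by auto
qed

text \<open>The supports of the cochains in the families (I)--(VIII) are disjoint, since the shape of a
  pair determines the number of the family. Pairs outside all these supports get a junk value.\<close>

definition kind :: "('v, 'a) path \<times> ('v, 'a) path \<Rightarrow> nat" where
  "kind = (\<lambda>((v, w), (v', w')). if w = [] \<and> w' = [] then 1
     else if w = [] then (if nrel (last w') (hd w') then 3 else 2)
     else if w' = [] \<and> rel (last w) (hd w) then 7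
     else if \<not> same_end w w' \<and> \<not> same_start w w' then 6
     else if w = w' \<and> length w = 1 then 4 else if length w = 1 then 5 else 8)"

definition gen_kind :: "('v, 'a) generator \<Rightarrow> nat" where
  "gen_kind h = (case h of Gen_I \<Rightarrow> 1 | Gen_II _ \<Rightarrow> 2 | Gen_III _ \<Rightarrow> 3 | Gen_IV _ \<Rightarrow> 4 | Gen_V _ \<Rightarrow> 5
     | Gen_VI _ _ \<Rightarrow> 6 | Gen_VII _ \<Rightarrow> 7 | Gen_VIII _ \<Rightarrow> 8)"

lemma kind_cyc:
  "x \<in> N.cyc_paths \<Longrightarrow> kind (pair_EB x) = 3" "x \<in> N.cyc_paths \<Longrightarrow> kind (pair_YB Q x) = 5"
  "x \<in> L.cyc_paths \<Longrightarrow> kind (pair_EG x) = 7" "x \<in> L.cyc_paths \<Longrightarrow> kind (pair_YG Q x) = 8"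
proof -
  obtain v w where x: "x = (v, w)" by (cases x)
  show "kind (pair_EB x) = 3" "kind (pair_YB Q x) = 5" if "x \<in> N.cyc_paths"
    using cyc_path_facts[OF that[unfolded x], simplified] by (simp_all add: x pair_eqs kind_def same_end_def)
  show "kind (pair_EG x) = 7" "kind (pair_YG Q x) = 8" if "x \<in> L.cyc_paths"
    using cyc_path_facts[OF that[unfolded x], simplified] by (simp_all add: x pair_eqs kind_def same_end_def)
qed

lemma kind_dpair: "kind (dpair c) = 4" and kind_vertex: "kind (pr v [] []) = 1"
  by (simp_all add: kind_def same_end_def)

text \<open>A maximal path cannot close up to a cocomplete cycle, because its first arrow would then
  extend it. For \<open>kind_VI\<close> the same is said about \<Gamma>.\<close>

lemma kind_II:
  assumes "Gen_II \<alpha> \<in> J m" shows "kind (pair_EB \<alpha>) = 2"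
proof -
  obtain v w where a: "\<alpha> = (v, w)" "pair_EB \<alpha> = pr v [] w" "w \<noteq> []" "pr v [] w \<in> pbasis 0"
    "lext v [] w = {}" using assms by (rule J_II_pair)
  have "\<not> nrel (last w) (hd w)"
  proof
    assume n: "nrel (last w) (hd w)"
    have "v = tail Q (hd w)" using a(3,4) by (simp add: pbasis_pr chain_path_def)
    then have "hd w \<in> lext v [] w" using n a(3,4) nrelD[OF n]
      by (simp add: lext_def nrel_snoc pbasis_pr ptgt_eq)
    then show False using a(5) by simp
  qed
  then show ?thesis using a by (simp add: kind_def)
qed

lemma kind_VI:
  assumes "Gen_VI \<gamma> \<alpha> \<in> J m" shows "kind (\<gamma>, \<alpha>) = 6"
proof -
  obtain v w w' where a: "(\<gamma>, \<alpha>) = pr v w w'" "w \<noteq> []" "pr v w w' \<in> pbasis m"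
    "lext v w w' = {}" "rext v w w' = {}" "\<not> same_start w w'" "\<not> same_end w w'"
    using assms by (rule J_VI_pair)
  have "\<not> (w' = [] \<and> rel (last w) (hd w))"
  proof
    assume n: "w' = [] \<and> rel (last w) (hd w)"
    have "v = tail Q (hd w)" using a(2,3) by (simp add: pbasis_pr chain_path_def)
    then have "hd w \<in> lext v w w'" using n a(2,3) relD[of "last w" "hd w"]
      by (simp add: lext_def rel_snoc pbasis_pr ptgt_eq)
    then show False using a(4) by simp
  qed
  then show ?thesis using a by (auto simp: kind_def)
qed

lemma sum_bvec_nonzero: "(\<Sum>i\<in>S. bvec (f i) p) \<noteq> (0 :: 'k) \<Longrightarrow> \<exists>i\<in>S. p = f i"
  by (rule ccontr) (auto simp: bvec_def intro!: sum.neutral)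

lemma bvec_nonzero: "bvec x p \<noteq> (0 :: 'k) \<Longrightarrow> p = x"
  by (auto simp: bvec_def split: if_splits)

lemma powers_cyc: "\<alpha> \<in> powers RB \<Longrightarrow> (rot Q ^^ i) \<alpha> \<in> N.cyc_paths" "\<alpha> \<in> powers RG \<Longrightarrow> (rot Q ^^ i) \<alpha> \<in> L.cyc_paths"
  using SB.pow_closed SB.reps CG.pow_closed CG.reps by blast+

lemma powers_cyc0: "\<alpha> \<in> powers RB \<Longrightarrow> \<alpha> \<in> N.cyc_paths" "\<alpha> \<in> powers RG \<Longrightarrow> \<alpha> \<in> L.cyc_paths"
  using SB.reps CG.reps by blast+

lemma gen_cochain_kind:
  assumes h: "h \<in> J m" and nz: "gen_cochain Q h p \<noteq> (0 :: 'k)"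
  shows "kind p = gen_kind h"
proof (cases h)
  case Gen_I
  have "\<exists>i\<in>verts Q. p = pr i [] []" by (rule sum_bvec_nonzero) (use nz in \<open>simp add: Gen_I gen_cochain_eqs del: gen_cochain.simps\<close>)
  then show ?thesis using kind_vertex by (auto simp: Gen_I gen_kind_def)
next
  case (Gen_II \<alpha>)
  then show ?thesis using bvec_nonzero[of "pair_EB \<alpha>" p] nz kind_II[OF h[unfolded Gen_II]]
    unfolding Gen_II gen_cochain_eqs by (simp add: gen_kind_def)
next
  case (Gen_III \<alpha>)
  then have "\<alpha> \<in> powers RB" using h by (simp add: J_iffs)
  then have "kind (pair_EB ((rot Q ^^ i) \<alpha>)) = 3" for i by (intro kind_cyc(1) powers_cyc(1))
  moreover have "\<exists>i\<in>{..<period Q \<alpha>}. p = pair_EB ((rot Q ^^ i) \<alpha>)"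
    by (rule sum_bvec_nonzero) (use nz in \<open>simp add: Gen_III gen_cochain_eqs del: gen_cochain.simps\<close>)
  ultimately show ?thesis by (auto simp: Gen_III gen_kind_def)
next
  case (Gen_IV c)
  then show ?thesis using bvec_nonzero[of "dpair c" p] nz kind_dpair[of c]
    unfolding Gen_IV gen_cochain_eqs by (simp add: gen_kind_def)
next
  case (Gen_V \<alpha>)
  then have "\<alpha> \<in> powers RB" using h by (simp add: J_iffs)
  then show ?thesis using bvec_nonzero[of "pair_YB Q \<alpha>" p] nz kind_cyc(2)[OF powers_cyc0(1)]
    unfolding Gen_V gen_cochain_eqs by (simp add: gen_kind_def)
next
  case (Gen_VI \<gamma> \<alpha>)
  then show ?thesis using bvec_nonzero[of "(\<gamma>, \<alpha>)" p] nz kind_VI[OF h[unfolded Gen_VI]]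
    unfolding Gen_VI gen_cochain_eqs by (simp add: gen_kind_def)
next
  case (Gen_VII C)
  then have "C \<in> powers RG" using h by (simp add: J_iffs)
  then have "kind (pair_EG ((rot Q ^^ i) C)) = 7" for i by (intro kind_cyc(3) powers_cyc(2))
  moreover have "\<exists>i\<in>{..<period Q C}. p = pair_EG ((rot Q ^^ i) C)"
    by (rule sum_bvec_nonzero) (use nz in \<open>simp add: Gen_VII gen_cochain_eqs del: gen_cochain.simps\<close>)
  ultimately show ?thesis by (auto simp: Gen_VII gen_kind_def)
next
  case (Gen_VIII C)
  then have "C \<in> powers RG" using h by (simp add: J_iffs)
  then show ?thesis using bvec_nonzero[of "pair_YG Q C" p] nz kind_cyc(4)[OF powers_cyc0(2)]
    unfolding Gen_VIII gen_cochain_eqs by (simp add: gen_kind_def)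
qed

text \<open>Each functional reads only coefficients of pairs of its own kind. With
  \<open>gen_cochain_kind\<close> this reduces duality to two generators of the same family.\<close>

lemma lam_local:
  assumes h: "h \<in> J m" and eq: "\<And>p. kind p = gen_kind h \<Longrightarrow> y p = z p"
  shows "lam h y = lam h z"
proof (cases h)
  case (Gen_II \<alpha>)
  then show ?thesis using eq kind_II[of \<alpha> m] h by (simp add: lam_def gen_kind_def)
next
  case (Gen_III \<alpha>)
  then show ?thesis using eq kind_cyc(1) powers_cyc0(1) h by (simp add: lam_def gen_kind_def J_iffs)
next
  case (Gen_V \<alpha>)
  then show ?thesis using eq kind_cyc(2) powers_cyc(1) h by (simp add: lam_def gen_kind_def J_iffs)
next
  case (Gen_VI \<gamma> \<alpha>)
  then show ?thesis using eq kind_VI[of \<gamma> \<alpha> m] h by (simp add: lam_def gen_kind_def)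
next
  case (Gen_VII C)
  then show ?thesis using eq kind_cyc(3) powers_cyc0(2) h by (simp add: lam_def gen_kind_def J_iffs)
next
  case (Gen_VIII C)
  then show ?thesis using eq kind_cyc(4) powers_cyc(2) h by (simp add: lam_def gen_kind_def J_iffs)
qed (simp_all add: lam_def gen_kind_def kind_dpair kind_vertex eq)

lemma lam_dual:
  assumes h: "h \<in> J m" and k: "k \<in> J m"
  shows "lam h (gen_cochain Q k) = (if h = k then 1 else 0)"
proof (cases "gen_kind h = gen_kind k")
  case False
  then have "lam h (gen_cochain Q k) = lam h (\<lambda>_. 0)"
    using gen_cochain_kind[OF k] by (intro lam_local[OF h]) metis
  then show ?thesis using False by (auto simp: lam_zero)
next
  case True
  have inj: "pair_EB x = pair_EB y \<longleftrightarrow> x = y" for x y :: "('v, 'a) path" by (auto simp: pair_EB_def)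
  have dinj: "dpair c = dpair c' \<longleftrightarrow> c = c'" for c c' by auto
  show ?thesis
  proof (cases h)
    case Gen_I
    then have "k = Gen_I" using True by (cases k) (auto simp: gen_kind_def)
    moreover have "(\<Sum>i\<in>verts Q. bvec (pr i [] []) (pr u ([] :: 'a list) ([] :: 'a list))) = (\<Sum>i\<in>verts Q. if u = i then 1 else (0::'k))" for u :: 'v
      by (intro sum.cong) (auto simp: bvec_def)
    ultimately show ?thesis using some_vert unfolding Gen_I by (simp add: lam_def gen_cochain_eqs del: gen_cochain.simps)
  next
    case (Gen_II \<alpha>)
    then obtain \<beta> where k: "k = Gen_II \<beta>" using True by (cases k) (auto simp: gen_kind_def)
    show ?thesis unfolding Gen_II k gen_cochain_eqs by (auto simp: lam_def bvec_def inj)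
  next
    case (Gen_III \<alpha>)
    then obtain \<beta> where kb: "k = Gen_III \<beta>" using True by (cases k) (auto simp: gen_kind_def)
    have "\<alpha> \<in> powers RB" "\<beta> \<in> powers RB" using h k Gen_III kb by (auto simp: J_iffs)
    then show ?thesis using SB.dual_E[of \<beta> \<alpha>] unfolding Gen_III kb gen_cochain_eqs by (simp add: lam_def period_per(1))
  next
    case (Gen_IV c)
    then obtain c' where kb: "k = Gen_IV c'" using True by (cases k) (auto simp: gen_kind_def)
    have "c' \<notin> T" using k kb by (auto simp: J_iffs)
    then have "(\<Sum>t\<in>T. bvec (dpair c') (dpair t) * (g t (tail Q c) - g t (head Q c))) = 0"
      by (intro sum.neutral) (auto simp: bvec_def)
    then show ?thesis unfolding Gen_IV kb gen_cochain_eqs by (auto simp: lam_def bvec_def dinj)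
  next
    case (Gen_V \<alpha>)
    then obtain \<beta> where kb: "k = Gen_V \<beta>" using True by (cases k) (auto simp: gen_kind_def)
    have "\<alpha> \<in> powers RB" "\<beta> \<in> powers RB" using h k Gen_V kb by (auto simp: J_iffs)
    then show ?thesis using SB.dual_Y[of \<alpha> \<beta>] unfolding Gen_V kb gen_cochain_eqs by (simp add: lam_def period_per(1))
  next
    case (Gen_VI \<gamma> \<alpha>)
    then obtain \<gamma>' \<alpha>' where kb: "k = Gen_VI \<gamma>' \<alpha>'" using True by (cases k) (auto simp: gen_kind_def)
    show ?thesis unfolding Gen_VI kb gen_cochain_eqs by (auto simp: lam_def bvec_def)
  next
    case (Gen_VII C)
    then obtain D where kb: "k = Gen_VII D" using True by (cases k) (auto simp: gen_kind_def)
    have CD: "C \<in> LR m" "D \<in> LR m" and m: "1 \<le> m" using h k Gen_VII kb by (auto simp: J_iffs)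
    interpret S: circuit_pairs Q I "LX m" "LR m" m pair_EG "pair_YG Q" "(-1) ^ m" by (rule SG[OF m])
    show ?thesis using S.dual_E[OF CD(2,1)] unfolding Gen_VII kb gen_cochain_eqs by (simp add: lam_def per_SG[OF m])
  next
    case (Gen_VIII C)
    then obtain D where kb: "k = Gen_VIII D" using True by (cases k) (auto simp: gen_kind_def)
    have CD: "C \<in> LR (m - 1)" "D \<in> LR (m - 1)" and m: "1 \<le> m - 1" using h k Gen_VIII kb by (auto simp: J_iffs)
    interpret S: circuit_pairs Q I "LX (m - 1)" "LR (m - 1)" "m - 1" pair_EG "pair_YG Q" "(-1) ^ (m - 1)" by (rule SG[OF m])
    show ?thesis using S.dual_Y[OF CD] unfolding Gen_VIII kb gen_cochain_eqs by (simp add: lam_def per_SG[OF m])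
  qed
qed

lemma bvec_cocycle: "pr v w w' \<in> pbasis m \<Longrightarrow> lext v w w' = {} \<Longrightarrow> rext v w w' = {} \<Longrightarrow> bvec (pr v w w') \<in> cocycles m"
  by (simp add: cocycles_iff pdiff_pr)

lemma cyc_cocycle:
  shows "x \<in> N.cyc_paths \<Longrightarrow> bvec (pair_YB Q x) \<in> cocycles 1"
    and "x \<in> L.cyc_paths \<Longrightarrow> bvec (pair_YG Q x) \<in> cocycles (Suc (plen x))"
proof -
  obtain v w where x: "x = (v, w)" by (cases x)
  show "bvec (pair_YB Q x) \<in> cocycles 1" if "x \<in> N.cyc_paths"
  proof -
    note c = cyc_path_facts[OF that[unfolded x], simplified]
    have p: "pr v [hd w] (w @ [hd w]) \<in> pbasis 1" using c by (simp add: pbasis_pr nrel_snoc ptgt_eq)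
    moreover have "pair_YB Q x = pr v [hd w] (w @ [hd w])" using c(4) by (simp add: x pair_eqs)
    moreover have "same_end [hd w] (w @ [hd w])" "same_start [hd w] (w @ [hd w])"
      using c(1) by (auto simp: same_end_def same_start_def)
    ultimately show ?thesis using bvec_cocycle[OF p] lext_same_end rext_same_start by simp
  qed
  show "bvec (pair_YG Q x) \<in> cocycles (Suc (plen x))" if "x \<in> L.cyc_paths"
  proof -
    note c = cyc_path_facts[OF that[unfolded x], simplified]
    have p: "pr v (w @ [hd w]) [hd w] \<in> pbasis (Suc (plen x))" using c by (simp add: x pbasis_pr rel_snoc ptgt_eq)
    moreover have "pair_YG Q x = pr v (w @ [hd w]) [hd w]" using c(4) by (simp add: x pair_eqs)
    moreover have "same_end (w @ [hd w]) [hd w]" "same_start (w @ [hd w]) [hd w]"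
      using c(1) by (auto simp: same_end_def same_start_def)
    ultimately show ?thesis using bvec_cocycle[OF p] lext_same_end rext_same_start by simp
  qed
qed

lemma gen_cocycle:
  assumes h: "h \<in> J m" shows "gen_cochain Q h \<in> cocycles m"
proof (cases h)
  case Gen_I
  then have m: "m = 0" using h by (simp add: J_iffs)
  have "(\<lambda>y. \<Sum>i\<in>verts Q. bvec (pr i [] []) y :: 'k) \<in> free_space (pbasis 0)"
    by (intro sum_free_space) (simp add: pbasis_pr)
  moreover have "lin_ext (pdiff 0) (\<lambda>y. \<Sum>i\<in>verts Q. bvec (pr i [] []) y :: 'k) = (\<lambda>_. 0)"
    using diag_differential[of "\<lambda>_. 1"] by simp
  ultimately show ?thesis unfolding Gen_I gen_cochain_eqs m by (simp add: cocycles_iff)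
next
  case (Gen_II \<alpha>)
  obtain v w where a: "\<alpha> = (v, w)" "pair_EB \<alpha> = pr v [] w" "w \<noteq> []" "pr v [] w \<in> pbasis 0"
    "lext v [] w = {}" "rext v [] w = {}" using h[unfolded Gen_II] by (rule J_II_pair)
  have "m = 0" using h Gen_II by (simp add: J_iffs)
  then show ?thesis unfolding Gen_II gen_cochain_eqs a(2) using bvec_cocycle[OF a(4-6)] by simp
next
  case (Gen_III \<alpha>)
  then have "m = 0" "\<alpha> \<in> N.cyc_paths" using h powers_cyc0 by (auto simp: J_iffs)
  then show ?thesis unfolding Gen_III gen_cochain_eqs using SB.sum_E_cocycle[of \<alpha>] by (simp add: period_per(1))
next
  case (Gen_IV c)
  then have c: "m = 1" "c \<in> arcs Q" using h by (auto simp: J_iffs)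
  have p: "dpair c \<in> pbasis 1" using c by (simp add: pbasis_pr)
  have "same_end [c] [c]" "same_start [c] [c]" by (simp_all add: same_end_def same_start_def)
  then show ?thesis unfolding Gen_IV gen_cochain_eqs using bvec_cocycle[OF p] lext_same_end rext_same_start c by simp
next
  case (Gen_V \<alpha>)
  then have "m = 1" "\<alpha> \<in> N.cyc_paths" using h powers_cyc0 by (auto simp: J_iffs)
  then show ?thesis unfolding Gen_V gen_cochain_eqs using cyc_cocycle(1) by simp
next
  case (Gen_VI \<gamma> \<alpha>)
  obtain v w w' where a: "(\<gamma>, \<alpha>) = pr v w w'" "w \<noteq> []" "pr v w w' \<in> pbasis m"
    "lext v w w' = {}" "rext v w w' = {}" using h[unfolded Gen_VI] by (rule J_VI_pair)
  then show ?thesis unfolding Gen_VI gen_cochain_eqs a(1) using bvec_cocycle[OF a(3-5)] by simp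
next
  case (Gen_VII C)
  then have m: "1 \<le> m" "even m \<or> CHAR('k) = 2" "C \<in> LX m" using h powers_cyc0 by (auto simp: J_iffs)
  interpret S: circuit_pairs Q I "LX m" "LR m" m pair_EG "pair_YG Q" "(-1) ^ m" by (rule SG[OF m(1)])
  show ?thesis unfolding Gen_VII gen_cochain_eqs using S.sum_E_cocycle[OF m(3) sign_one[OF m(2)]] by (simp add: per_SG[OF m(1)])
next
  case (Gen_VIII C)
  then have "2 \<le> m" "C \<in> L.cyc_paths" "plen C = m - 1" using h powers_cyc0 by (auto simp: J_iffs)
  then show ?thesis unfolding Gen_VIII gen_cochain_eqs using cyc_cocycle(2)[of C] by simp
qed

text \<open>For (IV) a coboundary has the jumps of a potential on the diagonal, and such jumps are
  determined by those on the tree. For (V) and (VIII) orbit sums annihilate differences of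
  rotations. The pairs of (VI) and (VII) do not occur in coboundaries, and in degree 0 the only
  coboundary is 0.\<close>

lemma lam_coboundary:
  assumes h: "h \<in> J m" and b: "b \<in> coboundaries m"
  shows "lam h b = 0"
proof (cases m)
  case 0
  then show ?thesis using b lam_zero by simp
next
  case (Suc n)
  have bs: "b \<in> coboundaries (Suc n)" using b Suc by simp
  show ?thesis
  proof (cases h)
    case (Gen_IV c)
    then have c: "n = 0" "c \<in> arcs Q" using h Suc by (auto simp: J_iffs)
    obtain y where y: "y \<in> free_space (pbasis 0)" "b = lin_ext (pdiff 0) y" using bs c by auto
    let ?f = "\<lambda>v. y (pr v [] [])"
    have "b (dpair a) = ?f (tail Q a) - ?f (head Q a)" if "a \<in> arcs Q" for a
      using diag_coefficient[OF y(1) that] y(2) by simp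
    then have "lam h b = ?f (tail Q c) - ?f (head Q c) - (\<Sum>t\<in>T. (?f (tail Q t) - ?f (head Q t)) * (g t (tail Q c) - g t (head Q c)))"
      using T_arcs c by (simp add: Gen_IV lam_def subset_iff)
    then show ?thesis using potential[OF c(2), of ?f] by simp
  next
    case (Gen_V \<alpha>)
    then have "n = 0" "\<alpha> \<in> powers RB" using h Suc by (auto simp: J_iffs)
    then show ?thesis using SB.coboundary_Y[of b \<alpha>] bs by (simp add: Gen_V lam_def period_per(1))
  next
    case (Gen_VI \<gamma> \<alpha>)
    obtain v w w' where a: "(\<gamma>, \<alpha>) = pr v w w'" "\<not> same_start w w'" "\<not> same_end w w'"
      using h[unfolded Gen_VI] by (rule J_VI_pair)
    show ?thesis using coboundary_top_zero[OF bs a(3,2), of v] by (simp add: Gen_VI lam_def a(1))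
  next
    case (Gen_VII C)
    then have C: "C \<in> L.cyc_paths" using h powers_cyc0 by (auto simp: J_iffs)
    obtain v w where x: "C = (v, w)" by (cases C)
    have "b (pr v w []) = 0" by (rule coboundary_top_zero[OF bs]) (auto simp: same_end_def same_start_def)
    then show ?thesis by (simp add: Gen_VII lam_def x pair_eqs)
  next
    case (Gen_VIII C)
    then have n: "1 \<le> n" "even n \<or> CHAR('k) = 2" "C \<in> LR n" using h Suc by (auto simp: J_iffs)
    interpret S: circuit_pairs Q I "LX n" "LR n" n pair_EG "pair_YG Q" "(-1) ^ n" by (rule SG[OF n(1)])
    show ?thesis using S.coboundary_Y[OF bs n(3) sign_one[OF n(2)]] by (simp add: Gen_VIII lam_def per_SG[OF n(1)])
  qed (use h Suc in \<open>auto simp: J_iffs\<close>)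
qed

lemma lam_finite:
  assumes z: "z \<in> free_space (pbasis m)"
  shows "finite {h \<in> J m. lam h z \<noteq> 0}"
proof -
  let ?S = "{p. z p \<noteq> 0}"
  \<comment> \<open>Deleting the repeated last arrow recovers the cycle from its Y-pair. So a pair
    in the support of z leads back to at most one generator of each family, except for (IV), which
    has only finitely many generators anyway.\<close>
  let ?u = "\<lambda>p. (fst (fst p), butlast (snd (snd p)))"
  let ?v = "\<lambda>p. (fst (fst p), butlast (snd (fst p)))"
  let ?U = "{Gen_I} \<union> (\<lambda>p. Gen_II (snd p)) ` ?S \<union> (\<lambda>p. Gen_III (snd p)) ` ?S \<union> Gen_IV ` arcs Q
    \<union> (\<lambda>p. Gen_V (SB.rep (?u p))) ` ?S \<union> (\<lambda>p. Gen_VI (fst p) (snd p)) ` ?S \<union> (\<lambda>p. Gen_VII (fst p)) ` ?S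
    \<union> (\<lambda>p. Gen_VIII (CG.rep (?v p))) ` ?S"
  have ex_nonzero: "\<exists>i. f i \<noteq> 0" if "(\<Sum>i<n. f i) \<noteq> 0" for f :: "nat \<Rightarrow> 'k" and n :: nat
    using that by (metis sum.neutral)
  have fS: "finite ?S" using z by (simp add: free_space_def)
  have u: "?u (pair_YB Q x) = x" if "x \<in> N.cyc_paths" for x
    using cyc_path_facts(4)[of "fst x" "snd x" nrel] that by (cases x) (simp add: pair_eqs)
  have v: "?v (pair_YG Q x) = x" if "x \<in> L.cyc_paths" for x
    using cyc_path_facts(4)[of "fst x" "snd x" rel] that by (cases x) (simp add: pair_eqs)
  have "h \<in> ?U" if h: "h \<in> J m" and nz: "lam h z \<noteq> 0" for h
  proof (cases h)
    case (Gen_V \<alpha>)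
    then have a: "\<alpha> \<in> powers RB" using h by (simp add: J_iffs)
    obtain i where i: "z (pair_YB Q ((rot Q ^^ i) \<alpha>)) \<noteq> 0"
      using nz ex_nonzero[of "\<lambda>i. z (pair_YB Q ((rot Q ^^ i) \<alpha>))" "period Q \<alpha>"] by (auto simp: Gen_V lam_def)
    have "SB.rep (?u (pair_YB Q ((rot Q ^^ i) \<alpha>))) = \<alpha>"
      using u[OF powers_cyc(1)[OF a]] SB.rep_pow[OF powers_cyc0(1)[OF a]] SB.rep_rep[OF a] by simp
    then have "h \<in> (\<lambda>p. Gen_V (SB.rep (?u p))) ` ?S" using i unfolding Gen_V by (intro image_eqI[of _ _ "pair_YB Q ((rot Q ^^ i) \<alpha>)"]) auto
    then show ?thesis by blast
  next
    case (Gen_VIII C)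
    then have a: "C \<in> powers RG" using h by (simp add: J_iffs)
    obtain i where i: "z (pair_YG Q ((rot Q ^^ i) C)) \<noteq> 0"
      using nz ex_nonzero[of "\<lambda>i. z (pair_YG Q ((rot Q ^^ i) C))" "period Q C"] by (auto simp: Gen_VIII lam_def)
    have "CG.rep (?v (pair_YG Q ((rot Q ^^ i) C))) = C"
      using v[OF powers_cyc(2)[OF a]] CG.rep_pow[OF powers_cyc0(2)[OF a]] CG.rep_rep[OF a] by simp
    then have "h \<in> (\<lambda>p. Gen_VIII (CG.rep (?v p))) ` ?S" using i unfolding Gen_VIII by (intro image_eqI[of _ _ "pair_YG Q ((rot Q ^^ i) C)"]) auto
    then show ?thesis by blast
  next
    case (Gen_II \<alpha>)
    then have "h \<in> (\<lambda>p. Gen_II (snd p)) ` ?S" using nz by (intro image_eqI[of _ _ "pair_EB \<alpha>"]) (auto simp: lam_def pair_EB_def)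
    then show ?thesis by blast
  next
    case (Gen_III \<alpha>)
    then have "h \<in> (\<lambda>p. Gen_III (snd p)) ` ?S" using nz by (intro image_eqI[of _ _ "pair_EB \<alpha>"]) (auto simp: lam_def pair_EB_def)
    then show ?thesis by blast
  next
    case (Gen_VI \<gamma> \<alpha>)
    then have "h \<in> (\<lambda>p. Gen_VI (fst p) (snd p)) ` ?S" using nz by (intro image_eqI[of _ _ "(\<gamma>, \<alpha>)"]) (auto simp: lam_def)
    then show ?thesis by blast
  next
    case (Gen_VII C)
    then have "h \<in> (\<lambda>p. Gen_VII (fst p)) ` ?S" using nz by (intro image_eqI[of _ _ "pair_EG C"]) (auto simp: lam_def pair_EG_def)
    then show ?thesis by blast
  qed (use h in \<open>auto simp: J_iffs\<close>)
  then have "{h \<in> J m. lam h z \<noteq> 0} \<subseteq> ?U" by blast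
  then show ?thesis by (rule finite_subset) (use fS in \<open>intro finite_UnI finite_imageI finite.intros finite_arcs; simp\<close>)
qed

section \<open>Detection of coboundaries among cocycles\<close>

text \<open>The critical pairs are those of the generators, with more of them on the diagonal and
  among complete circuits: arrows of T and lengths of the wrong parity occur as well. Hence the
  cases \<open>diagonal\<close>, \<open>cycle_G\<close> and \<open>power_G\<close> make no claim
  about membership in \<open>J m\<close>.\<close>

lemma crit_cases:
  assumes p: "pr v w w' \<in> pbasis m" and c: "crit v w w'"
  obtains (vertex) "m = 0" "w = []" "w' = []"
    | (max_B) "Gen_II (v, w') \<in> J m" "w = []"
    | (cycle_B) "m = 0" "w = []" "(v, w') \<in> N.cyc_paths"
    | (diagonal) c where "m = 1" "pr v w w' = dpair c" "c \<in> arcs Q"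
    | (power_B) x where "m = 1" "x \<in> N.cyc_paths" "pr v w w' = pair_YB Q x"
    | (max_G) "Gen_VI (v, w) (v, w') \<in> J m"
    | (cycle_G) "1 \<le> m" "(v, w) \<in> LX m" "w' = []"
    | (power_G) x where "2 \<le> m" "x \<in> LX (m - 1)" "pr v w w' = pair_YG Q x"
proof -
  have q: "chain_path Q rel v w" "chain_path Q nrel v w'" "length w = m" "ptgt Q (v, w) = ptgt Q (v, w')"
    using p by (auto simp: pbasis_pr)
  have v: "v = tail Q (hd u)" if "u \<noteq> []" "chain_path Q P v u" for u P
    using that by (auto simp: chain_path_def)
  consider "w = []" "w' = []"
    | c where "w = [c]" "same_end w w'" "same_start w w'"
    | c where "length w \<noteq> 1" "w' = [c]" "same_end w w'" "same_start w w'"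
    | "w = []" "w' \<noteq> []" "nrel (last w') (hd w')"
    | "w' = []" "w \<noteq> []" "rel (last w) (hd w)"
    | "w = []" "w' \<noteq> []" "\<not> same_end w w'" "\<not> same_start w w'" "lext v w w' = {}" "rext v w w' = {}"
    | "w \<noteq> []" "\<not> same_end w w'" "\<not> same_start w w'" "lext v w w' = {}" "rext v w w' = {}"
    using c unfolding crit_def by (auto simp: length_Suc_conv)
  then show thesis
  proof cases
    case 1
    then show ?thesis using vertex q(3) by simp
  next
    case (2 c)
    then have w': "w' \<noteq> []" "last w' = c" "hd w' = c" by (auto simp: same_end_def same_start_def)
    have vc: "v = tail Q c" "c \<in> arcs Q" using v[of w rel] q(1) 2(1) by (auto simp: chain_path_def)
    show ?thesis
    proof (cases "butlast w' = []")
      case True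
      then have "w' = [c]" using w' by (metis append_butlast_last_id append_Nil)
      then show ?thesis using diagonal[of c] 2(1) vc q(3) by simp
    next
      case False
      define u where "u = butlast w'"
      have "w' = u @ [c]" "u \<noteq> []" using w' False by (auto simp: u_def)
      then have u: "w' = u @ [c]" "u \<noteq> []" "hd u = c" using w'(3) by simp_all
      then have n: "chain_path Q nrel v u" "nrel (last u) c" using q(2) by (simp_all add: nrel_snoc)
      then have "(v, u) \<in> N.cyc_paths" using u by (simp add: N.cyc_paths_def)
      moreover have "pr v w w' = pair_YB Q (v, u)" using u vc 2(1) by (simp add: pair_eqs)
      ultimately show ?thesis using power_B[of "(v, u)"] 2(1) q(3) by simp
    qed
  next
    case (3 c)
    then have w: "w \<noteq> []" "last w = c" "hd w = c" by (auto simp: same_end_def same_start_def)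
    define u where "u = butlast w"
    have "u \<noteq> []" using 3(1) w unfolding u_def by (cases w) auto
    moreover have "w = u @ [c]" using w by (auto simp: u_def)
    ultimately have u: "w = u @ [c]" "u \<noteq> []" "hd u = c" using w(3) by simp_all
    have vc: "v = tail Q c" using v[OF w(1) q(1)] w(3) by simp
    have "chain_path Q rel v u" "rel (last u) c" using q(1) u by (simp_all add: rel_snoc)
    then have "(v, u) \<in> LX (m - 1)" using u q(3) by (auto simp: L.cyc_paths_def)
    moreover have "pr v w w' = pair_YG Q (v, u)" using u vc 3(2) by (simp add: pair_eqs)
    moreover have "2 \<le> m" using u q(3) by (cases u) auto
    ultimately show ?thesis using power_G[of "(v, u)"] by blast
  next
    case 4
    then show ?thesis using cycle_B q by (simp add: N.cyc_paths_def)
  next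
    case 5
    then have "1 \<le> m" using q(3) by (cases w) auto
    then show ?thesis using cycle_G q 5 by (simp add: L.cyc_paths_def)
  next
    case 6
    then have "m = 0" using q(3) by simp
    moreover have "maximal_in Q BB (v, w')" using maximal_\<B>_iff[OF p 6(3,4,2)] 6 by simp
    ultimately show ?thesis using max_B p 6(1) by (simp add: J_iffs pair_eqs)
  next
    case 7
    have "maximal_in Q (\<Gamma> Q I) (v, w)" using maximal_\<Gamma>_iff[OF p 7(2,3,1)] 7 by simp
    then show ?thesis using max_G p 7 by (simp add: J_iffs)
  qed
qed

text \<open>If m is even or the characteristic is 2, the coefficients of a cocycle are constant
  along each orbit, and (VII) tests them at the representative. Otherwise they alternate along
  orbits of odd period and vanish without any functional.\<close>

lemma pair_EG_zero:
  assumes z: "z \<in> cocycles m" and l: "\<And>h. h \<in> J m \<Longrightarrow> lam h z = 0" and x: "x \<in> LX m" and m: "1 \<le> m"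
  shows "z (pair_EG x) = 0"
proof -
  interpret S: circuit_pairs Q I "LX m" "LR m" m pair_EG "pair_YG Q" "(-1) ^ m" by (rule SG[OF m])
  have rot: "z (pair_EG (rot Q y)) = (-1) ^ m * z (pair_EG y)" if "y \<in> LX m" for y
    by (rule S.cocycle_E[OF z that])
  show ?thesis
  proof (cases "even m \<or> CHAR('k) = 2")
    case True
    show ?thesis
    proof (rule S.invariant_zero[where f = "\<lambda>x. z (pair_EG x)", OF _ _ x])
      show "z (pair_EG (rot Q y)) = z (pair_EG y)" if "y \<in> LX m" for y
        using rot[OF that] unfolding sign_one[OF True] by (simp only: mult_1)
      show "z (pair_EG p) = 0" if "p \<in> LR m" for p
        using l[of "Gen_VII p"] that True m by (simp add: J_iffs lam_def)
    qed
  next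
    case False
    then have "odd (S.per x)" using odd_period[of x] x by (simp add: per_SG[OF m])
    then show ?thesis using S.alternating_zero[where f = "\<lambda>x. z (pair_EG x)" and x = x] rot False x char_two by simp
  qed
qed

lemma pair_EB_zero:
  assumes z: "z \<in> cocycles 0" and l: "\<And>h. h \<in> J 0 \<Longrightarrow> lam h z = 0" and x: "x \<in> N.cyc_paths"
  shows "z (pair_EB x) = 0"
proof (rule SB.invariant_zero[where f = "\<lambda>x. z (pair_EB x)", OF _ _ x])
  show "z (pair_EB (rot Q y)) = z (pair_EB y)" if "y \<in> N.cyc_paths" for y
    using SB.cocycle_E[OF z that] by simp
  show "z (pair_EB p) = 0" if "p \<in> powers RB" for p
    using l[of "Gen_III p"] that by (simp add: J_iffs lam_def)
qed

text \<open>The cocycle condition at the diagonal pairs makes the coefficients agree at the two ends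
  of each tree arrow, hence at all vertices.\<close>

lemma vertex_zero:
  assumes z: "z \<in> cocycles 0" and l: "lam Gen_I z = 0" and v: "v \<in> verts Q"
  shows "z (pr v [] []) = 0"
proof -
  have "z (pr (tail Q t) [] []) = z (pr (head Q t) [] [])" if "t \<in> T" for t
    using diag_coefficient[of z t] z that T_arcs by (auto simp: cocycles_iff)
  then have "z (pr v [] []) = z (pr (SOME v. v \<in> verts Q) [] [])"
    by (rule tree_constant[where f = "\<lambda>v. z (pr v [] [])", OF _ v some_vert])
  then show ?thesis using l by (simp add: lam_def)
qed

lemma cut_diagonal_coboundary:
  assumes l: "\<And>c. c \<in> arcs Q - T \<Longrightarrow> lam (Gen_IV c) z = 0"
  shows "cut (dpair ` arcs Q) z \<in> coboundaries 1"
proof -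
  \<comment> \<open>By duality of the cuts this potential has the jump z (dpair t) along each t in
    T. On the other arrows the vanishing of the functionals (IV) says that its jump is the
    coefficient of z.\<close>
  let ?f = "\<lambda>v. \<Sum>t\<in>T. z (dpair t) * g t v"
  have fT: "finite T" using T_arcs finite_arcs by (rule finite_subset)
  have d: "?f (tail Q c) - ?f (head Q c) = z (dpair c)" if c: "c \<in> arcs Q" for c
  proof (cases "c \<in> T")
    case True
    have "?f (tail Q c) - ?f (head Q c) = (\<Sum>t\<in>T. z (dpair t) * (g t (tail Q c) - g t (head Q c)))"
      by (simp add: sum_subtractf algebra_simps)
    also have "\<dots> = (\<Sum>t\<in>T. if c = t then z (dpair t) else 0)"
      by (rule sum.cong) (simp_all add: cut_tree True)
    also have "\<dots> = z (dpair c)" using True fT by simp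
    finally show ?thesis .
  next
    case False
    then show ?thesis using l[of c] c by (simp add: lam_def sum_subtractf algebra_simps)
  qed
  let ?y = "\<lambda>p. \<Sum>v\<in>verts Q. ?f v * bvec (pr v [] []) p"
  have "lin_ext (pdiff 0) ?y = (\<lambda>q. \<Sum>c\<in>arcs Q. z (dpair c) * bvec (dpair c) q)"
    unfolding diag_differential by (simp add: d)
  also have "\<dots> = cut (dpair ` arcs Q) z"
  proof
    fix q
    show "(\<Sum>c\<in>arcs Q. z (dpair c) * bvec (dpair c) q) = cut (dpair ` arcs Q) z q"
    proof (cases "q \<in> dpair ` arcs Q")
      case True
      then obtain c where c: "c \<in> arcs Q" "q = dpair c" by blast
      have "(\<Sum>c\<in>arcs Q. z (dpair c) * bvec (dpair c) q) = (\<Sum>c'\<in>arcs Q. if c' = c then z (dpair c) else 0)"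
        unfolding c(2) by (rule sum.cong) (auto simp: bvec_def)
      then show ?thesis using c by (simp add: cut_def)
    next
      case False
      then have "(\<Sum>c\<in>arcs Q. z (dpair c) * bvec (dpair c) q) = 0" by (intro sum.neutral) (auto simp: bvec_def)
      then show ?thesis using False by (simp add: cut_def)
    qed
  qed
  finally have "lin_ext (pdiff 0) ?y = cut (dpair ` arcs Q) z" .
  moreover have "?y \<in> free_space (pbasis 0)"
    by (intro sum_free_space scale_free_space) (simp add: pbasis_pr)
  ultimately show ?thesis by (auto intro!: image_eqI[of _ _ ?y])
qed

lemma crit_Y:
  "x \<in> N.cyc_paths \<Longrightarrow> pair_YB Q x \<in> crit_pairs" "x \<in> L.cyc_paths \<Longrightarrow> pair_YG Q x \<in> crit_pairs"
proof -
  obtain v w where x: "x = (v, w)" by (cases x)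
  show "pair_YB Q x \<in> crit_pairs" if "x \<in> N.cyc_paths"
    using cyc_path_facts[OF that[unfolded x], simplified]
    by (simp add: x pair_eqs crit_pairs_iff crit_def same_end_def same_start_def)
  show "pair_YG Q x \<in> crit_pairs" if "x \<in> L.cyc_paths"
    using cyc_path_facts[OF that[unfolded x], simplified]
    by (simp add: x pair_eqs crit_pairs_iff crit_def same_end_def same_start_def)
qed

lemma crit_dpair: "dpair c \<in> crit_pairs"
  by (simp add: crit_pairs_iff crit_def same_end_def same_start_def)

text \<open>By \<open>crit_reduce\<close> it is enough that the critical part of z is a coboundary.
  Every critical coefficient tested by a single pair is 0. What can remain is the diagonal part and
  the part on the Y-pairs, and these are coboundaries by the potential along the tree and by solving
  on rotation orbits. Degree 1 contains the diagonal and the cocomplete Y-pairs; the complete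
  Y-pairs begin in degree 2.\<close>

lemma faithful:
  assumes z: "z \<in> cocycles m" and l: "\<And>h. h \<in> J m \<Longrightarrow> lam h z = 0"
  shows "z \<in> coboundaries m"
proof -
  have zs: "z \<in> free_space (pbasis m)" using z by (rule cocycles_space)
  then have supp: "z p = 0" if "p \<notin> pbasis m" for p using that by (auto simp: free_space_def)
  have VI: "z (pr v w w') = 0" if "Gen_VI (v, w) (v, w') \<in> J m" for v w w'
    using l[OF that] by (simp add: lam_def)
  have EG: "z (pr v w []) = 0" if "(v, w) \<in> LX m" "1 \<le> m" for v w
    using pair_EG_zero[OF z l that] by (simp add: pair_eqs)
  have "cut crit_pairs z \<in> coboundaries m"
  proof (cases m)
    case 0
    have "z p = 0" if p: "p \<in> crit_pairs" "p \<in> pbasis m" for p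
    proof -
      obtain v w w' where q: "p = pr v w w'" "pr v w w' \<in> pbasis m" using p(2) by (rule pbasisE)
      have c: "crit v w w'" using p(1) q(1) by (simp add: crit_pairs_iff)
      have "z (pr v w w') = 0" using q(2) c
      proof (cases rule: crit_cases)
        case vertex
        then show ?thesis using vertex_zero[of z v] z l[of Gen_I] q 0 by (simp add: pbasis_pr J_iffs)
      next
        case max_B
        then show ?thesis using l[of "Gen_II (v, w')"] by (simp add: lam_def pair_eqs)
      next
        case cycle_B
        then show ?thesis using pair_EB_zero[of z "(v, w')"] z l 0 by (simp add: pair_eqs)
      next
        case max_G
        then show ?thesis by (rule VI)
      qed (use 0 in simp_all)
      then show ?thesis using q(1) by simp
    qed
    then have "cut crit_pairs z p = 0" for p using supp[of p] by (cases "p \<in> pbasis m") (simp_all add: cut_def)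
    then have "cut crit_pairs z = (\<lambda>_. 0)" by blast
    then show ?thesis by (simp add: coboundaries_zero)
  next
    case (Suc n)
    have crit: "z p = 0 \<or> m = 1 \<and> p \<in> dpair ` arcs Q \<or> m = 1 \<and> p \<in> pair_YB Q ` N.cyc_paths
        \<or> 2 \<le> m \<and> p \<in> pair_YG Q ` LX (m - 1)" if p: "p \<in> crit_pairs" "p \<in> pbasis m" for p
    proof -
      obtain v w w' where q: "p = pr v w w'" "pr v w w' \<in> pbasis m" using p(2) by (rule pbasisE)
      have c: "crit v w w'" using p(1) q(1) by (simp add: crit_pairs_iff)
      have "z (pr v w w') = 0 \<or> m = 1 \<and> pr v w w' \<in> dpair ` arcs Q \<or> m = 1 \<and> pr v w w' \<in> pair_YB Q ` N.cyc_paths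
        \<or> 2 \<le> m \<and> pr v w w' \<in> pair_YG Q ` LX (m - 1)" using q(2) c
      proof (cases rule: crit_cases)
        case max_B
        then show ?thesis using Suc by (simp add: J_iffs)
      next
        case max_G
        then show ?thesis using VI by blast
      next
        case cycle_G
        then show ?thesis using EG by blast
      next
        case (diagonal c)
        then show ?thesis by blast
      next
        case (power_B x)
        then show ?thesis by blast
      next
        case (power_G x)
        then show ?thesis by blast
      qed (use Suc in simp_all)
      then show ?thesis unfolding q(1) .
    qed
    show ?thesis
    proof (cases "n = 0")
      case True
      then have m: "m = 1" using Suc by simp
      have "cut crit_pairs z p = cut (dpair ` arcs Q) z p + cut (pair_YB Q ` N.cyc_paths) z p" for p
      proof -
        \<comment> \<open>The two restrictions may be added only if no pair is counted twice; their
          kinds separate them.\<close>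
        have "dpair ` arcs Q \<inter> pair_YB Q ` N.cyc_paths = {}"
        proof -
          have "kind q = 4" if "q \<in> dpair ` arcs Q" for q using that kind_dpair by blast
          moreover have "kind q = 5" if "q \<in> pair_YB Q ` N.cyc_paths" for q using that kind_cyc(2) by blast
          ultimately show ?thesis by fastforce
        qed
        moreover have "dpair ` arcs Q \<subseteq> crit_pairs" "pair_YB Q ` N.cyc_paths \<subseteq> crit_pairs"
          using crit_dpair crit_Y(1) by blast+
        ultimately show ?thesis using crit[of p] supp[of p] m unfolding cut_def
          by (cases "p \<in> pbasis m") auto
      qed
      then have "cut crit_pairs z = (\<lambda>p. cut (dpair ` arcs Q) z p + cut (pair_YB Q ` N.cyc_paths) z p)" by blast
      moreover have "cut (dpair ` arcs Q) z \<in> coboundaries m"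
        unfolding m by (rule cut_diagonal_coboundary) (use l m in \<open>simp add: J_iffs\<close>)
      moreover have "cut (pair_YB Q ` N.cyc_paths) z \<in> coboundaries (Suc 0)"
      proof (rule SB.cut_Y_coboundary[OF zs refl])
        fix p assume "p \<in> powers RB"
        then show "(\<Sum>i<SB.per p. z (pair_YB Q ((rot Q ^^ i) p))) = 0"
          using l[of "Gen_V p"] m by (simp add: J_iffs lam_def period_per(1))
      qed
      ultimately show ?thesis using m by (simp add: coboundaries_add del: coboundaries.simps)
    next
      case False
      then have n: "1 \<le> n" by simp
      interpret S: circuit_pairs Q I "LX n" "LR n" n pair_EG "pair_YG Q" "(-1) ^ n" by (rule SG[OF n])
      have "cut crit_pairs z p = cut (pair_YG Q ` LX n) z p" for p
      proof -
        have "pair_YG Q ` LX n \<subseteq> crit_pairs" using crit_Y(2) by blast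
        then show ?thesis using crit[of p] supp[of p] Suc False unfolding cut_def
          by (cases "p \<in> pbasis m") auto
      qed
      then have "cut crit_pairs z = cut (pair_YG Q ` LX n) z" by blast
      moreover have "cut (pair_YG Q ` LX n) z \<in> coboundaries (Suc n)"
      proof (cases "even n \<or> CHAR('k) = 2")
        case True
        show ?thesis
        proof (rule S.cut_Y_coboundary[OF zs sign_one[OF True]])
          fix p assume "p \<in> LR n"
          then show "(\<Sum>i<S.per p. z (pair_YG Q ((rot Q ^^ i) p))) = 0"
            using l[of "Gen_VIII p"] Suc True n by (simp add: J_iffs lam_def per_SG[OF n])
        qed
      next
        \<comment> \<open>For odd n outside characteristic 2 there is no generator (VIII) to test
          the coefficients, and none is needed: 1 + rot is onto on orbits of odd length.\<close>
        case False
        show ?thesis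
        proof (rule S.cut_Y_coboundary_odd[OF zs])
          show "odd (S.per x)" if "x \<in> LX n" for x using odd_period[of x] that False by (simp add: per_SG[OF n])
        qed (use False char_two in auto)
      qed
      ultimately show ?thesis using Suc by simp
    qed
  qed
  from coboundaries_add[OF crit_reduce[OF z] this] show ?thesis by simp
qed

theorem generators_basis:
  "is_basis (HH Q I m) (J m) (\<lambda>h. HH_class Q I m (par_hom Q I m (gen_cochain Q h)))"
  by (rule HH_basis_dualI[where lam = lam])
    (use gen_cocycle lam_lin lam_coboundary lam_dual lam_finite faithful in blast)+

end

theorem theorem3p12:
  fixes Q :: "('v, 'a) pre_digraph"
    and I :: "(('v, 'a) path \<Rightarrow> 'k::field) set"
    and T :: "'a set"
    and RB RG :: "('v, 'a) path set"
  assumes "gentle_presentation Q I"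
    and "fin_digraph Q"
    and "connected Q"
    and "arcs Q \<noteq> {}"
    and "spanning_tree_arrows Q T"
    and "circuit_reps Q (\<B> Q I) RB"
    and "circuit_reps Q (\<Gamma> Q I) RG"
  shows "projective_resolution TYPE('x) (gentle_algebra Q I) (gentle_unit Q I)
           (bardzell Q I) (bardzell_diff Q I) (bardzell_aug Q I) (gentle_bimodule Q I)
         \<and> par_hom_iso Q I
         \<and> (\<forall>m. gen_cochain Q \<in> generators Q I T RB RG m \<rightarrow> par_cocycles Q I m)
         \<and> (\<forall>m. is_basis (HH Q I m) (generators Q I T RB RG m)
              (\<lambda>g. HH_class Q I m (par_hom Q I m (gen_cochain Q g))))"
proof -
  interpret fin_digraph Q by (rule assms(2))
  have T: "T \<subseteq> arcs Q" "connected (Q\<lparr>arcs := T\<rparr>)" "undirected_acyclic (Q\<lparr>arcs := T\<rparr>)"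
    using assms(5) by (simp_all add: spanning_tree_arrows_def)
  obtain g :: "'a \<Rightarrow> 'v \<Rightarrow> 'k" where g:
    "\<And>t t'. t \<in> T \<Longrightarrow> t' \<in> T \<Longrightarrow> g t (tail Q t') - g t (head Q t') = (if t' = t then 1 else 0)"
    "\<And>f c. c \<in> arcs Q \<Longrightarrow> f (tail Q c) - f (head Q c) =
       (\<Sum>t\<in>T. (f (tail Q t) - f (head Q t)) * (g t (tail Q c) - g t (head Q c)))"
    using tree_potential[OF T] by blast
  obtain a where a: "a \<in> arcs Q" using assms(4) by blast
  interpret gentle_basis Q I T RB RG g
  proof (intro gentle_basis.intro gentle.intro gentle_basis_axioms.intro)
    show "f u = f v" if "\<And>t. t \<in> T \<Longrightarrow> f (tail Q t) = f (head Q t)" "u \<in> verts Q" "v \<in> verts Q"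
      for f :: "'v \<Rightarrow> 'k" and u v
      by (rule connected_constant[OF T(2)]) (use that in simp_all)
    show "\<exists>b\<in>arcs Q. tail Q b = v \<or> head Q b = v" if v: "v \<in> verts Q" for v
    proof -
      \<comment> \<open>Both ends of an arrow touch an arrow, so the truth value of this property is
        constant along arrows, hence on the connected quiver, and it holds at the tail of a.\<close>
      have "(\<exists>b\<in>arcs Q. tail Q b = v \<or> head Q b = v) = (\<exists>b\<in>arcs Q. tail Q b = tail Q a \<or> head Q b = tail Q a)"
        by (rule connected_constant[OF assms(3), of "\<lambda>v. \<exists>b\<in>arcs Q. tail Q b = v \<or> head Q b = v"]) (use v a in auto)
      then show ?thesis using a by blast
    qed
    show "verts Q \<noteq> {}" using a tail_in_verts by blast
  qed (use assms T g in \<open>auto simp: gentle_axioms_def\<close>)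
  show ?thesis
    using projective_resolution_bardzell par_hom_iso gen_cocycle generators_basis by (intro conjI allI) auto
qed

end
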